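(* Let $G$ be a finitely generated group, and $T$ a tree with a minimal action of $G$. Assume that no two groups commensurable to edge stabilizers of $T$ are contained in each other with infinite index (i.e. if $A\subset B$ are subgroups of $G$, each commensurable to some edge stabilizer of $T$, then $[B:A]<\infty$). Let $\mathcal B(T)$ be the set of (equivalence classes of) almost invariant subsets based on $T$. Then the regular neighbourhood $RN(\mathcal B(T))$ is equivariantly isomorphic to a subdivision of $T_c$, the tree of cylinders of $T$ for the commensurability relation; in particular, $RN(\mathcal B(T))$ is a tree.
   Context: **Trees and cylinders.** A tree means a simplicial tree on which $G$ acts without inversions; it is minimal if it has no proper $G$-invariant subtree. Subgroups $A,B$ of $G$ are commensurable if $A\cap B$ has finite index in both. Two (non-oriented) edges of $T$ are equivalent if their stabilizers are commensurable; a cylinder of $T$ is an equivalence class $Y$, identified with the union of its edges, which is a subtree of $T$; two distinct cylinders meet in at most one point. The tree of cylinders $T_c$ is the bipartite tree with vertex set $V_0(T_c)\sqcup V_1(T_c)$, where $V_0(T_c)$ is the set of vertices of $T$ belonging to at least two distinct cylinders, $V_1(T_c)$ is the set of cylinders of $T$, with an edge $(x,Y)$ between $x\in V_0(T_c)$ and $Y\in V_1(T_c)$ if and only if $x\in Y$. Convention: if $T$ is a single point, $T_c$ is a point. **Almost invariant sets.** For $H<G$, a subset of $G$ is $H$-finite if it is contained in finitely many $H$-orbits for left multiplication. $X^*$ denotes $G\setminus X$, and $X+Y$ the symmetric difference. A subset $X\subset G$ is an almost invariant subset over $H$ if $HX=X$ and $X+Xs$ is $H$-finite for all $s\in G$;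 it is non-trivial if neither $X$ nor $X^*$ is $H$-finite. Almost invariant subsets $X$ (over $H$) and $Y$ (over $K$) are equivalent if $X+Y$ is $H$-finite (equivalently, $K$-finite); $[X]$ is the equivalence class. Given a commensurability class $\mathcal C$ of subgroups of $G$, the equivalence classes of almost invariant subsets over subgroups in $\mathcal C$ form a Boolean algebra $\mathcal B_{\mathcal C}$. $G$ acts on equivalence classes by left translation. **Almost invariant sets based on $T$.** Fix a base vertex $v_0\in T$. For an oriented edge $e$, let $T_e$ be the component of $T\setminus \mathring e$ ($\mathring e$ the open edge) containing the terminal vertex of $e$. Then $Z_e=\{g\in G: gv_0\in T_e\}$ is almost invariant over the stabilizer $G_e$, and its class does not depend on $v_0$. For a cylinder $Y$, whose edge stabilizers lie in a commensurability class $\mathcal C$, let $\mathcal B_{\mathcal C}(T)$ be the Boolean subalgebra of $\mathcal B_{\mathcal C}$ generated by the classes $[Z_e]$ for $e$ an edge of $Y$. Let $\mathcal B(T)=\bigcup_{\mathcal C}\mathcal B_{\mathcal C}(T)$, the union over all cylinders. **Regular neighbourhood.** $X$ (over $H$) crosses $Y$ (over $K$) if none of the four sets $X\cap Y$, $X\cap Y^*$, $X^*\cap Y$, $X^*\cap Y^*$ is $H$-finite; this is a symmetric relation depending only on equivalence classes. Given a set $\mathcal X$ of equivalence classes of almost invariant sets, let $\overline{\mathcal X}$ be the set of unordered pairs $\{[X],[X^*]\}$ with $[X]\in\mathcal X$ non-trivial. A cross-connected component (CCC) is an equivalence class for the equivalence relation on $\overline{\mathcal X}$ generated by crossing; $X$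 represents a CCC $C$ if $\{[X],[X^*]\}\in C$. Let $\mathcal H$ be the set of CCCs. Given distinct CCCs $C_1,C_2,C_3$, $C_2$ is between $C_1$ and $C_3$ if there are representatives $X_i$ of $C_i$ with $X_1\subset X_2\subset X_3$. A star is a subset $\Sigma\subset\mathcal H$ with at least two elements, maximal for the property: given $C,C'\in\Sigma$, no $C''\in\mathcal H$ is between $C$ and $C'$. $RN(\mathcal X)$ is the bipartite graph whose vertices are the CCCs and the stars, with an edge $(C,\Sigma)$ whenever $C\in\Sigma$; if $\mathcal X$ is $G$-invariant, $G$ acts on it. Convention: if $\mathcal H$ is empty, $RN(\mathcal X)$ is a point. *)

theory Defs
  imports Complex_Main "HOL-Algebra.Generated_Groups" "HOL-Algebra.Group_Action"
begin

section \<open>Simplicial trees and group actions on them\<close>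

record 'v sgraph =
  verts :: "'v set"
  edges :: "'v set set"

definition simple_graph :: "'v sgraph \<Rightarrow> bool" where
  "simple_graph \<Gamma> \<longleftrightarrow>
     (\<forall>e \<in> edges \<Gamma>. \<exists>u \<in> verts \<Gamma>. \<exists>v \<in> verts \<Gamma>. u \<noteq> v \<and> e = {u, v})"

definition connected_graph :: "'v sgraph \<Rightarrow> bool" where
  "connected_graph \<Gamma> \<longleftrightarrow>
     (\<forall>u \<in> verts \<Gamma>. \<forall>v \<in> verts \<Gamma>. (u, v) \<in> {(a, b). {a, b} \<in> edges \<Gamma>}\<^sup>*)"

definition graph_cycle :: "'v sgraph \<Rightarrow> 'v list \<Rightarrow> bool" where
  "graph_cycle \<Gamma> vs \<longleftrightarrow>
     length vs \<ge> 3 \<and> distinct vs \<and>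
     successively (\<lambda>a b. {a, b} \<in> edges \<Gamma>) vs \<and> {last vs, hd vs} \<in> edges \<Gamma>"

definition is_tree :: "'v sgraph \<Rightarrow> bool" where
  "is_tree \<Gamma> \<longleftrightarrow>
     simple_graph \<Gamma> \<and> verts \<Gamma> \<noteq> {} \<and> connected_graph \<Gamma> \<and> (\<nexists>vs. graph_cycle \<Gamma> vs)"

text \<open>The library's actions are by extensional bijections, hence the restriction;
  the values of \<open>act g\<close> outside the vertex set are irrelevant.\<close>

definition graph_action ::
    "('a, 'm) monoid_scheme \<Rightarrow> 'v sgraph \<Rightarrow> ('a \<Rightarrow> 'v \<Rightarrow> 'v) \<Rightarrow> bool" where
  "graph_action G \<Gamma> act \<longleftrightarrow>
     group_action G (verts \<Gamma>) (\<lambda>g. restrict (act g) (verts \<Gamma>)) \<and>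
     (\<forall>g \<in> carrier G. \<forall>e \<in> edges \<Gamma>. act g ` e \<in> edges \<Gamma>)"

definition without_inversions ::
    "('a, 'm) monoid_scheme \<Rightarrow> 'v sgraph \<Rightarrow> ('a \<Rightarrow> 'v \<Rightarrow> 'v) \<Rightarrow> bool" where
  "without_inversions G \<Gamma> act \<longleftrightarrow>
     (\<forall>g \<in> carrier G. \<forall>u v. {u, v} \<in> edges \<Gamma> \<and> u \<noteq> v \<longrightarrow> \<not> (act g u = v \<and> act g v = u))"

definition minimal_action ::
    "('a, 'm) monoid_scheme \<Rightarrow> 'v sgraph \<Rightarrow> ('a \<Rightarrow> 'v \<Rightarrow> 'v) \<Rightarrow> bool" where
  "minimal_action G \<Gamma> act \<longleftrightarrow>
     (\<forall>\<Delta> :: 'v sgraph.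
        is_tree \<Delta> \<and> verts \<Delta> \<subseteq> verts \<Gamma> \<and> edges \<Delta> \<subseteq> edges \<Gamma> \<and>
        (\<forall>g \<in> carrier G. (\<forall>v \<in> verts \<Delta>. act g v \<in> verts \<Delta>) \<and>
                         (\<forall>e \<in> edges \<Delta>. act g ` e \<in> edges \<Delta>))
        \<longrightarrow> \<Delta> = \<Gamma>)"

definition equivariantly_isomorphic ::
    "('a, 'm) monoid_scheme \<Rightarrow> 'v sgraph \<Rightarrow> ('a \<Rightarrow> 'v \<Rightarrow> 'v) \<Rightarrow>
       'w sgraph \<Rightarrow> ('a \<Rightarrow> 'w \<Rightarrow> 'w) \<Rightarrow> bool" where
  "equivariantly_isomorphic G \<Gamma> act \<Delta> act' \<longleftrightarrow>
     graph_action G \<Gamma> act \<and> graph_action G \<Delta> act' \<and>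
     (\<exists>f. bij_betw f (verts \<Gamma>) (verts \<Delta>) \<and>
        (\<forall>u \<in> verts \<Gamma>. \<forall>v \<in> verts \<Gamma>. {u, v} \<in> edges \<Gamma> \<longleftrightarrow> {f u, f v} \<in> edges \<Delta>) \<and>
        (\<forall>g \<in> carrier G. \<forall>v \<in> verts \<Gamma>. f (act g v) = act' g (f v)))"

subsection \<open>Subdivisions\<close>

text \<open>Points of the geometric realization are given by their barycentric coordinates:
  \<open>bary u v t\<close> is the point \<open>(1 - t) u + t v\<close>, so that \<open>bary u v t = bary v u (1 - t)\<close>
  and \<open>bary v v t\<close> is the vertex \<open>v\<close>. In \<open>subdivision \<Gamma> n\<close>, each edge \<open>e\<close>
  acquires \<open>n e\<close> equally spaced new vertices; an action on the graph extends to its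
  realization by permuting coordinates. When there are no inversions, every subdivision to
  which the action extends is equivariantly isomorphic to one of these, with \<open>n\<close> invariant.\<close>

definition bary :: "'v \<Rightarrow> 'v \<Rightarrow> rat \<Rightarrow> ('v \<Rightarrow> rat)" where
  "bary u v t = (\<lambda>w. (if w = u then 1 - t else 0) + (if w = v then t else 0))"

definition subdivision :: "'v sgraph \<Rightarrow> ('v set \<Rightarrow> nat) \<Rightarrow> ('v \<Rightarrow> rat) sgraph" where
  "subdivision \<Gamma> n =
     \<lparr> verts = {bary v v 0 | v. v \<in> verts \<Gamma>} \<union>
               {bary u v (of_nat k / of_nat (n {u, v} + 1)) | u v k.
                  {u, v} \<in> edges \<Gamma> \<and> k \<le> n {u, v} + 1},
       edges = {{bary u v (of_nat k / of_nat (n {u, v} + 1)),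
                 bary u v (of_nat (k + 1) / of_nat (n {u, v} + 1))} | u v k.
                  {u, v} \<in> edges \<Gamma> \<and> k \<le> n {u, v}} \<rparr>"

definition subdivision_act ::
    "('a, 'm) monoid_scheme \<Rightarrow> 'v sgraph \<Rightarrow> ('a \<Rightarrow> 'v \<Rightarrow> 'v) \<Rightarrow>
       'a \<Rightarrow> ('v \<Rightarrow> rat) \<Rightarrow> ('v \<Rightarrow> rat)" where
  "subdivision_act G \<Gamma> act g p =
     (\<lambda>w. if w \<in> verts \<Gamma> then p (act (inv\<^bsub>G\<^esub> g) w) else 0)"

definition isomorphic_to_subdivision ::
    "('a, 'm) monoid_scheme \<Rightarrow> 'w sgraph \<Rightarrow> ('a \<Rightarrow> 'w \<Rightarrow> 'w) \<Rightarrow>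
       'v sgraph \<Rightarrow> ('a \<Rightarrow> 'v \<Rightarrow> 'v) \<Rightarrow> bool" where
  "isomorphic_to_subdivision G \<Delta> act' \<Gamma> act \<longleftrightarrow>
     (\<exists>n :: 'v set \<Rightarrow> nat.
        (\<forall>g \<in> carrier G. \<forall>e \<in> edges \<Gamma>. n (act g ` e) = n e) \<and>
        equivariantly_isomorphic G \<Delta> act' (subdivision \<Gamma> n) (subdivision_act G \<Gamma> act))"

section \<open>Commensurability and the tree of cylinders\<close>

definition finitely_generated_group :: "('a, 'm) monoid_scheme \<Rightarrow> bool" where
  "finitely_generated_group G \<longleftrightarrow>
     group G \<and> (\<exists>S. finite S \<and> S \<subseteq> carrier G \<and> generate G S = carrier G)"

definition finite_index :: "('a, 'm) monoid_scheme \<Rightarrow> 'a set \<Rightarrow> 'a set \<Rightarrow> bool" where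
  "finite_index G A B \<longleftrightarrow> A \<subseteq> B \<and> finite (rcosets\<^bsub>G\<lparr>carrier := B\<rparr>\<^esub> A)"

definition commensurable :: "('a, 'm) monoid_scheme \<Rightarrow> 'a set \<Rightarrow> 'a set \<Rightarrow> bool" where
  "commensurable G A B \<longleftrightarrow>
     subgroup A G \<and> subgroup B G \<and> finite_index G (A \<inter> B) A \<and> finite_index G (A \<inter> B) B"

text \<open>For an action without inversions, the setwise stabilizer of an edge is also the
  stabilizer of each of its two orientations.\<close>

definition edge_stab ::
    "('a, 'm) monoid_scheme \<Rightarrow> ('a \<Rightarrow> 'v \<Rightarrow> 'v) \<Rightarrow> 'v set \<Rightarrow> 'a set" where
  "edge_stab G act e = stabilizer G (\<lambda>g. (`) (act g)) e"

text \<open>A cylinder is the set of its edges; its set of vertices is the union of these.\<close>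

definition cylinders ::
    "('a, 'm) monoid_scheme \<Rightarrow> 'v sgraph \<Rightarrow> ('a \<Rightarrow> 'v \<Rightarrow> 'v) \<Rightarrow> 'v set set set" where
  "cylinders G T act =
     edges T // {(e, e'). e \<in> edges T \<and> e' \<in> edges T \<and>
                   commensurable G (edge_stab G act e) (edge_stab G act e')}"

definition cylinder_vertices0 ::
    "('a, 'm) monoid_scheme \<Rightarrow> 'v sgraph \<Rightarrow> ('a \<Rightarrow> 'v \<Rightarrow> 'v) \<Rightarrow> 'v set" where
  "cylinder_vertices0 G T act =
     {x \<in> verts T. \<exists>Y \<in> cylinders G T act. \<exists>Y' \<in> cylinders G T act.
        Y \<noteq> Y' \<and> x \<in> \<Union>Y \<and> x \<in> \<Union>Y'}"

text \<open>A tree without edges is a point, and is then its own tree of cylinders.\<close>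

definition tree_of_cylinders ::
    "('a, 'm) monoid_scheme \<Rightarrow> 'v sgraph \<Rightarrow> ('a \<Rightarrow> 'v \<Rightarrow> 'v) \<Rightarrow>
       ('v + 'v set set) sgraph" where
  "tree_of_cylinders G T act =
     (if edges T = {} then \<lparr> verts = Inl ` verts T, edges = {} \<rparr>
      else \<lparr> verts = Inl ` cylinder_vertices0 G T act \<union> Inr ` cylinders G T act,
             edges = {{Inl x, Inr Y} | x Y.
                x \<in> cylinder_vertices0 G T act \<and> Y \<in> cylinders G T act \<and> x \<in> \<Union>Y} \<rparr>)"

definition tree_of_cylinders_act ::
    "('a \<Rightarrow> 'v \<Rightarrow> 'v) \<Rightarrow> 'a \<Rightarrow> ('v + 'v set set) \<Rightarrow> ('v + 'v set set)" where
  "tree_of_cylinders_act act g = map_sum (act g) ((`) ((`) (act g)))"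

section \<open>Almost invariant sets\<close>

definition H_finite :: "('a, 'm) monoid_scheme \<Rightarrow> 'a set \<Rightarrow> 'a set \<Rightarrow> bool" where
  "H_finite G H Z \<longleftrightarrow>
     (\<exists>F. finite F \<and> F \<subseteq> carrier G \<and> Z \<subseteq> (\<Union>g \<in> F. H #>\<^bsub>G\<^esub> g))"

definition almost_invariant :: "('a, 'm) monoid_scheme \<Rightarrow> 'a set \<Rightarrow> 'a set \<Rightarrow> bool" where
  "almost_invariant G H X \<longleftrightarrow>
     subgroup H G \<and> X \<subseteq> carrier G \<and> H <#>\<^bsub>G\<^esub> X = X \<and>
     (\<forall>s \<in> carrier G. H_finite G H (sym_diff X (X #>\<^bsub>G\<^esub> s)))"

definition nontrivial_ai :: "('a, 'm) monoid_scheme \<Rightarrow> 'a set \<Rightarrow> 'a set \<Rightarrow> bool" where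
  "nontrivial_ai G H X \<longleftrightarrow>
     almost_invariant G H X \<and> \<not> H_finite G H X \<and> \<not> H_finite G H (carrier G - X)"

text \<open>An almost invariant set is recorded as a pair \<open>(H, X)\<close>, together with the subgroup over
  which it is considered, and \<open>ai_class\<close> gives the class of \<open>X\<close>. Equivalence is symmetric and
  transitive on non-trivial sets, and on sets over the subgroups of one commensurability class;
  it is only used there.\<close>

type_synonym 'a ai_class = "('a set \<times> 'a set) set"

definition ai_class :: "('a, 'm) monoid_scheme \<Rightarrow> 'a set \<Rightarrow> 'a set \<Rightarrow> 'a ai_class" where
  "ai_class G H X = {(K, Y). almost_invariant G K Y \<and> H_finite G H (sym_diff X Y)}"

definition ai_translate ::
    "('a, 'm) monoid_scheme \<Rightarrow> 'a \<Rightarrow> 'a set \<times> 'a set \<Rightarrow> 'a set \<times> 'a set" where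
  "ai_translate G g = (\<lambda>(H, X). (g <#\<^bsub>G\<^esub> H #>\<^bsub>G\<^esub> (inv\<^bsub>G\<^esub> g), g <#\<^bsub>G\<^esub> X))"

text \<open>The Boolean subalgebra generated by \<open>S\<close> in the algebra of classes of almost invariant
  sets over the subgroups belonging to the commensurability class \<open>\<C>\<close>.\<close>

inductive_set boolean_subalgebra ::
    "('a, 'm) monoid_scheme \<Rightarrow> 'a set set \<Rightarrow> 'a ai_class set \<Rightarrow> 'a ai_class set"
  for G :: "('a, 'm) monoid_scheme" and \<C> :: "'a set set" and S :: "'a ai_class set" where
  generator: "c \<in> S \<Longrightarrow> c \<in> boolean_subalgebra G \<C> S"
| zero: "H \<in> \<C> \<Longrightarrow> ai_class G H {} \<in> boolean_subalgebra G \<C> S"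
| compl: "\<lbrakk> H \<in> \<C>; almost_invariant G H X; ai_class G H X \<in> boolean_subalgebra G \<C> S \<rbrakk>
    \<Longrightarrow> ai_class G H (carrier G - X) \<in> boolean_subalgebra G \<C> S"
| join: "\<lbrakk> H \<in> \<C>; almost_invariant G H X; ai_class G H X \<in> boolean_subalgebra G \<C> S;
           K \<in> \<C>; almost_invariant G K Y; ai_class G K Y \<in> boolean_subalgebra G \<C> S \<rbrakk>
    \<Longrightarrow> ai_class G (H \<inter> K) (X \<union> Y) \<in> boolean_subalgebra G \<C> S"

subsection \<open>Almost invariant sets based on a tree\<close>

text \<open>An oriented edge is a pair \<open>(u, v)\<close> with terminal vertex \<open>v\<close>.\<close>

definition half_tree :: "'v sgraph \<Rightarrow> 'v \<Rightarrow> 'v \<Rightarrow> 'v set" where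
  "half_tree T u v =
     {w \<in> verts T. (v, w) \<in> {(a, b). {a, b} \<in> edges T - {{u, v}}}\<^sup>*}"

definition Z_set ::
    "('a, 'm) monoid_scheme \<Rightarrow> 'v sgraph \<Rightarrow> ('a \<Rightarrow> 'v \<Rightarrow> 'v) \<Rightarrow> 'v \<Rightarrow> 'v \<Rightarrow> 'v \<Rightarrow> 'a set" where
  "Z_set G T act v0 u v = {g \<in> carrier G. act g v0 \<in> half_tree T u v}"

definition cylinder_class ::
    "('a, 'm) monoid_scheme \<Rightarrow> ('a \<Rightarrow> 'v \<Rightarrow> 'v) \<Rightarrow> 'v set set \<Rightarrow> 'a set set" where
  "cylinder_class G act Y = {H. \<exists>e \<in> Y. commensurable G H (edge_stab G act e)}"

definition based_cylinder ::
    "('a, 'm) monoid_scheme \<Rightarrow> 'v sgraph \<Rightarrow> ('a \<Rightarrow> 'v \<Rightarrow> 'v) \<Rightarrow> 'v \<Rightarrow> 'v set set \<Rightarrow>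
       'a ai_class set" where
  "based_cylinder G T act v0 Y =
     boolean_subalgebra G (cylinder_class G act Y)
       {ai_class G (edge_stab G act {u, v}) (Z_set G T act v0 u v) | u v. {u, v} \<in> Y}"

definition based_on_tree ::
    "('a, 'm) monoid_scheme \<Rightarrow> 'v sgraph \<Rightarrow> ('a \<Rightarrow> 'v \<Rightarrow> 'v) \<Rightarrow> 'v \<Rightarrow> 'a ai_class set" where
  "based_on_tree G T act v0 = (\<Union>Y \<in> cylinders G T act. based_cylinder G T act v0 Y)"

section \<open>Regular neighbourhoods\<close>

definition crosses ::
    "('a, 'm) monoid_scheme \<Rightarrow> 'a set \<Rightarrow> 'a set \<Rightarrow> 'a set \<Rightarrow> bool" where
  "crosses G H X Y \<longleftrightarrow>
     \<not> H_finite G H (X \<inter> Y) \<and> \<not> H_finite G H (X \<inter> (carrier G - Y)) \<and>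
     \<not> H_finite G H ((carrier G - X) \<inter> Y) \<and>
     \<not> H_finite G H ((carrier G - X) \<inter> (carrier G - Y))"

type_synonym 'a ai_pair = "'a ai_class set"
type_synonym 'a ccc = "'a ai_pair set"

definition ai_pair :: "('a, 'm) monoid_scheme \<Rightarrow> 'a set \<Rightarrow> 'a set \<Rightarrow> 'a ai_pair" where
  "ai_pair G H X = {ai_class G H X, ai_class G H (carrier G - X)}"

definition ai_pairs :: "('a, 'm) monoid_scheme \<Rightarrow> 'a ai_class set \<Rightarrow> 'a ai_pair set" where
  "ai_pairs G \<X> = {ai_pair G H X | H X. nontrivial_ai G H X \<and> ai_class G H X \<in> \<X>}"

definition crossing_rel ::
    "('a, 'm) monoid_scheme \<Rightarrow> 'a ai_class set \<Rightarrow> ('a ai_pair \<times> 'a ai_pair) set" where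
  "crossing_rel G \<X> =
     {(p, q). p \<in> ai_pairs G \<X> \<and> q \<in> ai_pairs G \<X> \<and>
        (\<exists>H X K Y. almost_invariant G H X \<and> almost_invariant G K Y \<and>
           p = ai_pair G H X \<and> q = ai_pair G K Y \<and> crosses G H X Y)}"

definition cccs :: "('a, 'm) monoid_scheme \<Rightarrow> 'a ai_class set \<Rightarrow> 'a ccc set" where
  "cccs G \<X> = ai_pairs G \<X> // (crossing_rel G \<X> \<union> (crossing_rel G \<X>)\<inverse>)\<^sup>*"

definition represents_ccc ::
    "('a, 'm) monoid_scheme \<Rightarrow> 'a set \<Rightarrow> 'a ccc \<Rightarrow> bool" where
  "represents_ccc G X C \<longleftrightarrow> (\<exists>H. almost_invariant G H X \<and> ai_pair G H X \<in> C)"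

definition between_ccc ::
    "('a, 'm) monoid_scheme \<Rightarrow> 'a ccc \<Rightarrow> 'a ccc \<Rightarrow> 'a ccc \<Rightarrow> bool" where
  "between_ccc G C1 C2 C3 \<longleftrightarrow>
     C1 \<noteq> C2 \<and> C2 \<noteq> C3 \<and> C1 \<noteq> C3 \<and>
     (\<exists>X1 X2 X3. represents_ccc G X1 C1 \<and> represents_ccc G X2 C2 \<and> represents_ccc G X3 C3 \<and>
        X1 \<subseteq> X2 \<and> X2 \<subseteq> X3)"

definition nothing_between ::
    "('a, 'm) monoid_scheme \<Rightarrow> 'a ai_class set \<Rightarrow> 'a ccc set \<Rightarrow> bool" where
  "nothing_between G \<X> \<Sigma> \<longleftrightarrow>
     (\<forall>C \<in> \<Sigma>. \<forall>C' \<in> \<Sigma>. \<forall>C'' \<in> cccs G \<X>. \<not> between_ccc G C C'' C')"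

definition stars :: "('a, 'm) monoid_scheme \<Rightarrow> 'a ai_class set \<Rightarrow> 'a ccc set set" where
  "stars G \<X> =
     {\<Sigma>. \<Sigma> \<subseteq> cccs G \<X> \<and> (\<exists>C \<in> \<Sigma>. \<exists>C' \<in> \<Sigma>. C \<noteq> C') \<and> nothing_between G \<X> \<Sigma> \<and>
        (\<forall>\<Sigma>'. \<Sigma> \<subseteq> \<Sigma>' \<and> \<Sigma>' \<subseteq> cccs G \<X> \<and> nothing_between G \<X> \<Sigma>' \<longrightarrow> \<Sigma>' = \<Sigma>)}"

text \<open>If there are no CCCs, the graph is a point; \<open>Inr {}\<close> is a dummy name for that point,
  and it is fixed by the action defined below.\<close>

definition regular_neighbourhood ::
    "('a, 'm) monoid_scheme \<Rightarrow> 'a ai_class set \<Rightarrow> ('a ccc + 'a ccc set) sgraph" where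
  "regular_neighbourhood G \<X> =
     (if cccs G \<X> = {} then \<lparr> verts = {Inr {}}, edges = {} \<rparr>
      else \<lparr> verts = Inl ` cccs G \<X> \<union> Inr ` stars G \<X>,
             edges = {{Inl C, Inr \<Sigma>} | C \<Sigma>. C \<in> cccs G \<X> \<and> \<Sigma> \<in> stars G \<X> \<and> C \<in> \<Sigma>} \<rparr>)"

definition ccc_translate :: "('a, 'm) monoid_scheme \<Rightarrow> 'a \<Rightarrow> 'a ccc \<Rightarrow> 'a ccc" where
  "ccc_translate G g = (`) ((`) ((`) (ai_translate G g)))"

definition regular_neighbourhood_act ::
    "('a, 'm) monoid_scheme \<Rightarrow> 'a \<Rightarrow> ('a ccc + 'a ccc set) \<Rightarrow> ('a ccc + 'a ccc set)" where
  "regular_neighbourhood_act G g = map_sum (ccc_translate G g) ((`) (ccc_translate G g))"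

end

theory Submission
  imports Defs
begin

text \<open>For a set \<open>S\<close> of vertices with finite coboundary contained in a cylinder \<open>Y\<close>, the set \<open>X S\<close> of all
  \<open>g\<close> with \<open>g v0 \<in> S\<close> is almost invariant over a subgroup commensurable to the edge stabilizers of \<open>Y\<close>;
  up to equivalence these are all almost invariant sets based on \<open>Y\<close>. Sets based on distinct cylinders
  do not cross, since a cylinder is a subtree and lies on one side of any coboundary in another one.
  Inside one cylinder, an element of the Boolean algebra crosses nothing if and only if it or its complement
  is an atom, and the remaining elements form a single cross-connected component. By minimality, every 
  orbit of vertices meets every half-tree; this implies that, unless the algebra has only 
  four elements, its atoms are the branches of \<open>T\<close> attached to \<open>Y\<close> at the vertices \<open>x \<in> V0\<close> which have 
  finite valence in \<open>Y\<close>.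

  So a cylinder \<open>Y\<close> yields one component if its algebra has four elements, one component for each of 
  the three atoms if it has eight, and one component for each atom and one further component otherwise. 
  Betweenness is separation in the tree of cylinders in which the edge from \<open>x\<close> to \<open>Y\<close> receives, if 
  the branch at \<open>x\<close> is an atom, no new vertex in the first case, one in the second case and two in the 
  third. Hence the stars are the remaining vertices of that subdivision.\<close>

section \<open>Sets that are finite over a subgroup\<close>

text \<open>The obstacle is that the notions live on different levels. Elements of the algebras are
  vertex sets modulo small ones, classes contain arbitrary almost invariant sets, crossing asks for
  infinite corners, and betweenness asks for genuine inclusions of representatives. All of this is
  reduced to one relation: \<open>side\<close> tells on which side of a set in one component another
  component lies, and the corner of two sets from different components is small exactly if neither
  component lies on the side of the set of the other (\<open>side_small\<close>). This works because
  a corner of two non-trivial sets from different cylinders is empty or not small, whereas inside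
  one cylinder a small corner can be subtracted without changing the class; inclusions modulo small
  sets thus become genuine ones (\<open>reps_shrink\<close>).

  Half-trees are never small, and they are the usual witnesses that a set is not small.

  The tree structure is then recovered in the abstract setting \<open>walls\<close>, from points,
  stars and sides alone. Its graph is mapped injectively onto both graphs of the theorem, so that no
  map between these two has to be written down.\<close>

context group
begin

lemma H_finite_iff:
  assumes "H \<subseteq> carrier G"
  shows "H_finite G H Z \<longleftrightarrow> (\<exists>F. finite F \<and> F \<subseteq> carrier G \<and> (\<forall>z\<in>Z. \<exists>h\<in>H. \<exists>f\<in>F. z = h \<otimes> f))"
  unfolding H_finite_def r_coset_def by (intro ex_cong1) blast

lemma H_finiteE:
  assumes "H_finite G H Z" "H \<subseteq> carrier G"
  obtains F where "finite F" "F \<subseteq> carrier G" "\<forall>z\<in>Z. \<exists>h\<in>H. \<exists>f\<in>F. z = h \<otimes> f"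
  using assms(1) unfolding H_finite_iff[OF assms(2)] by auto

lemma H_finite_coverE:
  assumes "H_finite G H Z"
  obtains F where "finite F" "F \<subseteq> carrier G" "Z \<subseteq> (\<Union>g\<in>F. H #> g)"
  using assms unfolding H_finite_def by auto

lemma H_finite_coverI:
  "finite F \<Longrightarrow> F \<subseteq> carrier G \<Longrightarrow> Z \<subseteq> (\<Union>g\<in>F. H #> g) \<Longrightarrow> H_finite G H Z"
  unfolding H_finite_def by auto

lemma H_finite_mono: "H_finite G H Z \<Longrightarrow> W \<subseteq> Z \<Longrightarrow> H_finite G H W"
  unfolding H_finite_def by blast

lemma H_finite_empty [simp]: "H_finite G H {}"
  unfolding H_finite_def by blast

lemma H_finite_UnI:
  assumes "H_finite G H Z" "H_finite G H W"
  shows "H_finite G H (Z \<union> W)"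
proof -
  obtain F where F: "finite F" "F \<subseteq> carrier G" "Z \<subseteq> (\<Union>g\<in>F. H #> g)"
    using assms(1) unfolding H_finite_def by auto
  obtain F' where F': "finite F'" "F' \<subseteq> carrier G" "W \<subseteq> (\<Union>g\<in>F'. H #> g)"
    using assms(2) unfolding H_finite_def by auto
  have "Z \<union> W \<subseteq> (\<Union>g\<in>F \<union> F'. H #> g)"
    unfolding UN_Un using F(3) F'(3) by (rule Un_mono)
  then show ?thesis
    unfolding H_finite_def using F F' by (intro exI[of _ "F \<union> F'"] conjI) simp_all
qed

lemma H_finite_Un: "H_finite G H (Z \<union> W) \<longleftrightarrow> H_finite G H Z \<and> H_finite G H W"
  by (meson H_finite_UnI H_finite_mono Un_upper1 Un_upper2)

lemma H_finite_sub: 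
  assumes "H_finite G H Z" "H_finite G H (W - Z)"
  shows "H_finite G H W"
  using assms H_finite_Un[of H Z "W - Z"] H_finite_mono[of H "Z \<union> (W - Z)" W] by auto

lemma H_finite_UN:
  "finite I \<Longrightarrow> (\<And>i. i \<in> I \<Longrightarrow> H_finite G H (f i)) \<Longrightarrow> H_finite G H (\<Union>i\<in>I. f i)"
  by (induction I rule: finite_induct) (auto simp: H_finite_Un)

lemma H_finite_r_coset:
  assumes "H \<subseteq> carrier G" "H_finite G H Z" "s \<in> carrier G"
  shows "H_finite G H (Z #> s)"
proof -
  obtain F where F: "finite F" "F \<subseteq> carrier G" "\<forall>z\<in>Z. \<exists>h\<in>H. \<exists>f\<in>F. z = h \<otimes> f"
    using H_finiteE[OF assms(2,1)] .
  have "\<forall>z\<in>Z #> s. \<exists>h\<in>H. \<exists>f\<in>(\<lambda>f. f \<otimes> s) ` F. z = h \<otimes> f"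
  proof
    fix w assume "w \<in> Z #> s"
    then obtain z where "z \<in> Z" "w = z \<otimes> s" unfolding r_coset_def by auto
    moreover then obtain h f where "h \<in> H" "f \<in> F" "z = h \<otimes> f" using F(3) by auto
    moreover then have "h \<in> carrier G" "f \<in> carrier G" using F(2) assms(1) by auto
    ultimately show "\<exists>h\<in>H. \<exists>f\<in>(\<lambda>f. f \<otimes> s) ` F. w = h \<otimes> f"
      using assms(3) by (auto simp: m_assoc)
  qed
  then show ?thesis
    unfolding H_finite_iff[OF assms(1)] using F assms by (intro exI[of _ "(\<lambda>f. f \<otimes> s) ` F"]) auto
qed

lemma H_finite_trans:
  assumes "H \<subseteq> carrier G" "K \<subseteq> carrier G" "H_finite G H K" "H_finite G K Z"
  shows "H_finite G H Z"
proof -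
  obtain F where F: "finite F" "F \<subseteq> carrier G" "\<forall>z\<in>K. \<exists>h\<in>H. \<exists>f\<in>F. z = h \<otimes> f"
    using H_finiteE[OF assms(3,1)] .
  obtain F' where F': "finite F'" "F' \<subseteq> carrier G" "\<forall>z\<in>Z. \<exists>h\<in>K. \<exists>f\<in>F'. z = h \<otimes> f"
    using H_finiteE[OF assms(4,2)] .
  have "\<forall>z\<in>Z. \<exists>h\<in>H. \<exists>f\<in>(\<lambda>(f,f'). f \<otimes> f') ` (F \<times> F'). z = h \<otimes> f"
  proof
    fix z assume "z \<in> Z"
    then obtain k f' where "k \<in> K" "f' \<in> F'" "z = k \<otimes> f'" using F' by blast
    moreover then obtain h f where "h \<in> H" "f \<in> F" "k = h \<otimes> f" using F by blast
    ultimately have "z = h \<otimes> (f \<otimes> f')" "f \<otimes> f' \<in> (\<lambda>(f,f'). f \<otimes> f') ` (F \<times> F')" 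
      using F F' assms by (auto simp: m_assoc subset_iff)
    then show "\<exists>h\<in>H. \<exists>f\<in>(\<lambda>(f,f'). f \<otimes> f') ` (F \<times> F'). z = h \<otimes> f" using \<open>h \<in> H\<close> by blast
  qed
  then show ?thesis
    unfolding H_finite_iff[OF assms(1)] using F F' assms
    by (intro exI[of _ "(\<lambda>(f,f'). f \<otimes> f') ` (F \<times> F')"]) auto
qed

lemma H_finite_superset:
  assumes "H \<subseteq> K" "H_finite G H Z"
  shows "H_finite G K Z"
proof -
  obtain F where F: "finite F" "F \<subseteq> carrier G" "Z \<subseteq> (\<Union>g\<in>F. H #> g)"
    using H_finite_coverE[OF assms(2)] .
  moreover have "(\<Union>g\<in>F. H #> g) \<subseteq> (\<Union>g\<in>F. K #> g)"
    using assms(1) unfolding r_coset_def by (intro UN_mono) auto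
  ultimately show ?thesis by (intro H_finite_coverI[of F]) auto
qed

lemma H_finite_self: 
  assumes "subgroup H G"
  shows "H_finite G H H"
  using coset_mult_one[OF subgroup.subset[OF assms]] by (intro H_finite_coverI[of "{\<one>}"]) auto

text \<open>A non-empty intersection of a coset of \<open>H\<close> with one of \<open>K\<close> is a coset of \<open>H \<inter> K\<close>.\<close>

lemma H_finite_Int:
  assumes H: "subgroup H G" and K: "subgroup K G" and "H_finite G H Z" "H_finite G K Z" 
    and Z: "Z \<subseteq> carrier G"
  shows "H_finite G (H \<inter> K) Z"
proof -
  note HK = subgroup.subset[OF H] subgroup.subset[OF K]
  obtain F where F: "finite F" "F \<subseteq> carrier G" "Z \<subseteq> (\<Union>g\<in>F. H #> g)"
    using H_finite_coverE[OF assms(3)] .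
  obtain F' where F': "finite F'" "F' \<subseteq> carrier G" "Z \<subseteq> (\<Union>g\<in>F'. K #> g)"
    using H_finite_coverE[OF assms(4)] .
  \<comment> \<open>One point of \<open>Z\<close> is chosen for every pair of cosets whose
    intersection meets \<open>Z\<close>. These finitely many points represent the required cosets of
    the intersection of the two subgroups.\<close>
  define c where "c = (\<lambda>(f,f'). SOME z. z \<in> Z \<and> z \<in> H #> f \<and> z \<in> K #> f')"
  let ?I = "{p \<in> F \<times> F'. \<exists>z. z \<in> Z \<and> z \<in> H #> fst p \<and> z \<in> K #> snd p}"
  have c: "c p \<in> Z \<and> c p \<in> H #> fst p \<and> c p \<in> K #> snd p" if "p \<in> ?I" for p
  proof -
    have "\<exists>z. z \<in> Z \<and> z \<in> H #> fst p \<and> z \<in> K #> snd p" using that by blast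
    from someI_ex[OF this] show ?thesis by (simp add: c_def case_prod_unfold)
  qed
  have *: "z \<otimes> inv w \<in> L" 
    if L: "subgroup L G" and z: "z \<in> L #> f" and w: "w \<in> L #> f" and f: "f \<in> carrier G" for L z w f
  proof -
    have "w \<in> carrier G" using w f r_coset_subset_G[OF subgroup.subset[OF L]] by blast
    moreover have "z \<in> L #> w" using repr_independence[OF w f L] z by simp
    ultimately show ?thesis using subgroup.rcos_module_imp[OF L is_group] by blast
  qed
  have "\<forall>z\<in>Z. \<exists>h\<in>H \<inter> K. \<exists>f\<in>c ` ?I. z = h \<otimes> f"
  proof
    fix z assume z: "z \<in> Z"
    obtain f where f: "f \<in> F" "z \<in> H #> f" using F(3) z by auto
    moreover obtain f' where f': "f' \<in> F'" "z \<in> K #> f'" using F'(3) z by auto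
    ultimately have p: "(f,f') \<in> ?I" using z by auto
    have cp: "c (f,f') \<in> H #> f" "c (f,f') \<in> K #> f'" "c (f,f') \<in> carrier G" 
      using c[OF p] Z by auto
    have "f \<in> carrier G" "f' \<in> carrier G" using f f' F(2) F'(2) by auto
    then have "z \<otimes> inv (c (f,f')) \<in> H \<inter> K" 
      using *[OF H f(2) cp(1)] *[OF K f'(2) cp(2)] by simp
    moreover have "z = (z \<otimes> inv (c (f,f'))) \<otimes> c (f,f')"
      using cp(3) subsetD[OF Z z] by (simp add: m_assoc)
    moreover have "c (f,f') \<in> c ` ?I" using p by (rule imageI)
    ultimately show "\<exists>h\<in>H \<inter> K. \<exists>f\<in>c ` ?I. z = h \<otimes> f" by (rule_tac bexI, rule_tac bexI)
  qed
  moreover have "c ` ?I \<subseteq> carrier G" 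
  proof
    fix g assume "g \<in> c ` ?I"
    then obtain p where "p \<in> ?I" "g = c p" by (rule imageE)
    then show "g \<in> carrier G" using c[of p] Z by auto
  qed
  moreover have "finite (c ` ?I)" using F F' by auto
  ultimately show ?thesis
    unfolding H_finite_iff[OF le_infI1[OF HK(1)]] by (intro exI[of _ "c ` ?I"] conjI)
qed

section \<open>Finite index and commensurability in terms of \<open>H_finite\<close>\<close>

lemma finite_index_iff:
  assumes A: "subgroup A G" and B: "subgroup B G"
  shows "finite_index G A B \<longleftrightarrow> A \<subseteq> B \<and> H_finite G A B"
proof (cases "A \<subseteq> B")
  case True
  have eq: "rcosets\<^bsub>G\<lparr>carrier := B\<rparr>\<^esub> A = (\<lambda>b. A #> b) ` B"
    unfolding RCOSETS_def r_coset_def by auto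
  have "finite ((\<lambda>b. A #> b) ` B) \<longleftrightarrow> H_finite G A B"
  proof
    assume "finite ((\<lambda>b. A #> b) ` B)"
    then obtain F where F: "F \<subseteq> B" "finite F" "(\<lambda>b. A #> b) ` B = (\<lambda>b. A #> b) ` F" 
      by (meson finite_subset_image order_refl)
    have "B \<subseteq> (\<Union>g\<in>F. A #> g)"
    proof
      fix b assume "b \<in> B"
      then have "b \<in> A #> b" using subgroup.subset[OF B] A by (auto intro: rcos_self)
      moreover have "A #> b \<in> (\<lambda>b. A #> b) ` F" using F \<open>b \<in> B\<close> by blast
      ultimately show "b \<in> (\<Union>g\<in>F. A #> g)" by auto
    qed
    then show "H_finite G A B" using F subgroup.subset[OF B] by (intro H_finite_coverI[of F]) auto
  next
    assume "H_finite G A B"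
    then obtain F where F: "finite F" "F \<subseteq> carrier G" "B \<subseteq> (\<Union>g\<in>F. A #> g)"
      by (rule H_finite_coverE)
    have "(\<lambda>b. A #> b) ` B \<subseteq> (\<lambda>b. A #> b) ` F"
    proof
      fix C assume "C \<in> (\<lambda>b. A #> b) ` B"
      then obtain b where b: "b \<in> B" "C = A #> b" by blast
      then obtain g where "g \<in> F" "b \<in> A #> g" using F by blast
      then have "A #> b = A #> g" using F A by (metis repr_independence subsetD)
      then show "C \<in> (\<lambda>b. A #> b) ` F" using b \<open>g \<in> F\<close> by blast
    qed
    then show "finite ((\<lambda>b. A #> b) ` B)" using F(1) finite_surj by blast
  qed
  then show ?thesis using eq True by (simp add: finite_index_def)
qed (simp add: finite_index_def)

text \<open>\<open>B\<close> lies in finitely many cosets of \<open>A\<close> and in one coset of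
  \<open>B\<close>, so \<open>H_finite_Int\<close> covers it by finitely many cosets of
  \<open>A \<inter> B\<close>. Without intersections in the condition, transitivity is that of
  \<open>H_finite\<close>.\<close>

lemma commensurable_iff:
  "commensurable G A B \<longleftrightarrow> subgroup A G \<and> subgroup B G \<and> H_finite G A B \<and> H_finite G B A"
proof (cases "subgroup A G \<and> subgroup B G")
  case True
  then have "subgroup (A \<inter> B) G" using subgroups_Inter_pair by blast
  then show ?thesis
    using True H_finite_Int[of A B A] H_finite_Int[of A B B] H_finite_self
      H_finite_superset[of "A \<inter> B" A B] H_finite_superset[of "A \<inter> B" B A]
    unfolding commensurable_def by (auto simp: finite_index_iff dest: subgroup.subset)
qed (auto simp: commensurable_def)

lemma commensurable_refl: "subgroup A G \<Longrightarrow> commensurable G A A"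
  by (simp add: commensurable_iff H_finite_self)

lemma commensurable_sym: "commensurable G A B \<Longrightarrow> commensurable G B A"
  by (simp add: commensurable_iff)

lemma commensurable_trans: "commensurable G A B \<Longrightarrow> commensurable G B C \<Longrightarrow> commensurable G A C"
  unfolding commensurable_iff by (meson H_finite_trans subgroup.subset)

lemma commensurable_H_finite:
  "commensurable G A B \<Longrightarrow> H_finite G A Z \<longleftrightarrow> H_finite G B Z"
  unfolding commensurable_iff by (meson H_finite_trans subgroup.subset)

lemma commensurable_Int:
  assumes "commensurable G A C" "commensurable G B C"
  shows "commensurable G (A \<inter> B) C"
proof -
  have s: "subgroup A G" "subgroup B G" "subgroup C G" using assms commensurable_iff by auto
  have "H_finite G A C" "H_finite G B C" "H_finite G C A" using assms commensurable_iff by auto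
  moreover have "H_finite G (A \<inter> B) C" 
    using H_finite_Int[OF s(1,2)] calculation subgroup.subset[OF s(3)] by blast
  moreover have "H_finite G C (A \<inter> B)" 
    using H_finite_mono[of C A "A \<inter> B"] calculation by blast
  ultimately show ?thesis unfolding commensurable_iff using s subgroups_Inter_pair by blast
qed

section \<open>Almost invariant sets and commensurability\<close>

lemma almost_invariant_iff:
  "almost_invariant G H X \<longleftrightarrow> subgroup H G \<and> X \<subseteq> carrier G \<and> (\<forall>h\<in>H. \<forall>x\<in>X. h \<otimes> x \<in> X) \<and>
     (\<forall>s \<in> carrier G. H_finite G H (sym_diff X (X #> s)))"
proof -
  have "H <#> X = X \<longleftrightarrow> (\<forall>h\<in>H. \<forall>x\<in>X. h \<otimes> x \<in> X)" if "subgroup H G" "X \<subseteq> carrier G"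
  proof
    assume "\<forall>h\<in>H. \<forall>x\<in>X. h \<otimes> x \<in> X"
    moreover have "X \<subseteq> H <#> X"
    proof
      fix x assume x: "x \<in> X"
      then have "x = \<one> \<otimes> x" using that by auto
      then show "x \<in> H <#> X" unfolding set_mult_def using x subgroup.one_closed[OF that(1)] by blast
    qed
    ultimately show "H <#> X = X" unfolding set_mult_def by blast
  qed (auto simp: set_mult_def)
  then show ?thesis unfolding almost_invariant_def by blast
qed

lemma mem_r_coset_iff:
  assumes "X \<subseteq> carrier G" "s \<in> carrier G" "g \<in> carrier G"
  shows "g \<in> X #> s \<longleftrightarrow> g \<otimes> inv s \<in> X"
  using assms unfolding r_coset_def 
  by (auto simp: m_assoc subset_iff) (metis inv_closed inv_solve_right m_closed)

lemma r_coset_subset: "X \<subseteq> carrier G \<Longrightarrow> s \<in> carrier G \<Longrightarrow> X #> s \<subseteq> carrier G"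
  unfolding r_coset_def by auto

lemma r_coset_compl:
  assumes "X \<subseteq> carrier G" "s \<in> carrier G"
  shows "(carrier G - X) #> s = carrier G - (X #> s)"
proof (rule Set.set_eqI)
  fix g
  show "g \<in> (carrier G - X) #> s \<longleftrightarrow> g \<in> carrier G - (X #> s)"
  proof (cases "g \<in> carrier G")
    case True
    then show ?thesis using assms(2) mem_r_coset_iff[OF assms True] 
        mem_r_coset_iff[of "carrier G - X" s g] by simp
  next
    case False
    then show ?thesis using r_coset_subset[of "carrier G - X" s] assms(2) by blast
  qed
qed

lemma almost_invariant_compl:
  assumes "almost_invariant G H X"
  shows "almost_invariant G H (carrier G - X)"
proof -
  have H: "subgroup H G" "X \<subseteq> carrier G" "\<forall>h\<in>H. \<forall>x\<in>X. h \<otimes> x \<in> X"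
    "\<forall>s \<in> carrier G. H_finite G H (sym_diff X (X #> s))"
    using assms by (auto simp: almost_invariant_iff)
  have "h \<otimes> x \<in> carrier G - X" if "h \<in> H" "x \<in> carrier G - X" for h x
  proof -
    have h: "h \<in> carrier G" using that H subgroup.subset by blast
    have "inv h \<otimes> (h \<otimes> x) = x" using h that by (simp flip: m_assoc)
    moreover have "inv h \<in> H" using that H by (simp add: subgroup.m_inv_closed)
    ultimately show ?thesis using H that h by (metis Diff_iff m_closed)
  qed
  moreover have "sym_diff (carrier G - X) ((carrier G - X) #> s) = sym_diff X (X #> s)" 
    if "s \<in> carrier G" for s
    unfolding r_coset_compl[OF H(2) that] using H(2) r_coset_subset[OF H(2) that] by blast
  ultimately show ?thesis using H by (auto simp: almost_invariant_iff)
qed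

lemma almost_invariant_Un:
  assumes X: "almost_invariant G H X" and Y: "almost_invariant G K Y"
    and c: "commensurable G H K"
  shows "almost_invariant G (H \<inter> K) (X \<union> Y)"
proof -
  have H: "subgroup H G" "X \<subseteq> carrier G" "\<forall>h\<in>H. \<forall>x\<in>X. h \<otimes> x \<in> X"
    "\<forall>s \<in> carrier G. H_finite G H (sym_diff X (X #> s))"
    using X by (auto simp: almost_invariant_iff)
  have K: "subgroup K G" "Y \<subseteq> carrier G" "\<forall>h\<in>K. \<forall>x\<in>Y. h \<otimes> x \<in> Y"
    "\<forall>s \<in> carrier G. H_finite G K (sym_diff Y (Y #> s))"
    using Y by (auto simp: almost_invariant_iff)
  have "commensurable G (H \<inter> K) K" using commensurable_Int[OF c] K commensurable_refl by blast
  moreover have "commensurable G (H \<inter> K) H" 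
    using commensurable_Int[OF _ commensurable_sym[OF c]] H commensurable_refl by blast
  moreover have "sym_diff (X \<union> Y) ((X \<union> Y) #> s) \<subseteq> sym_diff X (X #> s) \<union> sym_diff Y (Y #> s)" for s
    unfolding r_coset_def by blast
  ultimately have "\<forall>s \<in> carrier G. H_finite G (H \<inter> K) (sym_diff (X \<union> Y) ((X \<union> Y) #> s))"
    using H(4) K(4) by (meson H_finite_Un H_finite_mono commensurable_H_finite)
  then show ?thesis using H K subgroups_Inter_pair unfolding almost_invariant_iff by auto
qed

text \<open>Right translation by \<open>inv x \<otimes> g\<close> carries \<open>x\<close> to
  \<open>g\<close>. The contrapositive supplies a translation that moves a given proper non-empty
  set.\<close>

lemma right_invariant_trivial:
  assumes "X \<subseteq> carrier G" "\<forall>s\<in>carrier G. X #> s = X" "x \<in> X"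
  shows "X = carrier G"
proof -
  have "g \<in> X" if "g \<in> carrier G" for g
  proof -
    have "x \<in> carrier G" using assms by blast
    then have "g = x \<otimes> (inv x \<otimes> g)" using that by (simp flip: m_assoc)
    then have "g \<in> X #> (inv x \<otimes> g)" using assms unfolding r_coset_def by blast
    then show ?thesis using assms \<open>x \<in> carrier G\<close> that by auto
  qed
  then show ?thesis using assms by blast
qed

text \<open>If \<open>Y s \<noteq> Y\<close>, the symmetric difference of the two is a non-empty union of cosets of \<open>K\<close>.\<close>

lemma equivalent_H_finite:
  assumes X: "almost_invariant G H X" and Y: "almost_invariant G K Y"
    and XY: "H_finite G H (sym_diff X Y)" and ne: "Y \<noteq> {}" "Y \<noteq> carrier G"
  shows "H_finite G H K"
proof -
  have H: "subgroup H G" "X \<subseteq> carrier G" "\<forall>s \<in> carrier G. H_finite G H (sym_diff X (X #> s))"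
    using X by (auto simp: almost_invariant_iff)
  have K: "subgroup K G" "Y \<subseteq> carrier G" "\<forall>h\<in>K. \<forall>x\<in>Y. h \<otimes> x \<in> Y" and 
    K': "\<forall>h\<in>K. \<forall>x\<in>carrier G - Y. h \<otimes> x \<in> carrier G - Y"
    using Y almost_invariant_compl[OF Y] by (auto simp: almost_invariant_iff)
  note Hc = subgroup.subset[OF H(1)] and Kc = subgroup.subset[OF K(1)]
  obtain y where y: "y \<in> Y" using ne(1) by auto
  obtain s where s: "s \<in> carrier G" "Y #> s \<noteq> Y" 
    using right_invariant_trivial[OF K(2) _ y] ne(2) by auto
  then obtain g where g: "g \<in> sym_diff Y (Y #> s)" by auto
  have gc: "g \<in> carrier G" using g K(2) r_coset_subset[OF K(2) s(1)] by auto
  have "sym_diff Y (Y #> s) \<subseteq> sym_diff X Y \<union> sym_diff X (X #> s) \<union> (sym_diff X Y #> s)"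
    unfolding r_coset_def by blast
  moreover have "H_finite G H (sym_diff X Y \<union> sym_diff X (X #> s) \<union> (sym_diff X Y #> s))"
    using XY H(3) s H_finite_r_coset[OF Hc XY s(1)] by (intro H_finite_UnI[of H "_ \<union> _"] H_finite_UnI[of H "sym_diff _ _"]) simp_all
  ultimately have fin: "H_finite G H (sym_diff Y (Y #> s))" by (rule H_finite_mono[rotated])
  have "k \<otimes> g \<in> sym_diff Y (Y #> s)" if "k \<in> K" for k
  proof -
    have *: "w \<in> Y \<longleftrightarrow> k \<otimes> w \<in> Y" if "w \<in> carrier G" for w using K K' \<open>k \<in> K\<close> that by blast
    have "k \<in> carrier G" using that Kc by blast
    then have "k \<otimes> g \<in> Y #> s \<longleftrightarrow> g \<in> Y #> s"
      using mem_r_coset_iff[OF K(2) s(1)] gc s *[of "g \<otimes> inv s"] by (simp add: m_assoc)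
    then show ?thesis using *[OF gc] g by blast
  qed
  then have "K #> g \<subseteq> sym_diff Y (Y #> s)" unfolding r_coset_def by (intro UN_least) simp
  then have "H_finite G H (K #> g)" by (rule H_finite_mono[OF fin])
  then have "H_finite G H (K #> g #> inv g)" using H_finite_r_coset[OF Hc] gc by simp
  then show ?thesis using gc Kc by (simp add: coset_mult_assoc)
qed

text \<open>Non-triviality of \<open>Y\<close> keeps both sets away from the empty set and the whole
  group, so \<open>equivalent_H_finite\<close> applies in both directions. This is why a class
  determines its subgroup up to commensurability, and hence its cylinder.\<close>

lemma equivalent_commensurable:
  assumes X: "almost_invariant G H X" and Y: "nontrivial_ai G K Y"
    and XY: "H_finite G H (sym_diff X Y)" "H_finite G K (sym_diff X Y)"
  shows "commensurable G H K \<and> nontrivial_ai G H X"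
proof -
  have Y': "almost_invariant G K Y" "\<not> H_finite G K Y" "\<not> H_finite G K (carrier G - Y)"
    using Y by (auto simp: nontrivial_ai_def)
  have s: "X \<subseteq> carrier G" "Y \<subseteq> carrier G" using X Y' by (auto simp: almost_invariant_iff)
  have ne: "Y \<noteq> {}" "Y \<noteq> carrier G" using Y' by auto
  have "X \<noteq> {}" using XY Y' by auto
  moreover have "X \<noteq> carrier G" 
  proof
    assume "X = carrier G"
    then have "sym_diff X Y = carrier G - Y" using s by auto
    then show False using XY Y' by simp
  qed
  moreover have "sym_diff Y X = sym_diff X Y" by auto
  ultimately have "H_finite G K H" using equivalent_H_finite[OF Y'(1) X] XY by simp
  moreover have "H_finite G H K" using equivalent_H_finite[OF X Y'(1)] XY ne by simp
  ultimately have c: "commensurable G H K" 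
    using X Y' by (auto simp: commensurable_iff almost_invariant_iff)
  have "H_finite G K (Y - X)" "H_finite G K ((carrier G - Y) - (carrier G - X))"
    by (rule H_finite_mono[OF XY(2)], use s in auto)+
  then have "\<not> H_finite G K X" "\<not> H_finite G K (carrier G - X)"
    using Y' H_finite_sub[of K X Y] H_finite_sub[of K "carrier G - X" "carrier G - Y"] by auto
  then have "\<not> H_finite G H X" "\<not> H_finite G H (carrier G - X)"
    unfolding commensurable_H_finite[OF c] .
  then show ?thesis using c X by (simp add: nontrivial_ai_def)
qed

text \<open>For \<open>x\<^sub>1 \<in> X\<close> outside the cosets \<open>H f\<^sub>i\<close> covering \<open>X \<inter> Y\<close>, the coset \<open>H x\<^sub>1\<close> lies in
  \<open>X - Y\<close>; hence right translation by the inverse of some \<open>f\<^sub>i\<close> times \<open>x\<^sub>1\<close> moves any point of \<open>X \<inter> Y\<close>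
  out of \<open>Y\<close>.\<close>

lemma H_finite_corner_sym:
  assumes X: "almost_invariant G H X" "\<not> H_finite G H X" and Y: "almost_invariant G K Y"
    and fin: "H_finite G H (X \<inter> Y)"
  shows "H_finite G K (X \<inter> Y)"
proof -
  have H: "subgroup H G" "X \<subseteq> carrier G" "\<forall>h\<in>H. \<forall>x\<in>X. h \<otimes> x \<in> X"
    using X by (auto simp: almost_invariant_iff)
  have K: "subgroup K G" "Y \<subseteq> carrier G" "\<forall>s \<in> carrier G. H_finite G K (sym_diff Y (Y #> s))"
    using Y by (auto simp: almost_invariant_iff)
  note Hc = subgroup.subset[OF H(1)]
  obtain F where F: "finite F" "F \<subseteq> carrier G" "X \<inter> Y \<subseteq> (\<Union>g\<in>F. H #> g)"
    using fin by (rule H_finite_coverE)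
  then obtain x where x: "x \<in> X" "x \<notin> (\<Union>g\<in>F. H #> g)" using X(2) H_finite_coverI by blast
  have xc: "x \<in> carrier G" using x H by blast
  have "X \<inter> Y \<subseteq> (\<Union>f\<in>F. sym_diff Y (Y #> inv (inv f \<otimes> x)))"
  proof
    fix g assume g: "g \<in> X \<inter> Y"
    then obtain f where f: "f \<in> F" "g \<in> H #> f" using F(3) by auto
    then obtain h where h: "h \<in> H" "g = h \<otimes> f" unfolding r_coset_def by auto
    have c: "f \<in> carrier G" "h \<in> carrier G" using f F h Hc by auto
    have "h \<otimes> x \<notin> Y"
    proof
      assume "h \<otimes> x \<in> Y"
      then have "h \<otimes> x \<in> X \<inter> Y" using H(3) x(1) h(1) by simp
      then have "h \<otimes> x \<in> (\<Union>g\<in>F. H #> g)" by (rule subsetD[OF F(3)])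
      then obtain f' where f': "f' \<in> F" "h \<otimes> x \<in> H #> f'" by auto
      then obtain k where k: "k \<in> H" "h \<otimes> x = k \<otimes> f'" unfolding r_coset_def by auto
      have c': "f' \<in> carrier G" "k \<in> carrier G" using f' F(2) k Hc by auto
      have "x = inv h \<otimes> (h \<otimes> x)" using c xc by (simp flip: m_assoc)
      then have "x = (inv h \<otimes> k) \<otimes> f'" using k c c' by (simp add: m_assoc)
      then have "x \<in> H #> f'" unfolding r_coset_def using H(1) h k 
        by (auto simp: subgroup.m_closed subgroup.m_inv_closed)
      then show False using x(2) f' by auto
    qed
    moreover have "g \<otimes> (inv f \<otimes> x) = h \<otimes> x" using h(2) c xc
      by (simp add: m_assoc, simp flip: m_assoc[of f])
    ultimately have "g \<notin> Y #> inv (inv f \<otimes> x)"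
      using mem_r_coset_iff[of Y "inv (inv f \<otimes> x)" g] K g c xc by auto
    then show "g \<in> (\<Union>f\<in>F. sym_diff Y (Y #> inv (inv f \<otimes> x)))" using f(1) g by auto
  qed
  moreover have "H_finite G K (\<Union>f\<in>F. sym_diff Y (Y #> inv (inv f \<otimes> x)))"
    using F xc K(3) by (intro H_finite_UN) (auto simp: subset_iff)
  ultimately show ?thesis by (rule H_finite_mono[rotated])
qed

text \<open>The change from \<open>X0\<close> to \<open>X\<close> is finite over \<open>H\<close>,
  that from \<open>Y0\<close> to \<open>Y\<close> only over \<open>K\<close>. So the corner is
  carried to the other subgroup by \<open>H_finite_corner_sym\<close> between the two replacements,
  and back at the end.\<close>

lemma H_finite_corner_cong:
  assumes X: "almost_invariant G H X" "\<not> H_finite G H X" and X0: "H_finite G H (sym_diff X X0)"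
    and Y: "almost_invariant G K Y" "\<not> H_finite G K Y" and Y0: "almost_invariant G L Y0"
    "commensurable G L K" "H_finite G K (sym_diff Y Y0)" and fin: "H_finite G H (X0 \<inter> Y0)"
  shows "H_finite G H (X \<inter> Y)"
proof -
  have "H_finite G H (X \<inter> Y0)"
    by (rule H_finite_sub[OF fin]) (rule H_finite_mono[OF X0], blast)
  then have "H_finite G L (X \<inter> Y0)" by (rule H_finite_corner_sym[OF X Y0(1)])
  then have "H_finite G K (X \<inter> Y0)" by (simp add: commensurable_H_finite[OF Y0(2)])
  then have "H_finite G K (X \<inter> Y)"
    by (rule H_finite_sub) (rule H_finite_mono[OF Y0(3)], blast)
  then show ?thesis using H_finite_corner_sym[OF Y X(1)] by (simp add: Int_commute)
qed

lemma ai_class_self: "almost_invariant G H X \<Longrightarrow> (H, X) \<in> ai_class G H X"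
  by (simp add: ai_class_def)

end

section \<open>Half-trees and coboundaries\<close>

text \<open>Reachability is turned into the list without repetitions that \<open>graph_cycle\<close>
  expects.\<close>

lemma rtrancl_distinct_path:
  assumes "(x, y) \<in> R\<^sup>*"
  obtains vs where "vs \<noteq> []" "hd vs = x" "last vs = y" "distinct vs"
    "successively (\<lambda>a b. (a, b) \<in> R) vs"
proof -
  have "\<exists>vs. vs \<noteq> [] \<and> hd vs = x \<and> last vs = y \<and> distinct vs \<and> successively (\<lambda>a b. (a, b) \<in> R) vs"
    using assms
  proof (induction rule: rtrancl_induct)
    case base
    show ?case by (intro exI[of _ "[x]"]) simp
  next
    case (step y z)
    then obtain vs where vs: "vs \<noteq> []" "hd vs = x" "last vs = y" "distinct vs"
      "successively (\<lambda>a b. (a, b) \<in> R) vs" by auto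
    show ?case
    proof (cases "z \<in> set vs")
      case True
      \<comment> \<open>If the path has met \<open>z\<close> before, it is cut off there.\<close>
      then obtain p q where pq: "vs = p @ z # q" by (meson split_list)
      then have "successively (\<lambda>a b. (a, b) \<in> R) (p @ [z])"
        using vs(5) successively_append_iff[of _ "p @ [z]" q] by simp
      then show ?thesis using vs(2,4) pq
        by (intro exI[of _ "p @ [z]"]) (cases p; auto)
    next
      case False
      then show ?thesis using vs step
        by (intro exI[of _ "vs @ [z]"]) (auto simp: successively_append_iff)
    qed
  qed
  then show ?thesis using that by auto
qed

locale tree =
  fixes T :: "'v sgraph"
  assumes is_tree: "is_tree T"
begin

abbreviation "V \<equiv> verts T"
abbreviation "E \<equiv> edges T"
abbreviation "hf \<equiv> half_tree T"

definition cobd :: "'v set \<Rightarrow> 'v set set" where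
  "cobd S = {e \<in> E. \<exists>a b. e = {a, b} \<and> a \<in> S \<and> b \<notin> S}"

text \<open>These are the edges of the geodesic from \<open>a\<close> to \<open>b\<close>.
  Describing them by half-trees avoids choosing a path, makes them additive modulo 2
  (\<open>sep_sym_diff\<close>), and turns \<open>card (sep a b)\<close> into the distance.\<close>

definition sep :: "'v \<Rightarrow> 'v \<Rightarrow> 'v set set" where
  "sep a b = {e \<in> E. \<exists>u v. e = {u, v} \<and> a \<in> hf u v \<and> b \<notin> hf u v}"

lemma edgeD: "{u, v} \<in> E \<Longrightarrow> u \<in> V \<and> v \<in> V \<and> u \<noteq> v"
  using is_tree unfolding is_tree_def simple_graph_def by (fastforce simp: doubleton_eq_iff)

lemma edgeE:
  assumes "e \<in> E" 
  obtains u v where "e = {u, v}" "{u, v} \<in> E" "u \<in> V" "v \<in> V" "u \<noteq> v"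
  using assms is_tree unfolding is_tree_def simple_graph_def by metis

lemma edge_commute: "{u, v} \<in> E \<Longrightarrow> {v, u} \<in> E"
  by (simp add: insert_commute)

lemma V_induct:
  assumes "a \<in> V" "b \<in> V" "P a" "\<And>x y. P x \<Longrightarrow> {x, y} \<in> E \<Longrightarrow> P y"
  shows "P b"
proof -
  have "(a, b) \<in> {(a, b). {a, b} \<in> E}\<^sup>*"
    using assms(1,2) is_tree unfolding is_tree_def connected_graph_def by blast
  then show ?thesis by (induction rule: rtrancl_induct) (use assms in auto)
qed

lemma cobd_edge: "{a, b} \<in> E \<Longrightarrow> {a, b} \<in> cobd S \<longleftrightarrow> (a \<in> S) \<noteq> (b \<in> S)"
  unfolding cobd_def by (auto simp: doubleton_eq_iff)

lemma cobd_sub: "cobd S \<subseteq> E"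
  unfolding cobd_def by auto

text \<open>This is the form in which connectedness is used: a set is shown to be empty or
  everything by checking that no edge leaves it.\<close>

lemma cobd_empty_iff:
  assumes "S \<subseteq> V" 
  shows "cobd S = {} \<longleftrightarrow> S = {} \<or> S = V"
proof
  assume c: "cobd S = {}"
  show "S = {} \<or> S = V"
  proof (cases "S = {}")
    case False
    then obtain a where a: "a \<in> S" by auto
    have "b \<in> S" if "b \<in> V" for b
    proof (rule V_induct[of a b "\<lambda>x. x \<in> S"])
      fix x y assume "x \<in> S" "{x, y} \<in> E"
      then show "y \<in> S" using cobd_edge[of x y S] c by auto
    qed (use a assms that in auto)
    then show ?thesis using assms by auto
  qed simp
next
  assume "S = {} \<or> S = V"
  then show "cobd S = {}"
    unfolding cobd_def using edgeD by auto
qed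

lemma cobd_endpoints: "e \<in> cobd S \<Longrightarrow> \<exists>a b. e = {a, b} \<and> {a, b} \<in> E \<and> a \<in> S \<and> b \<in> V - S"
  unfolding cobd_def using edgeD by auto

lemma hf_sub_V: "hf u v \<subseteq> V"
  unfolding half_tree_def by auto

lemma hf_V [intro]: "w \<in> hf u v \<Longrightarrow> w \<in> V"
  using hf_sub_V by auto

lemma hf_self: "{u, v} \<in> E \<Longrightarrow> v \<in> hf u v"
  unfolding half_tree_def using edgeD by auto

text \<open>Acyclicity enters here: a path from \<open>v\<close> back to \<open>u\<close> that
  avoids the edge would close up to a cycle.\<close>

lemma hf_other: 
  assumes "{u, v} \<in> E"
  shows "u \<notin> hf u v"
proof
  assume "u \<in> hf u v"
  then have "(v, u) \<in> {(a, b). {a, b} \<in> E - {{u, v}}}\<^sup>*" unfolding half_tree_def by auto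
  then obtain vs where vs: "vs \<noteq> []" "hd vs = v" "last vs = u" "distinct vs"
    "successively (\<lambda>a b. (a, b) \<in> {(a, b). {a, b} \<in> E - {{u, v}}}) vs"
    by (rule rtrancl_distinct_path)
  have "u \<noteq> v" using edgeD assms by auto
  \<comment> \<open>A path with only two vertices would be the removed edge itself.\<close>
  have "length vs \<ge> 3"
  proof (rule ccontr)
    assume "\<not> length vs \<ge> 3"
    then consider x where "vs = [x]" | x y where "vs = [x, y]"
      using vs(1) by (cases vs; cases "tl vs"; cases "tl (tl vs)") auto
    then show False
      using vs \<open>u \<noteq> v\<close> by cases (auto simp: insert_commute)
  qed
  moreover have "successively (\<lambda>a b. {a, b} \<in> E) vs"
    using vs(5) by (rule successively_mono) auto
  ultimately have "graph_cycle T vs" unfolding graph_cycle_def using vs assms by simp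
  then show False using is_tree unfolding is_tree_def by auto
qed

lemma hf_cross: 
  assumes uv: "{u, v} \<in> E" and ab: "{a, b} \<in> E" "a \<in> hf u v" "b \<notin> hf u v"
  shows "a = v \<and> b = u"
proof (cases "{a, b} = {u, v}")
  case True
  then show ?thesis using hf_self[OF uv] ab by (auto simp: doubleton_eq_iff)
next
  case False
  then have "(a, b) \<in> {(a, b). {a, b} \<in> E - {{u, v}}}" using ab by auto
  moreover have "(v, a) \<in> {(a, b). {a, b} \<in> E - {{u, v}}}\<^sup>*" using ab unfolding half_tree_def by auto
  ultimately have "(v, b) \<in> {(a, b). {a, b} \<in> E - {{u, v}}}\<^sup>*" by (rule rtrancl_into_rtrancl[rotated])
  then have "b \<in> hf u v" unfolding half_tree_def using edgeD[OF ab(1)] by simp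
  then show ?thesis using ab by auto
qed

text \<open>The edge \<open>{u, v}\<close> is the only edge leaving either half-tree, and it joins
  one to the other. So their union and their intersection have empty coboundary.\<close>

lemma hf_compl: 
  assumes uv: "{u, v} \<in> E"
  shows "hf v u = V - hf u v"
proof -
  note vu = edge_commute[OF uv]
  note o = hf_other[OF uv] hf_other[OF vu] hf_self[OF uv] hf_self[OF vu]
  have "cobd (hf u v \<union> hf v u) = {}"
    unfolding cobd_def using hf_cross[OF uv] hf_cross[OF vu] o by blast
  then have "hf u v \<union> hf v u = V" using cobd_empty_iff[of "hf u v \<union> hf v u"] hf_sub_V o by auto
  moreover have "cobd (hf u v \<inter> hf v u) = {}"
    unfolding cobd_def using hf_cross[OF uv] hf_cross[OF vu] o by blast
  then have "hf u v \<inter> hf v u = {}" using cobd_empty_iff[of "hf u v \<inter> hf v u"] hf_sub_V[of u v] o edgeD[OF uv] by blast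
  ultimately show ?thesis by auto
qed

lemma cobd_hf: 
  assumes uv: "{u, v} \<in> E"
  shows "cobd (hf u v) = {{u, v}}"
proof -
  have "cobd (hf u v) \<subseteq> {{u, v}}"
    unfolding cobd_def using hf_cross[OF uv] by auto
  moreover have "{u, v} \<in> cobd (hf u v)" 
    using cobd_edge[OF uv] hf_self[OF uv] hf_other[OF uv] by simp
  ultimately show ?thesis by auto
qed

lemma cobd_eqI: "X \<subseteq> E \<Longrightarrow> (\<And>a b. {a, b} \<in> E \<Longrightarrow> {a, b} \<in> X \<longleftrightarrow> (a \<in> S) \<noteq> (b \<in> S)) \<Longrightarrow> cobd S = X"
proof (rule Set.set_eqI)
  fix e assume *: "X \<subseteq> E" "\<And>a b. {a, b} \<in> E \<Longrightarrow> {a, b} \<in> X \<longleftrightarrow> (a \<in> S) \<noteq> (b \<in> S)"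
  show "e \<in> cobd S \<longleftrightarrow> e \<in> X"
  proof (cases "e \<in> E")
    case True
    then obtain u v where "e = {u, v}" "{u, v} \<in> E" by (rule edgeE)
    then show ?thesis using * cobd_edge[of u v S] by simp
  next
    case False
    then show ?thesis using *(1) cobd_sub[of S] by auto
  qed
qed

lemma cobd_compl: "cobd (V - S) = cobd S"
  by (rule cobd_eqI) (auto simp: cobd_edge dest: edgeD subsetD[OF cobd_sub])

lemma cobd_sym_diff: "cobd (sym_diff S S') = sym_diff (cobd S) (cobd S')"
  by (rule cobd_eqI) (auto simp: cobd_edge dest: subsetD[OF cobd_sub])

lemma cobd_Un: "cobd (S \<union> S') \<subseteq> cobd S \<union> cobd S'"
  unfolding cobd_def by auto

lemma cobd_Int: "cobd (S \<inter> S') \<subseteq> cobd S \<union> cobd S'"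
  unfolding cobd_def by auto

section \<open>Edges separating two vertices\<close>

lemma sep_edge: 
  assumes "{u, v} \<in> E" "a \<in> V" "b \<in> V"
  shows "{u, v} \<in> sep a b \<longleftrightarrow> (a \<in> hf u v) \<noteq> (b \<in> hf u v)"
proof -
  have "hf v u = V - hf u v" using hf_compl assms by simp
  then show ?thesis unfolding sep_def using assms by (auto simp: doubleton_eq_iff)
qed

lemma sep_eqI: 
  assumes "a \<in> V" "b \<in> V" "X \<subseteq> E" "\<And>u v. {u, v} \<in> E \<Longrightarrow> {u, v} \<in> X \<longleftrightarrow> (a \<in> hf u v) \<noteq> (b \<in> hf u v)" 
  shows "sep a b = X"
proof (rule Set.set_eqI)
  fix e
  show "e \<in> sep a b \<longleftrightarrow> e \<in> X"
  proof (cases "e \<in> E")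
    case True
    then obtain u v where "e = {u, v}" "{u, v} \<in> E" by (rule edgeE)
    then show ?thesis using assms(4)[of u v] sep_edge[of u v a b] assms by simp
  next
    case False
    then show ?thesis using assms(3) unfolding sep_def by auto
  qed
qed

lemma sep_sub: "sep a b \<subseteq> E"
  unfolding sep_def by auto

lemma sep_sym_diff: 
  assumes "a \<in> V" "b \<in> V" "c \<in> V"
  shows "sep a c = sym_diff (sep a b) (sep b c)"
  by (rule sep_eqI) (use assms in \<open>auto simp: sep_edge dest: subsetD[OF sep_sub]\<close>)

lemma sep_commute: 
  assumes "a \<in> V" "b \<in> V"
  shows "sep a b = sep b a"
  by (rule sep_eqI) (use assms in \<open>auto simp: sep_edge dest: subsetD[OF sep_sub]\<close>)

lemma sep_self [simp]: "sep a a = {}"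
  unfolding sep_def by auto

lemma sep_step: 
  assumes ab: "{a, b} \<in> E"
  shows "sep a b = {{a, b}}"
proof -
  have "(a \<in> hf u v) \<noteq> (b \<in> hf u v) \<longleftrightarrow> {u, v} = {a, b}" if uv: "{u, v} \<in> E" for u v
  proof
    assume "(a \<in> hf u v) \<noteq> (b \<in> hf u v)"
    then show "{u, v} = {a, b}"
      using hf_cross[OF uv ab] hf_cross[OF uv edge_commute[OF ab]] by auto
  next
    assume "{u, v} = {a, b}"
    then show "(a \<in> hf u v) \<noteq> (b \<in> hf u v)" 
      using hf_self[OF uv] hf_other[OF uv] by (auto simp: doubleton_eq_iff)
  qed
  then show ?thesis using ab edgeD[OF ab] by (intro sep_eqI) auto
qed

lemma finite_sep: 
  assumes "a \<in> V" "b \<in> V" 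
  shows "finite (sep a b)"
proof -
  have "b \<in> V \<and> finite (sep a b)"
  proof (rule V_induct[of a b "\<lambda>b. b \<in> V \<and> finite (sep a b)"])
    fix x y assume "x \<in> V \<and> finite (sep a x)" "{x, y} \<in> E"
    then show "y \<in> V \<and> finite (sep a y)" 
      using sep_sym_diff[of a x y] sep_step[of x y] edgeD assms by auto
  qed (use assms in auto)
  then show ?thesis by simp
qed

lemma first_edge:
  assumes "a \<in> V" "b \<in> V" "a \<noteq> b"
  obtains a' where "{a, a'} \<in> E" "b \<in> hf a a'"
proof -
  have "b = a \<or> (\<exists>a'. {a, a'} \<in> E \<and> b \<in> hf a a')"
  proof (rule V_induct[of a b])
    fix x y assume IH: "x = a \<or> (\<exists>a'. {a, a'} \<in> E \<and> x \<in> hf a a')" and xy: "{x, y} \<in> E"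
    show "y = a \<or> (\<exists>a'. {a, a'} \<in> E \<and> y \<in> hf a a')"
    proof (cases "x = a")
      case True
      then show ?thesis using xy hf_self[of a y] by auto
    next
      case False
      then obtain a' where "{a, a'} \<in> E" "x \<in> hf a a'" using IH by auto
      then show ?thesis using hf_cross[of a a' x y] xy by auto
    qed
  qed (use assms in auto)
  then show ?thesis using assms that by auto
qed

lemma sep_first:
  assumes e: "{a, a'} \<in> E" and b: "b \<in> hf a a'"
  shows "sep a b = insert {a, a'} (sep a' b)" "{a, a'} \<notin> sep a' b"
proof -
  have V: "a \<in> V" "a' \<in> V" "b \<in> V" using edgeD[OF e] hf_V[OF b] by auto
  show *: "{a, a'} \<notin> sep a' b" using sep_edge[OF e, of a' b] V hf_self[OF e] b by simp
  then show "sep a b = insert {a, a'} (sep a' b)"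
    using sep_sym_diff[of a a' b] sep_step[OF e] V by auto
qed

text \<open>The distance drops by one along the first edge of a geodesic; it is the measure for most
  inductions along geodesics.\<close>

lemma sep_first_card:
  assumes e: "{a, a'} \<in> E" and b: "b \<in> hf a a'"
  shows "card (sep a b) = Suc (card (sep a' b))"
  using sep_first[OF assms] finite_sep[of a' b] edgeD[OF e] hf_V[OF b] by auto

lemma sep_empty_iff:
  assumes "a \<in> V" "b \<in> V" 
  shows "sep a b = {} \<longleftrightarrow> a = b"
proof (cases "a = b")
  case False
  then obtain a' where "{a, a'} \<in> E" "b \<in> hf a a'" using first_edge[OF assms] by auto
  then show ?thesis using sep_first(1)[of a a' b] False by simp
qed simp

text \<open>If an edge of the coboundary does not separate \<open>a\<close> from \<open>b\<close>,
  adding one of its half-trees modulo 2 removes it from the coboundary, and \<open>a\<close>,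
  \<open>b\<close> still lie on opposite sides, possibly exchanged. Induction on the size of the
  coboundary does the rest.\<close>

lemma crossing_edge:
  assumes "finite (cobd S)" "S \<subseteq> V" "a \<in> S" "b \<in> V - S"
  obtains e where "e \<in> cobd S" "e \<in> sep a b"
proof -
  have "cobd S \<inter> sep a b \<noteq> {}" 
    using assms
  proof (induction "card (cobd S)" arbitrary: S a b rule: less_induct)
    case less
    have "cobd S \<noteq> {}" using less(3-5) cobd_empty_iff[of S] by auto
    then obtain e where e: "e \<in> cobd S" by auto
    then have "e \<in> E" using cobd_sub by auto
    then obtain u v where uv: "e = {u, v}" "{u, v} \<in> E" by (rule edgeE)
    show ?case
    proof (cases "e \<in> sep a b")
      case False
      then have *: "(a \<in> hf u v) = (b \<in> hf u v)" using uv sep_edge less(4,5,3) by auto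
      let ?S = "sym_diff S (hf u v)"
      have c: "cobd ?S = cobd S - {e}" using cobd_sym_diff cobd_hf[OF uv(2)] e uv(1) by auto
      then have "card (cobd ?S) < card (cobd S)" using e less(2) by (simp add: card_Diff1_less del: card_Diff_insert)
      moreover have "?S \<subseteq> V" "finite (cobd ?S)" using less(2,3) c by auto
      ultimately have "cobd ?S \<inter> sep a b \<noteq> {}"
        using less(1)[of ?S a b] less(1)[of ?S b a] less(3,4,5) * sep_commute[of a b] by auto
      then show ?thesis using c by auto
    qed (use e in auto)
  qed
  then show ?thesis using that by auto
qed

text \<open>An edge leaving the intersection leaves one of the two sets and has an end in the other
  one, which the hypotheses forbid. So the intersection has no coboundary.\<close>

lemma corner_empty:
  assumes "S \<subseteq> V" "w \<in> V" "w \<notin> S \<inter> S'"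
    "\<forall>e\<in>cobd S. e \<inter> S' = {}" "\<forall>e\<in>cobd S'. e \<inter> S = {}"
  shows "S \<inter> S' = {}"
proof -
  have "cobd (S \<inter> S') = {}"
  proof (rule ccontr)
    assume "cobd (S \<inter> S') \<noteq> {}"
    then obtain e where "e \<in> cobd (S \<inter> S')" by auto
    then obtain a b where ab: "e = {a, b}" "{a, b} \<in> E" "a \<in> S \<inter> S'" "b \<in> V - S \<inter> S'"
      using cobd_endpoints by meson
    then have "{a, b} \<in> cobd S \<or> {a, b} \<in> cobd S'" using cobd_edge by auto
    then show False using assms(4,5) ab by auto
  qed
  then show ?thesis using cobd_empty_iff[of "S \<inter> S'"] assms by auto
qed

section \<open>Nesting and convexity of half-trees\<close>

lemma hf_subset:
  assumes uv: "{u, v} \<in> E" and S: "S \<subseteq> V" "v \<in> S" "\<forall>e\<in>cobd S. \<not> e \<subseteq> hf u v"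
  shows "hf u v \<subseteq> S"
proof -
  have "cobd (hf u v - S) = {}"
  proof (rule ccontr)
    assume "cobd (hf u v - S) \<noteq> {}"
    then obtain e where "e \<in> cobd (hf u v - S)" by auto
    then obtain a b where ab: "e = {a, b}" "{a, b} \<in> E" "a \<in> hf u v - S" "b \<in> V - (hf u v - S)"
      using cobd_endpoints by meson
    show False
    proof (cases "b \<in> hf u v")
      case True
      then have "{a, b} \<in> cobd S" "{a, b} \<subseteq> hf u v" using ab cobd_edge by auto
      then show ?thesis using S by auto
    next
      case False
      then show ?thesis using hf_cross[OF uv ab(2)] ab S by auto
    qed
  qed
  then show ?thesis using cobd_empty_iff[of "hf u v - S"] hf_sub_V[of u v] S(1,2) subsetD[OF S(1,2)] by blast
qed

lemma hf_nested:
  assumes uv: "{u, v} \<in> E" and p: "{p, p'} \<in> E" "p \<in> hf u v" "u \<notin> hf p p'"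
  shows "hf p p' \<subseteq> hf u v"
proof (rule hf_subset[OF p(1) hf_sub_V])
  show "p' \<in> hf u v" using hf_cross[OF uv p(1,2)] p(3) hf_self[OF p(1)] by auto
  show "\<forall>e\<in>cobd (hf u v). \<not> e \<subseteq> hf p p'" using cobd_hf[OF uv] p by auto
qed

lemma hf_branches:
  assumes "{p, a} \<in> E" "{p, b} \<in> E" "a \<noteq> b"
  shows "hf p a \<inter> hf p b = {}"
proof -
  have "hf p b \<subseteq> hf a p"
    using hf_nested[OF edge_commute[OF assms(1)] assms(2)] hf_self[OF edge_commute[OF assms(1)]]
      hf_cross[OF assms(2), of a p] hf_other[OF assms(2)] assms edge_commute[OF assms(1)] by auto
  then show ?thesis using hf_compl[OF assms(1)] by auto
qed

text \<open>An edge that is not contained in \<open>hf u v\<close> has all of \<open>hf u v\<close>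
  on one of its two sides, so it separates no two points of it.\<close>

lemma hf_convex:
  assumes uv: "{u, v} \<in> E" and ab: "a \<in> hf u v" "b \<in> hf u v" "e \<in> sep a b"
  shows "e \<subseteq> hf u v"
proof (rule ccontr)
  assume n: "\<not> e \<subseteq> hf u v"
  have "e \<in> E" using ab(3) sep_sub[of a b] by auto
  then obtain p q where e: "e = {p, q}" "{p, q} \<in> E" by (rule edgeE)
  note e' = edge_commute[OF e(2)]
  have V: "a \<in> V" "b \<in> V" "v \<in> V" using hf_V[OF ab(1)] hf_V[OF ab(2)] edgeD[OF uv] by auto
  have "hf u v \<subseteq> hf p q \<or> hf u v \<subseteq> hf q p"
    using hf_subset[OF uv hf_sub_V, of p q] hf_subset[OF uv hf_sub_V, of q p]
      cobd_hf[OF e(2)] cobd_hf[OF e'] n e hf_compl[OF e(2)] V by (auto simp: insert_commute)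
  then show False using ab(3) sep_edge[OF e(2) V(1,2)] e(1) ab(1,2) hf_compl[OF e(2)] by auto
qed

text \<open>Seen from \<open>p\<close>, the half-tree is entered through \<open>v\<close>, so the
  geodesic from \<open>p\<close> to any of its points begins with the one to
  \<open>v\<close>.\<close>

lemma sep_mono:
  assumes uv: "{u, v} \<in> E" and w: "w \<in> hf u v" and p: "p \<in> V" "p \<notin> hf u v"
  shows "sep p v \<subseteq> sep p w"
proof
  fix e assume e: "e \<in> sep p v"
  have V: "u \<in> V" "v \<in> V" "w \<in> V" using edgeD[OF uv] hf_V[OF w] by auto
  show "e \<in> sep p w"
  proof (rule ccontr)
    assume "e \<notin> sep p w"
    then have "e \<in> sep v w" using sep_sym_diff[OF p(1) V(2,3)] e by auto
    then have sub: "e \<subseteq> hf u v" using hf_convex[OF uv hf_self[OF uv] w] by simp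
    then have "e \<noteq> {u, v}" using hf_other[OF uv] by auto
    then have "e \<in> sep p u" using sep_sym_diff[OF p(1) V(2) V(1)] e sep_step[OF edge_commute[OF uv]] 
      by (auto simp: insert_commute)
    moreover have "p \<in> hf v u" using hf_compl[OF uv] p by auto
    ultimately have "e \<subseteq> hf v u" 
      using hf_convex[OF edge_commute[OF uv] _ hf_self[OF edge_commute[OF uv]]] by auto
    then have "e = {}" using sub hf_compl[OF uv] by auto
    then show False using e sep_sub edgeE[of e] by blast
  qed
qed

text \<open>Seen from \<open>a0\<close>, the other two half-trees lie behind edges different from
  \<open>{a0, a1}\<close>, hence behind the same edge \<open>{a0, y}\<close>, as at most two edges
  meet at \<open>a0\<close>. The half-tree on the near side of that edge replaces the first one, and
  its root is closer to \<open>b1\<close>.\<close>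

lemma no_three_disjoint_hf:
  assumes nb: "\<And>w x y z. {w, x} \<in> E \<Longrightarrow> {w, y} \<in> E \<Longrightarrow> {w, z} \<in> E \<Longrightarrow> x = y \<or> y = z \<or> x = z"
    and b: "{b0, b1} \<in> E" and c: "{c0, c1} \<in> E" and bc: "hf b0 b1 \<inter> hf c0 c1 = {}"
  shows "{a0, a1} \<in> E \<Longrightarrow> hf a0 a1 \<inter> hf b0 b1 = {} \<Longrightarrow> hf a0 a1 \<inter> hf c0 c1 = {} \<Longrightarrow> False"
proof (induction "card (sep a0 b1)" arbitrary: a0 a1 rule: less_induct)
  case less
  note a = less(2)
  have V: "a0 \<in> V" "a1 \<in> V" "b1 \<in> V" "c1 \<in> V" using edgeD a b c by auto
  \<comment> \<open>Otherwise the two half-trees would be complementary, leaving no room for the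
    third.\<close>
  have *: "a0 \<notin> hf x0 x1" if x: "{x0, x1} \<in> E" "hf a0 a1 \<inter> hf x0 x1 = {}" 
    and y: "y1 \<in> V - hf x0 x1 - hf a0 a1" for x0 x1 y1
  proof
    assume "a0 \<in> hf x0 x1"
    moreover have "a1 \<notin> hf x0 x1" using x hf_self[OF a] by auto
    ultimately have "a0 = x1 \<and> a1 = x0" using hf_cross[OF x(1) a] by auto
    then have "hf a0 a1 = V - hf x0 x1" using hf_compl[OF x(1)] by simp
    then show False using y by auto
  qed
  have nb0: "a0 \<notin> hf b0 b1" using *[OF b less(3), of c1] V hf_self[OF c] bc less(4) by auto
  have nc0: "a0 \<notin> hf c0 c1" using *[OF c less(4), of b1] V hf_self[OF b] bc less(3) by auto
  have "a0 \<noteq> b1" "a0 \<noteq> c1" using nb0 nc0 hf_self b c by auto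
  then obtain y z where y: "{a0, y} \<in> E" "b1 \<in> hf a0 y" and z: "{a0, z} \<in> E" "c1 \<in> hf a0 z"
    using first_edge V by metis
  have "y \<noteq> a1" "z \<noteq> a1" using y z less(3,4) hf_self[OF b] hf_self[OF c] by auto
  then have "y = z" using nb[OF a y(1) z(1)] by auto
  have "hf b0 b1 \<subseteq> hf a0 y"
    using hf_subset[OF b hf_sub_V y(2)] cobd_hf[OF y(1)] nb0 by auto
  moreover have "hf c0 c1 \<subseteq> hf a0 y"
    using hf_subset[OF c hf_sub_V z(2)] cobd_hf[OF z(1)] nc0 \<open>y = z\<close> by auto
  ultimately have "hf y a0 \<inter> hf b0 b1 = {}" "hf y a0 \<inter> hf c0 c1 = {}"
    using hf_compl[OF y(1)] by auto
  moreover have "card (sep y b1) < card (sep a0 b1)" using sep_first_card[OF y] by simp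
  ultimately show False using less(1)[OF _ edge_commute[OF y(1)]] by auto
qed

text \<open>The convex hull of \<open>B\<close>: no half-tree may contain the vertex and miss
  \<open>B\<close>. In this form invariance under a group follows from that of \<open>B\<close> and
  of the family of half-trees.\<close>

definition chull :: "'v set \<Rightarrow> 'v set" where
  "chull B = {w \<in> V. \<forall>u v. {u, v} \<in> E \<and> w \<in> hf u v \<longrightarrow> hf u v \<inter> B \<noteq> {}}"

lemma is_tree_chull:
  assumes "B \<subseteq> V" "B \<noteq> {}"
  shows "is_tree \<lparr>verts = chull B, edges = {e \<in> E. e \<subseteq> chull B}\<rparr>" (is "is_tree ?D")
proof -
  have "B \<subseteq> chull B" using assms unfolding chull_def by auto
  then have "chull B \<noteq> {}" using assms by auto
  moreover have "simple_graph ?D" unfolding simple_graph_def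
  proof
    fix e assume "e \<in> edges ?D"
    then have e: "e \<in> E" "e \<subseteq> chull B" by auto
    obtain u v where "e = {u, v}" "u \<noteq> v" using edgeE[OF e(1)] by metis
    then show "\<exists>u\<in>verts ?D. \<exists>v\<in>verts ?D. u \<noteq> v \<and> e = {u, v}" using e(2) 
      by (intro bexI[of _ u] bexI[of _ v]) auto
  qed
  moreover have "\<not> graph_cycle ?D vs" for vs
  proof
    assume c: "graph_cycle ?D vs"
    then have "successively (\<lambda>a b. {a, b} \<in> E) vs"
      unfolding graph_cycle_def by (auto elim: successively_mono)
    then have "graph_cycle T vs" using c unfolding graph_cycle_def by auto
    then show False using is_tree unfolding is_tree_def by auto
  qed
  moreover have "(a, b) \<in> {(a, b). {a, b} \<in> edges ?D}\<^sup>*" if "a \<in> chull B" "b \<in> chull B" for a b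
    using that
  proof (induction "card (sep a b)" arbitrary: a rule: less_induct)
    case less
    show ?case
    proof (cases "a = b")
      case False
      have V: "a \<in> V" "b \<in> V" using less chull_def by auto
      obtain a' where a': "{a, a'} \<in> E" "b \<in> hf a a'" using first_edge[OF V False] .
      \<comment> \<open>The next vertex on the geodesic to \<open>b\<close> stays in the hull: the
        only half-tree that contains it and not \<open>a\<close> also contains
        \<open>b\<close>.\<close>
      have "hf u v \<inter> B \<noteq> {}" if uv: "{u, v} \<in> E" "a' \<in> hf u v" for u v
      proof (cases "a \<in> hf u v")
        case True
        then show ?thesis using less(2) uv unfolding chull_def by auto
      next
        case False
        then have "a' = v \<and> a = u" using hf_cross[OF uv(1) edge_commute[OF a'(1)] uv(2)] by auto
        then show ?thesis using less(3) a' unfolding chull_def by auto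
      qed
      then have h: "a' \<in> chull B" unfolding chull_def using edgeD[OF a'(1)] by auto
      moreover have "card (sep a' b) < card (sep a b)" using sep_first_card[OF a'] by simp
      ultimately have "(a', b) \<in> {(a, b). {a, b} \<in> edges ?D}\<^sup>*" using less by auto
      moreover have "(a, a') \<in> {(a, b). {a, b} \<in> edges ?D}" using a' h less(2) by auto
      ultimately show ?thesis by (rule converse_rtrancl_into_rtrancl[rotated])
    qed simp
  qed
  ultimately show ?thesis unfolding is_tree_def connected_graph_def by auto
qed

end

section \<open>Minimal actions on trees\<close>

locale tree_action = group G + tree T
  for G :: "('a, 'm) monoid_scheme" (structure) and T :: "'v sgraph" +
  fixes act :: "'a \<Rightarrow> 'v \<Rightarrow> 'v" and v0 :: 'v
  assumes action: "graph_action G T act"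
    and no_inversions: "without_inversions G T act"
    and minimal: "minimal_action G T act"
    and no_infinite_index: "\<lbrakk> subgroup A G; subgroup B G; A \<subseteq> B;
                 \<exists>e \<in> edges T. commensurable G A (edge_stab G act e);
                 \<exists>e \<in> edges T. commensurable G B (edge_stab G act e) \<rbrakk>
               \<Longrightarrow> finite_index G A B"
    and v0: "v0 \<in> verts T"
begin

abbreviation "stab \<equiv> edge_stab G act"

definition X :: "'v set \<Rightarrow> 'a set" where
  "X S = {g \<in> carrier G. act g v0 \<in> S}"

lemma act_group: "group_action G V (\<lambda>g. restrict (act g) V)"
  using action unfolding graph_action_def by auto

lemma act_V [simp]: "g \<in> carrier G \<Longrightarrow> v \<in> V \<Longrightarrow> act g v \<in> V"
  using group_action.element_image[OF act_group, of g v "act g v"] by simp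

lemma act_one [simp]: "v \<in> V \<Longrightarrow> act \<one> v = v"
  using group_action.id_eq_one[OF act_group] by (metis restrict_apply')

lemma act_mult: "g \<in> carrier G \<Longrightarrow> h \<in> carrier G \<Longrightarrow> v \<in> V \<Longrightarrow> act (g \<otimes> h) v = act g (act h v)"
  using group_action.composition_rule[OF act_group, of v g h] by simp

lemma act_inv_act [simp]: "g \<in> carrier G \<Longrightarrow> v \<in> V \<Longrightarrow> act (inv g) (act g v) = v"
  using act_mult[of "inv g" g v] by simp

lemma act_act_inv [simp]: "g \<in> carrier G \<Longrightarrow> v \<in> V \<Longrightarrow> act g (act (inv g) v) = v"
  using act_mult[of g "inv g" v] by simp

lemma act_eq_iff [simp]: 
  "g \<in> carrier G \<Longrightarrow> v \<in> V \<Longrightarrow> w \<in> V \<Longrightarrow> act g v = act g w \<longleftrightarrow> v = w"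
  by (metis act_inv_act)

lemma act_inj: "g \<in> carrier G \<Longrightarrow> inj_on (act g) V"
  by (auto simp: inj_on_def)

lemma act_edge: "g \<in> carrier G \<Longrightarrow> e \<in> E \<Longrightarrow> act g ` e \<in> E"
  using action unfolding graph_action_def by auto

lemma act_edge2: "g \<in> carrier G \<Longrightarrow> {u, v} \<in> E \<Longrightarrow> {act g u, act g v} \<in> E"
  using act_edge[of g "{u, v}"] by simp

lemma edge_sub_V: "e \<in> E \<Longrightarrow> e \<subseteq> V"
  by (erule edgeE) simp

lemma act_mem [simp]:
  "g \<in> carrier G \<Longrightarrow> v \<in> V \<Longrightarrow> S \<subseteq> V \<Longrightarrow> act g v \<in> act g ` S \<longleftrightarrow> v \<in> S"
  by (meson act_inj inj_on_image_mem_iff)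

lemma act_image_sub: "g \<in> carrier G \<Longrightarrow> S \<subseteq> V \<Longrightarrow> act g ` S \<subseteq> V"
  by (auto simp: subset_iff)

lemma act_image_mult: 
  "g \<in> carrier G \<Longrightarrow> h \<in> carrier G \<Longrightarrow> S \<subseteq> V \<Longrightarrow> act (g \<otimes> h) ` S = act g ` act h ` S"
  unfolding image_image by (intro image_cong) (auto simp: act_mult)

lemma act_image_one: "S \<subseteq> V \<Longrightarrow> act \<one> ` S = S"
  by (subst image_cong[OF refl, of S _ "\<lambda>x. x"]) (auto simp: subset_iff)

lemma act_image_inv: 
  "g \<in> carrier G \<Longrightarrow> S \<subseteq> V \<Longrightarrow> act (inv g) ` act g ` S = S"
  "g \<in> carrier G \<Longrightarrow> S \<subseteq> V \<Longrightarrow> act g ` act (inv g) ` S = S"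
  using act_image_mult[of "inv g" g S] act_image_mult[of g "inv g" S] act_image_one by simp_all

lemma act_image_V: "g \<in> carrier G \<Longrightarrow> act g ` V = V"
  using act_image_inv(2)[of g V] act_image_sub[of g V] image_mono[OF act_image_sub[of "inv g" V], of "act g"] 
  by auto

lemma act_image_Diff: "g \<in> carrier G \<Longrightarrow> S \<subseteq> V \<Longrightarrow> act g ` (V - S) = V - act g ` S"
  using inj_on_image_set_diff[OF act_inj, of g V S] act_image_V by auto

lemma cobd_act: 
  assumes g: "g \<in> carrier G" and S: "S \<subseteq> V"
  shows "cobd (act g ` S) = (`) (act g) ` cobd S"
proof -
  have *: "(`) (act g) ` cobd S \<subseteq> cobd (act g ` S)" if g: "g \<in> carrier G" and S: "S \<subseteq> V" for g S
  proof
    fix e assume "e \<in> (`) (act g) ` cobd S"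
    then obtain f where f: "f \<in> cobd S" "e = act g ` f" by auto
    then obtain a b where "f = {a, b}" "{a, b} \<in> E" "a \<in> S" "b \<in> V - S"
      using cobd_endpoints[OF f(1)] by auto
    then show "e \<in> cobd (act g ` S)"
      using f cobd_edge[OF act_edge2[OF g, of a b], of "act g ` S"] g S by (auto simp: subset_iff)
  qed
  have "cobd (act g ` S) \<subseteq> (`) (act g) ` cobd S"
  proof
    fix e assume e: "e \<in> cobd (act g ` S)"
    then have "act (inv g) ` e \<in> cobd (act (inv g) ` act g ` S)"
      using *[of "inv g" "act g ` S"] g act_image_sub[OF g S] by auto
    moreover have "e \<subseteq> V" using e cobd_sub edge_sub_V by blast
    ultimately show "e \<in> (`) (act g) ` cobd S"
      using act_image_inv[OF g] S g by (metis imageI)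
  qed
  then show ?thesis using *[OF g S] by auto
qed

lemma act_hf: 
  assumes g: "g \<in> carrier G" and uv: "{u, v} \<in> E"
  shows "act g ` hf u v = hf (act g u) (act g v)"
proof -
  have *: "hf (act g u) (act g v) \<subseteq> act g ` hf u v" if g: "g \<in> carrier G" and uv: "{u, v} \<in> E" for g u v
  proof (rule hf_subset[OF act_edge2[OF g uv]])
    show "act g ` hf u v \<subseteq> V" by (rule act_image_sub[OF g hf_sub_V])
    show "act g v \<in> act g ` hf u v" using hf_self[OF uv] by auto
    show "\<forall>e\<in>cobd (act g ` hf u v). \<not> e \<subseteq> hf (act g u) (act g v)"
      unfolding cobd_act[OF g hf_sub_V] cobd_hf[OF uv] using hf_other[OF act_edge2[OF g uv]] by auto
  qed
  have V: "u \<in> V" "v \<in> V" using edgeD[OF uv] by auto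
  have "act g ` hf u v \<subseteq> act g ` act (inv g) ` hf (act g u) (act g v)"
    using *[OF inv_closed[OF g] act_edge2[OF g uv]] g V by (intro image_mono) simp
  then show ?thesis using *[OF g uv] act_image_inv(2)[OF g hf_sub_V] by auto
qed

lemma act_hf_mem:
  assumes "g \<in> carrier G" "{u, v} \<in> E" "a \<in> V"
  shows "act g a \<in> hf (act g u) (act g v) \<longleftrightarrow> a \<in> hf u v"
  unfolding act_hf[OF assms(1,2), symmetric] using assms hf_sub_V by simp

lemma sep_act:
  assumes g: "g \<in> carrier G" and a: "a \<in> V" and b: "b \<in> V"
  shows "sep (act g a) (act g b) = (`) (act g) ` sep a b"
proof (rule sep_eqI)
  have *: "e \<in> sep a b \<Longrightarrow> act g ` e \<in> E" for e using act_edge[OF g] sep_sub by blast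
  then show "(`) (act g) ` sep a b \<subseteq> E" by auto
  fix u v assume uv: "{u, v} \<in> E"
  then have V: "u \<in> V" "v \<in> V" using edgeD by auto
  let ?u = "act (inv g) u" and ?v = "act (inv g) v"
  have e: "{?u, ?v} \<in> E" using act_edge2[OF _ uv] g by simp
  have i: "act g ` {?u, ?v} = {u, v}" using g V by simp
  have "{u, v} \<in> (`) (act g) ` sep a b \<longleftrightarrow> {?u, ?v} \<in> sep a b"
  proof
    assume "{u, v} \<in> (`) (act g) ` sep a b"
    then obtain f where f: "f \<in> sep a b" "{u, v} = act g ` f" by auto
    then have "f = act (inv g) ` {u, v}" 
      using act_image_inv(1)[OF g, of f] sep_sub edge_sub_V by (metis subsetD)
    then show "{?u, ?v} \<in> sep a b" using f(1) by simp
  qed (metis i imageI)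
  then show "{u, v} \<in> (`) (act g) ` sep a b \<longleftrightarrow> (act g a \<in> hf u v) \<noteq> (act g b \<in> hf u v)"
    using sep_edge[OF e a b] act_hf_mem[OF g e a] act_hf_mem[OF g e b] g V by simp
qed (use assms in auto)

lemma card_sep_act:
  assumes g: "g \<in> carrier G" and a: "a \<in> V" and b: "b \<in> V"
  shows "card (sep (act g a) (act g b)) = card (sep a b)"
proof -
  have "inj_on ((`) (act g)) (sep a b)"
  proof (rule inj_onI)
    fix e f assume *: "e \<in> sep a b" "f \<in> sep a b" "act g ` e = act g ` f"
    then have "e \<subseteq> V" "f \<subseteq> V" using sep_sub edge_sub_V by blast+
    then show "e = f" using *(3) act_image_inv(1)[OF g] by metis
  qed
  then show ?thesis unfolding sep_act[OF assms] by (rule card_image)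
qed

section \<open>Edge stabilizers\<close>

lemma stab_iff: "g \<in> stab e \<longleftrightarrow> g \<in> carrier G \<and> act g ` e = e"
  unfolding edge_stab_def stabilizer_def by auto

lemma stab_subgroup:
  assumes "e \<in> E"
  shows "subgroup (stab e) G"
proof (rule subgroupI)
  have e: "e \<subseteq> V" using edge_sub_V[OF assms] .
  show "stab e \<subseteq> carrier G" by (auto simp: stab_iff)
  have "\<one> \<in> stab e" using act_image_one[OF e] by (simp add: stab_iff)
  then show "stab e \<noteq> {}" by auto
  show "inv a \<in> stab e" if "a \<in> stab e" for a
    using that act_image_inv(1)[OF _ e, of a] by (auto simp: stab_iff)
  show "a \<otimes> b \<in> stab e" if "a \<in> stab e" "b \<in> stab e" for a b
    using that act_image_mult[OF _ _ e, of a b] by (auto simp: stab_iff)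
qed

lemma stab_carrier: "stab e \<subseteq> carrier G"
  by (auto simp: stab_iff)

lemma stab_fixes:
  assumes "{u, v} \<in> E" "g \<in> stab {u, v}"
  shows "act g u = u" "act g v = v"
proof -
  have *: "{act g u, act g v} = {u, v}" "g \<in> carrier G" using assms by (auto simp: stab_iff)
  moreover have "\<not> (act g u = v \<and> act g v = u)"
    using no_inversions * assms edgeD[OF assms(1)] unfolding without_inversions_def by auto
  ultimately show "act g u = u" "act g v = v" by (auto simp: doubleton_eq_iff)
qed

lemma stab_act:
  assumes g: "g \<in> carrier G" and e: "e \<subseteq> V"
  shows "stab (act g ` e) = g <# stab e #> inv g"
proof (rule Set.set_eqI)
  fix h
  have s: "g <# stab e \<subseteq> carrier G" using g stab_carrier by (rule l_coset_subset_G[rotated])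
  have l: "k \<in> g <# stab e \<longleftrightarrow> inv g \<otimes> k \<in> stab e" if "k \<in> carrier G" for k
  proof
    assume "k \<in> g <# stab e"
    then obtain s where "s \<in> stab e" "k = g \<otimes> s" unfolding l_coset_def by auto
    moreover have "s \<in> carrier G" using calculation(1) stab_carrier[of e] by auto
    ultimately show "inv g \<otimes> k \<in> stab e" using g by (simp add: m_assoc[symmetric])
  next
    assume *: "inv g \<otimes> k \<in> stab e"
    have "k = g \<otimes> (inv g \<otimes> k)" using g that by (simp add: m_assoc[symmetric])
    then show "k \<in> g <# stab e" unfolding l_coset_def using * by auto
  qed
  show "h \<in> stab (act g ` e) \<longleftrightarrow> h \<in> g <# stab e #> inv g"
  proof (cases "h \<in> carrier G")
    case True
    have "h \<in> g <# stab e #> inv g \<longleftrightarrow> h \<otimes> g \<in> g <# stab e"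
      using mem_r_coset_iff[OF s _ True, of "inv g"] g by simp
    also have "\<dots> \<longleftrightarrow> inv g \<otimes> (h \<otimes> g) \<in> stab e" using l[of "h \<otimes> g"] g True by simp
    also have "\<dots> \<longleftrightarrow> act (inv g) ` act h ` act g ` e = e"
      using g True e act_image_sub by (simp add: stab_iff act_image_mult)
    also have "\<dots> \<longleftrightarrow> act h ` act g ` e = act g ` e"
      using g True e act_image_inv act_image_sub by metis
    finally show ?thesis using True by (simp add: stab_iff)
  next
    case False
    then show ?thesis using r_coset_subset[OF s, of "inv g"] g stab_carrier by auto
  qed
qed

text \<open>The image of the first edge of the geodesic starts at \<open>a\<close> as well and has
  \<open>b\<close> behind it. Branches at \<open>a\<close> are disjoint, so the edge is fixed, and
  the argument moves on to its far end.\<close>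

lemma fixes_sep:
  assumes g: "g \<in> carrier G" and b: "b \<in> V" "act g b = b"
  shows "a \<in> V \<Longrightarrow> act g a = a \<Longrightarrow> {u, v} \<in> sep a b \<Longrightarrow> act g u = u \<and> act g v = v"
proof (induction "card (sep a b)" arbitrary: a rule: less_induct)
  case less
  then have "a \<noteq> b" by auto
  obtain a' where a': "{a, a'} \<in> E" "b \<in> hf a a'" using first_edge[OF less(2) b(1) \<open>a \<noteq> b\<close>] .
  then have e: "{a, act g a'} \<in> E" "b \<in> hf a (act g a')"
    using act_edge2[OF g a'(1)] act_hf_mem[OF g a'(1) b(1)] less(3) b by auto
  then have *: "act g a' = a'" using hf_branches[OF a'(1) e(1)] a'(2) e(2) by (metis IntI empty_iff)
  show ?case
  proof (cases "{u, v} = {a, a'}")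
    case True
    then show ?thesis using less(3) * by (auto simp: doubleton_eq_iff)
  next
    case False
    then have "{u, v} \<in> sep a' b" using sep_first(1)[OF a'] less(4) by auto
    then show ?thesis using less(1)[of a'] sep_first_card[OF a'] edgeD[OF a'(1)] * by auto
  qed
qed

lemma H_finite_stabI:
  assumes Z: "Z \<subseteq> carrier G" and fin: "finite ((\<lambda>g. act (inv g) ` e) ` Z)" and e: "e \<in> E"
  shows "H_finite G (stab e) Z"
proof -
  obtain F where F: "F \<subseteq> Z" "finite F" "(\<lambda>g. act (inv g) ` e) ` Z = (\<lambda>g. act (inv g) ` e) ` F"
    using finite_subset_image[OF fin order_refl] by metis
  have "Z \<subseteq> (\<Union>f\<in>F. stab e #> f)"
  proof
    fix z assume z: "z \<in> Z"
    then have "act (inv z) ` e \<in> (\<lambda>g. act (inv g) ` e) ` F" using F(3) by auto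
    then obtain f where f: "f \<in> F" "act (inv z) ` e = act (inv f) ` e" by auto
    have c: "z \<in> carrier G" "f \<in> carrier G" using z f F Z by auto
    have "act (z \<otimes> inv f) ` e = act z ` act (inv z) ` e"
      using act_image_mult[of z "inv f" e] c f edge_sub_V[OF e] by simp
    then have "z \<otimes> inv f \<in> stab e" 
      using c act_image_inv(2)[of z e] edge_sub_V[OF e] by (simp add: stab_iff)
    then have "z \<in> stab e #> f" using mem_r_coset_iff[OF stab_carrier c(2,1)] by simp
    then show "z \<in> (\<Union>f\<in>F. stab e #> f)" using f by auto
  qed
  then show ?thesis using F Z by (intro H_finite_coverI[of F]) auto
qed

section \<open>Preimages of vertex sets under the orbit map\<close>

lemma X_sub: "X S \<subseteq> carrier G"
  unfolding X_def by auto

lemma X_mono: "S \<subseteq> S' \<Longrightarrow> X S \<subseteq> X S'"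
  unfolding X_def by auto

lemma X_Un: "X (S \<union> S') = X S \<union> X S'"
  unfolding X_def by auto

lemma X_Int: "X (S \<inter> S') = X S \<inter> X S'"
  unfolding X_def by auto

lemma X_Diff: "X (S - S') = X S - X S'"
  unfolding X_def by auto

lemma X_empty [simp]: "X {} = {}"
  unfolding X_def by auto

lemma X_V [simp]: "X V = carrier G"
  unfolding X_def using v0 by auto

lemma X_act:
  assumes g: "g \<in> carrier G" and S: "S \<subseteq> V"
  shows "g <# X S = X (act g ` S)"
proof (rule Set.set_eqI)
  fix h
  show "h \<in> g <# X S \<longleftrightarrow> h \<in> X (act g ` S)"
  proof
    assume "h \<in> g <# X S"
    then obtain k where "k \<in> carrier G" "act k v0 \<in> S" "h = g \<otimes> k"
      unfolding l_coset_def X_def by auto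
    then show "h \<in> X (act g ` S)" using g S v0 unfolding X_def by (auto simp: act_mult)
  next
    assume "h \<in> X (act g ` S)"
    then have h: "h \<in> carrier G" "act h v0 \<in> act g ` S" unfolding X_def by auto
    then obtain s where s: "s \<in> S" "act h v0 = act g s" by auto
    then have "act (inv g \<otimes> h) v0 = s" using g h v0 S by (auto simp: act_mult)
    then have "inv g \<otimes> h \<in> X S" unfolding X_def using g h s by auto
    moreover have "h = g \<otimes> (inv g \<otimes> h)" using g h by (simp add: m_assoc[symmetric])
    ultimately show "h \<in> g <# X S" unfolding l_coset_def by auto
  qed
qed

lemma Z_set_eq: "Z_set G T act v0 u v = X (hf u v)"
  unfolding Z_set_def X_def by simp

text \<open>The convex hull of an orbit is an invariant subtree, so by minimality it is the whole
  tree; in particular \<open>v\<close> belongs to it.\<close>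

lemma orbit_meets_hf:
  assumes uv: "{u, v} \<in> E" and b: "b \<in> V"
  shows "\<exists>g\<in>carrier G. act g b \<in> hf u v"
proof -
  let ?B = "(\<lambda>g. act g b) ` carrier G"
  let ?D = "\<lparr>verts = chull ?B, edges = {e \<in> E. e \<subseteq> chull ?B}\<rparr>"
  have B: "?B \<subseteq> V" "?B \<noteq> {}" using b by auto
  have inv: "act g w \<in> chull ?B" if g: "g \<in> carrier G" and w: "w \<in> chull ?B" for g w
  proof -
    have wV: "w \<in> V" using w unfolding chull_def by auto
    have "hf x y \<inter> ?B \<noteq> {}" if xy: "{x, y} \<in> E" "act g w \<in> hf x y" for x y
    proof -
      have V: "x \<in> V" "y \<in> V" using edgeD[OF xy(1)] by auto
      have "w \<in> hf (act (inv g) x) (act (inv g) y)"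
        using act_hf_mem[OF inv_closed[OF g] xy(1), of "act g w"] xy g wV by simp
      then have "hf (act (inv g) x) (act (inv g) y) \<inter> ?B \<noteq> {}"
        using w act_edge2[OF inv_closed[OF g] xy(1)] unfolding chull_def by blast
      then obtain h where h: "h \<in> carrier G" "act h b \<in> hf (act (inv g) x) (act (inv g) y)" by auto
      then have "act (g \<otimes> h) b \<in> hf x y"
        using act_hf_mem[OF inv_closed[OF g] xy(1), of "act (g \<otimes> h) b"] g b by (simp add: act_mult)
      then show ?thesis using g h by auto
    qed
    then show ?thesis unfolding chull_def using wV g by auto
  qed
  have "act g ` e \<in> edges ?D" if "g \<in> carrier G" "e \<in> edges ?D" for g e
    using that act_edge inv by auto
  then have "?D = T"
    using minimal is_tree_chull[OF B] inv unfolding minimal_action_def chull_def by auto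
  then have "chull ?B = V" by (metis sgraph.select_convs(1))
  then have "hf u v \<inter> ?B \<noteq> {}" using uv hf_self[OF uv] edgeD[OF uv] unfolding chull_def by blast
  then show ?thesis by auto
qed

text \<open>If \<open>v\<close> were a leaf, its half-tree would be \<open>{v}\<close>. As the orbit
  of \<open>u\<close> meets it, some \<open>g\<close> maps \<open>u\<close> to \<open>v\<close>;
  then \<open>g\<close> maps \<open>v\<close> to its only neighbour \<open>u\<close>, which is an
  inversion.\<close>

lemma no_leaf:
  assumes uv: "{u, v} \<in> E"
  obtains w where "w \<noteq> u" "{v, w} \<in> E"
proof -
  have "\<exists>w. w \<noteq> u \<and> {v, w} \<in> E"
  proof (rule ccontr)
    assume "\<not> ?thesis"
    then have leaf: "w = u" if "{v, w} \<in> E" for w using that by auto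
    have "hf u v \<subseteq> {v}"
    proof (rule hf_subset[OF uv])
      show "\<forall>e\<in>cobd {v}. \<not> e \<subseteq> hf u v"
      proof
        fix e assume "e \<in> cobd {v}"
        then obtain w where "e = {v, w}" "{v, w} \<in> E" using cobd_endpoints by blast
        then show "\<not> e \<subseteq> hf u v" using leaf[of w] hf_other[OF uv] by auto
      qed
    qed (use edgeD[OF uv] in auto)
    moreover obtain g where g: "g \<in> carrier G" "act g u \<in> hf u v" 
      using orbit_meets_hf[OF uv, of u] edgeD[OF uv] by auto
    ultimately have gu: "act g u = v" by auto
    moreover have "act g v = u" using leaf[of "act g v"] act_edge2[OF g(1) uv] gu by simp
    ultimately show False using no_inversions g(1) uv edgeD[OF uv] unfolding without_inversions_def by blast
  qed
  then show ?thesis using that by auto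
qed

text \<open>Since there are no leaves, a half-tree that avoids \<open>p\<close> contains another one
  whose root is one step further from \<open>p\<close>.\<close>

lemma deep_hf:
  assumes uv: "{u, v} \<in> E" and p: "p \<in> V"
  shows "\<exists>u' v'. {u', v'} \<in> E \<and> hf u' v' \<subseteq> hf u v \<and> p \<notin> hf u' v' \<and> n \<le> card (sep p v')"
proof (induction n)
  case 0
  show ?case
  proof (cases "p \<in> hf u v")
    case True
    \<comment> \<open>If \<open>p\<close> lies in the half-tree, the start is a branch at
      \<open>p\<close> that points away from \<open>u\<close>.\<close>
    have "\<exists>p'. {p, p'} \<in> E \<and> u \<notin> hf p p'"
    proof -
      have "p \<noteq> u" using True hf_other[OF uv] by auto
      then obtain q where q: "{p, q} \<in> E" "u \<in> hf p q" using first_edge[OF p] edgeD[OF uv] by metis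
      obtain p' where p': "p' \<noteq> q" "{p, p'} \<in> E" using no_leaf[OF edge_commute[OF q(1)]] .
      then show ?thesis using hf_branches[OF q(1) p'(2)] q(2) by auto
    qed
    then obtain p' where p': "{p, p'} \<in> E" "u \<notin> hf p p'" by auto
    then show ?thesis using hf_nested[OF uv p'(1) True p'(2)] hf_other[OF p'(1)] by auto
  qed (use uv in auto)
next
  case (Suc n)
  then obtain u' v' where *: "{u', v'} \<in> E" "hf u' v' \<subseteq> hf u v" "p \<notin> hf u' v'" "n \<le> card (sep p v')" by auto
  obtain w where w: "w \<noteq> u'" "{v', w} \<in> E" using no_leaf[OF *(1)] .
  have n: "u' \<notin> hf v' w" using hf_branches[OF w(2) edge_commute[OF *(1)] w(1)] 
      hf_self[OF edge_commute[OF *(1)]] by auto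
  have sub: "hf v' w \<subseteq> hf u' v'" by (rule hf_nested[OF *(1) w(2) hf_self[OF *(1)] n])
  have V: "v' \<in> V" "w \<in> V" using edgeD[OF w(2)] by auto
  have np: "p \<notin> hf v' w" using sub *(3) by auto
  have "{v', w} \<notin> sep p v'" using sep_edge[OF w(2) p V(1)] np hf_other[OF w(2)] by simp
  then have "sep p w = insert {v', w} (sep p v')" 
    using sep_sym_diff[OF p V] sep_step[OF w(2)] by auto
  then have "card (sep p w) = Suc (card (sep p v'))" 
    using \<open>{v', w} \<notin> sep p v'\<close> finite_sep[OF p V(1)] by simp
  then have "Suc n \<le> card (sep p w)" using *(4) by simp
  moreover have "hf v' w \<subseteq> hf u v" using sub *(2) by auto
  ultimately show ?case using w(2) np by blast
qed

text \<open>The stabilizer of \<open>{p, q}\<close> preserves the distance to \<open>p\<close>, which is unbounded on \<open>hf u v\<close>.\<close>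

lemma hf_not_H_finite:
  assumes uv: "{u, v} \<in> E" and e: "e \<in> E"
  shows "\<not> H_finite G (stab e) (X (hf u v))"
proof
  assume "H_finite G (stab e) (X (hf u v))"
  then obtain F where F: "finite F" "F \<subseteq> carrier G" "X (hf u v) \<subseteq> (\<Union>f\<in>F. stab e #> f)"
    by (rule H_finite_coverE)
  obtain p q where pq: "e = {p, q}" "{p, q} \<in> E" using e by (rule edgeE)
  have p: "p \<in> V" using edgeD[OF pq(2)] by simp
  \<comment> \<open>One more than the largest distance from \<open>p\<close> reached by the coset
    representatives; left multiplication by the stabilizer cannot increase it.\<close>
  define n where "n = Suc (Max ((\<lambda>f. card (sep p (act f v0))) ` F))"
  obtain u' v' where *: "{u', v'} \<in> E" "hf u' v' \<subseteq> hf u v" "p \<notin> hf u' v'" "n \<le> card (sep p v')"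
    using deep_hf[OF uv p] by metis
  obtain g where g: "g \<in> carrier G" "act g v0 \<in> hf u' v'" using orbit_meets_hf[OF *(1) v0] by auto
  have "n \<le> card (sep p (act g v0))"
    using card_mono[OF finite_sep sep_mono[OF *(1) g(2) p *(3)]] *(4) g(1) p v0 by force
  have "g \<in> X (hf u v)" using g *(2) unfolding X_def by auto
  then have "g \<in> (\<Union>f\<in>F. stab e #> f)" by (rule subsetD[OF F(3)])
  then obtain f where f: "f \<in> F" "g \<in> stab e #> f" by auto
  then obtain s where s: "s \<in> stab e" "g = s \<otimes> f" unfolding r_coset_def by auto
  have c: "f \<in> carrier G" "s \<in> carrier G" using f F s stab_carrier by auto
  have "act s p = p" using stab_fixes(1)[OF pq(2)] s pq(1) by simp
  then have "card (sep p (act g v0)) = card (sep p (act f v0))"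
    using card_sep_act[OF c(2) p, of "act f v0"] c v0 s(2) by (simp add: act_mult)
  also have "\<dots> < n" unfolding n_def using F(1) f(1) by (simp add: less_Suc_eq_le)
  finally show False using \<open>n \<le> card (sep p (act g v0))\<close> by simp
qed

end

section \<open>Cylinders and the almost invariant sets based on them\<close>

context tree_action
begin

abbreviation "CY \<equiv> cylinders G T act"

lemma commensurable_stab_refl: "e \<in> E \<Longrightarrow> commensurable G (stab e) (stab e)"
  by (intro commensurable_refl stab_subgroup)

lemma cyl_iff: "Y \<in> CY \<longleftrightarrow> (\<exists>e\<in>E. Y = {e' \<in> E. commensurable G (stab e) (stab e')})"
  unfolding cylinders_def quotient_def by auto

lemma cyl_sub: "Y \<in> CY \<Longrightarrow> Y \<subseteq> E"
  unfolding cyl_iff by auto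

lemma cyl_edge: "Y \<in> CY \<Longrightarrow> e \<in> Y \<Longrightarrow> e \<in> E"
  using cyl_sub by auto

lemma cyl_nonempty: 
  assumes "Y \<in> CY" 
  obtains e where "e \<in> Y"
  using assms commensurable_stab_refl unfolding cyl_iff by auto

lemma cyl_comm: "Y \<in> CY \<Longrightarrow> e \<in> Y \<Longrightarrow> e' \<in> Y \<Longrightarrow> commensurable G (stab e) (stab e')"
  unfolding cyl_iff by (auto intro: commensurable_trans commensurable_sym)

lemma cyl_closed: "Y \<in> CY \<Longrightarrow> e \<in> Y \<Longrightarrow> e' \<in> E \<Longrightarrow> commensurable G (stab e) (stab e') \<Longrightarrow> e' \<in> Y"
  unfolding cyl_iff by (auto intro: commensurable_trans)

lemma cyl_ex: 
  assumes "e \<in> E" 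
  obtains Y where "Y \<in> CY" "e \<in> Y"
  using assms commensurable_stab_refl[OF assms] unfolding cyl_iff by blast

lemma cyl_eq: 
  assumes "Y \<in> CY" "Y' \<in> CY" "e \<in> Y" "e \<in> Y'" 
  shows "Y = Y'"
proof -
  have "A \<subseteq> B" if "A \<in> CY" "B \<in> CY" "e \<in> A" "e \<in> B" for A B
    using that cyl_comm[of A e] cyl_closed[of B e] cyl_edge by blast
  then show ?thesis using assms by blast
qed

lemma cyl_V: "Y \<in> CY \<Longrightarrow> \<Union>Y \<subseteq> V"
  using cyl_sub edge_sub_V by blast

text \<open>Cylinders are subtrees: the stabilizer of an edge between two edges of \<open>Y\<close> contains the
  intersection of their stabilizers, with finite index by hypothesis.\<close>

lemma cyl_convex:
  assumes Y: "Y \<in> CY" and a: "a \<in> \<Union>Y" and b: "b \<in> \<Union>Y" and e: "e \<in> sep a b"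
  shows "e \<in> Y"
proof -
  obtain e1 e2 where e12: "e1 \<in> Y" "a \<in> e1" "e2 \<in> Y" "b \<in> e2" using a b by auto
  have E: "e1 \<in> E" "e2 \<in> E" "e \<in> E" using e12 Y cyl_edge e sep_sub[of a b] by auto
  have V: "a \<in> V" "b \<in> V" using a b cyl_V[OF Y] by auto
  obtain u v where uv: "e = {u, v}" "{u, v} \<in> E" using edgeE[OF E(3)] by metis
  let ?A = "stab e1 \<inter> stab e2"
  have fx: "act g x = x" if "g \<in> stab f" "x \<in> f" "f \<in> E" for g f x
    using that(3) by (rule edgeE) (use stab_fixes that in auto)
  have sub: "?A \<subseteq> stab e"
  proof
    fix g assume g: "g \<in> ?A"
    then have "act g a = a" "act g b = b" "g \<in> carrier G" using fx e12 E by (auto simp: stab_iff)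
    then have "act g u = u \<and> act g v = v" using fixes_sep[of g b a u v] V e uv by auto
    then show "g \<in> stab e" using \<open>g \<in> carrier G\<close> uv by (simp add: stab_iff)
  qed
  have sg: "subgroup ?A G" "subgroup (stab e) G" 
    using stab_subgroup E subgroups_Inter_pair by auto
  have c1: "commensurable G (stab e2) (stab e1)" using cyl_comm[OF Y e12(3,1)] .
  then have cA: "commensurable G ?A (stab e1)" 
    using commensurable_Int[OF commensurable_stab_refl[OF E(1)] c1] by simp
  have "finite_index G ?A (stab e)"
    using no_infinite_index[OF sg sub] cA commensurable_stab_refl E by blast
  then have "H_finite G ?A (stab e)" using finite_index_iff[OF sg] by simp
  moreover have "H_finite G (stab e) ?A" using H_finite_mono[OF H_finite_self[OF sg(2)] sub] .
  ultimately have "commensurable G ?A (stab e)" using sg by (simp add: commensurable_iff)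
  then have "commensurable G (stab e1) (stab e)" 
    using commensurable_trans commensurable_sym[OF cA] by blast
  then show ?thesis using cyl_closed[OF Y e12(1) E(3)] by simp
qed

text \<open>Finiteness is attached to the cylinder instead of a subgroup: the stabilizers of the
  edges of \<open>Y\<close> are commensurable, so one edge is as good as all
  (\<open>finY_iff\<close>).\<close>

definition finY :: "'v set set \<Rightarrow> 'a set \<Rightarrow> bool" where
  "finY Y Z \<longleftrightarrow> (\<exists>e\<in>Y. H_finite G (stab e) Z)"

lemma finY_iff: "Y \<in> CY \<Longrightarrow> e \<in> Y \<Longrightarrow> finY Y Z \<longleftrightarrow> H_finite G (stab e) Z"
  unfolding finY_def using commensurable_H_finite[OF cyl_comm] by blast

lemma finY_mono: "finY Y Z \<Longrightarrow> W \<subseteq> Z \<Longrightarrow> finY Y W"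
  unfolding finY_def using H_finite_mono by meson

lemma finY_Un: "Y \<in> CY \<Longrightarrow> finY Y (Z \<union> W) \<longleftrightarrow> finY Y Z \<and> finY Y W"
  by (metis cyl_nonempty finY_iff H_finite_Un)

lemma finY_trans: 
  assumes "Y \<in> CY" "finY Y (sym_diff A B)" 
  shows "finY Y (sym_diff A C) \<longleftrightarrow> finY Y (sym_diff B C)"
proof -
  have "finY Y (sym_diff A B \<union> sym_diff A C)" if "finY Y (sym_diff A C)"
    using assms that finY_Un by simp
  moreover have "finY Y (sym_diff A B \<union> sym_diff B C)" if "finY Y (sym_diff B C)"
    using assms that finY_Un by simp
  ultimately show ?thesis 
    using finY_mono[of Y "sym_diff A B \<union> sym_diff A C" "sym_diff B C"]
      finY_mono[of Y "sym_diff A B \<union> sym_diff B C" "sym_diff A C"] by blast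
qed

text \<open>Small is weaker than empty: a set that the orbit of \<open>v0\<close> misses is small,
  and so is a vertex of finite valence under the conditions of \<open>vertex_small\<close>.\<close>

definition small :: "'v set set \<Rightarrow> 'v set \<Rightarrow> bool" where
  "small Y S \<longleftrightarrow> finY Y (X S)"

lemma small_mono: "small Y S \<Longrightarrow> S' \<subseteq> S \<Longrightarrow> small Y S'"
  unfolding small_def using finY_mono X_mono by meson

lemma small_Un: "Y \<in> CY \<Longrightarrow> small Y (S \<union> S') \<longleftrightarrow> small Y S \<and> small Y S'"
  unfolding small_def X_Un by (rule finY_Un)

lemma small_empty: "Y \<in> CY \<Longrightarrow> small Y {}"
  unfolding small_def finY_def by (auto elim: cyl_nonempty)

lemma hf_not_small: "Y \<in> CY \<Longrightarrow> {u, v} \<in> E \<Longrightarrow> \<not> small Y (hf u v)"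
  unfolding small_def finY_def using hf_not_H_finite cyl_edge by auto

lemma not_small_if_hf: "Y \<in> CY \<Longrightarrow> {u, v} \<in> E \<Longrightarrow> hf u v \<subseteq> S \<Longrightarrow> \<not> small Y S"
  using hf_not_small small_mono by blast

definition alg :: "'v set set \<Rightarrow> 'v set set" where
  "alg Y = {S. S \<subseteq> V \<and> finite (cobd S) \<and> cobd S \<subseteq> Y}"

lemma algD: "S \<in> alg Y \<Longrightarrow> S \<subseteq> V" "S \<in> alg Y \<Longrightarrow> finite (cobd S)" "S \<in> alg Y \<Longrightarrow> cobd S \<subseteq> Y"
  unfolding alg_def by auto

lemma alg_empty: "{} \<in> alg Y" and alg_V: "V \<in> alg Y"
  unfolding alg_def using cobd_empty_iff[of "{}"] cobd_empty_iff[of V] by auto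

lemma alg_compl: "S \<in> alg Y \<Longrightarrow> V - S \<in> alg Y"
  unfolding alg_def by (simp add: cobd_compl)

lemma alg_Un: "S \<in> alg Y \<Longrightarrow> S' \<in> alg Y \<Longrightarrow> S \<union> S' \<in> alg Y"
  unfolding alg_def using cobd_Un[of S S'] by (auto intro: finite_subset)

lemma alg_Int: "S \<in> alg Y \<Longrightarrow> S' \<in> alg Y \<Longrightarrow> S \<inter> S' \<in> alg Y"
  unfolding alg_def using cobd_Int[of S S'] by (auto intro: finite_subset)

lemma alg_Diff: 
  assumes "S \<in> alg Y" "S' \<in> alg Y" 
  shows "S - S' \<in> alg Y"
proof -
  have "S - S' = S \<inter> (V - S')" using algD(1)[OF assms(1)] by auto
  then show ?thesis using assms alg_compl alg_Int by simp
qed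

lemma alg_sym_diff: "S \<in> alg Y \<Longrightarrow> S' \<in> alg Y \<Longrightarrow> sym_diff S S' \<in> alg Y"
  by (intro alg_Un alg_Diff)

lemma alg_hf: "Y \<in> CY \<Longrightarrow> {u, v} \<in> Y \<Longrightarrow> hf u v \<in> alg Y"
  unfolding alg_def using cobd_hf[of u v] cyl_edge hf_sub_V by auto

lemma alg_side:
  assumes Y: "Y \<in> CY" "Y' \<in> CY" "Y \<noteq> Y'" and S: "S \<in> alg Y"
  shows "\<Union>Y' \<subseteq> S \<or> \<Union>Y' \<inter> S = {}"
proof (rule ccontr)
  assume "\<not> ?thesis"
  then obtain a b where ab: "a \<in> \<Union>Y'" "a \<in> S" "b \<in> \<Union>Y'" "b \<notin> S" by blast
  then have "b \<in> V - S" using cyl_V[OF Y(2)] by auto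
  then obtain e where "e \<in> cobd S" "e \<in> sep a b" 
    using crossing_edge[OF algD(2,1)[OF S] ab(2)] by metis
  then show False using cyl_convex[OF Y(2) ab(1,3)] cyl_eq[OF Y(1,2)] algD(3)[OF S] Y(3) by auto
qed

lemma alg_side_iff:
  assumes Y: "Y \<in> CY" "Y' \<in> CY" "Y \<noteq> Y'" and S: "S \<in> alg Y" and x: "x \<in> \<Union>Y'"
  shows "\<Union>Y' \<subseteq> S \<longleftrightarrow> x \<in> S"
  using alg_side[OF assms(1-4)] x by blast

text \<open>The coboundary of \<open>S\<close> consists of edges of \<open>Y\<close> and so misses
  \<open>S'\<close>, and conversely. The corner is literally empty, not just small; betweenness
  relies on this.\<close>

lemma alg_corner:
  assumes Y: "Y \<in> CY" "Y' \<in> CY" and S: "S \<in> alg Y" "S' \<in> alg Y'" 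
    and "\<Union>Y' \<inter> S = {}" "\<Union>Y \<inter> S' = {}"
  shows "S \<inter> S' = {}"
proof -
  obtain e where "e \<in> Y" using cyl_nonempty[OF Y(1)] .
  then obtain w where w: "w \<in> \<Union>Y" using edgeE[OF cyl_edge[OF Y(1)]] by (metis Union_iff insertI1)
  have "w \<in> V" "w \<notin> S \<inter> S'" using w cyl_V[OF Y(1)] assms(6) by auto
  moreover have "\<forall>e\<in>cobd S. e \<inter> S' = {}"
    using algD(3)[OF S(1)] assms(6) by auto
  moreover have "\<forall>e\<in>cobd S'. e \<inter> S = {}"
    using algD(3)[OF S(2)] assms(5) by auto
  ultimately show ?thesis by (rule corner_empty[OF algD(1)[OF S(1)]])
qed

section \<open>The commensurability class of a cylinder\<close>

abbreviation "cyc \<equiv> cylinder_class G act"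

lemma cycI: "e \<in> Y \<Longrightarrow> commensurable G H (stab e) \<Longrightarrow> H \<in> cyc Y"
  unfolding cylinder_class_def by auto

lemma cyc_commensurable: "Y \<in> CY \<Longrightarrow> H \<in> cyc Y \<Longrightarrow> e \<in> Y \<Longrightarrow> commensurable G H (stab e)"
  unfolding cylinder_class_def using commensurable_trans cyl_comm by blast

lemma cyc_comm: 
  assumes "Y \<in> CY" "H \<in> cyc Y" "K \<in> cyc Y" 
  shows "commensurable G H K"
proof -
  obtain e where e: "e \<in> Y" using cyl_nonempty[OF assms(1)] .
  show ?thesis
    by (rule commensurable_trans[OF cyc_commensurable[OF assms(1,2) e] 
        commensurable_sym[OF cyc_commensurable[OF assms(1,3) e]]])
qed

lemma cyc_closed: 
  assumes "Y \<in> CY" "H \<in> cyc Y" "commensurable G K H" 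
  shows "K \<in> cyc Y"
proof -
  obtain e where e: "e \<in> Y" using cyl_nonempty[OF assms(1)] .
  show ?thesis
    by (rule cycI[OF e commensurable_trans[OF assms(3) cyc_commensurable[OF assms(1,2) e]]])
qed

lemma cyc_Int: 
  assumes "Y \<in> CY" "H \<in> cyc Y" "K \<in> cyc Y" 
  shows "H \<inter> K \<in> cyc Y"
proof -
  obtain e where e: "e \<in> Y" using cyl_nonempty[OF assms(1)] .
  show ?thesis
    by (rule cycI[OF e commensurable_Int[OF cyc_commensurable[OF assms(1,2) e] 
        cyc_commensurable[OF assms(1,3) e]]])
qed

lemma cyc_stab: 
  assumes "Y \<in> CY" "e \<in> Y" 
  shows "stab e \<in> cyc Y"
  by (rule cycI[OF assms(2) commensurable_stab_refl[OF cyl_edge[OF assms]]])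

lemma cyc_eq: 
  assumes "Y \<in> CY" "Y' \<in> CY" "H \<in> cyc Y" "H \<in> cyc Y'" 
  shows "Y = Y'"
proof -
  obtain e where e1: "e \<in> Y" using cyl_nonempty[OF assms(1)] .
  obtain e' where "e' \<in> Y'" using cyl_nonempty[OF assms(2)] .
  note e = e1 this
  have "commensurable G (stab e) (stab e')"
    using commensurable_trans[OF commensurable_sym[OF cyc_commensurable[OF assms(1,3) e(1)]] 
      cyc_commensurable[OF assms(2,4) e(2)]] .
  then have "e' \<in> Y" using cyl_closed[OF assms(1) e(1) cyl_edge[OF assms(2) e(2)]] by simp
  then show ?thesis using cyl_eq[OF assms(1,2) _ e(2)] by simp
qed

lemma cyc_H_finite: 
  assumes "Y \<in> CY" "H \<in> cyc Y" 
  shows "H_finite G H Z \<longleftrightarrow> finY Y Z"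
proof -
  obtain e where e: "e \<in> Y" using cyl_nonempty[OF assms(1)] .
  show ?thesis unfolding finY_iff[OF assms(1) e]
    by (rule commensurable_H_finite[OF cyc_commensurable[OF assms e]])
qed

text \<open>The class of \<open>X S\<close> written without a subgroup. By \<open>ai_class_X\<close>
  it equals \<open>ai_class G H (X S)\<close> for every \<open>H\<close> in the class of
  \<open>Y\<close>.\<close>

definition cyl_class :: "'v set set \<Rightarrow> 'v set \<Rightarrow> 'a ai_class" where
  "cyl_class Y S = {(K, Z). almost_invariant G K Z \<and> finY Y (sym_diff (X S) Z)}"

definition cyl_pair :: "'v set set \<Rightarrow> 'v set \<Rightarrow> 'a ai_pair" where
  "cyl_pair Y S = {cyl_class Y S, cyl_class Y (V - S)}"

lemma ai_class_cyl_class: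
  assumes "Y \<in> CY" "H \<in> cyc Y" "finY Y (sym_diff Z (X S))"
  shows "ai_class G H Z = cyl_class Y S"
  unfolding ai_class_def cyl_class_def cyc_H_finite[OF assms(1,2)] finY_trans[OF assms(1,3)] ..

lemma finY_self: "Y \<in> CY \<Longrightarrow> finY Y (sym_diff Z Z)"
  unfolding finY_def by (auto elim: cyl_nonempty)

lemma finY_empty: "Y \<in> CY \<Longrightarrow> finY Y {}"
  using finY_self[of Y "{}"] by simp

lemma ai_class_X: "Y \<in> CY \<Longrightarrow> H \<in> cyc Y \<Longrightarrow> ai_class G H (X S) = cyl_class Y S"
  by (rule ai_class_cyl_class) (auto simp: finY_empty)

lemma ai_pair_X: "Y \<in> CY \<Longrightarrow> H \<in> cyc Y \<Longrightarrow> ai_pair G H (X S) = cyl_pair Y S"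
  unfolding ai_pair_def cyl_pair_def using ai_class_X[of Y H S] ai_class_X[of Y H "V - S"] 
  by (simp add: X_Diff)

lemma cyl_class_cong: "Y \<in> CY \<Longrightarrow> small Y (sym_diff S S') \<Longrightarrow> cyl_class Y S = cyl_class Y S'"
  unfolding cyl_class_def small_def using finY_trans[of Y "X S" "X S'"] by (simp add: X_Diff X_Un)

lemma sym_diff_compl: 
  assumes "S \<subseteq> W" "S' \<subseteq> W" 
  shows "sym_diff (W - S) (W - S') = sym_diff S S'"
  using assms by auto

lemma cyl_pair_cong: 
  assumes "Y \<in> CY" "S \<subseteq> V" "S' \<subseteq> V" "small Y (sym_diff S S')" 
  shows "cyl_pair Y S = cyl_pair Y S'"
  unfolding cyl_pair_def using cyl_class_cong[OF assms(1,4)] cyl_class_cong[OF assms(1), of "V - S" "V - S'"] 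
    sym_diff_compl[OF assms(2,3)] assms(4) by simp

lemma cyl_pair_compl: "S \<subseteq> V \<Longrightarrow> cyl_pair Y (V - S) = cyl_pair Y S"
  unfolding cyl_pair_def by (auto simp: double_diff)

text \<open>\<open>g\<close> lies in exactly one of the set and its translate by \<open>s\<close>
  iff \<open>{u, v}\<close> separates \<open>g v0\<close> from \<open>g s^-1 v0\<close>, that is,
  iff \<open>g^-1\<close> carries \<open>{u, v}\<close> into the geodesic from \<open>v0\<close> to
  \<open>s^-1 v0\<close>. That geodesic is finite, and \<open>H_finite_stabI\<close>
  applies.\<close>

lemma almost_invariant_hf:
  assumes uv: "{u, v} \<in> E"
  shows "almost_invariant G (stab {u, v}) (X (hf u v))"
  unfolding almost_invariant_iff
proof (intro conjI ballI)
  show "subgroup (stab {u, v}) G" by (rule stab_subgroup[OF uv])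
  show "X (hf u v) \<subseteq> carrier G" by (rule X_sub)
next
  fix h g assume h: "h \<in> stab {u, v}" and g: "g \<in> X (hf u v)"
  then have c: "h \<in> carrier G" "g \<in> carrier G" using stab_carrier X_sub by auto
  have "act h (act g v0) \<in> hf (act h u) (act h v)" 
    using g c v0 act_hf_mem[OF c(1) uv, of "act g v0"] unfolding X_def by simp
  then show "h \<otimes> g \<in> X (hf u v)" 
    using c v0 stab_fixes[OF uv h] unfolding X_def by (simp add: act_mult)
next
  fix s assume s: "s \<in> carrier G"
  let ?D = "sym_diff (X (hf u v)) (X (hf u v) #> s)"
  have D: "?D \<subseteq> carrier G" using X_sub r_coset_subset[OF X_sub s] by auto
  have "(\<lambda>g. act (inv g) ` {u, v}) ` ?D \<subseteq> sep v0 (act (inv s) v0)"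
  proof
    fix e assume "e \<in> (\<lambda>g. act (inv g) ` {u, v}) ` ?D"
    then obtain g where g: "g \<in> ?D" "e = act (inv g) ` {u, v}" by auto
    then have gc: "g \<in> carrier G" using D by auto
    have "(act g v0 \<in> hf u v) \<noteq> (act (g \<otimes> inv s) v0 \<in> hf u v)"
      using g(1) mem_r_coset_iff[OF X_sub s gc] gc s unfolding X_def by auto
    then have "{u, v} \<in> sep (act g v0) (act g (act (inv s) v0))"
      using sep_edge[OF uv] gc s v0 by (simp add: act_mult)
    then obtain f where f: "f \<in> sep v0 (act (inv s) v0)" "{u, v} = act g ` f"
      using sep_act[OF gc v0, of "act (inv s) v0"] s v0 by auto
    have "f \<subseteq> V" by (rule edge_sub_V[OF subsetD[OF sep_sub f(1)]])
    then have "e = f" using g(2) act_image_inv(1)[OF gc] f(2) by simp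
    then show "e \<in> sep v0 (act (inv s) v0)" using f by simp
  qed
  then have "finite ((\<lambda>g. act (inv g) ` {u, v}) ` ?D)"
    using finite_sep[OF v0, of "act (inv s) v0"] s v0 finite_subset by auto
  then show "H_finite G (stab {u, v}) ?D" by (rule H_finite_stabI[OF D _ uv])
qed

text \<open>Almost invariance and membership of the class are carried together, because the rules of
  \<open>boolean_subalgebra\<close> demand both of their arguments.\<close>

definition realized :: "'v set set \<Rightarrow> 'v set \<Rightarrow> bool" where
  "realized Y S \<longleftrightarrow> S \<subseteq> V \<and> 
     (\<exists>H\<in>cyc Y. almost_invariant G H (X S) \<and> cyl_class Y S \<in> based_cylinder G T act v0 Y)"

lemma realized_empty:
  assumes "Y \<in> CY"
  shows "realized Y {}"
proof -
  obtain e where e: "e \<in> Y" using cyl_nonempty[OF assms] .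
  have "almost_invariant G (stab e) (X {})"
    using stab_subgroup[OF cyl_edge[OF assms e]] by (simp add: almost_invariant_iff r_coset_def)
  moreover have "cyl_class Y {} \<in> based_cylinder G T act v0 Y"
    unfolding based_cylinder_def ai_class_X[OF assms cyc_stab[OF assms e], of "{}", symmetric]
    using boolean_subalgebra.zero[OF cyc_stab[OF assms e]] by simp
  ultimately show ?thesis unfolding realized_def using cyc_stab[OF assms e] by auto
qed

lemma realized_hf:
  assumes "Y \<in> CY" "{u, v} \<in> Y"
  shows "realized Y (hf u v)"
proof -
  have "cyl_class Y (hf u v) \<in> based_cylinder G T act v0 Y"
    unfolding based_cylinder_def ai_class_X[OF assms(1) cyc_stab[OF assms], symmetric]
      Z_set_eq[symmetric]
    by (rule boolean_subalgebra.generator) (use assms in blast)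
  then show ?thesis unfolding realized_def 
    using cyc_stab[OF assms] almost_invariant_hf[OF cyl_edge[OF assms]] hf_sub_V by auto
qed

lemma realized_compl:
  assumes Y: "Y \<in> CY" and S: "realized Y S"
  shows "realized Y (V - S)"
proof -
  obtain H where H: "S \<subseteq> V" "H \<in> cyc Y" "almost_invariant G H (X S)" 
    "cyl_class Y S \<in> based_cylinder G T act v0 Y" using S unfolding realized_def by auto
  have "ai_class G H (carrier G - X S) \<in> based_cylinder G T act v0 Y"
    unfolding based_cylinder_def 
    by (rule boolean_subalgebra.compl) 
      (use H ai_class_X[OF Y H(2)] in \<open>auto simp: based_cylinder_def\<close>)
  moreover have "carrier G - X S = X (V - S)" by (simp add: X_Diff)
  ultimately show ?thesis unfolding realized_def 
    using H almost_invariant_compl[OF H(3)] ai_class_X[OF Y H(2)] by auto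
qed

lemma realized_Un:
  assumes Y: "Y \<in> CY" and S: "realized Y S" and S': "realized Y S'"
  shows "realized Y (S \<union> S')"
proof -
  obtain H where H: "S \<subseteq> V" "H \<in> cyc Y" "almost_invariant G H (X S)" 
    "cyl_class Y S \<in> based_cylinder G T act v0 Y" using S unfolding realized_def by auto
  obtain K where K: "S' \<subseteq> V" "K \<in> cyc Y" "almost_invariant G K (X S')" 
    "cyl_class Y S' \<in> based_cylinder G T act v0 Y" using S' unfolding realized_def by auto
  have "ai_class G (H \<inter> K) (X S \<union> X S') \<in> based_cylinder G T act v0 Y"
    unfolding based_cylinder_def 
    by (rule boolean_subalgebra.join) 
      (use H K ai_class_X[OF Y H(2)] ai_class_X[OF Y K(2)] in \<open>auto simp: based_cylinder_def\<close>)
  then show ?thesis unfolding realized_def 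
    using H K almost_invariant_Un[OF H(3) K(3) cyc_comm[OF Y H(2) K(2)]] 
      ai_class_X[OF Y cyc_Int[OF Y H(2) K(2)], of "S \<union> S'"] cyc_Int[OF Y H(2) K(2)] 
    by (auto simp: X_Un)
qed

lemma realized_sym_diff:
  assumes Y: "Y \<in> CY" and S: "realized Y S" and S': "realized Y S'"
  shows "realized Y (sym_diff S S')"
proof -
  have D: "realized Y (A - B)" if "realized Y A" "realized Y B" for A B
  proof -
    have "A \<subseteq> V" using that unfolding realized_def by auto
    then have "A - B = V - ((V - A) \<union> B)" by auto
    then show ?thesis using realized_compl[OF Y] realized_Un[OF Y] that by simp
  qed
  show ?thesis by (rule realized_Un[OF Y D[OF S S'] D[OF S' S]])
qed

text \<open>Adding the half-tree of a coboundary edge modulo 2 removes this edge. So every set in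
  the algebra is a sum modulo 2 of finitely many half-trees and possibly \<open>V\<close>.\<close>

lemma alg_realized:
  assumes Y: "Y \<in> CY" and S: "S \<in> alg Y"
  shows "realized Y S"
  using S
proof (induction "card (cobd S)" arbitrary: S rule: less_induct)
  case less
  show ?case
  proof (cases "cobd S = {}")
    case True
    then have "S = {} \<or> S = V" using cobd_empty_iff algD(1)[OF less(2)] by simp
    then show ?thesis using realized_empty[OF Y] realized_compl[OF Y realized_empty[OF Y]] by auto
  next
    case False
    then obtain e where e: "e \<in> cobd S" by auto
    then have eY: "e \<in> Y" using algD(3)[OF less(2)] by auto
    then obtain u v where uv: "e = {u, v}" "{u, v} \<in> E" using cyl_edge[OF Y] edgeE by metis
    let ?S = "sym_diff S (hf u v)"
    have c: "cobd ?S = cobd S - {e}" using cobd_sym_diff cobd_hf[OF uv(2)] e uv(1) by auto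
    then have "card (cobd ?S) < card (cobd S)" using e algD(2)[OF less(2)] 
      by (simp add: card_Diff1_less del: card_Diff_insert)
    moreover have "?S \<in> alg Y" using alg_sym_diff[OF less(2) alg_hf[OF Y]] eY uv by simp
    ultimately have "realized Y ?S" using less by simp
    then have "realized Y (sym_diff ?S (hf u v))" 
      using realized_sym_diff[OF Y _ realized_hf[OF Y]] eY uv by simp
    moreover have "sym_diff ?S (hf u v) = S" by auto
    ultimately show ?thesis by simp
  qed
qed

lemma alg_rep:
  assumes "Y \<in> CY" "S \<in> alg Y"
  obtains H where "H \<in> cyc Y" "almost_invariant G H (X S)"
  using alg_realized[OF assms] unfolding realized_def by auto

text \<open>The rules \<open>compl\<close> and \<open>join\<close> may be applied to any
  representative of a class. Such a representative differs from some \<open>X S\<close> by a finite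
  set, and Boolean operations respect this.\<close>

lemma based_cyl_class:
  assumes Y: "Y \<in> CY" and c: "c \<in> based_cylinder G T act v0 Y"
  shows "\<exists>S\<in>alg Y. c = cyl_class Y S"
  using c unfolding based_cylinder_def
proof (induction rule: boolean_subalgebra.induct)
  case (generator c)
  then obtain u v where uv: "{u, v} \<in> Y" "c = ai_class G (stab {u, v}) (X (hf u v))"
    unfolding Z_set_eq by auto
  then show ?case using ai_class_X[OF Y cyc_stab[OF Y uv(1)]] alg_hf[OF Y uv(1)] by auto
next
  case (zero H)
  then show ?case using ai_class_X[OF Y zero, of "{}"] alg_empty by auto
next
  case (compl H Z)
  then obtain S where S: "S \<in> alg Y" "ai_class G H Z = cyl_class Y S" by auto
  have "(H, Z) \<in> cyl_class Y S" using ai_class_self[OF compl(2)] S(2) by simp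
  then have "finY Y (sym_diff Z (X S))" unfolding cyl_class_def by (simp add: Un_commute)
  moreover have "sym_diff (carrier G - Z) (X (V - S)) = sym_diff Z (X S)"
    using sym_diff_compl[of Z "carrier G" "X S"] compl(2) X_sub
    by (simp add: X_Diff almost_invariant_iff)
  ultimately have "ai_class G H (carrier G - Z) = cyl_class Y (V - S)"
    using ai_class_cyl_class[OF Y compl(1)] by simp
  then show ?case using alg_compl[OF S(1)] by blast
next
  case (join H Z K W)
  then obtain S S' where S: "S \<in> alg Y" "ai_class G H Z = cyl_class Y S" "S' \<in> alg Y" "ai_class G K W = cyl_class Y S'" 
    by auto
  have "(H, Z) \<in> cyl_class Y S" "(K, W) \<in> cyl_class Y S'" 
    using ai_class_self[OF join(2)] ai_class_self[OF join(5)] S by auto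
  then have "finY Y (sym_diff (X S) Z \<union> sym_diff (X S') W)" unfolding cyl_class_def using finY_Un[OF Y] by simp
  then have "finY Y (sym_diff (Z \<union> W) (X (S \<union> S')))" by (rule finY_mono) (auto simp: X_Un)
  then have "ai_class G (H \<inter> K) (Z \<union> W) = cyl_class Y (S \<union> S')"
    by (rule ai_class_cyl_class[OF Y cyc_Int[OF Y join(1,4)]])
  then show ?case using alg_Un[OF S(1,3)] by blast
qed

definition nontriv :: "'v set set \<Rightarrow> 'v set \<Rightarrow> bool" where
  "nontriv Y S \<longleftrightarrow> \<not> small Y S \<and> \<not> small Y (V - S)"

lemma nontriv_compl: "S \<subseteq> V \<Longrightarrow> nontriv Y (V - S) \<longleftrightarrow> nontriv Y S"
  unfolding nontriv_def by (auto simp: double_diff)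

lemma nontriv_ai: "Y \<in> CY \<Longrightarrow> H \<in> cyc Y \<Longrightarrow> almost_invariant G H (X S) \<Longrightarrow> 
    nontrivial_ai G H (X S) \<longleftrightarrow> nontriv Y S"
  unfolding nontrivial_ai_def nontriv_def small_def 
  using cyc_H_finite[of Y H] by (simp add: X_Diff)

text \<open>Membership in a class only gives finiteness over the subgroup of that class. Reading the
  equality of the classes both ways gives it over both subgroups, as
  \<open>equivalent_commensurable\<close> requires.\<close>

lemma class_rep:
  assumes Y: "Y \<in> CY" and S: "S \<in> alg Y" "nontriv Y S" 
    and Z: "almost_invariant G H Z" "ai_class G H Z = cyl_class Y S"
  shows "H \<in> cyc Y \<and> finY Y (sym_diff Z (X S)) \<and> nontrivial_ai G H Z"
proof -
  obtain K where K: "K \<in> cyc Y" "almost_invariant G K (X S)" using alg_rep[OF Y S(1)] .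
  have nt: "nontrivial_ai G K (X S)" using nontriv_ai[OF Y K] S(2) by simp
  have "(K, X S) \<in> cyl_class Y S" using K finY_self[OF Y] unfolding cyl_class_def by auto
  then have 1: "H_finite G H (sym_diff Z (X S))" using Z(2) unfolding ai_class_def by auto
  have "(H, Z) \<in> cyl_class Y S" using ai_class_self[OF Z(1)] Z(2) by simp
  then have 2: "finY Y (sym_diff Z (X S))" unfolding cyl_class_def by (simp add: Un_commute)
  then have "H_finite G K (sym_diff Z (X S))" using cyc_H_finite[OF Y K(1)] by simp
  then have "commensurable G H K \<and> nontrivial_ai G H Z"
    using equivalent_commensurable[OF Z(1) nt 1] by simp
  then show ?thesis using 2 cyc_closed[OF Y K(1)] by auto
qed

lemma pair_rep:
  assumes Y: "Y \<in> CY" and S: "S \<in> alg Y" "nontriv Y S" 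
    and Z: "almost_invariant G H Z" "ai_pair G H Z = cyl_pair Y S"
  obtains S' where "S' = S \<or> S' = V - S" "H \<in> cyc Y" "finY Y (sym_diff Z (X S'))" 
    "nontrivial_ai G H Z"
proof -
  have "ai_class G H Z \<in> cyl_pair Y S" using Z(2) unfolding ai_pair_def by auto
  then obtain S' where S': "S' = S \<or> S' = V - S" "ai_class G H Z = cyl_class Y S'" unfolding cyl_pair_def by auto
  moreover have "S' \<in> alg Y" "nontriv Y S'" 
    using S S'(1) alg_compl nontriv_compl[OF algD(1)[OF S(1)]] by auto
  ultimately show ?thesis using that class_rep[OF Y _ _ Z(1)] by blast
qed

abbreviation "based \<equiv> based_on_tree G T act v0"

lemma ai_pairs_based:
  "ai_pairs G based = {cyl_pair Y S | Y S. Y \<in> CY \<and> S \<in> alg Y \<and> nontriv Y S}"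
proof (intro equalityI subsetI)
  fix p assume "p \<in> ai_pairs G based"
  then obtain H Z Y where H: "p = ai_pair G H Z" "nontrivial_ai G H Z" "Y \<in> CY" 
    "ai_class G H Z \<in> based_cylinder G T act v0 Y"
    unfolding ai_pairs_def based_on_tree_def by blast
  obtain S where S: "S \<in> alg Y" "ai_class G H Z = cyl_class Y S" using based_cyl_class[OF H(3,4)] by auto
  obtain K where K: "K \<in> cyc Y" "almost_invariant G K (X S)" using alg_rep[OF H(3) S(1)] .
  have aiH: "almost_invariant G H Z" using H(2) unfolding nontrivial_ai_def by auto
  have "(K, X S) \<in> cyl_class Y S" using K finY_self[OF H(3)] unfolding cyl_class_def by auto
  then have "(K, X S) \<in> ai_class G H Z" using S(2) by simp
  then have 1: "H_finite G H (sym_diff (X S) Z)" unfolding ai_class_def by (simp add: Un_commute)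
  have "(H, Z) \<in> cyl_class Y S" using ai_class_self[OF aiH] S(2) by simp
  then have 2: "finY Y (sym_diff (X S) Z)" unfolding cyl_class_def by simp
  then have "H_finite G K (sym_diff (X S) Z)" using cyc_H_finite[OF H(3) K(1)] by simp
  then have *: "commensurable G K H" "nontrivial_ai G K (X S)"
    using equivalent_commensurable[OF K(2) H(2) _ 1] by auto
  then have HY: "H \<in> cyc Y" using cyc_closed[OF H(3) K(1)] commensurable_sym by blast
  have "sym_diff (carrier G - Z) (X (V - S)) = sym_diff (X S) Z"
    using sym_diff_compl[of Z "carrier G" "X S"] aiH X_sub
    by (simp add: X_Diff almost_invariant_iff Un_commute)
  then have "ai_class G H (carrier G - Z) = cyl_class Y (V - S)"
    using ai_class_cyl_class[OF H(3) HY, of "carrier G - Z" "V - S"] 2 by simp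
  then have "p = cyl_pair Y S" using H(1) S(2) unfolding cyl_pair_def ai_pair_def by simp
  then show "p \<in> {cyl_pair Y S | Y S. Y \<in> CY \<and> S \<in> alg Y \<and> nontriv Y S}" 
    using H(3) S(1) *(2) nontriv_ai[OF H(3) K] by auto
next
  fix p assume "p \<in> {cyl_pair Y S | Y S. Y \<in> CY \<and> S \<in> alg Y \<and> nontriv Y S}"
  then obtain Y S where S: "p = cyl_pair Y S" "Y \<in> CY" "S \<in> alg Y" "nontriv Y S" by auto
  obtain H where H: "H \<in> cyc Y" "almost_invariant G H (X S)" "cyl_class Y S \<in> based_cylinder G T act v0 Y"
    using alg_realized[OF S(2,3)] unfolding realized_def by auto
  have "p = ai_pair G H (X S)" using ai_pair_X[OF S(2) H(1)] S(1) by simp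
  moreover have "nontrivial_ai G H (X S)" using nontriv_ai[OF S(2) H(1,2)] S(4) by simp
  moreover have "ai_class G H (X S) \<in> based" 
    using ai_class_X[OF S(2) H(1)] H(3) S(2) unfolding based_on_tree_def by auto
  ultimately show "p \<in> ai_pairs G based" unfolding ai_pairs_def by blast
qed

lemma cyl_pair_eq_iff:
  assumes Y: "Y \<in> CY" "Y' \<in> CY" and S: "S \<in> alg Y" "nontriv Y S" and S': "S' \<in> alg Y'" "nontriv Y' S'"
  shows "cyl_pair Y S = cyl_pair Y' S' \<longleftrightarrow> Y = Y' \<and> (small Y (sym_diff S S') \<or> small Y (sym_diff S (V - S')))"
proof
  assume eq: "cyl_pair Y S = cyl_pair Y' S'"
  obtain H where H: "H \<in> cyc Y" "almost_invariant G H (X S)" using alg_rep[OF Y(1) S(1)] .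
  have "ai_pair G H (X S) = cyl_pair Y' S'" using ai_pair_X[OF Y(1) H(1)] eq by simp
  then obtain S'' where S'': "S'' = S' \<or> S'' = V - S'" "H \<in> cyc Y'" "finY Y' (sym_diff (X S) (X S''))"
    using pair_rep[OF Y(2) S' H(2)] by metis
  then have "Y = Y'" using cyc_eq[OF Y H(1)] by simp
  moreover have "X (sym_diff S S'') = sym_diff (X S) (X S'')" by (simp add: X_Un X_Diff)
  ultimately show "Y = Y' \<and> (small Y (sym_diff S S') \<or> small Y (sym_diff S (V - S')))"
    using S'' unfolding small_def by metis
next
  assume "Y = Y' \<and> (small Y (sym_diff S S') \<or> small Y (sym_diff S (V - S')))"
  then show "cyl_pair Y S = cyl_pair Y' S'"
    using cyl_pair_cong[OF Y(1) algD(1)[OF S(1)] algD(1)[OF S'(1)]]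
      cyl_pair_cong[OF Y(1) algD(1)[OF S(1)], of "V - S'"] cyl_pair_compl[OF algD(1)[OF S'(1)]] by auto
qed

section \<open>Corners and crossing for arbitrary representatives\<close>

lemma corner_transfer:
  assumes Y: "Y \<in> CY" "Y' \<in> CY" and B: "B \<in> alg Y'"
    and Z: "H \<in> cyc Y" "nontrivial_ai G H Z" "finY Y (sym_diff Z (X A))"
    and W: "K \<in> cyc Y'" "nontrivial_ai G K W" "finY Y' (sym_diff W (X B))"
    and sm: "small Y (A \<inter> B)"
  shows "H_finite G H (Z \<inter> W)"
proof -
  obtain L where L: "L \<in> cyc Y'" "almost_invariant G L (X B)" using alg_rep[OF Y(2) B] .
  show ?thesis
    by (rule H_finite_corner_cong[of H Z "X A" K W L "X B"])
      (use Z W L cyc_comm[OF Y(2) L(1) W(1)] cyc_H_finite[OF Y(1) Z(1)] cyc_H_finite[OF Y(2) W(1)] sm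
        in \<open>auto simp: nontrivial_ai_def small_def X_Int\<close>)
qed

text \<open>The replacement runs the other way here: \<open>X A\<close> and \<open>X B\<close>
  become the target sets of \<open>H_finite_corner_cong\<close>, so these are the sets that must not
  be finite.\<close>

lemma corner_transfer':
  assumes Y: "Y \<in> CY" "Y' \<in> CY" and A: "A \<in> alg Y" "nontriv Y A" and B: "B \<in> alg Y'" "nontriv Y' B"
    and Z: "H \<in> cyc Y" "nontrivial_ai G H Z" "finY Y (sym_diff Z (X A))"
    and W: "K \<in> cyc Y'" "nontrivial_ai G K W" "finY Y' (sym_diff W (X B))"
    and fin: "H_finite G H (Z \<inter> W)"
  shows "small Y (A \<inter> B)"
proof -
  obtain H' where H': "H' \<in> cyc Y" "almost_invariant G H' (X A)" using alg_rep[OF Y(1) A(1)] .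
  obtain L where L: "L \<in> cyc Y'" "almost_invariant G L (X B)" using alg_rep[OF Y(2) B(1)] .
  have "H_finite G H' (X A \<inter> X B)"
    by (rule H_finite_corner_cong[of H' "X A" Z L "X B" K W])
      (use Z W L H' cyc_comm[OF Y(2) W(1) L(1)] cyc_H_finite[OF Y(1) H'(1)] cyc_H_finite[OF Y(2) L(1)] 
        cyc_H_finite[OF Y(1) Z(1)] A(2) B(2) fin
        in \<open>auto simp: nontrivial_ai_def nontriv_def small_def X_Int Un_commute\<close>)
  then show ?thesis using cyc_H_finite[OF Y(1) H'(1)] unfolding small_def X_Int by simp
qed

definition tcross :: "'v set set \<Rightarrow> 'v set \<Rightarrow> 'v set \<Rightarrow> bool" where
  "tcross Y S S' \<longleftrightarrow> \<not> small Y (S \<inter> S') \<and> \<not> small Y (S \<inter> (V - S')) \<and> 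
     \<not> small Y ((V - S) \<inter> S') \<and> \<not> small Y ((V - S) \<inter> (V - S'))"

lemma finY_compl:
  assumes "Z \<subseteq> carrier G" "finY Y (sym_diff Z (X S))"
  shows "finY Y (sym_diff (carrier G - Z) (X (V - S)))"
  using assms sym_diff_compl[OF assms(1) X_sub, of S] by (simp add: X_Diff)

lemma nontrivial_compl: 
  assumes "nontrivial_ai G H Z"
  shows "nontrivial_ai G H (carrier G - Z)"
proof -
  have "carrier G - (carrier G - Z) = Z" 
    using assms by (auto simp: nontrivial_ai_def almost_invariant_iff)
  then show ?thesis using assms almost_invariant_compl unfolding nontrivial_ai_def by auto
qed

lemma crossing_iff:
  assumes Y: "Y \<in> CY" "Y' \<in> CY" and S: "S \<in> alg Y" "nontriv Y S" and S': "S' \<in> alg Y'" "nontriv Y' S'"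
  shows "(cyl_pair Y S, cyl_pair Y' S') \<in> crossing_rel G based \<longleftrightarrow> Y = Y' \<and> tcross Y S S'"
proof
  assume "(cyl_pair Y S, cyl_pair Y' S') \<in> crossing_rel G based"
  then obtain H Z K W where *: "almost_invariant G H Z" "almost_invariant G K W"
    "ai_pair G H Z = cyl_pair Y S" "ai_pair G K W = cyl_pair Y' S'" "crosses G H Z W"
    unfolding crossing_rel_def by auto
  obtain A where A: "A = S \<or> A = V - S" "H \<in> cyc Y" "finY Y (sym_diff Z (X A))" 
    "nontrivial_ai G H Z" using pair_rep[OF Y(1) S *(1,3)] .
  obtain B where B: "B = S' \<or> B = V - S'" "K \<in> cyc Y'" "finY Y' (sym_diff W (X B))" 
    "nontrivial_ai G K W" using pair_rep[OF Y(2) S' *(2,4)] .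
  have AB: "A \<in> alg Y" "B \<in> alg Y'" "A \<subseteq> V" "B \<subseteq> V" 
    using A(1) B(1) S(1) S'(1) alg_compl[OF S(1)] alg_compl[OF S'(1)] 
      algD(1)[OF S(1)] algD(1)[OF S'(1)] by auto
  have ZW: "Z \<subseteq> carrier G" "W \<subseteq> carrier G" using * by (auto simp: almost_invariant_iff)
  note t = corner_transfer[OF Y]
  have "\<not> small Y (A \<inter> B)" "\<not> small Y (A \<inter> (V - B))" "\<not> small Y ((V - A) \<inter> B)" 
    "\<not> small Y ((V - A) \<inter> (V - B))"
    using *(5) t[OF AB(2) A(2,4,3) B(2,4,3)] 
      t[OF alg_compl[OF AB(2)] A(2,4,3) B(2) nontrivial_compl[OF B(4)] finY_compl[OF ZW(2) B(3)]] 
      t[OF AB(2) A(2) nontrivial_compl[OF A(4)] finY_compl[OF ZW(1) A(3)] B(2,4,3)] 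
      t[OF alg_compl[OF AB(2)] A(2) nontrivial_compl[OF A(4)] finY_compl[OF ZW(1) A(3)]
        B(2) nontrivial_compl[OF B(4)] finY_compl[OF ZW(2) B(3)]] 
    unfolding crosses_def by auto
  moreover have "A \<union> (V - A) = V" "V - (V - S) = S" "V - (V - S') = S'" 
    using algD(1)[OF S(1)] algD(1)[OF S'(1)] AB by auto
  ultimately have c: "tcross Y S S'" using A(1) B(1) unfolding tcross_def by auto
  \<comment> \<open>Of \<open>S\<close> and of \<open>S'\<close>, one side misses the other
    cylinder. The corner of these two sides would be empty, against crossing.\<close>
  moreover have "Y = Y'"
  proof (rule ccontr)
    assume ne: "Y \<noteq> Y'"
    have "\<Union>Y' \<inter> S = {} \<or> \<Union>Y' \<inter> (V - S) = {}" "\<Union>Y \<inter> S' = {} \<or> \<Union>Y \<inter> (V - S') = {}"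
      using alg_side[OF Y ne S(1)] alg_side[OF Y(2,1) ne[symmetric] S'(1)] by auto
    moreover have "\<not> (\<Union>Y' \<inter> P = {} \<and> \<Union>Y \<inter> Q = {})" 
      if "P = S \<or> P = V - S" "Q = S' \<or> Q = V - S'" for P Q
    proof
      assume "\<Union>Y' \<inter> P = {} \<and> \<Union>Y \<inter> Q = {}"
      moreover have "P \<in> alg Y" "Q \<in> alg Y'" using that S S' alg_compl by auto
      ultimately have "P \<inter> Q = {}" using alg_corner[OF Y] by blast
      then show False using that c small_empty[OF Y(1)] unfolding tcross_def by auto
    qed
    ultimately show False by blast
  qed
  ultimately show "Y = Y' \<and> tcross Y S S'" by simp
next
  assume a: "Y = Y' \<and> tcross Y S S'"
  obtain H where H: "H \<in> cyc Y" "almost_invariant G H (X S)" using alg_rep[OF Y(1) S(1)] .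
  obtain K where K: "K \<in> cyc Y'" "almost_invariant G K (X S')" using alg_rep[OF Y(2) S'(1)] .
  have "crosses G H (X S) (X S')"
    using conjunct2[OF a] unfolding tcross_def crosses_def small_def X_Int X_Diff X_V
      cyc_H_finite[OF Y(1) H(1)] .
  moreover have "cyl_pair Y S \<in> ai_pairs G based" "cyl_pair Y' S' \<in> ai_pairs G based"
    unfolding ai_pairs_based using Y S S' by auto
  ultimately show "(cyl_pair Y S, cyl_pair Y' S') \<in> crossing_rel G based"
    unfolding crossing_rel_def using H(2) K(2) ai_pair_X[OF Y(1) H(1), of S] 
      ai_pair_X[OF Y(2) K(1), of S'] by (simp; blast)
qed

end

section \<open>Translates of cylinders\<close>

context group
begin

lemma H_finite_translate:
  assumes H: "H \<subseteq> carrier G" and g: "g \<in> carrier G" and Z: "H_finite G H Z"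
  shows "H_finite G (g <# H #> inv g) (g <# Z)"
proof -
  obtain F where F: "finite F" "F \<subseteq> carrier G" "\<forall>z\<in>Z. \<exists>h\<in>H. \<exists>f\<in>F. z = h \<otimes> f"
    using H_finiteE[OF Z H] .
  have "g <# Z \<subseteq> (\<Union>f\<in>(\<lambda>f. g \<otimes> f) ` F. g <# H #> inv g #> f)"
  proof
    fix w assume "w \<in> g <# Z"
    then obtain z where "z \<in> Z" "w = g \<otimes> z" unfolding l_coset_def by auto
    moreover then obtain h f where hf: "h \<in> H" "f \<in> F" "z = h \<otimes> f" using F(3) by auto
    moreover have c: "h \<in> carrier G" "f \<in> carrier G" using hf F(2) H by auto
    ultimately have "w = (g \<otimes> h \<otimes> inv g) \<otimes> (g \<otimes> f)" using g 
      by (simp add: m_assoc) (simp add: m_assoc[symmetric])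
    moreover have "g \<otimes> h \<otimes> inv g \<in> g <# H #> inv g" 
      unfolding l_coset_def r_coset_def using hf(1) by auto
    ultimately have "w \<in> g <# H #> inv g #> (g \<otimes> f)" 
      unfolding r_coset_def[of _ _ "g \<otimes> f"] by auto
    then show "w \<in> (\<Union>f\<in>(\<lambda>f. g \<otimes> f) ` F. g <# H #> inv g #> f)" using hf(2) by auto
  qed
  then show ?thesis using F g by (intro H_finite_coverI[of "(\<lambda>f. g \<otimes> f) ` F"]) auto
qed

end

context tree_action
begin

section \<open>The action on cylinders\<close>

definition actY :: "'a \<Rightarrow> 'v set set \<Rightarrow> 'v set set" where
  "actY g Y = (\<lambda>e. act g ` e) ` Y"

lemma stab_comm_act:
  assumes g: "g \<in> carrier G" and e: "e \<in> E" "e' \<in> E" and c: "commensurable G (stab e) (stab e')"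
  shows "commensurable G (stab (act g ` e)) (stab (act g ` e'))"
proof -
  have *: "H_finite G (stab (act g ` e)) (stab (act g ` e'))" 
    if "e \<in> E" "e' \<in> E" "H_finite G (stab e) (stab e')" for e e'
  proof -
    have s: "g <# stab e #> inv g \<subseteq> carrier G" 
      using stab_act[OF g edge_sub_V[OF that(1)]] stab_carrier by metis
    have "H_finite G (g <# stab e #> inv g) (g <# stab e' #> inv g)"
      by (rule H_finite_r_coset[OF s H_finite_translate[OF stab_carrier g that(3)] inv_closed[OF g]])
    then show ?thesis using stab_act[OF g edge_sub_V] that by simp
  qed
  show ?thesis unfolding commensurable_iff 
    using c * e act_edge[OF g] stab_subgroup by (auto simp: commensurable_iff)
qed

lemma actY_inv:
  assumes g: "g \<in> carrier G" and Y: "Y \<in> CY"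
  shows "actY (inv g) (actY g Y) = Y" "actY g (actY (inv g) Y) = Y"
proof -
  have "act (inv g) ` act g ` e = e" "act g ` act (inv g) ` e = e" if "e \<in> Y" for e
    using act_image_inv[OF g] edge_sub_V[OF cyl_edge[OF Y that]] by auto
  then show "actY (inv g) (actY g Y) = Y" "actY g (actY (inv g) Y) = Y" 
    unfolding actY_def image_image by (auto simp: image_iff)
qed

lemma actY_CY: 
  assumes g: "g \<in> carrier G" and Y: "Y \<in> CY"
  shows "actY g Y \<in> CY"
proof -
  obtain e where e: "e \<in> E" "Y = {e' \<in> E. commensurable G (stab e) (stab e')}"
    using Y unfolding cyl_iff by auto
  have "actY g Y = {e' \<in> E. commensurable G (stab (act g ` e)) (stab e')}"
  proof (intro equalityI subsetI)
    fix f assume "f \<in> actY g Y"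
    then show "f \<in> {e' \<in> E. commensurable G (stab (act g ` e)) (stab e')}"
      unfolding actY_def e(2) using act_edge[OF g] stab_comm_act[OF g e(1)] by auto
  next
    fix f assume "f \<in> {e' \<in> E. commensurable G (stab (act g ` e)) (stab e')}"
    then have f: "f \<in> E" "commensurable G (stab (act g ` e)) (stab f)" by auto
    have "commensurable G (stab (act (inv g) ` act g ` e)) (stab (act (inv g) ` f))"
      using stab_comm_act[OF inv_closed[OF g] act_edge[OF g e(1)] f] .
    then have "act (inv g) ` f \<in> Y" 
      using act_edge[OF inv_closed[OF g] f(1)] act_image_inv(1)[OF g edge_sub_V[OF e(1)]] 
      unfolding e(2) by simp
    moreover have "f = act g ` act (inv g) ` f" using act_image_inv(2)[OF g edge_sub_V[OF f(1)]] by simp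
    ultimately show "f \<in> actY g Y" unfolding actY_def by auto
  qed
  then show ?thesis unfolding cyl_iff using act_edge[OF g e(1)] by auto
qed

lemma Union_actY: "\<Union>(actY g Y) = act g ` \<Union>Y"
  unfolding actY_def by auto

lemma actY_eq_iff:
  assumes "g \<in> carrier G" "Y \<in> CY" "Y' \<in> CY"
  shows "actY g Y = actY g Y' \<longleftrightarrow> Y = Y'"
  using actY_inv(1)[OF assms(1,2)] actY_inv(1)[OF assms(1,3)] by metis

lemma actY_mult:
  assumes "g \<in> carrier G" "h \<in> carrier G" "Y \<in> CY"
  shows "actY (g \<otimes> h) Y = actY g (actY h Y)"
  unfolding actY_def image_image[of "\<lambda>e. act g ` e"]
  by (rule image_cong[OF refl]) (rule act_image_mult[OF assms(1,2) edge_sub_V[OF cyl_edge[OF assms(3)]]])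

lemma actY_one: 
  assumes "Y \<in> CY" 
  shows "actY \<one> Y = Y"
proof -
  have "act \<one> ` e = e" if "e \<in> Y" for e using act_image_one[OF edge_sub_V[OF cyl_edge[OF assms that]]] .
  then show ?thesis unfolding actY_def by simp
qed

lemma finY_act:
  assumes g: "g \<in> carrier G" and Y: "Y \<in> CY" and Z: "finY Y Z"
  shows "finY (actY g Y) (g <# Z)"
proof -
  obtain e where e: "e \<in> Y" "H_finite G (stab e) Z" using Z unfolding finY_def by auto
  have "H_finite G (stab (act g ` e)) (g <# Z)"
    using H_finite_translate[OF stab_carrier g e(2)] stab_act[OF g edge_sub_V[OF cyl_edge[OF Y e(1)]]] by simp
  then show ?thesis unfolding finY_def actY_def using e(1) by auto
qed

lemma small_act:
  assumes g: "g \<in> carrier G" and Y: "Y \<in> CY" and S: "S \<subseteq> V"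
  shows "small (actY g Y) (act g ` S) \<longleftrightarrow> small Y S"
proof -
  have *: "small (actY g Y) (act g ` S)" if "g \<in> carrier G" "Y \<in> CY" "S \<subseteq> V" "small Y S" for g Y S
    using finY_act[OF that(1,2)] that X_act[OF that(1,3)] unfolding small_def by metis
  show ?thesis 
    using *[OF g Y S] *[OF inv_closed[OF g] actY_CY[OF g Y] act_image_sub[OF g S]]
      actY_inv(1)[OF g Y] act_image_inv(1)[OF g S] by auto
qed

lemma alg_act:
  assumes g: "g \<in> carrier G" and Y: "Y \<in> CY" and S: "S \<in> alg Y"
  shows "act g ` S \<in> alg (actY g Y)"
  unfolding alg_def using algD[OF S] cobd_act[OF g algD(1)[OF S]] act_image_sub[OF g algD(1)[OF S]]
  by (auto simp: actY_def)

section \<open>Vertices lying in several cylinders\<close>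

abbreviation "V0 \<equiv> cylinder_vertices0 G T act"

lemma V0_iff: "x \<in> V0 \<longleftrightarrow> x \<in> V \<and> (\<exists>Y\<in>CY. \<exists>Y'\<in>CY. Y \<noteq> Y' \<and> x \<in> \<Union>Y \<and> x \<in> \<Union>Y')"
  unfolding cylinder_vertices0_def by simp

lemma V0_sub: "x \<in> V0 \<Longrightarrow> x \<in> V"
  unfolding V0_iff by simp

lemma V0_other:
  assumes "x \<in> V0" 
  obtains Y' where "Y' \<in> CY" "Y' \<noteq> Y" "x \<in> \<Union>Y'"
proof -
  obtain Y1 Y2 where "Y1 \<in> CY" "Y2 \<in> CY" "Y1 \<noteq> Y2" "x \<in> \<Union>Y1" "x \<in> \<Union>Y2" 
    using assms unfolding V0_iff by blast
  then show ?thesis using that by (cases "Y1 = Y") auto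
qed

lemma V0I: "Y \<in> CY \<Longrightarrow> Y' \<in> CY \<Longrightarrow> Y \<noteq> Y' \<Longrightarrow> x \<in> \<Union>Y \<Longrightarrow> x \<in> \<Union>Y' \<Longrightarrow> x \<in> V0"
  unfolding V0_iff using cyl_V by blast

lemma V0_act:
  assumes g: "g \<in> carrier G" and x: "x \<in> V0"
  shows "act g x \<in> V0"
proof -
  obtain Y1 Y2 where *: "Y1 \<in> CY" "Y2 \<in> CY" "Y1 \<noteq> Y2" "x \<in> \<Union>Y1" "x \<in> \<Union>Y2" 
    using x unfolding V0_iff by blast
  show ?thesis
    by (rule V0I[OF actY_CY[OF g *(1)] actY_CY[OF g *(2)]])
      (use * actY_eq_iff[OF g *(1,2)] in \<open>simp_all add: Union_actY imageI\<close>)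
qed

lemma not_V0_edge:
  assumes Y: "Y \<in> CY" and x: "x \<in> \<Union>Y" "x \<notin> V0" and e: "{x, y} \<in> E"
  shows "{x, y} \<in> Y"
proof -
  obtain Y' where Y': "Y' \<in> CY" "{x, y} \<in> Y'" using cyl_ex[OF e] .
  then have "x \<in> \<Union>Y'" by auto
  then have "Y' = Y" using V0I[OF Y'(1) Y _ _ x(1)] x(2) by auto
  then show ?thesis using Y' by simp
qed

section \<open>Branches and atoms\<close>

definition fval :: "'v set set \<Rightarrow> 'v \<Rightarrow> bool" where
  "fval Y x \<longleftrightarrow> finite {y. {x, y} \<in> Y}"

text \<open>For a vertex \<open>x\<close> of \<open>Y\<close> this is the part of \<open>T\<close>
  attached to \<open>Y\<close> at \<open>x\<close>: the component of \<open>x\<close> after deleting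
  the edges of \<open>Y\<close>. It contains \<open>x\<close> itself.\<close>

definition branch :: "'v set set \<Rightarrow> 'v \<Rightarrow> 'v set" where
  "branch Y x = {w \<in> V. sep x w \<inter> Y = {}}"

lemma branch_sub_V: "branch Y x \<subseteq> V"
  unfolding branch_def by auto

lemma branch_sub:
  assumes S: "S \<in> alg Y" and x: "x \<in> S"
  shows "branch Y x \<subseteq> S"
proof
  fix w assume w: "w \<in> branch Y x"
  show "w \<in> S"
  proof (rule ccontr)
    assume "w \<notin> S"
    then have "w \<in> V - S" using w unfolding branch_def by auto
    then obtain e where "e \<in> cobd S" "e \<in> sep x w" using crossing_edge[OF algD(2,1)[OF S] x] by metis
    then show False using w algD(3)[OF S] unfolding branch_def by auto
  qed
qed

lemma branch_disj:
  assumes "S \<in> alg Y" "x \<in> V" "x \<notin> S"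
  shows "branch Y x \<inter> S = {}"
  using branch_sub[OF alg_compl[OF assms(1)], of x] assms by auto

text \<open>An edge leaving the branch lies in \<open>Y\<close>. If \<open>a\<close> is its inner
  end, the geodesic from \<open>x\<close> to \<open>a\<close> lies in \<open>Y\<close> by convexity
  and avoids \<open>Y\<close> by definition of the branch, so \<open>a\<close> is
  \<open>x\<close>.\<close>

lemma cobd_branch:
  assumes Y: "Y \<in> CY" and x: "x \<in> \<Union>Y"
  shows "cobd (branch Y x) \<subseteq> {e \<in> Y. x \<in> e}"
proof
  fix e assume "e \<in> cobd (branch Y x)"
  then obtain a b where ab: "e = {a, b}" "{a, b} \<in> E" "a \<in> branch Y x" "b \<in> V - branch Y x"
    using cobd_endpoints by metis
  have V: "x \<in> V" "a \<in> V" "b \<in> V" using ab cyl_V[OF Y] x unfolding branch_def by auto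
  have "sep x b \<inter> Y \<noteq> {}" "sep x a \<inter> Y = {}" using ab unfolding branch_def by auto
  then have e: "e \<in> Y" using sep_sym_diff[OF V] sep_step[OF ab(2)] ab(1) by auto
  then have "a \<in> \<Union>Y" using ab by auto
  then have "sep x a \<subseteq> Y" using cyl_convex[OF Y x] by auto
  then have "x = a" using \<open>sep x a \<inter> Y = {}\<close> sep_empty_iff[OF V(1,2)] by auto
  then show "e \<in> {e \<in> Y. x \<in> e}" using e ab by auto
qed

lemma branch_alg:
  assumes Y: "Y \<in> CY" and x: "x \<in> \<Union>Y" "fval Y x"
  shows "branch Y x \<in> alg Y"
proof -
  have "{e \<in> Y. x \<in> e} \<subseteq> (\<lambda>y. {x, y}) ` {y. {x, y} \<in> Y}"
  proof
    fix e assume e: "e \<in> {e \<in> Y. x \<in> e}"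
    then obtain u v where uv: "e = {u, v}" using edgeE[OF cyl_edge[OF Y]] by blast
    then have "e = {x, u} \<or> e = {x, v}" using e by auto
    then show "e \<in> (\<lambda>y. {x, y}) ` {y. {x, y} \<in> Y}" using e by auto
  qed
  then have "finite {e \<in> Y. x \<in> e}" using x(2) finite_subset unfolding fval_def by blast
  then show ?thesis unfolding alg_def using cobd_branch[OF Y x(1)] branch_sub_V finite_subset by auto
qed

text \<open>An edge of \<open>Y\<close> inside \<open>hf x y\<close> would put \<open>{x, y}\<close>
  on a geodesic between two vertices of \<open>Y\<close>, hence into \<open>Y\<close> by
  convexity.\<close>

lemma hf_sub_branch:
  assumes Y: "Y \<in> CY" "Y' \<in> CY" "Y \<noteq> Y'" and x: "x \<in> \<Union>Y" and e: "{x, y} \<in> Y'"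
  shows "hf x y \<subseteq> branch Y x"
proof
  fix w assume w: "w \<in> hf x y"
  have xy: "{x, y} \<in> E" using cyl_edge[OF Y(2) e] .
  have n: "{x, y} \<notin> Y" using cyl_eq[OF Y(1,2) _ e] Y(3) by auto
  have "f \<notin> Y" if f: "f \<in> sep x w" for f
  proof
    assume fY: "f \<in> Y"
    then have "f \<in> sep y w" using f sep_first(1)[OF xy w] n by auto
    then have sub: "f \<subseteq> hf x y" by (rule hf_convex[OF xy hf_self[OF xy] w])
    obtain p q where pq: "f = {p, q}" using edgeE[OF cyl_edge[OF Y(1) fY]] by metis
    then have p: "p \<in> hf x y" "p \<in> \<Union>Y" using sub fY by auto
    then have "{x, y} \<in> sep x p" 
      using sep_edge[OF xy, of x p] hf_other[OF xy] edgeD[OF xy] by auto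
    then show False using cyl_convex[OF Y(1) x p(2)] n by auto
  qed
  then show "w \<in> branch Y x" unfolding branch_def using w by auto
qed

lemma branch_not_small:
  assumes Y: "Y \<in> CY" and x: "x \<in> \<Union>Y" "x \<in> V0"
  shows "\<not> small Y (branch Y x)"
proof -
  obtain Y' where Y': "Y' \<in> CY" "Y' \<noteq> Y" "x \<in> \<Union>Y'" using V0_other[OF x(2)] .
  then obtain e where e: "e \<in> Y'" "x \<in> e" by auto
  then obtain y where y: "e = {x, y}" using edgeE[OF cyl_edge[OF Y'(1) e(1)]] 
    by (metis empty_iff insert_commute insert_iff)
  then show ?thesis
    using not_small_if_hf[OF Y _ hf_sub_branch[OF Y Y'(1) Y'(2)[symmetric] x(1)], of y] e(1) 
      cyl_edge[OF Y'(1)] by auto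
qed

text \<open>If \<open>g v0 = w\<close>, then \<open>g^-1\<close> carries an edge at \<open>w\<close>
  to an edge at \<open>v0\<close>. All edges at \<open>w\<close> belong to \<open>Y\<close>, so
  there are finitely many edges at \<open>w\<close>, and therefore at \<open>v0\<close> if
  \<open>w\<close> is in its orbit; \<open>H_finite_stabI\<close> applies.\<close>

lemma vertex_small:
  assumes Y: "Y \<in> CY" and w: "w \<in> \<Union>Y" "w \<notin> V0" "fval Y w"
  shows "small Y {w}"
proof -
  have wV: "w \<in> V" using w cyl_V[OF Y] by auto
  obtain e where e: "e \<in> Y" "w \<in> e" using w by auto
  have eE: "e \<in> E" using cyl_edge[OF Y e(1)] .
  have fin: "finite {y. {w, y} \<in> E}"
    using w(3) not_V0_edge[OF Y w(1,2)] unfolding fval_def by (rule_tac finite_subset) auto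
  show ?thesis
  proof (cases "X {w} = {}")
    case True
    then show ?thesis unfolding small_def using finY_empty[OF Y] by simp
  next
    case False
    then obtain k where k: "k \<in> X {w}" by auto
    then have kc: "k \<in> carrier G" "act k v0 = w" unfolding X_def by auto
    have "(\<lambda>g. act (inv g) ` e) ` X {w} \<subseteq> (\<lambda>y. act (inv k) ` {w, y}) ` {y. {w, y} \<in> E}"
    proof
      fix f assume "f \<in> (\<lambda>g. act (inv g) ` e) ` X {w}"
      then obtain g where g: "g \<in> carrier G" "act g v0 = w" "f = act (inv g) ` e" 
        unfolding X_def by auto
      have fE: "f \<in> E" using act_edge[OF inv_closed[OF g(1)] eE] g(3) by simp
      have "act (inv g) w = v0" using g v0 by auto
      then have "v0 \<in> f" using e(2) g(3) by auto
      then have "w \<in> act k ` f" using kc by auto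
      moreover have "act k ` f \<in> E" using act_edge[OF kc(1) fE] .
      ultimately obtain y where "act k ` f = {w, y}" "{w, y} \<in> E" 
        using edgeE[of "act k ` f"] by (metis empty_iff insert_commute insert_iff)
      moreover have "f = act (inv k) ` act k ` f" 
        using act_image_inv(1)[OF kc(1) edge_sub_V[OF fE]] by simp
      ultimately show "f \<in> (\<lambda>y. act (inv k) ` {w, y}) ` {y. {w, y} \<in> E}" by auto
    qed
    then have "finite ((\<lambda>g. act (inv g) ` e) ` X {w})" using fin finite_subset by blast
    then have "H_finite G (stab e) (X {w})" using H_finite_stabI[OF X_sub _ eE] by blast
    then show ?thesis unfolding small_def using finY_iff[OF Y e(1)] by simp
  qed
qed

lemma finite_small:
  assumes Y: "Y \<in> CY" and "finite S" "\<And>w. w \<in> S \<Longrightarrow> small Y {w}"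
  shows "small Y S"
  using assms(2,3)
proof (induction S rule: finite_induct)
  case empty
  then show ?case using small_empty[OF Y] by simp
next
  case (insert w S)
  then show ?case using small_Un[OF Y, of "{w}" S] by simp
qed

definition atom :: "'v set set \<Rightarrow> 'v set \<Rightarrow> bool" where
  "atom Y S \<longleftrightarrow> S \<in> alg Y \<and> \<not> small Y S \<and> (\<forall>P\<in>alg Y. small Y (S \<inter> P) \<or> small Y (S - P))"

text \<open>Since every cylinder has non-trivial half-trees, the algebra modulo small sets has at
  least four elements; \<open>ge3\<close> says that it has more.\<close>

definition ge3 :: "'v set set \<Rightarrow> bool" where
  "ge3 Y \<longleftrightarrow> (\<exists>P\<in>alg Y. \<exists>Q\<in>alg Y. \<exists>R\<in>alg Y. \<not> small Y P \<and> \<not> small Y Q \<and> \<not> small Y R \<and>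
     P \<inter> Q = {} \<and> P \<inter> R = {} \<and> Q \<inter> R = {})"

lemma infinite_pick: "infinite A \<Longrightarrow> finite F \<Longrightarrow> \<exists>a\<in>A. a \<notin> F"
  by (metis finite_subset subsetI)

text \<open>The coboundary of \<open>S\<close> has finitely many end points, each in at most one
  branch at \<open>x\<close>. All but finitely many branches at \<open>x\<close> avoid them, and
  such a branch lies entirely in \<open>S\<close>.\<close>

lemma infinite_branches:
  assumes Y: "Y \<in> CY" and S: "S \<in> alg Y" and x: "x \<in> S" "\<not> fval Y x"
  shows "infinite {y. {x, y} \<in> Y \<and> hf x y \<subseteq> S}"
proof -
  let ?F = "\<Union>(cobd S)"
  let ?bad = "{y. {x, y} \<in> Y \<and> hf x y \<inter> ?F \<noteq> {}}"
  have F: "finite ?F"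
  proof (rule finite_Union[OF algD(2)[OF S]])
    fix e assume "e \<in> cobd S"
    then show "finite e" using cobd_endpoints[of e S] by auto
  qed
  have "finite {y. {x, y} \<in> Y \<and> z \<in> hf x y}" for z
  proof (cases "{y. {x, y} \<in> Y \<and> z \<in> hf x y} = {}")
    case False
    then obtain y where y: "{x, y} \<in> Y" "z \<in> hf x y" by auto
    have "{y. {x, y} \<in> Y \<and> z \<in> hf x y} \<subseteq> {y}"
    proof
      fix y' assume "y' \<in> {y. {x, y} \<in> Y \<and> z \<in> hf x y}"
      then show "y' \<in> {y}" using y hf_branches[of x y y'] cyl_edge[OF Y] by auto
    qed
    then show ?thesis using finite_subset by blast
  next
    case True
    show ?thesis unfolding True by simp
  qed
  then have "finite (\<Union>z\<in>?F. {y. {x, y} \<in> Y \<and> z \<in> hf x y})" using F by blast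
  moreover have "?bad \<subseteq> (\<Union>z\<in>?F. {y. {x, y} \<in> Y \<and> z \<in> hf x y})" by auto
  ultimately have "finite ?bad" by (rule finite_subset[rotated])
  then have "infinite ({y. {x, y} \<in> Y} - ?bad)" using x(2) unfolding fval_def by auto
  moreover have "{y. {x, y} \<in> Y} - ?bad \<subseteq> {y. {x, y} \<in> Y \<and> hf x y \<subseteq> S}"
  proof
    fix y assume "y \<in> {y. {x, y} \<in> Y} - ?bad"
    then have y: "{x, y} \<in> Y" "hf x y \<inter> ?F = {}" by auto
    have xy: "{x, y} \<in> E" using cyl_edge[OF Y y(1)] .
    have "y \<in> S"
    proof (rule ccontr)
      assume "y \<notin> S"
      then have "{x, y} \<in> cobd S" using cobd_edge[OF xy] x by simp
      then show False using y(2) hf_self[OF xy] by auto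
    qed
    moreover have "\<forall>e\<in>cobd S. \<not> e \<subseteq> hf x y"
    proof
      fix e assume e: "e \<in> cobd S"
      then have "e \<noteq> {}" using cobd_endpoints[OF e] by auto
      then show "\<not> e \<subseteq> hf x y" using e y(2) by auto
    qed
    ultimately have "hf x y \<subseteq> S" using hf_subset[OF xy algD(1)[OF S]] by simp
    then show "y \<in> {y. {x, y} \<in> Y \<and> hf x y \<subseteq> S}" using y by simp
  qed
  ultimately show ?thesis using infinite_super by blast
qed

text \<open>The vertices of \<open>S\<close> are small one by one, so \<open>S\<close> is infinite.
  A vertex of \<open>S\<close> off the finite hull of the coboundary sees the whole coboundary in
  one direction; any other direction gives a half-tree inside \<open>S\<close>.\<close>

lemma contains_hf:
  assumes Y: "Y \<in> CY" and S: "S \<in> alg Y" "\<not> small Y S" "cobd S \<noteq> {}"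
    and x: "\<And>x. x \<in> S \<Longrightarrow> x \<in> \<Union>Y \<Longrightarrow> x \<notin> V0 \<and> fval Y x"
  shows "S \<subseteq> \<Union>Y \<and> (\<exists>w y. {w, y} \<in> Y \<and> hf w y \<subseteq> S)"
proof
  have SV: "S \<subseteq> V" using algD(1)[OF S(1)] .
  \<comment> \<open>Outside \<open>Y\<close> there is nothing of \<open>S\<close>: an edge from
    there into the rest of \<open>S\<close> would start at a vertex of \<open>Y\<close> outside
    \<open>V0\<close>, and all edges at such a vertex belong to \<open>Y\<close>.\<close>
  have "cobd (S - \<Union>Y) = {}"
  proof (rule ccontr)
    assume "cobd (S - \<Union>Y) \<noteq> {}"
    then obtain e where "e \<in> cobd (S - \<Union>Y)" by auto
    then obtain a b where ab: "e = {a, b}" "{a, b} \<in> E" "a \<in> S - \<Union>Y" "b \<in> V - (S - \<Union>Y)"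
      using cobd_endpoints by metis
    have "{a, b} \<in> Y"
    proof (cases "b \<in> S")
      case True
      then have "{b, a} \<in> Y" using not_V0_edge[OF Y _ _ edge_commute[OF ab(2)]] x[of b] ab by auto
      then show ?thesis by (simp add: insert_commute)
    next
      case False
      then have "{a, b} \<in> cobd S" using cobd_edge[OF ab(2)] ab by auto
      then show ?thesis using algD(3)[OF S(1)] by auto
    qed
    then show False using ab by auto
  qed
  moreover obtain e where e: "e \<in> Y" using cyl_nonempty[OF Y] .
  then obtain u where "u \<in> \<Union>Y" using edgeE[OF cyl_edge[OF Y e]] by (metis UnionI insertI1)
  then have "S - \<Union>Y \<noteq> V" using cyl_V[OF Y] by auto
  ultimately show SY: "S \<subseteq> \<Union>Y" using cobd_empty_iff[of "S - \<Union>Y"] SV by auto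
  have sm: "small Y {w}" if "w \<in> S" for w using vertex_small[OF Y, of w] x[OF that] SY that by auto
  then have inf: "infinite S" using finite_small[OF Y] S(2) by blast
  let ?F = "\<Union>(cobd S)"
  have F: "finite ?F"
  proof (rule finite_Union[OF algD(2)[OF S(1)]])
    fix e assume "e \<in> cobd S"
    then show "finite e" using cobd_endpoints[of e S] by auto
  qed
  have FV: "?F \<subseteq> V" using cobd_sub[of S] edge_sub_V by blast
  \<comment> \<open>The edges of the hull spanned by the end points of the coboundary.\<close>
  let ?Z = "\<Union>a\<in>?F. \<Union>b\<in>?F. sep a b"
  have "finite ?Z" by (intro finite_UN_I F finite_sep subsetD[OF FV])
  moreover have "finite e" if "e \<in> ?Z" for e
    using that sep_sub edgeE by (metis (no_types, lifting) UN_E finite.emptyI finite_insert subsetD)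
  ultimately have "finite (\<Union>?Z)" by (rule finite_Union)
  then have "finite (\<Union>?Z \<union> ?F)" using F by (rule finite_UnI)
  then obtain w where w: "w \<in> S" "w \<notin> \<Union>?Z" "w \<notin> ?F" using inf finite_subset by (metis UnI1 UnI2 subsetI)
  obtain f where f: "f \<in> ?F" using S(3) cobd_endpoints by (metis UnionI all_not_in_conv insertI1)
  have wV: "w \<in> V" using w SV by auto
  have "w \<noteq> f" using w f by auto
  then obtain y where y: "{w, y} \<in> E" "f \<in> hf w y" using first_edge[OF wV] f FV by (metis subsetD)
  have Fy: "?F \<subseteq> hf w y"
  proof
    fix b assume b: "b \<in> ?F"
    have "{w, y} \<notin> sep f b"
    proof
      assume "{w, y} \<in> sep f b"
      then have "{w, y} \<in> ?Z" by (rule UN_I[OF f UN_I[OF b]])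
      then have "w \<in> \<Union>?Z" by (rule UnionI) simp
      then show False using w(2) by contradiction
    qed
    then show "b \<in> hf w y" using sep_edge[OF y(1), of f b] y(2) b f FV by auto
  qed
  obtain z where z: "z \<noteq> y" "{w, z} \<in> E" using no_leaf[OF edge_commute[OF y(1)]] .
  have d: "hf w z \<inter> ?F = {}" using hf_branches[OF z(2) y(1) z(1)] Fy by auto
  have "z \<in> S"
  proof (rule ccontr)
    assume "z \<notin> S"
    then have "{w, z} \<in> cobd S" using cobd_edge[OF z(2)] w by simp
    then show False using w by auto
  qed
  moreover have "\<forall>e\<in>cobd S. \<not> e \<subseteq> hf w z"
  proof
    fix e assume e: "e \<in> cobd S"
    then have "e \<noteq> {}" using cobd_endpoints[OF e] by auto
    then show "\<not> e \<subseteq> hf w z" using e d by auto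
  qed
  ultimately have "hf w z \<subseteq> S" using hf_subset[OF z(2) SV] by simp
  moreover have "{w, z} \<in> Y" using not_V0_edge[OF Y _ _ z(2)] x[OF w(1)] SY w(1) by auto
  ultimately show "\<exists>w y. {w, y} \<in> Y \<and> hf w y \<subseteq> S" by auto
qed

text \<open>An atom all of whose vertices have finite valence in \<open>Y\<close> and lie in no other cylinder
  contains a half-tree without branch vertex; as the orbit of any vertex meets that half-tree,
  \<open>T\<close> is then a line.\<close>

lemma no_line_atom:
  assumes Y: "Y \<in> CY" and ge3: "ge3 Y" and S: "atom Y S" "cobd S \<noteq> {}"
    and x: "\<And>x. x \<in> S \<Longrightarrow> x \<in> \<Union>Y \<Longrightarrow> x \<notin> V0 \<and> fval Y x"
  shows False
proof -
  have S': "S \<in> alg Y" "\<not> small Y S" "\<And>P. P \<in> alg Y \<Longrightarrow> small Y (S \<inter> P) \<or> small Y (S - P)"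
    using S(1) unfolding atom_def by auto
  obtain w y where SY: "S \<subseteq> \<Union>Y" and wy: "{w, y} \<in> Y" "hf w y \<subseteq> S"
    using contains_hf[OF Y S'(1,2) S(2) x] by auto
  have wyE: "{w, y} \<in> E" using cyl_edge[OF Y wy(1)] .
  \<comment> \<open>Two branches at \<open>b\<close> leading away from \<open>w\<close> would be
    disjoint half-trees inside the atom, and the half-tree of one of them would split it.\<close>
  have br1: "c1 = c2" if b: "b \<in> hf w y" and c: "{b, c1} \<in> E" "{b, c2} \<in> E" "w \<notin> hf b c1" "w \<notin> hf b c2" 
    for b c1 c2
  proof (rule ccontr)
    assume ne: "c1 \<noteq> c2"
    have "hf b c1 \<subseteq> S" "hf b c2 \<subseteq> S"
      using hf_nested[OF wyE c(1) b c(3)] hf_nested[OF wyE c(2) b c(4)] wy(2) by auto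
    then have sub: "hf b c1 \<subseteq> S \<inter> hf b c1" "hf b c2 \<subseteq> S - hf b c1" 
      using hf_branches[OF c(1,2) ne] by auto
    have "b \<in> S" using b wy(2) by auto
    then have "{b, c1} \<in> Y" using not_V0_edge[OF Y _ _ c(1)] x[of b] SY by auto
    then show False using S'(3)[OF alg_hf[OF Y]] not_small_if_hf[OF Y c(1) sub(1)]
      not_small_if_hf[OF Y c(2) sub(2)] by auto
  qed
  have br2: "c1 = c2 \<or> c2 = c3 \<or> c1 = c3" 
    if b: "b \<in> hf w y" and c: "{b, c1} \<in> E" "{b, c2} \<in> E" "{b, c3} \<in> E" for b c1 c2 c3
    using br1[OF b c(1,2)] br1[OF b c(2,3)] br1[OF b c(1,3)] hf_branches[OF c(1,2)] 
      hf_branches[OF c(2,3)] hf_branches[OF c(1,3)] by blast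
  \<comment> \<open>Any vertex can be translated into \<open>hf w y\<close>, so the bound on the
    valence holds everywhere; the same translation shows that \<open>V0\<close> is empty.\<close>
  have nb: "c1 = c2 \<or> c2 = c3 \<or> c1 = c3" 
    if c: "{b, c1} \<in> E" "{b, c2} \<in> E" "{b, c3} \<in> E" for b c1 c2 c3
  proof -
    have V: "b \<in> V" "c1 \<in> V" "c2 \<in> V" "c3 \<in> V" using edgeD c by auto
    obtain g where g: "g \<in> carrier G" "act g b \<in> hf w y" using orbit_meets_hf[OF wyE V(1)] by auto
    have "act g c1 = act g c2 \<or> act g c2 = act g c3 \<or> act g c1 = act g c3"
      using br2[OF g(2) act_edge2[OF g(1) c(1)] act_edge2[OF g(1) c(2)] act_edge2[OF g(1) c(3)]] .
    then show ?thesis using g(1) V by simp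
  qed
  have noV0: "z \<notin> V0" for z
  proof
    assume z: "z \<in> V0"
    obtain g where g: "g \<in> carrier G" "act g z \<in> hf w y" using orbit_meets_hf[OF wyE V0_sub[OF z]] by auto
    then have "act g z \<in> S" using wy(2) by auto
    then show False using x[of "act g z"] SY V0_act[OF g(1) z] by auto
  qed
  have fv: "fval Y z" for z
  proof -
    have "finite {c. {z, c} \<in> E}"
    proof (cases "\<exists>c1 c2. {z, c1} \<in> E \<and> {z, c2} \<in> E \<and> c1 \<noteq> c2")
      case True
      then obtain c1 c2 where "{z, c1} \<in> E" "{z, c2} \<in> E" "c1 \<noteq> c2" by auto
      then have "{c. {z, c} \<in> E} \<subseteq> {c1, c2}" using nb[of z c1 c2] by auto
      then show ?thesis using finite_subset by blast
    next
      case False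
      show ?thesis
      proof (cases "{c. {z, c} \<in> E} = {}")
        case ne: False
        then obtain c where "{z, c} \<in> E" by auto
        then have "{c. {z, c} \<in> E} \<subseteq> {c}" using False by auto
        then show ?thesis using finite_subset by blast
      qed simp
    qed
    then show ?thesis unfolding fval_def by (rule rev_finite_subset) (use cyl_edge[OF Y] in auto)
  qed
  \<comment> \<open>Now \<open>contains_hf\<close> applies to every non-small set of the algebra
    with non-small complement. The three disjoint sets from \<open>ge3\<close> yield three disjoint
    half-trees, impossible with all valences at most two.\<close>
  have hfin: "\<exists>a b. {a, b} \<in> E \<and> hf a b \<subseteq> P" 
    if P: "P \<in> alg Y" "\<not> small Y P" and Q: "\<not> small Y Q" "Q \<in> alg Y" "P \<inter> Q = {}" for P Q
  proof -
    have "P \<noteq> {}" "Q \<noteq> {}" using P Q small_empty[OF Y] by auto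
    then have "cobd P \<noteq> {}" using cobd_empty_iff[OF algD(1)[OF P(1)]] Q(3) algD(1)[OF Q(2)] by auto
    then show ?thesis using contains_hf[OF Y P] noV0 fv cyl_edge[OF Y] by blast
  qed
  obtain P Q R where PQR: "P \<in> alg Y" "Q \<in> alg Y" "R \<in> alg Y" "\<not> small Y P" "\<not> small Y Q" "\<not> small Y R"
    "P \<inter> Q = {}" "P \<inter> R = {}" "Q \<inter> R = {}" using ge3 unfolding ge3_def by blast
  obtain a0 a1 where a: "{a0, a1} \<in> E" "hf a0 a1 \<subseteq> P" using hfin[OF PQR(1,4,5,2,7)] by auto
  obtain b0 b1 where b: "{b0, b1} \<in> E" "hf b0 b1 \<subseteq> Q" using hfin[OF PQR(2,5,6,3,9)] by auto
  have "R \<inter> P = {}" using PQR(8) by auto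
  then obtain c0 c1 where c: "{c0, c1} \<in> E" "hf c0 c1 \<subseteq> R" using hfin[OF PQR(3,6,4,1)] by auto
  show False
    by (rule no_three_disjoint_hf[OF _ b(1) c(1) _ a(1)])
      (use nb a(2) b(2) c(2) PQR(7-9) in \<open>blast+\<close>)
qed

text \<open>By \<open>no_line_atom\<close> some vertex of \<open>Y\<close> in \<open>S\<close> lies
  in \<open>V0\<close> or has infinite valence in \<open>Y\<close>. Infinite valence would give two
  disjoint half-trees inside \<open>S\<close>, splitting the atom. The branch at the remaining kind
  of vertex is a non-small part of \<open>S\<close>, hence all of \<open>S\<close> up to a small
  set.\<close>

lemma atom_branch:
  assumes Y: "Y \<in> CY" and ge3: "ge3 Y" and S: "atom Y S"
  obtains x where "x \<in> V0" "x \<in> \<Union>Y" "fval Y x" "small Y (sym_diff S (branch Y x))"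
proof -
  have S': "S \<in> alg Y" "\<not> small Y S" "\<And>P. P \<in> alg Y \<Longrightarrow> small Y (S \<inter> P) \<or> small Y (S - P)"
    using S unfolding atom_def by auto
  have c: "cobd S \<noteq> {}"
  proof
    assume "cobd S = {}"
    then have "S = V" using cobd_empty_iff[OF algD(1)[OF S'(1)]] S'(2) small_empty[OF Y] by auto
    obtain P Q where PQ: "P \<in> alg Y" "Q \<in> alg Y" "\<not> small Y P" "\<not> small Y Q" "P \<inter> Q = {}" 
      using ge3 unfolding ge3_def by blast
    then have "Q \<subseteq> S - P" "S \<inter> P = P" using algD(1)[OF PQ(1)] algD(1)[OF PQ(2)] \<open>S = V\<close> by auto
    then show False using S'(3)[OF PQ(1)] PQ(3,4) small_mono by metis
  qed
  have "\<exists>x. x \<in> S \<and> x \<in> \<Union>Y \<and> \<not> (x \<notin> V0 \<and> fval Y x)" using no_line_atom[OF Y ge3 S c] by blast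
  then obtain x where x: "x \<in> S" "x \<in> \<Union>Y" "x \<in> V0 \<or> \<not> fval Y x" by auto
  have fv: "fval Y x"
  proof (rule ccontr)
    assume "\<not> fval Y x"
    then have inf: "infinite {y. {x, y} \<in> Y \<and> hf x y \<subseteq> S}" using infinite_branches[OF Y S'(1) x(1)] by simp
    obtain y1 where y1: "{x, y1} \<in> Y" "hf x y1 \<subseteq> S" using infinite_pick[OF inf, of "{}"] by auto
    obtain y2 where y2: "{x, y2} \<in> Y" "hf x y2 \<subseteq> S" "y2 \<noteq> y1" 
      using infinite_pick[OF inf, of "{y1}"] by auto
    note e = cyl_edge[OF Y y1(1)] cyl_edge[OF Y y2(1)]
    have "hf x y1 \<subseteq> S \<inter> hf x y1" "hf x y2 \<subseteq> S - hf x y1" 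
      using y1 y2 hf_branches[OF e y2(3)[symmetric]] by auto
    then show False using S'(3)[OF alg_hf[OF Y y1(1)]] not_small_if_hf[OF Y e(1)] 
        not_small_if_hf[OF Y e(2)] by metis
  qed
  then have x0: "x \<in> V0" using x by simp
  have sub: "branch Y x \<subseteq> S" by (rule branch_sub[OF S'(1) x(1)])
  then have "S \<inter> branch Y x = branch Y x" by auto
  then have "small Y (S - branch Y x)" 
    using S'(3)[OF branch_alg[OF Y x(2) fv]] branch_not_small[OF Y x(2) x0] by auto
  moreover have "sym_diff S (branch Y x) = S - branch Y x" using sub by auto
  ultimately show ?thesis using that x x0 fv by metis
qed

text \<open>A set of the algebra contains the branch or misses it, according to whether it contains
  \<open>x\<close>.\<close>

lemma branch_atom:
  assumes Y: "Y \<in> CY" and x: "x \<in> V0" "x \<in> \<Union>Y" "fval Y x"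
  shows "atom Y (branch Y x)"
  unfolding atom_def
proof (intro conjI ballI)
  fix P assume P: "P \<in> alg Y"
  show "small Y (branch Y x \<inter> P) \<or> small Y (branch Y x - P)"
  proof (cases "x \<in> P")
    case True
    then have "branch Y x - P = {}" using branch_sub[OF P] by auto
    then show ?thesis using small_empty[OF Y] by metis
  next
    case False
    then have "branch Y x \<inter> P = {}" using branch_disj[OF P V0_sub[OF x(1)]] by simp
    then show ?thesis using small_empty[OF Y] by simp
  qed
qed (use branch_alg[OF Y x(2,3)] branch_not_small[OF Y x(2,1)] in auto)

end

section \<open>Cross-connected components\<close>

context tree_action
begin

lemma small_cover: 
  assumes "Y \<in> CY" "small Y A" "small Y B" "C \<subseteq> A \<union> B"
  shows "small Y C"
  using small_mono[of Y "A \<union> B" C] small_Un[OF assms(1)] assms by simp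

lemma small_cover3: 
  assumes "Y \<in> CY" "small Y A" "small Y B" "small Y C" "D \<subseteq> A \<union> B \<union> C"
  shows "small Y D"
  using small_mono[of Y "A \<union> B \<union> C" D] small_Un[OF assms(1)] assms by simp

abbreviation eqv :: "'v set set \<Rightarrow> 'v set \<Rightarrow> 'v set \<Rightarrow> bool" where
  "eqv Y S S' \<equiv> small Y (sym_diff S S')"

lemma eqv_compl: "S \<subseteq> V \<Longrightarrow> S' \<subseteq> V \<Longrightarrow> eqv Y (V - S) (V - S') \<longleftrightarrow> eqv Y S S'"
  using sym_diff_compl[of S V S'] by simp

lemma eqv_sym: "eqv Y S S' \<Longrightarrow> eqv Y S' S"
  by (simp add: Un_commute)

lemma eqv_trans: 
  assumes "Y \<in> CY" "eqv Y A B" "eqv Y B C" 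
  shows "eqv Y A C"
  by (rule small_cover[OF assms]) blast

lemma eqv_self: "Y \<in> CY \<Longrightarrow> eqv Y A A"
  using small_empty by simp

lemma small_eqv: 
  assumes "Y \<in> CY" "eqv Y A B" 
  shows "small Y A \<longleftrightarrow> small Y B"
proof
  assume "small Y A" then show "small Y B" by (rule small_cover[OF assms(1) _ assms(2)]) blast
next
  assume "small Y B" then show "small Y A" by (rule small_cover[OF assms(1) _ assms(2)]) blast
qed

lemma nontriv_eqv: 
  assumes "Y \<in> CY" "eqv Y A B" "A \<subseteq> V" "B \<subseteq> V" 
  shows "nontriv Y A \<longleftrightarrow> nontriv Y B"
  unfolding nontriv_def 
  using small_eqv[OF assms(1,2)] small_eqv[OF assms(1), of "V - A" "V - B"] eqv_compl[OF assms(3,4)] assms(2)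
  by simp

lemma atom_eqv: 
  assumes Y: "Y \<in> CY" and e: "eqv Y A B" and A: "atom Y A" and B: "B \<in> alg Y"
  shows "atom Y B"
  unfolding atom_def
proof (intro conjI ballI B)
  show "\<not> small Y B" using small_eqv[OF Y e] A unfolding atom_def by simp
  fix P assume "P \<in> alg Y"
  then consider "small Y (A \<inter> P)" | "small Y (A - P)" using A unfolding atom_def by auto
  then show "small Y (B \<inter> P) \<or> small Y (B - P)"
  proof cases
    case 1
    then have "small Y (B \<inter> P)" by (rule small_cover[OF Y _ e]) blast
    then show ?thesis by simp
  next
    case 2
    then have "small Y (B - P)" by (rule small_cover[OF Y _ e]) blast
    then show ?thesis by simp
  qed
qed

text \<open>Otherwise the whole branch at \<open>x\<close> would lie in the difference, and it is
  not small. So classes have a well-defined trace on the vertices of \<open>V0\<close> in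
  \<open>Y\<close>.\<close>

lemma eqv_mem: 
  assumes Y: "Y \<in> CY" and e: "eqv Y A B" and A: "A \<in> alg Y" and B: "B \<in> alg Y" 
    and x: "x \<in> V0" "x \<in> \<Union>Y"
  shows "x \<in> A \<longleftrightarrow> x \<in> B"
proof -
  have *: "x \<in> B" if "eqv Y A B" "A \<in> alg Y" "B \<in> alg Y" "x \<in> A" for A B
  proof (rule ccontr)
    assume "x \<notin> B"
    then have "branch Y x \<subseteq> sym_diff A B" 
      using branch_disj[OF that(3) V0_sub[OF x(1)]] branch_sub[OF that(2,4)] by blast
    then show False using branch_not_small[OF Y x(2,1)] small_mono[OF that(1)] by blast
  qed
  show ?thesis using *[OF e A B] *[OF eqv_sym[OF e] B A] by blast
qed

lemma branch_mem:
  assumes Y: "Y \<in> CY" and x: "x \<in> \<Union>Y" "x' \<in> \<Union>Y" 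
  shows "x' \<in> branch Y x \<longleftrightarrow> x' = x"
proof -
  have V: "x \<in> V" "x' \<in> V" using x cyl_V[OF Y] by auto
  have "sep x x' \<subseteq> Y" using cyl_convex[OF Y x] by auto
  then show ?thesis using sep_empty_iff[OF V] V unfolding branch_def by auto
qed

text \<open>A pigeonhole argument: of the three disjoint non-small sets, each would meet
  \<open>A\<close> or \<open>B\<close> in a non-small set, but an atom can do this with only one of
  them. The case \<open>A = B\<close> gives \<open>atom_nontriv\<close>.\<close>

lemma two_atoms:
  assumes Y: "Y \<in> CY" and ge3: "ge3 Y" and A: "atom Y A" and B: "atom Y B"
  shows "\<not> small Y (V - (A \<union> B))"
proof
  assume s: "small Y (V - (A \<union> B))"
  obtain P Q R where PQR: "P \<in> alg Y" "Q \<in> alg Y" "R \<in> alg Y" "\<not> small Y P" "\<not> small Y Q" "\<not> small Y R"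
    "P \<inter> Q = {}" "P \<inter> R = {}" "Q \<inter> R = {}" using ge3 unfolding ge3_def by blast
  have *: "\<not> small Y (A \<inter> P) \<or> \<not> small Y (B \<inter> P)" if P: "P \<in> alg Y" "\<not> small Y P" for P
  proof (rule ccontr)
    assume "\<not> ?thesis"
    then have "small Y P" using small_cover3[OF Y s, of "A \<inter> P" "B \<inter> P" P] algD(1)[OF P(1)] by blast
    then show False using P by simp
  qed
  have **: "small Y (C \<inter> P) \<or> small Y (C \<inter> Q)" if "atom Y C" "P \<in> alg Y" "P \<inter> Q = {}" for C P Q
  proof -
    have "small Y (C \<inter> P) \<or> small Y (C - P)" using that unfolding atom_def by auto
    moreover have "C \<inter> Q \<subseteq> C - P" using that by auto
    ultimately show ?thesis using small_mono by blast
  qed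
  show False
    using *[OF PQR(1,4)] *[OF PQR(2,5)] *[OF PQR(3,6)] **[OF A PQR(1,7)] **[OF A PQR(1,8)] 
      **[OF A PQR(2,9)] **[OF B PQR(1,7)] **[OF B PQR(1,8)] **[OF B PQR(2,9)] by blast
qed

lemma atom_nontriv:
  assumes "Y \<in> CY" "ge3 Y" "atom Y A"
  shows "nontriv Y A"
  using two_atoms[OF assms(1,2,3,3)] assms(3) unfolding nontriv_def atom_def by simp

text \<open>The cross-connected components are indexed by pairs \<open>(o, Y)\<close>: the component of \<open>(Some x, Y)\<close> 
  consists of the branch at \<open>x\<close>, when it is an atom of the algebra of \<open>Y\<close>, and that of \<open>(None, Y)\<close> of 
  everything else in the algebra. If the algebra has only four elements, \<open>(None, Y)\<close> is the only index.\<close>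

definition reps :: "'v option \<times> 'v set set \<Rightarrow> 'v set set" where
  "reps \<alpha> = (let Y = snd \<alpha> in case fst \<alpha> of 
      None \<Rightarrow> {S \<in> alg Y. nontriv Y S \<and> (ge3 Y \<longrightarrow> \<not> atom Y S \<and> \<not> atom Y (V - S))}
    | Some x \<Rightarrow> {S \<in> alg Y. ge3 Y \<and> x \<in> V0 \<and> x \<in> \<Union>Y \<and> fval Y x \<and> 
                  (eqv Y S (branch Y x) \<or> eqv Y (V - S) (branch Y x))})"

definition I :: "('v option \<times> 'v set set) set" where
  "I = {\<alpha>. snd \<alpha> \<in> CY \<and> reps \<alpha> \<noteq> {}}"

lemma reps_None: "S \<in> reps (None, Y) \<longleftrightarrow> 
   S \<in> alg Y \<and> nontriv Y S \<and> (ge3 Y \<longrightarrow> \<not> atom Y S \<and> \<not> atom Y (V - S))"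
  unfolding reps_def by simp

lemma reps_Some: "S \<in> reps (Some x, Y) \<longleftrightarrow> S \<in> alg Y \<and> ge3 Y \<and> x \<in> V0 \<and> x \<in> \<Union>Y \<and> fval Y x \<and> 
                  (eqv Y S (branch Y x) \<or> eqv Y (V - S) (branch Y x))"
  unfolding reps_def by simp

lemma I_cyl: "\<alpha> \<in> I \<Longrightarrow> snd \<alpha> \<in> CY"
  unfolding I_def by simp

lemma I_Some: "(Some x, Y) \<in> I \<longleftrightarrow> Y \<in> CY \<and> ge3 Y \<and> x \<in> V0 \<and> x \<in> \<Union>Y \<and> fval Y x"
proof
  assume "Y \<in> CY \<and> ge3 Y \<and> x \<in> V0 \<and> x \<in> \<Union>Y \<and> fval Y x"
  then have "branch Y x \<in> reps (Some x, Y)" using branch_alg[of Y x] eqv_self[of Y] by (simp add: reps_Some)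
  then show "(Some x, Y) \<in> I" 
    unfolding I_def using \<open>Y \<in> CY \<and> _\<close> by auto
next
  assume "(Some x, Y) \<in> I"
  then obtain S where "S \<in> reps (Some x, Y)" "Y \<in> CY" unfolding I_def by auto
  then show "Y \<in> CY \<and> ge3 Y \<and> x \<in> V0 \<and> x \<in> \<Union>Y \<and> fval Y x" by (simp add: reps_Some)
qed

lemma reps_alg: "S \<in> reps \<alpha> \<Longrightarrow> S \<in> alg (snd \<alpha>)"
  unfolding reps_def by (auto simp: Let_def split: option.splits)

lemma reps_V: "S \<in> reps \<alpha> \<Longrightarrow> S \<subseteq> V"
  using reps_alg algD(1) by blast

lemma reps_nontriv: 
  assumes "\<alpha> \<in> I" "S \<in> reps \<alpha>"
  shows "nontriv (snd \<alpha>) S"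
proof (cases "fst \<alpha>")
  case None
  then show ?thesis using assms(2) by (cases \<alpha>) (simp add: reps_None)
next
  case (Some x)
  then obtain Y where a: "\<alpha> = (Some x, Y)" by (cases \<alpha>) auto
  then have Y: "Y \<in> CY" "ge3 Y" "x \<in> V0" "x \<in> \<Union>Y" "fval Y x" using assms(1) I_Some by auto
  have n: "nontriv Y (branch Y x)" by (rule atom_nontriv[OF Y(1,2) branch_atom[OF Y(1,3,4,5)]])
  have S: "S \<subseteq> V" "eqv Y S (branch Y x) \<or> eqv Y (V - S) (branch Y x)" 
    using assms(2) reps_V[OF assms(2)] unfolding a reps_Some by auto
  then show ?thesis 
    using n nontriv_eqv[OF Y(1) _ S(1) branch_sub_V] nontriv_eqv[OF Y(1) _ _ branch_sub_V, of "V - S"] 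
      nontriv_compl[OF S(1)] a by auto
qed

lemma reps_compl: 
  assumes "S \<in> reps \<alpha>"
  shows "V - S \<in> reps \<alpha>"
proof -
  have S: "S \<subseteq> V" "V - (V - S) = S" "V - S \<in> alg (snd \<alpha>)" 
    using reps_V[OF assms] alg_compl[OF reps_alg[OF assms]] by auto
  show ?thesis
  proof (cases \<alpha>)
    case (Pair ox Y)
    then show ?thesis
      using assms S nontriv_compl[OF S(1)] by (cases ox) (auto simp: reps_None reps_Some)
  qed
qed

lemma reps_eqv:
  assumes "\<alpha> \<in> I" "S \<in> reps \<alpha>" "S' \<in> alg (snd \<alpha>)" "eqv (snd \<alpha>) S S'"
  shows "S' \<in> reps \<alpha>"
proof -
  obtain ox Y where a: "\<alpha> = (ox, Y)" by (cases \<alpha>)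
  have Y: "Y \<in> CY" using I_cyl[OF assms(1)] a by simp
  have S: "S \<subseteq> V" "S' \<subseteq> V" "S \<in> alg Y" "S' \<in> alg Y" "eqv Y S S'" "V - S \<in> alg Y" 
    using reps_V[OF assms(2)] algD(1)[OF assms(3)] reps_alg[OF assms(2)] alg_compl assms(3,4) a by auto
  have ec: "eqv Y (V - S) (V - S')" using eqv_compl[OF S(1,2)] S(5) by simp
  show ?thesis
  proof (cases ox)
    case None
    have "nontriv Y S'" using nontriv_eqv[OF Y S(5,1,2)] assms(2) a None by (simp add: reps_None)
    moreover have "\<not> atom Y S'" if "\<not> atom Y S" using that atom_eqv[OF Y eqv_sym[OF S(5)] _ S(3)] by auto
    moreover have "\<not> atom Y (V - S')" if "\<not> atom Y (V - S)" 
      using that atom_eqv[OF Y eqv_sym[OF ec] _ S(6)] by auto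
    ultimately show ?thesis using assms(2) S(4) a None by (simp add: reps_None)
  next
    case (Some x)
    have "eqv Y S' (branch Y x)" if "eqv Y S (branch Y x)" using eqv_trans[OF Y eqv_sym[OF S(5)] that] .
    moreover have "eqv Y (V - S') (branch Y x)" if "eqv Y (V - S) (branch Y x)" 
      using eqv_trans[OF Y eqv_sym[OF ec] that] .
    ultimately show ?thesis using assms(2) S(4) a Some by (auto simp: reps_Some)
  qed
qed

text \<open>The component \<open>\<beta>\<close> lies on the side \<open>S\<close> of
  \<open>\<alpha>\<close>. Inside one cylinder an atom is located by its vertex, and the component
  without vertex lies opposite to the branch at the vertex of \<open>\<alpha>\<close>. The value
  \<open>undefined\<close> arises only for two equal indices, where the question has no
  meaning.\<close>

definition side :: "'v option \<times> 'v set set \<Rightarrow> 'v set \<Rightarrow> 'v option \<times> 'v set set \<Rightarrow> bool" where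
  "side \<alpha> S \<beta> \<longleftrightarrow> (if snd \<beta> \<noteq> snd \<alpha> then \<Union>(snd \<beta>) \<subseteq> S
     else case fst \<beta> of Some x \<Rightarrow> x \<in> S 
       | None \<Rightarrow> (case fst \<alpha> of Some x \<Rightarrow> x \<notin> S | None \<Rightarrow> undefined))"

lemma cyl_point: 
  assumes "Y \<in> CY" 
  obtains x where "x \<in> \<Union>Y"
proof -
  obtain e where e: "e \<in> Y" using cyl_nonempty[OF assms] .
  then show ?thesis using that edgeE[OF cyl_edge[OF assms e]] by (metis UnionI insertI1)
qed

lemma side_compl:
  assumes I: "\<alpha> \<in> I" "\<beta> \<in> I" "\<alpha> \<noteq> \<beta>" and S: "S \<in> reps \<alpha>"
  shows "side \<alpha> (V - S) \<beta> \<longleftrightarrow> \<not> side \<alpha> S \<beta>"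
proof (cases "snd \<beta> = snd \<alpha>")
  case True
  have "x \<in> V" if "(Some x, Y) \<in> I" for x Y using that I_Some V0_sub by auto
  then show ?thesis using I True unfolding side_def 
    by (cases \<alpha>; cases \<beta>; cases "fst \<beta>"; cases "fst \<alpha>") auto
next
  case False
  obtain x where x: "x \<in> \<Union>(snd \<beta>)" using cyl_point[OF I_cyl[OF I(2)]] .
  have "x \<in> V" using x cyl_V[OF I_cyl[OF I(2)]] by auto
  then show ?thesis 
    using alg_side_iff[OF I_cyl[OF I(1)] I_cyl[OF I(2)] False[symmetric] reps_alg[OF S] x]
      alg_side_iff[OF I_cyl[OF I(1)] I_cyl[OF I(2)] False[symmetric] alg_compl[OF reps_alg[OF S]] x]
      False unfolding side_def by simp
qed

text \<open>Each set has one side that misses the other cylinder, and the corner of these sides is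
  empty. If both are complements, \<open>S\<close> is equivalent to the complement of
  \<open>S'\<close>, which forces equal cylinders; if exactly one is, \<open>S\<close> or
  \<open>S'\<close> itself is small.\<close>

lemma small_corner_two_cylinders:
  assumes Y: "Y \<in> CY" "Y' \<in> CY" "Y \<noteq> Y'" and S: "S \<in> alg Y" "nontriv Y S" 
    and S': "S' \<in> alg Y'" "nontriv Y' S'" and sm: "small Y (S \<inter> S')"
  shows "\<Union>Y' \<inter> S = {} \<and> \<Union>Y \<inter> S' = {}"
proof -
  obtain H where H: "H \<in> cyc Y" "almost_invariant G H (X S)" using alg_rep[OF Y(1) S(1)] .
  obtain K where K: "K \<in> cyc Y'" "almost_invariant G K (X S')" using alg_rep[OF Y(2) S'(1)] .
  have sm': "small Y' (S \<inter> S')"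
    using H_finite_corner_sym[OF H(2) _ K(2)] S(2) sm cyc_H_finite[OF Y(1) H(1)] cyc_H_finite[OF Y(2) K(1)]
    unfolding small_def nontriv_def X_Int by simp
  have V: "S \<subseteq> V" "S' \<subseteq> V" using algD(1)[OF S(1)] algD(1)[OF S'(1)] .
  have A: False if "\<Union>Y' \<inter> (V - S) = {}" "\<Union>Y \<inter> (V - S') = {}"
  proof -
    have "(V - S) \<inter> (V - S') = {}" 
      by (rule alg_corner[OF Y(1,2) alg_compl[OF S(1)] alg_compl[OF S'(1)] that])
    then have d: "sym_diff S (V - S') = S \<inter> S'" using V by auto
    have K': "almost_invariant G K (X (V - S'))" using almost_invariant_compl[OF K(2)] by (simp add: X_Diff)
    have nt: "nontrivial_ai G K (X (V - S'))" 
      using nontriv_ai[OF Y(2) K(1) K'] S'(2) nontriv_compl[OF V(2)] by simp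
    have "sym_diff (X S) (X (V - S')) = X (sym_diff S (V - S'))" by (simp add: X_Un X_Diff)
    then have e: "sym_diff (X S) (X (V - S')) = X (S \<inter> S')" unfolding d .
    have "commensurable G H K"
      using equivalent_commensurable[OF H(2) nt] sm sm' 
        cyc_H_finite[OF Y(1) H(1)] cyc_H_finite[OF Y(2) K(1)] unfolding e small_def by simp
    then have "H \<in> cyc Y'" by (rule cyc_closed[OF Y(2) K(1)])
    then show False using cyc_eq[OF Y(1,2) H(1)] Y(3) by simp
  qed
  have B: False if "\<Union>Y' \<inter> (V - S) = {}" "\<Union>Y \<inter> S' = {}"
  proof -
    have "(V - S) \<inter> S' = {}" by (rule alg_corner[OF Y(1,2) alg_compl[OF S(1)] S'(1) that])
    then have "S \<inter> S' = S'" using V by auto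
    then show False using sm' S'(2) unfolding nontriv_def by simp
  qed
  have C: False if "\<Union>Y' \<inter> S = {}" "\<Union>Y \<inter> (V - S') = {}"
  proof -
    have "S \<inter> (V - S') = {}" by (rule alg_corner[OF Y(1,2) S(1) alg_compl[OF S'(1)] that])
    then have "S \<inter> S' = S" using V by auto
    then show False using sm S(2) unfolding nontriv_def by simp
  qed
  have "\<Union>Y' \<inter> S = {} \<or> \<Union>Y' \<inter> (V - S) = {}" "\<Union>Y \<inter> S' = {} \<or> \<Union>Y \<inter> (V - S') = {}"
    using alg_side[OF Y S(1)] alg_side[OF Y(2,1) Y(3)[symmetric] S'(1)] by auto
  then show ?thesis using A B C by blast
qed

lemma reps_Some_mem:
  assumes "(Some x, Y) \<in> I" "S \<in> reps (Some x, Y)"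
  shows "x \<in> S \<longleftrightarrow> eqv Y S (branch Y x)" "x \<notin> S \<longleftrightarrow> eqv Y (V - S) (branch Y x)"
    "\<And>z. z \<in> V0 \<Longrightarrow> z \<in> \<Union>Y \<Longrightarrow> z \<noteq> x \<Longrightarrow> z \<in> S \<longleftrightarrow> x \<notin> S"
proof -
  have Y: "Y \<in> CY" "ge3 Y" "x \<in> V0" "x \<in> \<Union>Y" "fval Y x" using assms(1) I_Some by auto
  have S: "S \<in> alg Y" "eqv Y S (branch Y x) \<or> eqv Y (V - S) (branch Y x)" using assms(2) reps_Some by auto
  have b: "branch Y x \<in> alg Y" by (rule branch_alg[OF Y(1,4,5)])
  have 1: "(z \<in> S) = (z = x)" if "eqv Y S (branch Y x)" "z \<in> V0" "z \<in> \<Union>Y" for z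
    using eqv_mem[OF Y(1) that(1) S(1) b that(2,3)] branch_mem[OF Y(1,4) that(3)] by simp
  have 2: "(z \<in> V - S) = (z = x)" if "eqv Y (V - S) (branch Y x)" "z \<in> V0" "z \<in> \<Union>Y" for z
    using eqv_mem[OF Y(1) that(1) alg_compl[OF S(1)] b that(2,3)] branch_mem[OF Y(1,4) that(3)] by simp
  show "x \<in> S \<longleftrightarrow> eqv Y S (branch Y x)" "x \<notin> S \<longleftrightarrow> eqv Y (V - S) (branch Y x)"
    using 1[OF _ Y(3,4)] 2[OF _ Y(3,4)] S(2) by auto
  show "z \<in> S \<longleftrightarrow> x \<notin> S" if z: "z \<in> V0" "z \<in> \<Union>Y" "z \<noteq> x" for z
    using 1[OF _ Y(3,4)] 2[OF _ Y(3,4)] 1[OF _ z(1,2)] 2[OF _ z(1,2)] S(2) z(3) V0_sub[OF z(1)] by auto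
qed

text \<open>Each set is a branch or the complement of one, up to small sets. Two branches are
  disjoint, a branch inside the corner is not small, and two complements meet in a non-small set by
  \<open>two_atoms\<close>.\<close>

lemma side_small_Some_Some:
  assumes I: "(Some x, Y) \<in> I" "(Some z, Y) \<in> I" "x \<noteq> z" 
    and S: "S \<in> reps (Some x, Y)" "S' \<in> reps (Some z, Y)"
  shows "small Y (S \<inter> S') \<longleftrightarrow> z \<notin> S \<and> x \<notin> S'"
proof -
  have Y: "Y \<in> CY" "ge3 Y" "x \<in> V0" "x \<in> \<Union>Y" "fval Y x" using I(1) I_Some by auto
  have z: "z \<in> V0" "z \<in> \<Union>Y" "fval Y z" using I(2) I_Some by auto
  have S': "S \<in> alg Y" "S' \<in> alg Y" using S reps_Some by auto
  note m = reps_Some_mem(3)[OF I(1) S(1) z(1,2) I(3)[symmetric]] 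
    reps_Some_mem(3)[OF I(2) S(2) Y(3,4) I(3)]
  consider "x \<in> S" "z \<in> S'" | "x \<in> S" "x \<in> S'" | "z \<in> S" "z \<in> S'" | "x \<notin> S" "z \<notin> S'" using m by blast
  then show ?thesis
  proof cases
    case 1
    have e: "eqv Y S (branch Y x)" "eqv Y S' (branch Y z)" 
      using 1 reps_Some_mem(1)[OF I(1) S(1)] reps_Some_mem(1)[OF I(2) S(2)] by auto
    have "branch Y x \<inter> branch Y z = {}" 
      using branch_disj[OF branch_alg[OF Y(1) z(2,3)] V0_sub[OF Y(3)]] branch_mem[OF Y(1) z(2) Y(4)] I(3) by simp
    then have "S \<inter> S' \<subseteq> sym_diff S (branch Y x) \<union> sym_diff S' (branch Y z)" by blast
    then have "small Y (S \<inter> S')" by (rule small_cover[OF Y(1) e])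
    then show ?thesis using 1 m by simp
  next
    case 2
    then have "branch Y x \<subseteq> S \<inter> S'" using branch_sub S' by auto
    then show ?thesis using branch_not_small[OF Y(1,4,3)] small_mono 2 by blast
  next
    case 3
    then have "branch Y z \<subseteq> S \<inter> S'" using branch_sub S' by auto
    then show ?thesis using branch_not_small[OF Y(1) z(2,1)] small_mono 3 by blast
  next
    case 4
    have e: "eqv Y (V - S) (branch Y x)" "eqv Y (V - S') (branch Y z)" 
      using 4 reps_Some_mem(2)[OF I(1) S(1)] reps_Some_mem(2)[OF I(2) S(2)] by auto
    have "\<not> small Y (S \<inter> S')"
    proof
      assume s: "small Y (S \<inter> S')"
      have "small Y (V - (branch Y x \<union> branch Y z))" by (rule small_cover3[OF Y(1) s e]) blast
      then show False 
        using two_atoms[OF Y(1,2) branch_atom[OF Y(1,3,4,5)] branch_atom[OF Y(1) z]] by simp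
    qed
    then show ?thesis using 4 m by blast
  qed
qed

text \<open>In the last case \<open>S\<close> is the complement of the branch. A small corner would
  put \<open>S'\<close> inside the branch up to a small set and so make it an atom.\<close>

lemma side_small_Some_None:
  assumes I: "(Some x, Y) \<in> I" "(None, Y) \<in> I" 
    and S: "S \<in> reps (Some x, Y)" "S' \<in> reps (None, Y)"
  shows "small Y (S \<inter> S') \<longleftrightarrow> x \<in> S \<and> x \<notin> S'"
proof -
  have Y: "Y \<in> CY" "ge3 Y" "x \<in> V0" "x \<in> \<Union>Y" "fval Y x" using I(1) I_Some by auto
  have S': "S \<in> alg Y" "S' \<in> alg Y" "nontriv Y S'" "\<not> atom Y S'" 
    using S Y(2) reps_Some reps_None by auto
  consider "x \<in> S" "x \<in> S'" | "x \<in> S" "x \<notin> S'" | "x \<notin> S" by blast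
  then show ?thesis
  proof cases
    case 1
    then have "branch Y x \<subseteq> S \<inter> S'" using branch_sub S' by auto
    then show ?thesis using branch_not_small[OF Y(1,4,3)] small_mono 1 by blast
  next
    case 2
    have e: "eqv Y S (branch Y x)" using 2 reps_Some_mem(1)[OF I(1) S(1)] by simp
    have "branch Y x \<inter> S' = {}" by (rule branch_disj[OF S'(2) V0_sub[OF Y(3)] 2(2)])
    then have "S \<inter> S' \<subseteq> sym_diff S (branch Y x)" by blast
    then have "small Y (S \<inter> S')" by (rule small_mono[OF e])
    then show ?thesis using 2 by simp
  next
    case 3
    have e: "eqv Y (V - S) (branch Y x)" using 3 reps_Some_mem(2)[OF I(1) S(1)] by simp
    have "\<not> small Y (S \<inter> S')"
    proof
      assume s: "small Y (S \<inter> S')"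
      have d: "small Y (S' - branch Y x)" 
        by (rule small_cover[OF Y(1) s e]) (use algD(1)[OF S'(2)] in blast)
      have "atom Y S'" unfolding atom_def
      proof (intro conjI ballI S'(2))
        show "\<not> small Y S'" using S'(3) unfolding nontriv_def by simp
        fix P assume "P \<in> alg Y"
        then consider "small Y (branch Y x \<inter> P)" | "small Y (branch Y x - P)" 
          using branch_atom[OF Y(1,3,4,5)] unfolding atom_def by auto
        then show "small Y (S' \<inter> P) \<or> small Y (S' - P)"
        proof cases
          case 1
          then have "small Y (S' \<inter> P)" by (rule small_cover[OF Y(1) _ d]) blast
          then show ?thesis by simp
        next
          case 2
          then have "small Y (S' - P)" by (rule small_cover[OF Y(1) _ d]) blast
          then show ?thesis by simp
        qed
      qed
      then show False using S'(4) by simp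
    qed
    then show ?thesis using 3 by simp
  qed
qed

lemma side_small_empty:
  assumes I: "\<alpha> \<in> I" "\<beta> \<in> I" "snd \<alpha> \<noteq> snd \<beta>" and S: "S \<in> reps \<alpha>" "S' \<in> reps \<beta>"
    and "\<not> side \<alpha> S \<beta>" "\<not> side \<beta> S' \<alpha>"
  shows "S \<inter> S' = {}"
proof (rule alg_corner[OF I_cyl[OF I(1)] I_cyl[OF I(2)] reps_alg[OF S(1)] reps_alg[OF S(2)]])
  show "\<Union>(snd \<beta>) \<inter> S = {}" 
    using alg_side[OF I_cyl[OF I(1)] I_cyl[OF I(2)] I(3) reps_alg[OF S(1)]] assms(6) I(3)
    unfolding side_def by auto
  show "\<Union>(snd \<alpha>) \<inter> S' = {}" 
    using alg_side[OF I_cyl[OF I(2)] I_cyl[OF I(1)] I(3)[symmetric] reps_alg[OF S(2)]] assms(7) I(3)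
    unfolding side_def by auto
qed

lemma side_small:
  assumes I: "\<alpha> \<in> I" "\<beta> \<in> I" "\<alpha> \<noteq> \<beta>" and S: "S \<in> reps \<alpha>" "S' \<in> reps \<beta>"
  shows "small (snd \<alpha>) (S \<inter> S') \<longleftrightarrow> \<not> side \<alpha> S \<beta> \<and> \<not> side \<beta> S' \<alpha>"
proof (cases "snd \<alpha> = snd \<beta>")
  case False
  note Y = I_cyl[OF I(1)] I_cyl[OF I(2)]
  obtain x where x: "x \<in> \<Union>(snd \<alpha>)" using cyl_point[OF Y(1)] .
  obtain z where z: "z \<in> \<Union>(snd \<beta>)" using cyl_point[OF Y(2)] .
  show ?thesis
  proof
    assume "small (snd \<alpha>) (S \<inter> S')"
    then have "\<Union>(snd \<beta>) \<inter> S = {} \<and> \<Union>(snd \<alpha>) \<inter> S' = {}"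
      by (rule small_corner_two_cylinders[OF Y False reps_alg[OF S(1)] reps_nontriv[OF I(1) S(1)]
            reps_alg[OF S(2)] reps_nontriv[OF I(2) S(2)]])
    then show "\<not> side \<alpha> S \<beta> \<and> \<not> side \<beta> S' \<alpha>" unfolding side_def using x z False by auto
  next
    assume "\<not> side \<alpha> S \<beta> \<and> \<not> side \<beta> S' \<alpha>"
    then have "S \<inter> S' = {}" using side_small_empty[OF I(1,2) False S] by simp
    then show "small (snd \<alpha>) (S \<inter> S')" using small_empty[OF Y(1)] by simp
  qed
next
  case True
  then obtain oa ob Y where ab: "\<alpha> = (oa, Y)" "\<beta> = (ob, Y)" by (cases \<alpha>; cases \<beta>) auto
  show ?thesis
  proof (cases oa)
    case oa: None
    then obtain z where ob: "ob = Some z" using I(3) ab by (cases ob) auto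
    show ?thesis 
      using side_small_Some_None[of z Y S' S] I S unfolding ab oa ob side_def 
      by (simp add: Int_commute) blast
  next
    case oa: (Some x)
    show ?thesis
    proof (cases ob)
      case ob: None
      show ?thesis using side_small_Some_None[of x Y S S'] I S unfolding ab oa ob side_def by simp
    next
      case ob: (Some z)
      show ?thesis using side_small_Some_Some[of x Y z S S'] I S unfolding ab oa ob side_def by auto
    qed
  qed
qed

text \<open>Betweenness demands genuine inclusions. Within one cylinder the small corner is
  subtracted, which keeps the class; for different cylinders the corner is empty already.\<close>

lemma reps_shrink:
  assumes I: "\<alpha> \<in> I" "\<beta> \<in> I" "\<alpha> \<noteq> \<beta>" and S: "S \<in> reps \<alpha>" "S' \<in> reps \<beta>"
    and "\<not> side \<alpha> S \<beta>" "\<not> side \<beta> S' \<alpha>"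
  obtains A where "A \<in> reps \<alpha>" "A \<inter> S' = {}"
proof (cases "snd \<alpha> = snd \<beta>")
  case True
  have "S - S' \<in> alg (snd \<alpha>)" using alg_Diff reps_alg[OF S(1)] reps_alg[OF S(2)] True by simp
  moreover have "small (snd \<alpha>) (S \<inter> S')" using side_small[OF assms(1-5)] assms(6,7) by simp
  then have "eqv (snd \<alpha>) S (S - S')" by (rule small_mono) auto
  ultimately have "S - S' \<in> reps \<alpha>" by (rule reps_eqv[OF I(1) S(1)])
  then show ?thesis using that[of "S - S'"] by auto
qed (use side_small_empty[OF I(1,2) _ S assms(6,7)] that S in auto)

lemma reps_cover:
  assumes Y: "Y \<in> CY" and S: "S \<in> alg Y" "nontriv Y S"
  obtains ox where "(ox, Y) \<in> I" "S \<in> reps (ox, Y)"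
proof -
  have V: "S \<subseteq> V" "V - (V - S) = S" using algD(1)[OF S(1)] by auto
  have "\<exists>ox. S \<in> reps (ox, Y)"
  proof (cases "ge3 Y \<and> (atom Y S \<or> atom Y (V - S))")
    case False
    then show ?thesis using S by (intro exI[of _ None]) (simp add: reps_None)
  next
    case True
    then obtain A where A: "A = S \<or> A = V - S" "atom Y A" "ge3 Y" by auto
    obtain x where "x \<in> V0" "x \<in> \<Union>Y" "fval Y x" "eqv Y A (branch Y x)" using atom_branch[OF Y A(3,2)] .
    then show ?thesis using A S by (intro exI[of _ "Some x"]) (auto simp: reps_Some)
  qed
  then show ?thesis using that Y unfolding I_def by auto
qed

text \<open>Applied to \<open>S\<close> and its complement, \<open>side_small\<close> would place
  one component on neither side of the other.\<close>

lemma reps_unique: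
  assumes I: "\<alpha> \<in> I" "\<beta> \<in> I" "snd \<alpha> = snd \<beta>" and S: "S \<in> reps \<alpha>" "S \<in> reps \<beta>"
  shows "\<alpha> = \<beta>"
proof (rule ccontr)
  assume ne: "\<alpha> \<noteq> \<beta>"
  have "small (snd \<alpha>) (S \<inter> (V - S))" "small (snd \<alpha>) ((V - S) \<inter> S)"
    using small_empty[OF I_cyl[OF I(1)]] by (simp_all add: Int_commute[of "V - S"])
  then have "\<not> side \<alpha> S \<beta>" "\<not> side \<alpha> (V - S) \<beta>"
    using side_small[OF I(1,2) ne S(1) reps_compl[OF S(2)]] 
      side_small[OF I(1,2) ne reps_compl[OF S(1)] S(2)] by auto
  then show False using side_compl[OF I(1,2) ne S(1)] by simp
qed

section \<open>Crossing generates exactly the indexed components\<close>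

definition ccc :: "'v option \<times> 'v set set \<Rightarrow> 'a ccc" where
  "ccc \<alpha> = cyl_pair (snd \<alpha>) ` reps \<alpha>"

text \<open>For two different indices, choose the side of each set that does not contain the other
  component. The corner of these sides is small, so the sets do not cross.\<close>

lemma tcross_reps:
  assumes I: "\<alpha> \<in> I" and S: "S \<in> reps \<alpha>" and S': "S' \<in> alg (snd \<alpha>)" "nontriv (snd \<alpha>) S'"
    and c: "tcross (snd \<alpha>) S S'"
  shows "S' \<in> reps \<alpha>"
proof -
  obtain oy where b: "(oy, snd \<alpha>) \<in> I" "S' \<in> reps (oy, snd \<alpha>)" 
    using reps_cover[OF I_cyl[OF I] S'] .
  show ?thesis
  proof (cases "\<alpha> = (oy, snd \<alpha>)")
    case False
    let ?\<beta> = "(oy, snd \<alpha>)"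
    have "\<exists>A\<in>{S, V - S}. \<not> side \<alpha> A ?\<beta>" using side_compl[OF I b(1) False S] by auto
    then obtain A where A: "A \<in> {S, V - S}" "\<not> side \<alpha> A ?\<beta>" by auto
    have "\<exists>B\<in>{S', V - S'}. \<not> side ?\<beta> B \<alpha>" using side_compl[OF b(1) I False[symmetric] b(2)] by auto
    then obtain B where B: "B \<in> {S', V - S'}" "\<not> side ?\<beta> B \<alpha>" by auto
    have "A \<in> reps \<alpha>" "B \<in> reps ?\<beta>" using A B reps_compl[OF S] reps_compl[OF b(2)] S b(2) by auto
    then have "small (snd \<alpha>) (A \<inter> B)" using side_small[OF I b(1) False] A B by simp
    then show ?thesis using c A B unfolding tcross_def by auto
  qed (use b in simp)
qed

text \<open>Among the four disjoint corners at most two are not small. By non-triviality two small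
  corners are never both in the same set or in the same complement, so the small ones are
  opposite.\<close>

lemma not_ge3_eqv:
  assumes Y: "Y \<in> CY" and n: "\<not> ge3 Y" and S: "S \<in> alg Y" "nontriv Y S" 
    and S': "S' \<in> alg Y" "nontriv Y S'"
  shows "eqv Y S S' \<or> eqv Y S (V - S')"
proof -
  have V: "S \<subseteq> V" "S' \<subseteq> V" using algD(1)[OF S(1)] algD(1)[OF S'(1)] .
  let ?a = "S \<inter> S'" and ?b = "S - S'" and ?c = "S' - S" and ?d = "V - (S \<union> S')"
  have al: "?a \<in> alg Y" "?b \<in> alg Y" "?c \<in> alg Y" "?d \<in> alg Y"
    using alg_Int alg_Diff alg_compl alg_Un S S' by auto
  have no3: "small Y P \<or> small Y Q \<or> small Y R" 
    if "P \<in> alg Y" "Q \<in> alg Y" "R \<in> alg Y" "P \<inter> Q = {}" "P \<inter> R = {}" "Q \<inter> R = {}" for P Q R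
    using n that unfolding ge3_def by blast
  have "\<not> (small Y ?a \<and> small Y ?b)" "\<not> (small Y ?c \<and> small Y ?d)" 
    "\<not> (small Y ?a \<and> small Y ?c)" "\<not> (small Y ?b \<and> small Y ?d)"
    using small_cover[OF Y, of ?a ?b S] small_cover[OF Y, of ?c ?d "V - S"] 
      small_cover[OF Y, of ?a ?c S'] small_cover[OF Y, of ?b ?d "V - S'"] S(2) S'(2) 
    unfolding nontriv_def by blast+
  moreover have "small Y ?a \<or> small Y ?b \<or> small Y ?c" "small Y ?a \<or> small Y ?b \<or> small Y ?d" 
    "small Y ?a \<or> small Y ?c \<or> small Y ?d" "small Y ?b \<or> small Y ?c \<or> small Y ?d"
    by (intro no3 al; blast)+
  ultimately consider "small Y ?a" "small Y ?d" | "small Y ?b" "small Y ?c" by blast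
  then show ?thesis
  proof cases
    case 1
    have "small Y (sym_diff S (V - S'))" by (rule small_cover[OF Y 1]) (use V in blast)
    then show ?thesis by simp
  next
    case 2
    have "small Y (sym_diff S S')" by (rule small_cover[OF Y 2]) blast
    then show ?thesis by simp
  qed
qed

abbreviation cross_eq :: "('a ai_pair \<times> 'a ai_pair) set" where
  "cross_eq \<equiv> (crossing_rel G based \<union> (crossing_rel G based)\<inverse>)\<^sup>*"

text \<open>Neither set is an atom, so each splits into two non-small parts. The union of one part
  of each crosses both sets, which links them in two steps.\<close>

lemma cross_connected_disjoint:
  assumes Y: "Y \<in> CY" and S: "S \<in> alg Y" "nontriv Y S" "\<not> atom Y S" 
    and S': "S' \<in> alg Y" "nontriv Y S'" "\<not> atom Y S'" and sm: "small Y (S \<inter> S')"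
  shows "(cyl_pair Y S, cyl_pair Y S') \<in> cross_eq"
proof -
  have V: "S \<subseteq> V" "S' \<subseteq> V" using algD(1)[OF S(1)] algD(1)[OF S'(1)] .
  obtain P where P: "P \<in> alg Y" "\<not> small Y (S \<inter> P)" "\<not> small Y (S - P)" 
    using S unfolding atom_def nontriv_def by auto
  obtain Q where Q: "Q \<in> alg Y" "\<not> small Y (S' \<inter> Q)" "\<not> small Y (S' - Q)" 
    using S' unfolding atom_def nontriv_def by auto
  let ?W = "(S \<inter> P) \<union> (S' \<inter> Q)"
  have W: "?W \<in> alg Y" using alg_Un alg_Int S S' P Q by simp
  have 1: "\<not> small Y A" if "S \<inter> P \<subseteq> A \<union> (S \<inter> S')" for A 
    using small_cover[OF Y _ sm that] P(2) by blast
  have 2: "\<not> small Y A" if "S - P \<subseteq> A \<union> (S \<inter> S')" for A 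
    using small_cover[OF Y _ sm that] P(3) by blast
  have 3: "\<not> small Y A" if "S' \<inter> Q \<subseteq> A \<union> (S \<inter> S')" for A 
    using small_cover[OF Y _ sm that] Q(2) by blast
  have 4: "\<not> small Y A" if "S' - Q \<subseteq> A \<union> (S \<inter> S')" for A 
    using small_cover[OF Y _ sm that] Q(3) by blast
  have "tcross Y S ?W" unfolding tcross_def 
    by (intro conjI 1[of "S \<inter> ?W"] 2[of "S \<inter> (V - ?W)"] 3[of "(V - S) \<inter> ?W"] 4[of "(V - S) \<inter> (V - ?W)"])
      (use V in blast)+
  moreover have "tcross Y ?W S'" unfolding tcross_def 
    by (intro conjI 3[of "?W \<inter> S'"] 1[of "?W \<inter> (V - S')"] 4[of "(V - ?W) \<inter> S'"] 2[of "(V - ?W) \<inter> (V - S')"])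
      (use V in blast)+
  moreover have "nontriv Y ?W" unfolding nontriv_def
    by (intro conjI 1[of ?W] 2[of "V - ?W"]) (use V in blast)+
  ultimately have "(cyl_pair Y S, cyl_pair Y ?W) \<in> crossing_rel G based" "(cyl_pair Y ?W, cyl_pair Y S') \<in> crossing_rel G based"
    using crossing_iff[OF Y Y S(1,2) W] crossing_iff[OF Y Y W _ S'(1,2)] by auto
  then show ?thesis by (meson UnI1 r_into_rtrancl rtrancl_trans)
qed

lemma reps_connected:
  assumes I: "\<alpha> \<in> I" and S: "S \<in> reps \<alpha>" "S' \<in> reps \<alpha>"
  shows "(cyl_pair (snd \<alpha>) S, cyl_pair (snd \<alpha>) S') \<in> cross_eq"
proof -
  obtain ox Y where a: "\<alpha> = (ox, Y)" by (cases \<alpha>)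
  have Y: "Y \<in> CY" using I_cyl[OF I] a by simp
  have V: "S \<subseteq> V" "S' \<subseteq> V" using reps_V S by auto
  have al: "S \<in> alg Y" "S' \<in> alg Y" "nontriv Y S" "nontriv Y S'"
    using reps_alg S reps_nontriv[OF I] a by fastforce+
  have eq: ?thesis if "eqv Y S S' \<or> eqv Y S (V - S')"
    using cyl_pair_eq_iff[OF Y Y al(1,3) al(2,4)] that a by simp
  show ?thesis
  proof (cases ox)
    case (Some x)
    let ?b = "branch Y x"
    have SS: "eqv Y S ?b \<or> eqv Y (V - S) ?b" "eqv Y S' ?b \<or> eqv Y (V - S') ?b"
      using S reps_Some a Some by auto
    have t: "eqv Y A B" if "eqv Y A ?b" "eqv Y B ?b" for A B
      using eqv_trans[OF Y that(1) eqv_sym[OF that(2)]] .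
    have c: "eqv Y A (V - B)" if "eqv Y (V - A) B" "A \<subseteq> V" "B \<subseteq> V" for A B
    proof -
      have "V - (V - A) = A" using that by auto
      then show ?thesis using eqv_compl[of "V - A" B Y] that by simp
    qed
    have "eqv Y S S' \<or> eqv Y S (V - S')"
      using SS t[of S S'] t[of S "V - S'"] t[of "V - S" S'] t[of "V - S" "V - S'"] 
        c[of S S'] V eqv_compl[OF V] by blast
    then show ?thesis by (rule eq)
  next
    case None
    show ?thesis
    proof (cases "ge3 Y")
      case False
      then show ?thesis using not_ge3_eqv[OF Y False al(1,3) al(2,4)] eq by simp
    next
      case True
      show ?thesis
      proof (cases "tcross Y S S'")
        case True
        then have "(cyl_pair Y S, cyl_pair Y S') \<in> crossing_rel G based" 
          using crossing_iff[OF Y Y al(1,3) al(2,4)] by simp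
        then show ?thesis using a by auto
      next
        case False
        then obtain A B where AB: "A = S \<or> A = V - S" "B = S' \<or> B = V - S'" "small Y (A \<inter> B)"
          unfolding tcross_def by auto
        then have r: "A \<in> reps (None, Y)" "B \<in> reps (None, Y)"
          using reps_compl[OF S(1)] reps_compl[OF S(2)] S a None by auto
        have "(cyl_pair Y A, cyl_pair Y B) \<in> cross_eq"
          by (rule cross_connected_disjoint[OF Y _ _ _ _ _ _ AB(3)]) 
            (use r True in \<open>auto simp: reps_None\<close>)
        moreover have "cyl_pair Y A = cyl_pair Y S" "cyl_pair Y B = cyl_pair Y S'" using AB cyl_pair_compl V by auto
        ultimately show ?thesis using a by simp
      qed
    qed
  qed
qed

lemma ai_pairs_reps: "ai_pairs G based = (\<Union>\<alpha>\<in>I. ccc \<alpha>)"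
proof (intro equalityI subsetI)
  fix p assume "p \<in> ai_pairs G based"
  then obtain Y S where S: "p = cyl_pair Y S" "Y \<in> CY" "S \<in> alg Y" "nontriv Y S" 
    unfolding ai_pairs_based by auto
  obtain ox where "(ox, Y) \<in> I" "S \<in> reps (ox, Y)" using reps_cover[OF S(2-4)] .
  then show "p \<in> (\<Union>\<alpha>\<in>I. ccc \<alpha>)" unfolding ccc_def using S(1) by force
next
  fix p assume "p \<in> (\<Union>\<alpha>\<in>I. ccc \<alpha>)"
  then obtain \<alpha> S where a: "\<alpha> \<in> I" "S \<in> reps \<alpha>" "p = cyl_pair (snd \<alpha>) S" unfolding ccc_def by auto
  then show "p \<in> ai_pairs G based" 
    unfolding ai_pairs_based using I_cyl reps_alg reps_nontriv by blast
qed

text \<open>Crossing never leaves an index by \<open>tcross_reps\<close>, and one index is connected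
  by \<open>reps_connected\<close>.\<close>

lemma ccc_class:
  assumes I: "\<alpha> \<in> I" and S: "S \<in> reps \<alpha>"
  shows "cross_eq `` {cyl_pair (snd \<alpha>) S} = ccc \<alpha>"
proof (intro equalityI subsetI)
  fix q assume "q \<in> cross_eq `` {cyl_pair (snd \<alpha>) S}"
  then have "(cyl_pair (snd \<alpha>) S, q) \<in> cross_eq" by simp
  then show "q \<in> ccc \<alpha>"
  proof (induction rule: rtrancl_induct)
    case base
    then show ?case unfolding ccc_def using S by auto
  next
    case (step p q)
    then obtain S1 where S1: "S1 \<in> reps \<alpha>" "p = cyl_pair (snd \<alpha>) S1" unfolding ccc_def by auto
    have "q \<in> ai_pairs G based" using step(2) unfolding crossing_rel_def by auto
    then obtain Y S2 where S2: "q = cyl_pair Y S2" "Y \<in> CY" "S2 \<in> alg Y" "nontriv Y S2" 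
      unfolding ai_pairs_based by auto
    note Y = I_cyl[OF I]
    have "snd \<alpha> = Y \<and> tcross Y S1 S2"
      using step(2) crossing_iff[OF Y S2(2) reps_alg[OF S1(1)] reps_nontriv[OF I S1(1)] S2(3,4)]
        crossing_iff[OF S2(2) Y S2(3,4) reps_alg[OF S1(1)] reps_nontriv[OF I S1(1)]] 
      unfolding S1(2) S2(1) by (auto simp: tcross_def Int_commute)
    then have "S2 \<in> reps \<alpha>" "snd \<alpha> = Y" using tcross_reps[OF I S1(1)] S2 by auto
    then show ?case unfolding ccc_def using S2(1) by auto
  qed
next
  fix q assume "q \<in> ccc \<alpha>"
  then show "q \<in> cross_eq `` {cyl_pair (snd \<alpha>) S}" 
    unfolding ccc_def using reps_connected[OF I S] by auto
qed

lemma cccs_eq: "cccs G based = ccc ` I"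
proof (intro equalityI subsetI)
  fix C assume "C \<in> cccs G based"
  then obtain p where p: "p \<in> ai_pairs G based" "C = cross_eq `` {p}" 
    unfolding cccs_def quotient_def by auto
  then obtain \<alpha> S where "\<alpha> \<in> I" "S \<in> reps \<alpha>" "p = cyl_pair (snd \<alpha>) S" 
    unfolding ai_pairs_reps ccc_def by auto
  then show "C \<in> ccc ` I" using ccc_class p by auto
next
  fix C assume "C \<in> ccc ` I"
  then obtain \<alpha> where a: "C = ccc \<alpha>" "\<alpha> \<in> I" by auto
  then obtain S where S: "S \<in> reps \<alpha>" unfolding I_def by auto
  have "cyl_pair (snd \<alpha>) S \<in> ai_pairs G based" unfolding ai_pairs_reps ccc_def using a S by auto
  then show "C \<in> cccs G based" 
    unfolding cccs_def quotient_def using ccc_class[OF a(2) S] a(1) by auto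
qed

lemma ccc_inj: "inj_on ccc I"
proof (rule inj_onI)
  fix \<alpha> \<beta> assume I: "\<alpha> \<in> I" "\<beta> \<in> I" and eq: "ccc \<alpha> = ccc \<beta>"
  obtain S where S: "S \<in> reps \<alpha>" using I unfolding I_def by auto
  then have "cyl_pair (snd \<alpha>) S \<in> ccc \<beta>" using eq unfolding ccc_def by auto
  then obtain S' where S': "S' \<in> reps \<beta>" "cyl_pair (snd \<alpha>) S = cyl_pair (snd \<beta>) S'" unfolding ccc_def by auto
  then have *: "snd \<alpha> = snd \<beta>" "eqv (snd \<alpha>) S S' \<or> eqv (snd \<alpha>) S (V - S')"
    using cyl_pair_eq_iff[OF I_cyl[OF I(1)] I_cyl[OF I(2)] reps_alg[OF S] reps_nontriv[OF I(1) S]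
       reps_alg[OF S'(1)] reps_nontriv[OF I(2) S'(1)]] by auto
  have a: "S' \<in> alg (snd \<alpha>)" "V - S' \<in> alg (snd \<alpha>)" using reps_alg[OF S'(1)] *(1) alg_compl by auto
  then have "S' \<in> reps \<alpha> \<or> V - S' \<in> reps \<alpha>" using *(2) reps_eqv[OF I(1) S] by blast
  then show "\<alpha> = \<beta>" 
    using reps_unique[OF I *(1)] S'(1) reps_compl[OF S'(1)] by blast
qed

section \<open>Representatives and betweenness\<close>

lemma represents_rep:
  assumes I: "\<alpha> \<in> I" and r: "represents_ccc G Z (ccc \<alpha>)"
  obtains H A where "A \<in> reps \<alpha>" "H \<in> cyc (snd \<alpha>)" "finY (snd \<alpha>) (sym_diff Z (X A))" 
    "nontrivial_ai G H Z" "Z \<subseteq> carrier G"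
proof -
  obtain H S where S: "almost_invariant G H Z" "ai_pair G H Z = cyl_pair (snd \<alpha>) S" "S \<in> reps \<alpha>" 
    using r unfolding represents_ccc_def ccc_def by auto
  obtain A where A: "A = S \<or> A = V - S" "H \<in> cyc (snd \<alpha>)" "finY (snd \<alpha>) (sym_diff Z (X A))" 
    "nontrivial_ai G H Z" 
    using pair_rep[OF I_cyl[OF I] reps_alg[OF S(3)] reps_nontriv[OF I S(3)] S(1,2)] .
  moreover have "A \<in> reps \<alpha>" using A(1) S(3) reps_compl[OF S(3)] by auto
  moreover have "Z \<subseteq> carrier G" using S(1) by (simp add: almost_invariant_iff)
  ultimately show ?thesis using that by blast
qed

lemma represents_X:
  assumes I: "\<alpha> \<in> I" and A: "A \<in> reps \<alpha>"
  shows "represents_ccc G (X A) (ccc \<alpha>)"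
proof -
  obtain H where H: "H \<in> cyc (snd \<alpha>)" "almost_invariant G H (X A)" 
    using alg_rep[OF I_cyl[OF I] reps_alg[OF A]] .
  then show ?thesis 
    unfolding represents_ccc_def ccc_def using ai_pair_X[OF I_cyl[OF I] H(1)] A by auto
qed

lemma represents_subset:
  assumes I: "\<alpha> \<in> I" "\<beta> \<in> I" "\<alpha> \<noteq> \<beta>" and A: "A \<in> reps \<alpha>" "B \<in> reps \<beta>"
    and Z: "H \<in> cyc (snd \<alpha>)" "nontrivial_ai G H Z" "finY (snd \<alpha>) (sym_diff Z (X A))"
    and W: "K \<in> cyc (snd \<beta>)" "nontrivial_ai G K W" "finY (snd \<beta>) (sym_diff W (X B))" "W \<subseteq> carrier G"
    and sub: "Z \<subseteq> W"
  shows "\<not> side \<alpha> A \<beta> \<and> side \<beta> B \<alpha>"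
proof -
  note B' = reps_compl[OF A(2)]
  have "Z \<inter> (carrier G - W) = {}" using sub by auto
  then have "H_finite G H (Z \<inter> (carrier G - W))" by simp
  then have "small (snd \<alpha>) (A \<inter> (V - B))"
    by (rule corner_transfer'[OF I_cyl[OF I(1)] I_cyl[OF I(2)] reps_alg[OF A(1)] reps_nontriv[OF I(1) A(1)]
          reps_alg[OF B'] reps_nontriv[OF I(2) B'] Z W(1) nontrivial_compl[OF W(2)] finY_compl[OF W(4,3)]])
  then have "\<not> side \<alpha> A \<beta> \<and> \<not> side \<beta> (V - B) \<alpha>"
    using side_small[OF I A(1) B'] by simp
  then show ?thesis using side_compl[OF I(2,1) I(3)[symmetric] A(2)] by simp
qed

lemma between_iff:
  assumes I: "\<alpha> \<in> I" "\<beta> \<in> I" "\<gamma> \<in> I"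
  shows "between_ccc G (ccc \<alpha>) (ccc \<beta>) (ccc \<gamma>) \<longleftrightarrow> 
    \<alpha> \<noteq> \<beta> \<and> \<beta> \<noteq> \<gamma> \<and> \<alpha> \<noteq> \<gamma> \<and> (\<exists>S\<in>reps \<beta>. side \<beta> S \<alpha> \<and> \<not> side \<beta> S \<gamma>)"
proof (cases "\<alpha> \<noteq> \<beta> \<and> \<beta> \<noteq> \<gamma> \<and> \<alpha> \<noteq> \<gamma>")
  case True
  have ne: "ccc \<alpha> \<noteq> ccc \<beta>" "ccc \<beta> \<noteq> ccc \<gamma>" "ccc \<alpha> \<noteq> ccc \<gamma>" 
    using True I inj_onD[OF ccc_inj] by blast+
  show ?thesis
  proof
    assume "between_ccc G (ccc \<alpha>) (ccc \<beta>) (ccc \<gamma>)"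
    then obtain X1 X2 X3 where X: "represents_ccc G X1 (ccc \<alpha>)" "represents_ccc G X2 (ccc \<beta>)" 
      "represents_ccc G X3 (ccc \<gamma>)" "X1 \<subseteq> X2" "X2 \<subseteq> X3" unfolding between_ccc_def by auto
    obtain H1 A1 where 1: "A1 \<in> reps \<alpha>" "H1 \<in> cyc (snd \<alpha>)" "finY (snd \<alpha>) (sym_diff X1 (X A1))" 
      "nontrivial_ai G H1 X1" using represents_rep[OF I(1) X(1)] .
    obtain H2 A2 where 2: "A2 \<in> reps \<beta>" "H2 \<in> cyc (snd \<beta>)" "finY (snd \<beta>) (sym_diff X2 (X A2))" 
      "nontrivial_ai G H2 X2" "X2 \<subseteq> carrier G" using represents_rep[OF I(2) X(2)] .
    obtain H3 A3 where 3: "A3 \<in> reps \<gamma>" "H3 \<in> cyc (snd \<gamma>)" "finY (snd \<gamma>) (sym_diff X3 (X A3))" 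
      "nontrivial_ai G H3 X3" "X3 \<subseteq> carrier G" using represents_rep[OF I(3) X(3)] .
    have "side \<beta> A2 \<alpha>" 
      using represents_subset[OF I(1,2) _ 1(1) 2(1) 1(2,4,3) 2(2,4,3,5) X(4)] True by simp
    moreover have "\<not> side \<beta> A2 \<gamma>" 
      using represents_subset[OF I(2,3) _ 2(1) 3(1) 2(2,4,3) 3(2,4,3,5) X(5)] True by simp
    ultimately show "\<alpha> \<noteq> \<beta> \<and> \<beta> \<noteq> \<gamma> \<and> \<alpha> \<noteq> \<gamma> \<and> (\<exists>S\<in>reps \<beta>. side \<beta> S \<alpha> \<and> \<not> side \<beta> S \<gamma>)"
      using 2(1) True by auto
  next
    assume "\<alpha> \<noteq> \<beta> \<and> \<beta> \<noteq> \<gamma> \<and> \<alpha> \<noteq> \<gamma> \<and> (\<exists>S\<in>reps \<beta>. side \<beta> S \<alpha> \<and> \<not> side \<beta> S \<gamma>)"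
    then obtain S where S: "S \<in> reps \<beta>" "side \<beta> S \<alpha>" "\<not> side \<beta> S \<gamma>" by auto
    \<comment> \<open>Starting from \<open>S\<close>, a set of each outer component is chosen on the
      side away from \<open>\<beta>\<close> and shrunk until it misses the complement of
      \<open>S\<close>, respectively \<open>S\<close>. The complement of the second one is the
      largest of the three nested sets.\<close>
    have *: "\<exists>A\<in>reps \<delta>. \<not> side \<delta> A \<beta>" if d: "\<delta> \<in> I" "\<delta> \<noteq> \<beta>" for \<delta>
    proof -
      obtain A where A: "A \<in> reps \<delta>" using d(1) unfolding I_def by auto
      then show ?thesis using side_compl[OF d(1) I(2) d(2) A] reps_compl[OF A] by blast
    qed
    obtain A where A: "A \<in> reps \<alpha>" "\<not> side \<alpha> A \<beta>" using *[OF I(1)] True by auto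
    have "\<not> side \<beta> (V - S) \<alpha>" using side_compl[OF I(2,1) _ S(1)] S(2) True by auto
    then obtain A' where A': "A' \<in> reps \<alpha>" "A' \<inter> (V - S) = {}"
      using reps_shrink[OF I(1,2) _ A(1) reps_compl[OF S(1)] A(2)] True by metis
    obtain B where B: "B \<in> reps \<gamma>" "\<not> side \<gamma> B \<beta>" using *[OF I(3)] True by auto
    obtain B' where B': "B' \<in> reps \<gamma>" "B' \<inter> S = {}"
      using reps_shrink[OF I(3,2) _ B(1) S(1) B(2) S(3)] True by metis
    have "A' \<subseteq> S" "S \<subseteq> V - B'" using A' B' reps_V[OF A'(1)] reps_V[OF S(1)] by auto
    then have "X A' \<subseteq> X S" "X S \<subseteq> X (V - B')" by (simp_all only: X_mono)
    then show "between_ccc G (ccc \<alpha>) (ccc \<beta>) (ccc \<gamma>)"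
      unfolding between_ccc_def using ne represents_X[OF I(1) A'(1)] represents_X[OF I(2) S(1)] 
        represents_X[OF I(3) reps_compl[OF B'(1)]] by blast
  qed
next
  case False
  then show ?thesis unfolding between_ccc_def by auto
qed

end

section \<open>Trees from walls\<close>

text \<open>The closing edge of a cycle would be the only edge leaving some \<open>M\<close>, but
  the rest of the cycle connects its ends without that edge.\<close>

lemma no_cycle_if_bridges:
  assumes bridge: "\<And>e. e \<in> edges \<Gamma> \<Longrightarrow> \<exists>M. (\<exists>x y. e = {x, y} \<and> x \<in> M \<and> y \<notin> M) \<and> 
      (\<forall>a b. {a, b} \<in> edges \<Gamma> \<longrightarrow> a \<in> M \<longrightarrow> b \<notin> M \<longrightarrow> {a, b} = e)"
  shows "\<not> graph_cycle \<Gamma> vs"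
proof
  assume "graph_cycle \<Gamma> vs"
  then have c: "length vs \<ge> 3" "distinct vs" "successively (\<lambda>a b. {a, b} \<in> edges \<Gamma>) vs" 
    "{last vs, hd vs} \<in> edges \<Gamma>" unfolding graph_cycle_def by auto
  obtain M where M: "\<exists>x y. {last vs, hd vs} = {x, y} \<and> x \<in> M \<and> y \<notin> M" 
    "\<And>a b. {a, b} \<in> edges \<Gamma> \<Longrightarrow> a \<in> M \<Longrightarrow> b \<notin> M \<Longrightarrow> {a, b} = {last vs, hd vs}"
    using bridge[OF c(4)] by auto
  have ne: "vs \<noteq> []" using c(1) by auto
  have hl: "last vs = vs ! (length vs - 1)" "hd vs = vs ! 0" 
    using ne by (auto simp: last_conv_nth hd_conv_nth)
  have step: "vs ! Suc i \<in> M \<longleftrightarrow> vs ! i \<in> M" if i: "Suc i < length vs" for i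
  proof -
    have e: "{vs ! i, vs ! Suc i} \<in> edges \<Gamma>" using c(3) i by (simp add: successively_conv_nth)
    \<comment> \<open>With at least three distinct vertices, no step of the list is the closing
      edge.\<close>
    have "{vs ! i, vs ! Suc i} \<noteq> {last vs, hd vs}"
    proof
      assume "{vs ! i, vs ! Suc i} = {last vs, hd vs}"
      then consider "vs ! i = vs ! 0" "vs ! Suc i = vs ! (length vs - 1)" | "vs ! Suc i = vs ! 0"
        unfolding hl by (auto simp: doubleton_eq_iff)
      then show False
      proof cases
        case 1
        then have "i = 0" "Suc i = length vs - 1"
          using i c(1) nth_eq_iff_index_eq[OF c(2), of i 0] 
            nth_eq_iff_index_eq[OF c(2), of "Suc i" "length vs - 1"] by linarith+
        then show False using c(1) by simp
      next
        case 2
        then show False using i c(1) nth_eq_iff_index_eq[OF c(2), of "Suc i" 0] by linarith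
      qed
    qed
    then show ?thesis using M(2)[OF e] M(2)[of "vs ! Suc i" "vs ! i"] e by (auto simp: insert_commute)
  qed
  have idx: "i < length vs \<Longrightarrow> vs ! i \<in> M \<longleftrightarrow> vs ! 0 \<in> M" for i
    by (induction i) (auto simp: step)
  have "last vs \<in> M \<longleftrightarrow> hd vs \<in> M" unfolding hl by (rule idx) (use ne in simp)
  then show False using M(1) by (auto simp: doubleton_eq_iff)
qed

text \<open>Each point \<open>c\<close> comes with a set \<open>sides c\<close> of ways to divide the other points. The stars are the 
  maximal sets no two points of which are divided at a third.\<close>

locale walls =
  fixes P :: "'p set" and Q :: "'q set" and St :: "'q \<Rightarrow> 'p set" 
    and btw :: "'p \<Rightarrow> 'p \<Rightarrow> 'p \<Rightarrow> bool" and sides :: "'p \<Rightarrow> ('p \<Rightarrow> bool) set"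
  assumes btw: "\<lbrakk>a \<in> P; b \<in> P; c \<in> P\<rbrakk> \<Longrightarrow> btw a b c \<longleftrightarrow> a \<noteq> b \<and> b \<noteq> c \<and> a \<noteq> c \<and> (\<exists>s\<in>sides b. s a \<and> \<not> s c)"
    and St_sub: "q \<in> Q \<Longrightarrow> St q \<subseteq> P"
    and side_const: "\<lbrakk>c \<in> P; q \<in> Q; s \<in> sides c; a \<in> St q; b \<in> St q; a \<noteq> c; b \<noteq> c\<rbrakk> \<Longrightarrow> s a \<longleftrightarrow> s b"
    and side_sep: "\<lbrakk>q \<in> Q; q' \<in> Q; q \<noteq> q'; c \<in> St q; c \<in> St q'\<rbrakk> \<Longrightarrow> 
      \<exists>s\<in>sides c. \<exists>a\<in>St q - {c}. \<exists>b\<in>St q' - {c}. s a \<and> \<not> s b"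
    and St_two: "q \<in> Q \<Longrightarrow> \<exists>a\<in>St q. \<exists>b\<in>St q. a \<noteq> b"
    and connected: "\<lbrakk>a \<in> P; b \<in> P\<rbrakk> \<Longrightarrow> (a, b) \<in> {(a, b). \<exists>q\<in>Q. a \<in> St q \<and> b \<in> St q}\<^sup>*"
    and nonempty: "P \<noteq> {}"
begin

definition costar :: "('p \<times> 'p) set" where
  "costar = {(a, b). \<exists>q\<in>Q. a \<in> St q \<and> b \<in> St q}"

definition undivided :: "'p set \<Rightarrow> bool" where
  "undivided \<Sigma> \<longleftrightarrow> (\<forall>a\<in>\<Sigma>. \<forall>b\<in>\<Sigma>. \<forall>c\<in>P. \<not> btw a c b)"

lemma costar_P: "(a, b) \<in> costar \<Longrightarrow> a \<in> P \<and> b \<in> P"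
  unfolding costar_def using St_sub by blast

text \<open>By \<open>side_const\<close> the two witnesses from \<open>side_sep\<close> may be
  replaced by any other points of the two stars.\<close>

lemma sep_at:
  assumes "q \<in> Q" "q' \<in> Q" "q \<noteq> q'" "c \<in> St q" "c \<in> St q'" "a \<in> St q" "b \<in> St q'" "a \<noteq> c" "b \<noteq> c"
  obtains s where "s \<in> sides c" "s a" "\<not> s b"
proof -
  obtain s x y where s: "s \<in> sides c" "x \<in> St q - {c}" "y \<in> St q' - {c}" "s x" "\<not> s y"
    using side_sep[OF assms(1-5)] by blast
  have c: "c \<in> P" using St_sub assms by auto
  have "s a" using side_const[OF c assms(1) s(1), of a x] s assms by auto
  moreover have "\<not> s b" using side_const[OF c assms(2) s(1), of b y] s assms by auto
  ultimately show ?thesis using that s(1) by blast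
qed

text \<open>In a shortest chain of stars from \<open>a\<close> to \<open>b\<close>, the second point
  \<open>p1\<close> is between them: its first two stars differ, so some side at \<open>p1\<close>
  divides \<open>a\<close> from the third point, and the rest of the chain never returns to
  \<open>p1\<close> and keeps its side.\<close>

lemma between_or_costar:
  assumes ab: "a \<in> P" "b \<in> P" "a \<noteq> b" and n: "(a, b) \<notin> costar"
  shows "\<exists>c\<in>P. btw a c b"
proof -
  have "(a, b) \<in> costar\<^sup>*" using connected[OF ab(1,2)] unfolding costar_def .
  then have ex: "\<exists>n. (a, b) \<in> costar ^^ n" by (simp add: rtrancl_power)
  define n where "n = (LEAST n. (a, b) \<in> costar ^^ n)"
  have n1: "(a, b) \<in> costar ^^ n" unfolding n_def using ex by (rule LeastI_ex)
  have n2: "n \<le> m" if "(a, b) \<in> costar ^^ m" for m unfolding n_def using that by (rule Least_le)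
  have "n \<noteq> 0" using n1 ab(3) by (cases n) auto
  moreover have "n \<noteq> 1" using n1 n by auto
  ultimately obtain m where m: "n = Suc (Suc m)" by (metis One_nat_def not0_implies_Suc)
  obtain p1 where p1: "(a, p1) \<in> costar" "(p1, b) \<in> costar ^^ Suc m" 
    using relpow_Suc_D2[of a b "Suc m" costar] n1 m by auto
  obtain p2 where p2: "(p1, p2) \<in> costar" "(p2, b) \<in> costar ^^ m" 
    using relpow_Suc_D2[OF p1(2)] by auto
  obtain q where q: "q \<in> Q" "a \<in> St q" "p1 \<in> St q" using p1 unfolding costar_def by auto
  obtain q' where q': "q' \<in> Q" "p1 \<in> St q'" "p2 \<in> St q'" using p2 unfolding costar_def by auto
  have p1P: "p1 \<in> P" using costar_P[OF p1(1)] by simp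
  \<comment> \<open>A return to \<open>p1\<close> would shorten the chain.\<close>
  have far: "x \<noteq> p1" if "(x, b) \<in> costar ^^ k" "k \<le> m" for x k
  proof
    assume "x = p1"
    then have "(a, b) \<in> costar ^^ Suc k" using that(1) p1(1) relpow_Suc_I2[of a p1 costar b k] by simp
    then show False using n2[of "Suc k"] that(2) m by simp
  qed
  have ap1: "a \<noteq> p1"
  proof
    assume "a = p1"
    then show False using n2[OF p1(2)[folded \<open>a = p1\<close>]] m by simp
  qed
  have p2p1: "p2 \<noteq> p1" using far[OF p2(2)] by simp
  have "q \<noteq> q'"
  proof
    assume "q = q'"
    then have "(a, p2) \<in> costar" using q q' unfolding costar_def by auto
    then have "(a, b) \<in> costar ^^ Suc m" using p2(2) by (rule relpow_Suc_I2)
    then show False using n2[of "Suc m"] m by simp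
  qed
  then obtain s where s: "s \<in> sides p1" "s a" "\<not> s p2"
    using sep_at[OF q(1) q'(1) _ q(3) q'(2) q(2) q'(3) ap1 p2p1] by auto
  have "s x = s b" if "(x, b) \<in> costar ^^ k" "k \<le> m" for x k
    using that
  proof (induction k arbitrary: x)
    case (Suc k)
    obtain y where y: "(x, y) \<in> costar" "(y, b) \<in> costar ^^ k" using relpow_Suc_D2[OF Suc(2)] by auto
    obtain r where r: "r \<in> Q" "x \<in> St r" "y \<in> St r" using y(1) unfolding costar_def by auto
    have "s x = s y" using side_const[OF p1P r(1) s(1) r(2,3)] far[OF Suc(2,3)] far[OF y(2)] Suc(3) by simp
    then show ?case using Suc.IH[OF y(2)] Suc(3) by simp
  qed simp
  then have "\<not> s b" using s(3) p2(2) by blast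
  moreover have "b \<noteq> p1" using far[of b 0] by simp
  ultimately have "btw a p1 b" using btw[OF ab(1) p1P ab(2)] ap1 s ab(3) by auto
  then show ?thesis using p1P by auto
qed

lemma undivided_St: 
  assumes "q \<in> Q" 
  shows "undivided (St q)"
  unfolding undivided_def
proof (intro ballI notI)
  fix a b c assume "a \<in> St q" "b \<in> St q" "c \<in> P" "btw a c b"
  then show False using btw[of a c b] side_const[of c q _ a b] St_sub[OF assms] assms by auto
qed

text \<open>A further point \<open>d\<close> shares a star with \<open>a\<close> and one with
  \<open>b\<close>. If \<open>d\<close> were not in the star of \<open>a\<close> and
  \<open>b\<close>, some side at \<open>a\<close> would divide \<open>b\<close> from
  \<open>d\<close>, although these two share a star.\<close>

lemma undivided_sub:
  assumes \<Sigma>: "\<Sigma> \<subseteq> P" "undivided \<Sigma>" and q: "q \<in> Q" "a \<in> St q" "b \<in> St q" "a \<in> \<Sigma>" "b \<in> \<Sigma>" "a \<noteq> b"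
  shows "\<Sigma> \<subseteq> St q"
proof
  fix d assume d: "d \<in> \<Sigma>"
  show "d \<in> St q"
  proof (rule ccontr)
    assume nd: "d \<notin> St q"
    then have ne: "d \<noteq> a" "d \<noteq> b" using q by auto
    have co: "\<exists>r\<in>Q. x \<in> St r \<and> d \<in> St r" if "x \<in> \<Sigma>" "x \<noteq> d" for x
      using between_or_costar[of x d] that d \<Sigma> unfolding undivided_def costar_def by blast
    obtain q1 where q1: "q1 \<in> Q" "a \<in> St q1" "d \<in> St q1" using co[of a] q ne by auto
    obtain q2 where q2: "q2 \<in> Q" "b \<in> St q2" "d \<in> St q2" using co[of b] q ne by auto
    have "q \<noteq> q1" using nd q1 by auto
    then obtain s where s: "s \<in> sides a" "s b" "\<not> s d"
      using sep_at[OF q(1) q1(1) _ q(2) q1(2) q(3) q1(3)] q(6) ne by auto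
    have "a \<in> P" using \<Sigma> q by auto
    then show False using side_const[OF _ q2(1) s(1) q2(2,3)] q(6) ne s by auto
  qed
qed

lemma stars_eq:
  "{\<Sigma>. \<Sigma> \<subseteq> P \<and> (\<exists>a\<in>\<Sigma>. \<exists>b\<in>\<Sigma>. a \<noteq> b) \<and> undivided \<Sigma> \<and> 
     (\<forall>\<Sigma>'. \<Sigma> \<subseteq> \<Sigma>' \<and> \<Sigma>' \<subseteq> P \<and> undivided \<Sigma>' \<longrightarrow> \<Sigma>' = \<Sigma>)} = St ` Q" (is "?L = ?R")
proof (intro equalityI subsetI)
  fix \<Sigma> assume "\<Sigma> \<in> ?L"
  then obtain a b where S: "\<Sigma> \<subseteq> P" "a \<in> \<Sigma>" "b \<in> \<Sigma>" "a \<noteq> b" "undivided \<Sigma>" 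
    "\<And>\<Sigma>'. \<Sigma> \<subseteq> \<Sigma>' \<Longrightarrow> \<Sigma>' \<subseteq> P \<Longrightarrow> undivided \<Sigma>' \<Longrightarrow> \<Sigma>' = \<Sigma>" by auto
  have "(a, b) \<in> costar" 
    using between_or_costar[of a b] S(1-5) unfolding undivided_def by blast
  then obtain q where q: "q \<in> Q" "a \<in> St q" "b \<in> St q" unfolding costar_def by auto
  have "\<Sigma> \<subseteq> St q" by (rule undivided_sub[OF S(1,5) q S(2,3,4)])
  then have "St q = \<Sigma>" using S(6) St_sub[OF q(1)] undivided_St[OF q(1)] by simp
  then show "\<Sigma> \<in> ?R" using q by auto
next
  fix \<Sigma> assume "\<Sigma> \<in> ?R"
  then obtain q where q: "q \<in> Q" "\<Sigma> = St q" by auto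
  obtain a b where ab: "a \<in> St q" "b \<in> St q" "a \<noteq> b" using St_two[OF q(1)] by auto
  have "\<Sigma>' = St q" if "St q \<subseteq> \<Sigma>'" "\<Sigma>' \<subseteq> P" "undivided \<Sigma>'" for \<Sigma>'
    using undivided_sub[OF that(2,3) q(1) ab(1,2) _ _ ab(3)] ab that(1) by auto
  then show "\<Sigma> \<in> ?L" using q ab St_sub[OF q(1)] undivided_St[OF q(1)] by auto
qed

lemma St_inj: "inj_on St Q"
proof (rule inj_onI, rule ccontr)
  fix q q' assume q: "q \<in> Q" "q' \<in> Q" "St q = St q'" "q \<noteq> q'"
  obtain a b where ab: "a \<in> St q" "b \<in> St q" "a \<noteq> b" using St_two[OF q(1)] by auto
  obtain s where "s \<in> sides a" "s b" "\<not> s b" 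
    using sep_at[OF q(1,2,4) ab(1) _ ab(2), of b] ab q(3) by auto
  then show False by simp
qed

definition star_graph :: "('p + 'q) sgraph" where
  "star_graph = \<lparr>verts = Inl ` P \<union> Inr ` Q, edges = {{Inl a, Inr q} | a q. a \<in> P \<and> q \<in> Q \<and> a \<in> St q}\<rparr>"

lemma star_graph_edge: 
  "{u, v} \<in> edges star_graph \<longleftrightarrow> 
     (\<exists>a q. a \<in> P \<and> q \<in> Q \<and> a \<in> St q \<and> (u = Inl a \<and> v = Inr q \<or> u = Inr q \<and> v = Inl a))"
  unfolding star_graph_def by (auto simp: doubleton_eq_iff)

text \<open>\<open>M\<close> is what \<open>q\<close> reaches without passing through
  \<open>c\<close>. It can be left only towards \<open>c\<close>, and only from \<open>q\<close>,
  because any other star at \<open>c\<close> is separated from \<open>q\<close> by some side at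
  \<open>c\<close>.\<close>

lemma star_graph_bridge:
  assumes c: "c \<in> P" "q \<in> Q" "c \<in> St q"
  shows "\<exists>M. Inr q \<in> M \<and> Inl c \<notin> M \<and> 
     (\<forall>a b. {a, b} \<in> edges star_graph \<longrightarrow> a \<in> M \<longrightarrow> b \<notin> M \<longrightarrow> a = Inr q \<and> b = Inl c)"
proof -
  define A where "A = {(x, y). {x, y} \<in> edges star_graph \<and> x \<noteq> Inl c \<and> y \<noteq> Inl c}"
  let ?M = "{w. (Inr q, w) \<in> A\<^sup>*}"
  have nc: "w \<noteq> Inl c" if "(Inr q, w) \<in> A\<^sup>*" for w
    using that by (induction rule: rtrancl_induct) (auto simp: A_def)
  have cross: "a = Inr q \<and> b = Inl c" if e: "{a, b} \<in> edges star_graph" "a \<in> ?M" "b \<notin> ?M" for a b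
  proof -
    have b: "b = Inl c"
    proof (rule ccontr)
      assume "b \<noteq> Inl c"
      moreover have "a \<noteq> Inl c" using nc[of a] e(2) by simp
      ultimately have "(a, b) \<in> A" using e(1) unfolding A_def by simp
      then have "(Inr q, b) \<in> A\<^sup>*" using e(2) rtrancl_into_rtrancl[of "Inr q" a A b] by simp
      then show False using e(3) by simp
    qed
    then obtain q' where q': "a = Inr q'" "q' \<in> Q" "c \<in> St q'" using e(1) star_graph_edge[of a b] by auto
    have "q' = q"
    proof (rule ccontr)
      assume "q' \<noteq> q"
      then obtain s x y where s: "s \<in> sides c" "x \<in> St q - {c}" "y \<in> St q' - {c}" "s x" "\<not> s y"
        using side_sep[OF c(2) q'(2) _ c(3) q'(3)] by metis
      \<comment> \<open>Everything that \<open>q\<close> reaches stays on one side of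
        \<open>c\<close>.\<close>
      have inv: "case w of Inl p \<Rightarrow> s p | Inr r \<Rightarrow> \<forall>p\<in>St r - {c}. s p" if "(Inr q, w) \<in> A\<^sup>*" for w
        using that
      proof (induction rule: rtrancl_induct)
        case base
        then show ?case using side_const[OF c(1,2) s(1), of x] s by auto
      next
        case (step w w')
        then obtain p r where pr: "p \<in> P" "r \<in> Q" "p \<in> St r" "w = Inl p \<and> w' = Inr r \<or> w = Inr r \<and> w' = Inl p" 
          "p \<noteq> c" unfolding A_def star_graph_edge by blast
        from pr(4) show ?case
        proof
          assume w: "w = Inl p \<and> w' = Inr r"
          then have "s p" using step(3) by simp
          then have "s p'" if "p' \<in> St r - {c}" for p'
            using side_const[OF c(1) pr(2) s(1) pr(3), of p'] pr(5) that by simp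
          then show ?thesis using w by simp
        next
          assume "w = Inr r \<and> w' = Inl p"
          then show ?thesis using step(3) pr(3,5) by simp
        qed
      qed
      have "\<forall>p\<in>St q' - {c}. s p" using inv[of a] e(2) q'(1) by simp
      then show False using s by auto
    qed
    then show ?thesis using b q' by simp
  qed
  show ?thesis
  proof (intro exI[of _ ?M] conjI allI impI)
    show "Inr q \<in> ?M" by simp
    show "Inl c \<notin> ?M" using nc[of "Inl c"] by auto
    fix a b assume "{a, b} \<in> edges star_graph" "a \<in> ?M" "b \<notin> ?M"
    then have "a = Inr q \<and> b = Inl c" by (rule cross)
    then show "a = Inr q" "b = Inl c" by simp_all
  qed
qed

lemma star_graph_tree: "is_tree star_graph"
proof -
  let ?A = "{(a, b). {a, b} \<in> edges star_graph}"
  have "simple_graph star_graph" unfolding simple_graph_def star_graph_def by fastforce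
  moreover have "verts star_graph \<noteq> {}" unfolding star_graph_def using nonempty by auto
  moreover have "\<not> graph_cycle star_graph vs" for vs
  proof (rule no_cycle_if_bridges)
    fix e assume "e \<in> edges star_graph"
    then obtain c q where c: "e = {Inl c, Inr q}" "c \<in> P" "q \<in> Q" "c \<in> St q" unfolding star_graph_def by auto
    obtain M where "Inr q \<in> M" "Inl c \<notin> M" 
      "\<And>a b. {a, b} \<in> edges star_graph \<Longrightarrow> a \<in> M \<Longrightarrow> b \<notin> M \<Longrightarrow> a = Inr q \<and> b = Inl c"
      using star_graph_bridge[OF c(2-4)] by auto
    then show "\<exists>M. (\<exists>x y. e = {x, y} \<and> x \<in> M \<and> y \<notin> M) \<and> 
      (\<forall>a b. {a, b} \<in> edges star_graph \<longrightarrow> a \<in> M \<longrightarrow> b \<notin> M \<longrightarrow> {a, b} = e)"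
      using c(1) by (intro exI[of _ M]) (auto simp: insert_commute)
  qed
  moreover have "connected_graph star_graph"
  proof -
    have sym: "(y, x) \<in> ?A\<^sup>*" if "(x, y) \<in> ?A\<^sup>*" for x y
    proof -
      have "sym ?A" by (auto simp: sym_def insert_commute)
      then show ?thesis using that by (meson sym_rtrancl symD)
    qed
    have ll: "(Inl a, Inl b) \<in> ?A\<^sup>*" if "a \<in> P" "b \<in> P" for a b
      using connected[OF that]
    proof (induction rule: rtrancl_induct)
      case (step y z)
      then obtain q where q: "q \<in> Q" "y \<in> St q" "z \<in> St q" by auto
      then have "(Inl y, Inr q) \<in> ?A" "(Inr q, Inl z) \<in> ?A" using star_graph_edge St_sub by fastforce+
      then show ?case using step(3) by (meson rtrancl_into_rtrancl)
    qed simp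
    have rl: "\<exists>a\<in>P. (u, Inl a) \<in> ?A\<^sup>*" if u: "u \<in> verts star_graph" for u
    proof (cases u)
      case (Inl a)
      then show ?thesis using u unfolding star_graph_def by auto
    next
      case (Inr q)
      then have q: "q \<in> Q" using u unfolding star_graph_def by auto
      then obtain a where a: "a \<in> St q" "a \<in> P" using St_two St_sub by blast
      then have "(u, Inl a) \<in> ?A" using star_graph_edge Inr q by auto
      then show ?thesis using a by auto
    qed
    show ?thesis unfolding connected_graph_def
    proof (intro ballI)
      fix u v assume "u \<in> verts star_graph" "v \<in> verts star_graph"
      then obtain a b where "a \<in> P" "b \<in> P" "(u, Inl a) \<in> ?A\<^sup>*" "(v, Inl b) \<in> ?A\<^sup>*" using rl by meson
      then show "(u, v) \<in> ?A\<^sup>*" using ll sym by (meson rtrancl_trans)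
    qed
  qed
  ultimately show ?thesis unfolding is_tree_def by auto
qed

end

section \<open>Transport along isomorphisms\<close>

lemma edge_image_iff:
  assumes sg: "simple_graph \<Gamma>" and uv: "u \<in> verts \<Gamma>" "v \<in> verts \<Gamma>" "inj_on f (verts \<Gamma>)"
  shows "{f u, f v} \<in> (\<lambda>e. f ` e) ` edges \<Gamma> \<longleftrightarrow> {u, v} \<in> edges \<Gamma>"
proof
  have ev: "e \<subseteq> verts \<Gamma>" if "e \<in> edges \<Gamma>" for e
    using sg that unfolding simple_graph_def by auto
  assume "{f u, f v} \<in> (\<lambda>e. f ` e) ` edges \<Gamma>"
  then obtain e where e: "e \<in> edges \<Gamma>" "f ` {u, v} = f ` e" by auto
  then have "{u, v} = e" using inj_on_image_eq_iff[OF assms(4), of "{u, v}" e] ev[OF e(1)] assms(2,3) by simp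
  then show "{u, v} \<in> edges \<Gamma>" using e by simp
next
  assume "{u, v} \<in> edges \<Gamma>"
  then show "{f u, f v} \<in> (\<lambda>e. f ` e) ` edges \<Gamma>" by (rule rev_image_eqI) simp
qed

lemma is_tree_image:
  assumes t: "is_tree \<Gamma>" and f: "inj_on f (verts \<Gamma>)" 
    and \<Delta>: "verts \<Delta> = f ` verts \<Gamma>" "edges \<Delta> = (\<lambda>e. f ` e) ` edges \<Gamma>"
  shows "is_tree \<Delta>"
proof -
  have sg: "simple_graph \<Gamma>" and cn: "connected_graph \<Gamma>" and nc: "\<And>vs. \<not> graph_cycle \<Gamma> vs"
    using t unfolding is_tree_def by auto
  have ev: "e \<subseteq> verts \<Gamma>" if "e \<in> edges \<Gamma>" for e
    using sg that unfolding simple_graph_def by auto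
  have edge: "{f u, f v} \<in> edges \<Delta> \<longleftrightarrow> {u, v} \<in> edges \<Gamma>" if "u \<in> verts \<Gamma>" "v \<in> verts \<Gamma>" for u v
    unfolding \<Delta>(2) by (rule edge_image_iff[OF sg that f])
  have "simple_graph \<Delta>" unfolding simple_graph_def
  proof
    fix e assume "e \<in> edges \<Delta>"
    then obtain e' where e': "e' \<in> edges \<Gamma>" "e = f ` e'" unfolding \<Delta> by auto
    then obtain u v where "u \<in> verts \<Gamma>" "v \<in> verts \<Gamma>" "u \<noteq> v" "e' = {u, v}" 
      using sg unfolding simple_graph_def by blast
    then show "\<exists>u\<in>verts \<Delta>. \<exists>v\<in>verts \<Delta>. u \<noteq> v \<and> e = {u, v}"
      using e' inj_onD[OF f, of u v] unfolding \<Delta> by (intro bexI[of _ "f u"] bexI[of _ "f v"]) auto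
  qed
  moreover have "verts \<Delta> \<noteq> {}" using t \<Delta> unfolding is_tree_def by auto
  moreover have "connected_graph \<Delta>" unfolding connected_graph_def
  proof (intro ballI)
    fix u v assume "u \<in> verts \<Delta>" "v \<in> verts \<Delta>"
    then obtain a b where ab: "u = f a" "v = f b" "a \<in> verts \<Gamma>" "b \<in> verts \<Gamma>" using \<Delta> by auto
    then have "(a, b) \<in> {(a, b). {a, b} \<in> edges \<Gamma>}\<^sup>*" using cn unfolding connected_graph_def by auto
    then have "(f a, f b) \<in> {(a, b). {a, b} \<in> edges \<Delta>}\<^sup>*"
    proof (induction rule: rtrancl_induct)
      case (step y z)
      then have "{y, z} \<in> edges \<Gamma>" by auto
      then have "(f y, f z) \<in> {(a, b). {a, b} \<in> edges \<Delta>}" using edge[of y z] ev by auto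
      then show ?case using step(3) by (rule rtrancl_into_rtrancl[rotated])
    qed simp
    then show "(u, v) \<in> {(a, b). {a, b} \<in> edges \<Delta>}\<^sup>*" using ab by simp
  qed
  moreover have "\<not> graph_cycle \<Delta> vs" for vs
  proof
    assume "graph_cycle \<Delta> vs"
    then have c: "length vs \<ge> 3" "distinct vs" "successively (\<lambda>a b. {a, b} \<in> edges \<Delta>) vs" 
      "{last vs, hd vs} \<in> edges \<Delta>" unfolding graph_cycle_def by auto
    have edv: "u \<in> f ` verts \<Gamma>" if uv: "{u, v} \<in> edges \<Delta>" for u v
    proof -
      obtain e where "e \<in> edges \<Gamma>" "{u, v} = f ` e" using uv unfolding \<Delta> by auto
      then show ?thesis using ev by blast
    qed
    have sub: "set vs \<subseteq> f ` verts \<Gamma>"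
    proof
      fix x assume "x \<in> set vs"
      then obtain i where i: "i < length vs" "x = vs ! i" by (auto simp: in_set_conv_nth)
      show "x \<in> f ` verts \<Gamma>"
      proof (cases "Suc i < length vs")
        case True
        then show ?thesis using c(3) i edv by (auto simp: successively_conv_nth)
      next
        case False
        then have "i = length vs - 1" "vs \<noteq> []" using i by auto
        then have "x = last vs" using i by (simp add: last_conv_nth)
        then show ?thesis using c(4) edv by auto
      qed
    qed
    define ws where "ws = map (inv_into (verts \<Gamma>) f) vs"
    have "map f ws = map (\<lambda>x. x) vs" 
      unfolding ws_def map_map using sub by (intro map_cong) (auto simp: f_inv_into_f)
    then have ws: "vs = map f ws" "set ws \<subseteq> verts \<Gamma>" 
      using sub unfolding ws_def by (auto intro: inv_into_into)
    have "ws \<noteq> []" using c(1) ws by auto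
    then have "hd vs = f (hd ws)" "last vs = f (last ws)" "hd ws \<in> verts \<Gamma>" "last ws \<in> verts \<Gamma>"
      using ws by (auto simp: hd_map last_map)
    then have "{last ws, hd ws} \<in> edges \<Gamma>" using c(4) edge by auto
    moreover have "successively (\<lambda>a b. {a, b} \<in> edges \<Gamma>) ws"
      unfolding successively_conv_nth
    proof (intro allI impI)
      fix i assume i: "Suc i < length ws"
      then have "{f (ws ! i), f (ws ! Suc i)} \<in> edges \<Delta>" 
        using c(3) unfolding ws(1) by (auto simp: successively_conv_nth)
      moreover have "ws ! i \<in> verts \<Gamma>" "ws ! Suc i \<in> verts \<Gamma>" using ws(2) i by (auto simp: subset_iff)
      ultimately show "{ws ! i, ws ! Suc i} \<in> edges \<Gamma>" using edge by simp
    qed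
    ultimately have "graph_cycle \<Gamma> ws"
      using c(1,2) ws(1) unfolding graph_cycle_def by (auto simp: distinct_map)
    then show False using nc by simp
  qed
  ultimately show ?thesis unfolding is_tree_def by auto
qed

lemma group_actionI:
  assumes G: "group G" and cl: "\<And>g x. g \<in> carrier G \<Longrightarrow> x \<in> S \<Longrightarrow> \<phi> g x \<in> S"
    and one: "\<And>x. x \<in> S \<Longrightarrow> \<phi> \<one>\<^bsub>G\<^esub> x = x"
    and mult: "\<And>g h x. g \<in> carrier G \<Longrightarrow> h \<in> carrier G \<Longrightarrow> x \<in> S \<Longrightarrow> \<phi> (g \<otimes>\<^bsub>G\<^esub> h) x = \<phi> g (\<phi> h x)"
  shows "group_action G S (\<lambda>g. restrict (\<phi> g) S)"
proof -
  interpret group G by (rule G)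
  have bij: "bij_betw (\<phi> g) S S" if g: "g \<in> carrier G" for g
  proof (rule bij_betw_byWitness[of S "\<phi> (inv\<^bsub>G\<^esub> g)"])
    show "\<forall>a\<in>S. \<phi> (inv\<^bsub>G\<^esub> g) (\<phi> g a) = a" using mult[of "inv\<^bsub>G\<^esub> g" g] one g by simp
    show "\<forall>a\<in>S. \<phi> g (\<phi> (inv\<^bsub>G\<^esub> g) a) = a" using mult[of g "inv\<^bsub>G\<^esub> g"] one g by simp
    show "\<phi> g ` S \<subseteq> S" "\<phi> (inv\<^bsub>G\<^esub> g) ` S \<subseteq> S" using cl g by auto
  qed
  have B: "restrict (\<phi> g) S \<in> carrier (BijGroup S)" if "g \<in> carrier G" for g
    unfolding BijGroup_def Bij_def using bij[OF that] by simp
  have "restrict (\<phi> (g \<otimes>\<^bsub>G\<^esub> h)) S = restrict (\<phi> g) S \<otimes>\<^bsub>BijGroup S\<^esub> restrict (\<phi> h) S" 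
    if "g \<in> carrier G" "h \<in> carrier G" for g h
  proof -
    have "restrict (\<phi> g) S \<otimes>\<^bsub>BijGroup S\<^esub> restrict (\<phi> h) S = compose S (restrict (\<phi> g) S) (restrict (\<phi> h) S)"
      using B[OF that(1)] B[OF that(2)] unfolding BijGroup_def by simp
    also have "\<dots> = restrict (\<phi> (g \<otimes>\<^bsub>G\<^esub> h)) S"
      using mult[OF that] cl[OF that(2)] unfolding compose_def by (auto simp: restrict_def)
    finally show ?thesis by simp
  qed
  then show ?thesis unfolding group_action_def group_hom_def group_hom_axioms_def
    using G B group_BijGroup by (auto simp: hom_def)
qed

lemma graph_action_image:
  assumes act: "graph_action G \<Gamma> act" and sg: "simple_graph \<Gamma>"
    and f: "verts \<Delta> = f ` verts \<Gamma>" "edges \<Delta> = (\<lambda>e. f ` e) ` edges \<Gamma>"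
      "\<And>g v. g \<in> carrier G \<Longrightarrow> v \<in> verts \<Gamma> \<Longrightarrow> f (act g v) = act' g (f v)"
  shows "graph_action G \<Delta> act'"
proof -
  have ga: "group_action G (verts \<Gamma>) (\<lambda>g. restrict (act g) (verts \<Gamma>))" 
    and ae: "\<And>g e. g \<in> carrier G \<Longrightarrow> e \<in> edges \<Gamma> \<Longrightarrow> act g ` e \<in> edges \<Gamma>"
    using act unfolding graph_action_def by auto
  interpret G: group G using ga unfolding group_action_def group_hom_def by simp
  have ev: "e \<subseteq> verts \<Gamma>" if "e \<in> edges \<Gamma>" for e
    using sg that unfolding simple_graph_def by auto
  have cl: "act g v \<in> verts \<Gamma>" if "g \<in> carrier G" "v \<in> verts \<Gamma>" for g v
    using group_action.element_image[OF ga that(1) that(2), of "act g v"] that by simp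
  have one: "act \<one>\<^bsub>G\<^esub> v = v" if "v \<in> verts \<Gamma>" for v
    using group_action.id_eq_one[OF ga] that by (metis restrict_apply')
  have mult: "act (g \<otimes>\<^bsub>G\<^esub> k) v = act g (act k v)" 
    if "g \<in> carrier G" "k \<in> carrier G" "v \<in> verts \<Gamma>" for g k v
    using group_action.composition_rule[OF ga that(3,1,2)] that cl by simp
  show ?thesis
    unfolding graph_action_def
  proof (intro conjI ballI)
    show "group_action G (verts \<Delta>) (\<lambda>g. restrict (act' g) (verts \<Delta>))"
    proof (rule group_actionI[OF G.group_axioms])
      show "act' g x \<in> verts \<Delta>" if "g \<in> carrier G" "x \<in> verts \<Delta>" for g x
        using that f(3)[OF that(1), symmetric] cl unfolding f(1) by auto
      show "act' \<one>\<^bsub>G\<^esub> x = x" if "x \<in> verts \<Delta>" for x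
        using that f(3)[OF G.one_closed, symmetric] one unfolding f(1) by auto
      show "act' (g \<otimes>\<^bsub>G\<^esub> k) x = act' g (act' k x)" 
        if "g \<in> carrier G" "k \<in> carrier G" "x \<in> verts \<Delta>" for g k x
        using that f(3)[symmetric] mult cl unfolding f(1) by auto
    qed
    show "act' g ` e \<in> edges \<Delta>" if g: "g \<in> carrier G" and e: "e \<in> edges \<Delta>" for g e
    proof -
      obtain e' where e': "e' \<in> edges \<Gamma>" "e = f ` e'" using e unfolding f(2) by auto
      have "act' g ` e = f ` act g ` e'" 
        unfolding e'(2) image_image using f(3)[OF g] ev[OF e'(1)] by (intro image_cong) auto
      then show ?thesis unfolding f(2) using ae[OF g e'(1)] by auto
    qed
  qed
qed

text \<open>The two target graphs are compared through a common source, so only injective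
  equivariant maps out of the simpler graph are needed.\<close>

lemma equivariantly_isomorphic_images:
  assumes act: "graph_action G \<Gamma> act" and sg: "simple_graph \<Gamma>"
    and f: "inj_on f (verts \<Gamma>)" "verts \<Delta> = f ` verts \<Gamma>" "edges \<Delta> = (\<lambda>e. f ` e) ` edges \<Gamma>"
      "\<And>g v. g \<in> carrier G \<Longrightarrow> v \<in> verts \<Gamma> \<Longrightarrow> f (act g v) = act1 g (f v)"
    and h: "inj_on h (verts \<Gamma>)" "verts \<Lambda> = h ` verts \<Gamma>" "edges \<Lambda> = (\<lambda>e. h ` e) ` edges \<Gamma>"
      "\<And>g v. g \<in> carrier G \<Longrightarrow> v \<in> verts \<Gamma> \<Longrightarrow> h (act g v) = act2 g (h v)"
  shows "equivariantly_isomorphic G \<Delta> act1 \<Lambda> act2"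
proof -
  have ga: "group_action G (verts \<Gamma>) (\<lambda>g. restrict (act g) (verts \<Gamma>))" 
    using act unfolding graph_action_def by auto
  have cl: "act g v \<in> verts \<Gamma>" if "g \<in> carrier G" "v \<in> verts \<Gamma>" for g v
    using group_action.element_image[OF ga that(1) that(2), of "act g v"] that by simp
  let ?k = "\<lambda>x. h (inv_into (verts \<Gamma>) f x)"
  have k: "?k (f v) = h v" if "v \<in> verts \<Gamma>" for v using f(1) that by simp
  show ?thesis unfolding equivariantly_isomorphic_def
  proof (intro conjI exI[of _ ?k] ballI)
    show "graph_action G \<Delta> act1" by (rule graph_action_image[of G \<Gamma> act \<Delta> f act1]; fact act sg f)
    show "graph_action G \<Lambda> act2" by (rule graph_action_image[of G \<Gamma> act \<Lambda> h act2]; fact act sg h)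
    have "bij_betw f (verts \<Gamma>) (verts \<Delta>)" using f(1,2) by (simp only: bij_betw_def)
    then have "bij_betw (inv_into (verts \<Gamma>) f) (verts \<Delta>) (verts \<Gamma>)" by (rule bij_betw_inv_into)
    moreover have "bij_betw h (verts \<Gamma>) (verts \<Lambda>)" using h(1,2) by (simp only: bij_betw_def)
    ultimately have "bij_betw (h \<circ> inv_into (verts \<Gamma>) f) (verts \<Delta>) (verts \<Lambda>)" by (rule bij_betw_trans)
    then show "bij_betw ?k (verts \<Delta>) (verts \<Lambda>)" by (simp only: comp_def)
    show "{u, v} \<in> edges \<Delta> \<longleftrightarrow> {?k u, ?k v} \<in> edges \<Lambda>" if uv: "u \<in> verts \<Delta>" "v \<in> verts \<Delta>" for u v
    proof -
      obtain a b where ab: "u = f a" "v = f b" "a \<in> verts \<Gamma>" "b \<in> verts \<Gamma>" using uv f(2) by auto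
      show ?thesis unfolding ab(1,2) k[OF ab(3)] k[OF ab(4)] f(3) h(3) 
        using edge_image_iff[OF sg ab(3,4) f(1)] edge_image_iff[OF sg ab(3,4) h(1)] by simp
    qed
    show "?k (act1 g v) = act2 g (?k v)" if gv: "g \<in> carrier G" "v \<in> verts \<Delta>" for g v
    proof -
      obtain a where a: "v = f a" "a \<in> verts \<Gamma>" using gv f(2) by auto
      show ?thesis using f(4)[OF gv(1) a(2), symmetric] h(4)[OF gv(1) a(2)] k[OF a(2)] 
          k[OF cl[OF gv(1) a(2)]] a(1) by simp
    qed
  qed
qed

section \<open>Stars\<close>

context tree_action
begin

lemma hf_nontriv:
  assumes "Y \<in> CY" "{u, v} \<in> Y"
  shows "nontriv Y (hf u v)"
proof -
  have e: "{u, v} \<in> E" using cyl_edge[OF assms] .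
  show ?thesis unfolding nontriv_def hf_compl[OF e, symmetric]
    using hf_not_small[OF assms(1) e] hf_not_small[OF assms(1) edge_commute[OF e]] by simp
qed

lemma cyl_index:
  assumes "Y \<in> CY"
  obtains \<alpha> where "\<alpha> \<in> I" "snd \<alpha> = Y"
proof -
  obtain e where e: "e \<in> Y" using cyl_nonempty[OF assms] .
  then obtain u v where uv: "{u, v} \<in> Y" using edgeE[OF cyl_edge[OF assms e]] by metis
  obtain ox where "(ox, Y) \<in> I" using reps_cover[OF assms alg_hf[OF assms uv] hf_nontriv[OF assms uv]] .
  then show ?thesis using that by auto
qed

lemma None_I:
  assumes "Y \<in> CY" "\<not> ge3 Y"
  shows "(None, Y) \<in> I"
proof -
  obtain \<alpha> where a: "\<alpha> \<in> I" "snd \<alpha> = Y" using cyl_index[OF assms(1)] .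
  then show ?thesis using I_Some assms(2) by (cases \<alpha>; cases "fst \<alpha>") auto
qed

text \<open>The component of \<open>Y\<close> that is met first when entering \<open>Y\<close> at
  \<open>x\<close>.\<close>

definition near :: "'v \<Rightarrow> 'v set set \<Rightarrow> 'v option \<times> 'v set set" where
  "near x Y = (if (Some x, Y) \<in> I then (Some x, Y) else (None, Y))"

text \<open>If the branch at \<open>x\<close> is not an index although \<open>ge3\<close> holds,
  \<open>x\<close> has infinite valence in \<open>Y\<close>. Four branches suffice: the union of two
  contains two disjoint half-trees and so does its complement, hence neither is an atom.\<close>

lemma near_I:
  assumes Y: "Y \<in> CY" and x: "x \<in> V0" "x \<in> \<Union>Y"
  shows "near x Y \<in> I"
proof (cases "(Some x, Y) \<in> I")
  case False
  have "(None, Y) \<in> I"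
  proof (cases "ge3 Y")
    case True
    then have "\<not> fval Y x" using False Y x unfolding I_Some by blast
    then have inf: "infinite {y. {x, y} \<in> Y \<and> hf x y \<subseteq> V}"
      using infinite_branches[OF Y alg_V V0_sub[OF x(1)]] by simp
    obtain y1 where y1: "{x, y1} \<in> Y" using infinite_pick[OF inf, of "{}"] by auto
    obtain y2 where y2: "{x, y2} \<in> Y" "y2 \<noteq> y1" using infinite_pick[OF inf, of "{y1}"] by auto
    obtain y3 where y3: "{x, y3} \<in> Y" "y3 \<noteq> y1" "y3 \<noteq> y2" 
      using infinite_pick[OF inf, of "{y1, y2}"] by auto
    obtain y4 where y4: "{x, y4} \<in> Y" "y4 \<noteq> y1" "y4 \<noteq> y2" "y4 \<noteq> y3" 
      using infinite_pick[OF inf, of "{y1, y2, y3}"] by auto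
    note e = cyl_edge[OF Y y1] cyl_edge[OF Y y2(1)] cyl_edge[OF Y y3(1)] cyl_edge[OF Y y4(1)]
    let ?S = "hf x y1 \<union> hf x y2"
    have S: "?S \<in> alg Y" using alg_Un alg_hf[OF Y] y1 y2 by simp
    have d: "hf x y1 \<inter> hf x y2 = {}" "hf x y1 \<inter> hf x y3 = {}" "hf x y2 \<inter> hf x y3 = {}"
      "hf x y1 \<inter> hf x y4 = {}" "hf x y2 \<inter> hf x y4 = {}" "hf x y3 \<inter> hf x y4 = {}"
      using hf_branches[OF e(1,2)] hf_branches[OF e(1,3)] hf_branches[OF e(2,3)] 
        hf_branches[OF e(1,4)] hf_branches[OF e(2,4)] hf_branches[OF e(3,4)] y2 y3 y4 by auto
    have n1: "\<not> small Y ?S" by (rule not_small_if_hf[OF Y e(1)]) auto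
    have n2: "\<not> small Y (V - ?S)" by (rule not_small_if_hf[OF Y e(3)]) (use d hf_sub_V in auto)
    have "\<not> small Y (?S \<inter> hf x y1)" by (rule not_small_if_hf[OF Y e(1)]) auto
    moreover have "\<not> small Y (?S - hf x y1)" by (rule not_small_if_hf[OF Y e(2)]) (use d in auto)
    ultimately have n3: "\<not> atom Y ?S" using alg_hf[OF Y y1] unfolding atom_def by blast
    have "\<not> small Y ((V - ?S) \<inter> hf x y3)" 
      by (rule not_small_if_hf[OF Y e(3)]) (use d hf_sub_V in auto)
    moreover have "\<not> small Y ((V - ?S) - hf x y3)"
      by (rule not_small_if_hf[OF Y e(4)]) (use d hf_sub_V in auto)
    ultimately have n4: "\<not> atom Y (V - ?S)" using alg_hf[OF Y y3(1)] unfolding atom_def by blast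
    have "?S \<in> reps (None, Y)" unfolding reps_None nontriv_def using S n1 n2 n3 n4 by simp
    then show ?thesis unfolding I_def using Y by auto
  qed (rule None_I[OF Y])
  then show ?thesis unfolding near_def using False by simp
qed (simp add: near_def)

text \<open>Without the component \<open>(None, Y)\<close>, every non-trivial set is an atom or the
  complement of one. Two of the disjoint sets from \<open>ge3\<close> then contain different
  vertices of atoms.\<close>

lemma two_Some:
  assumes Y: "Y \<in> CY" and n: "(None, Y) \<notin> I"
  shows "\<exists>x z. x \<noteq> z \<and> (Some x, Y) \<in> I \<and> (Some z, Y) \<in> I"
proof -
  have "ge3 Y" using None_I[OF Y] n by auto
  then obtain P Q R where PQR: "P \<in> alg Y" "Q \<in> alg Y" "R \<in> alg Y" "\<not> small Y P" "\<not> small Y Q" "\<not> small Y R"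
    "P \<inter> Q = {}" "P \<inter> R = {}" "Q \<inter> R = {}" unfolding ge3_def by blast
  have *: "\<exists>x. x \<in> A \<and> (Some x, Y) \<in> I" 
    if A: "A \<in> alg Y" "\<not> small Y A" and B: "B \<in> alg Y" "\<not> small Y B" "A \<inter> B = {}" 
      and C: "\<not> small Y C" "C \<subseteq> V" "A \<inter> C = {}" "B \<inter> C = {}" for A B C
  proof -
    have "B \<subseteq> V - A" using algD(1)[OF B(1)] B(3) by auto
    then have nt: "nontriv Y A" unfolding nontriv_def using A B(2) small_mono by blast
    obtain ox where ox: "(ox, Y) \<in> I" "A \<in> reps (ox, Y)" using reps_cover[OF Y A(1) nt] .
    then obtain x where x: "ox = Some x" using n by (cases ox) auto
    have Ix: "(Some x, Y) \<in> I" using ox x by simp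
    \<comment> \<open>Otherwise the complement of \<open>A\<close> would be an atom, but it contains
      the disjoint non-small sets \<open>B\<close> and \<open>C\<close>.\<close>
    have "x \<in> A"
    proof (rule ccontr)
      assume "x \<notin> A"
      then have "eqv Y (V - A) (branch Y x)" using reps_Some_mem(2)[OF Ix] ox x by simp
      moreover have "atom Y (branch Y x)" using branch_atom Ix I_Some by simp
      ultimately have "atom Y (V - A)" using atom_eqv[OF Y eqv_sym _ alg_compl[OF A(1)]] by blast
      then have "small Y ((V - A) \<inter> B) \<or> small Y ((V - A) - B)" using B(1) unfolding atom_def by auto
      moreover have "(V - A) \<inter> B = B" "C \<subseteq> (V - A) - B" using algD(1)[OF B(1)] B(3) C by auto
      ultimately show False using B(2) C(1) small_mono by metis
    qed
    then show ?thesis using Ix by auto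
  qed
  obtain x where x: "x \<in> P" "(Some x, Y) \<in> I" 
    using *[OF PQR(1,4,2,5,7,6) _ PQR(8,9)] algD(1)[OF PQR(3)] by auto
  have d: "Q \<inter> P = {}" using PQR(7) by auto
  obtain z where z: "z \<in> Q" "(Some z, Y) \<in> I" 
    using *[OF PQR(2,5,1,4) d PQR(6) _ PQR(9,8)] algD(1)[OF PQR(3)] by auto
  have "x \<noteq> z" using x(1) z(1) PQR(7) by auto
  then show ?thesis using x(2) z(2) by (intro exI conjI)
qed

text \<open>The atom is enlarged until it is no longer one: some set of the component meets
  \<open>S0\<close> in a small set and is not an atom; of its two parts, the one that avoids
  \<open>z\<close> is added to \<open>S0\<close>.\<close>

lemma separating_rep_atom:
  assumes Y: "Y \<in> CY" and I: "(None, Y) \<in> I" and ge3: "ge3 Y" 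
    and S0: "atom Y S0" and z: "z \<in> V0" "z \<in> \<Union>Y" "z \<notin> S0"
  shows "\<exists>S\<in>reps (None, Y). S0 \<subseteq> S \<and> z \<notin> S"
proof -
  obtain Q0 where Q0: "Q0 \<in> reps (None, Y)" using I unfolding I_def by auto
  have S0a: "S0 \<in> alg Y" "\<not> small Y S0" using S0 unfolding atom_def by auto
  have "Q0 \<in> alg Y" using Q0 reps_None by simp
  then have "small Y (S0 \<inter> Q0) \<or> small Y (S0 - Q0)" using S0 unfolding atom_def by auto
  moreover have "S0 - Q0 = S0 \<inter> (V - Q0)" using algD(1)[OF S0a(1)] by auto
  ultimately obtain Q where Q: "Q \<in> reps (None, Y)" "small Y (S0 \<inter> Q)" 
    using Q0 reps_compl[OF Q0] by auto
  have Q': "Q \<in> alg Y" "\<not> small Y Q" "\<not> atom Y Q" "\<not> atom Y (V - Q)" 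
    using Q(1) ge3 unfolding reps_None nontriv_def by auto
  obtain P where P: "P \<in> alg Y" "\<not> small Y (Q \<inter> P)" "\<not> small Y (Q - P)" 
    using Q' unfolding atom_def by auto
  \<comment> \<open>What remains outside both sets is not small, since otherwise the complement of
    \<open>Q\<close> would be equivalent to the atom \<open>S0\<close>. It prevents the complement
    of the enlarged set from being an atom.\<close>
  have D: "\<not> small Y (V - Q - S0)"
  proof
    assume d: "small Y (V - Q - S0)"
    have "eqv Y S0 (V - Q)" by (rule small_cover[OF Y d Q(2)]) (use algD(1)[OF S0a(1)] in auto)
    then show False using atom_eqv[OF Y _ S0 alg_compl[OF Q'(1)]] Q'(4) by simp
  qed
  have main: ?thesis 
    if Q12: "Q1 \<in> alg Y" "Q2 \<in> alg Y" "Q1 \<subseteq> Q" "Q2 \<subseteq> Q" "Q1 \<inter> Q2 = {}" "\<not> small Y Q1" "\<not> small Y Q2" 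
      and zn: "z \<notin> Q1" for Q1 Q2
  proof -
    let ?S = "S0 \<union> Q1"
    have al: "?S \<in> alg Y" using alg_Un S0a Q12 by simp
    have r1: "\<not> small Y (Q1 - S0)"
    proof
      assume "small Y (Q1 - S0)"
      then have "small Y Q1" by (rule small_cover[OF Y _ Q(2)]) (use Q12 in auto)
      then show False using Q12 by simp
    qed
    have r2: "\<not> small Y (Q2 - S0)"
    proof
      assume "small Y (Q2 - S0)"
      then have "small Y Q2" by (rule small_cover[OF Y _ Q(2)]) (use Q12 in auto)
      then show False using Q12 by simp
    qed
    have V: "Q1 \<subseteq> V" "Q2 \<subseteq> V" "S0 \<subseteq> V" using algD(1) Q12(1,2) S0a by blast+
    have "Q2 - S0 \<subseteq> V - ?S" using V Q12(5) by auto
    then have n2: "\<not> small Y (V - ?S)" using r2 small_mono by blast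
    have n1: "\<not> small Y ?S" using S0a(2) small_mono by blast
    have "?S \<inter> S0 = S0" "?S - S0 = Q1 - S0" by auto
    then have a1: "\<not> atom Y ?S" using S0a r1 unfolding atom_def by metis
    have "(V - ?S) \<inter> Q2 = Q2 - S0" "V - Q - S0 \<subseteq> (V - ?S) - Q2" using V Q12 by auto
    then have a2: "\<not> atom Y (V - ?S)" using r2 D Q12(2) small_mono unfolding atom_def by metis
    have "?S \<in> reps (None, Y)" unfolding reps_None nontriv_def using al n1 n2 a1 a2 by simp
    moreover have "S0 \<subseteq> ?S" "z \<notin> ?S" using zn z(3) by auto
    ultimately show ?thesis by (intro bexI[of _ ?S] conjI)
  qed
  show ?thesis
  proof (cases "z \<in> P")
    case True
    then show ?thesis
      using main[of "Q - P" "Q \<inter> P"] alg_Diff[OF Q'(1) P(1)] alg_Int[OF Q'(1) P(1)] P by blast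
  next
    case False
    then show ?thesis
      using main[of "Q \<inter> P" "Q - P"] alg_Diff[OF Q'(1) P(1)] alg_Int[OF Q'(1) P(1)] P by blast
  qed
qed

text \<open>A half-tree at an edge between \<open>x\<close> and \<open>z\<close> does it, unless
  this half-tree or its complement is an atom; then the atom is enlarged.\<close>

lemma separating_rep:
  assumes Y: "Y \<in> CY" and I: "(None, Y) \<in> I" 
    and x: "x \<in> V0" "x \<in> \<Union>Y" and z: "z \<in> V0" "z \<in> \<Union>Y" and ne: "x \<noteq> z"
  shows "\<exists>S\<in>reps (None, Y). x \<in> S \<and> z \<notin> S"
proof -
  have V: "x \<in> V" "z \<in> V" using V0_sub x z by auto
  obtain e where e: "e \<in> sep x z" using sep_empty_iff[OF V] ne by auto
  have eY: "e \<in> Y" using cyl_convex[OF Y x(2) z(2) e] .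
  obtain u v where uv: "e = {u, v}" "x \<in> hf u v" "z \<notin> hf u v" using e unfolding sep_def by auto
  let ?S = "hf u v"
  have S: "?S \<in> alg Y" "nontriv Y ?S" using alg_hf[OF Y] hf_nontriv[OF Y] eY uv(1) by auto
  show ?thesis
  proof (cases "ge3 Y \<and> (atom Y ?S \<or> atom Y (V - ?S))")
    case False
    then have "?S \<in> reps (None, Y)" using S reps_None by simp
    then show ?thesis using uv by auto
  next
    case True
    then consider "ge3 Y" "atom Y ?S" | "ge3 Y" "atom Y (V - ?S)" by auto
    then show ?thesis
    proof cases
      case 1
      then show ?thesis using separating_rep_atom[OF Y I 1 z uv(3)] uv(2) by auto
    next
      case 2
      obtain S' where S': "S' \<in> reps (None, Y)" "V - ?S \<subseteq> S'" "x \<notin> S'"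
        using separating_rep_atom[OF Y I 2 x] uv(2) by auto
      then show ?thesis using reps_compl[OF S'(1)] V uv(3) by (intro bexI[of _ "V - S'"]) auto
    qed
  qed
qed

text \<open>The stars are indexed by \<open>(Some x, None)\<close> for \<open>x \<in> V0\<close>, by \<open>(Some x, Some Y)\<close> if there are separate 
  components \<open>(Some x, Y)\<close> and \<open>(None, Y)\<close>, and by \<open>(None, Some Y)\<close> if \<open>(None, Y)\<close> is missing.\<close>

definition Q :: "('v option \<times> 'v set set option) set" where
  "Q = {(Some x, None) | x. x \<in> V0} \<union> {(Some x, Some Y) | x Y. (Some x, Y) \<in> I \<and> (None, Y) \<in> I} \<union>
     {(None, Some Y) | Y. Y \<in> CY \<and> (None, Y) \<notin> I}"

definition St :: "'v option \<times> 'v set set option \<Rightarrow> ('v option \<times> 'v set set) set" where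
  "St q = (case snd q of 
      None \<Rightarrow> (case fst q of None \<Rightarrow> {} | Some x \<Rightarrow> near x ` {Y \<in> CY. x \<in> \<Union>Y})
    | Some Y \<Rightarrow> (case fst q of None \<Rightarrow> {\<alpha> \<in> I. snd \<alpha> = Y} | Some x \<Rightarrow> {(Some x, Y), (None, Y)}))"

lemma St_simps: 
  "St (Some x, None) = near x ` {Y \<in> CY. x \<in> \<Union>Y}"
  "St (Some x, Some Y) = {(Some x, Y), (None, Y)}"
  "St (None, Some Y) = {\<alpha> \<in> I. snd \<alpha> = Y}"
  unfolding St_def by simp_all

lemma Q_cases:
  assumes "q \<in> Q"
  obtains (vertex) x where "q = (Some x, None)" "x \<in> V0"
  | (edge) x Y where "q = (Some x, Some Y)" "(Some x, Y) \<in> I" "(None, Y) \<in> I"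
  | (cyl) Y where "q = (None, Some Y)" "Y \<in> CY" "(None, Y) \<notin> I"
  using assms unfolding Q_def by auto

lemma snd_near [simp]: "snd (near x Y) = Y"
  unfolding near_def by simp

lemma St_I: 
  assumes "q \<in> Q" 
  shows "St q \<subseteq> I"
  using assms
proof (cases rule: Q_cases)
  case (vertex x)
  show ?thesis unfolding vertex(1) St_simps using near_I[OF _ vertex(2)] by blast
qed (auto simp: St_simps)

lemma side_near:
  assumes c: "c \<in> I" and S: "S \<in> reps c" and Y': "Y' \<in> CY" and x: "x \<in> V0" "x \<in> \<Union>Y'" and ne: "near x Y' \<noteq> c"
  shows "side c S (near x Y') \<longleftrightarrow> x \<in> S"
proof (cases "Y' = snd c")
  case False
  then show ?thesis unfolding side_def 
    using alg_side_iff[OF I_cyl[OF c] Y' _ reps_alg[OF S] x(2)] by simp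
next
  case True
  show ?thesis
  proof (cases "(Some x, Y') \<in> I")
    case I: True
    then show ?thesis using True unfolding side_def near_def by simp
  next
    case nI: False
    then have "c \<noteq> (None, Y')" using ne unfolding near_def by auto
    then obtain z where z: "c = (Some z, Y')" using True by (cases c; cases "fst c") auto
    then have "x \<noteq> z" using c nI by auto
    then have "x \<in> S \<longleftrightarrow> z \<notin> S" using reps_Some_mem(3)[of z Y' S x] c S z x by simp
    then show ?thesis using nI z unfolding side_def near_def by simp
  qed
qed

lemma side_edge:
  assumes c: "c \<in> I" and S: "S \<in> reps c" and I: "(Some x, Y) \<in> I" 
    and a: "a \<in> {(Some x, Y), (None, Y)}" "a \<noteq> c" "c \<noteq> (Some x, Y)"
  shows "side c S a \<longleftrightarrow> x \<in> S"
proof -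
  have x: "Y \<in> CY" "x \<in> V0" "x \<in> \<Union>Y" using I I_Some by auto
  have "near x Y = (Some x, Y)" using I unfolding near_def by simp
  then have *: "side c S (Some x, Y) \<longleftrightarrow> x \<in> S" using side_near[OF c S x] a(3) by auto
  show ?thesis
  proof (cases "a = (Some x, Y)")
    case False
    then have aN: "a = (None, Y)" using a by auto
    show ?thesis
    proof (cases "Y = snd c")
      case True
      then obtain z where z: "c = (Some z, Y)" using a aN by (cases c; cases "fst c") auto
      then have "x \<noteq> z" using a(3) by auto
      then have "x \<in> S \<longleftrightarrow> z \<notin> S" using reps_Some_mem(3)[of z Y S x] c S z x by simp
      then show ?thesis using aN z unfolding side_def by simp
    next
      case False
      then show ?thesis using * aN unfolding side_def by simp
    qed
  qed (use * in simp)
qed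

lemma St_side_const:
  assumes c: "c \<in> I" and q: "q \<in> Q" and S: "S \<in> reps c" 
    and a: "a \<in> St q" "b \<in> St q" "a \<noteq> c" "b \<noteq> c"
  shows "side c S a \<longleftrightarrow> side c S b"
  using q
proof (cases rule: Q_cases)
  case (vertex x)
  then obtain Y1 Y2 where "a = near x Y1" "Y1 \<in> CY" "x \<in> \<Union>Y1" "b = near x Y2" "Y2 \<in> CY" "x \<in> \<Union>Y2"
    using a by (auto simp: St_simps)
  then show ?thesis using side_near[OF c S _ vertex(2)] a by metis
next
  case (edge x Y)
  show ?thesis
  proof (cases "c = (Some x, Y)")
    case True
    then show ?thesis using a edge by (auto simp: St_simps)
  next
    case False
    then show ?thesis using side_edge[OF c S edge(2)] a edge by (auto simp: St_simps)
  qed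
next
  case (cyl Y)
  then have ab: "a \<in> I" "b \<in> I" "snd a = Y" "snd b = Y" using a by (auto simp: St_simps)
  then obtain x z where xz: "a = (Some x, Y)" "b = (Some z, Y)" 
    using cyl(3) by (cases a; cases b; cases "fst a"; cases "fst b") auto
  show ?thesis
  proof (cases "snd c = Y")
    case False
    then show ?thesis using ab unfolding side_def by simp
  next
    case True
    then obtain w where w: "c = (Some w, Y)" using c cyl(3) by (cases c; cases "fst c") auto
    have "x \<in> V0" "x \<in> \<Union>Y" "z \<in> V0" "z \<in> \<Union>Y" "x \<noteq> w" "z \<noteq> w" using ab xz I_Some a w by auto
    then have "x \<in> S \<longleftrightarrow> z \<in> S" using reps_Some_mem(3)[of w Y S x] reps_Some_mem(3)[of w Y S z] c S w by simp
    then show ?thesis using xz w unfolding side_def by simp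
  qed
qed

text \<open>A star at \<open>(None, Y)\<close> is determined by the vertex \<open>x\<close> through
  which it leaves \<open>Y\<close>, and another of its members lies in that direction.\<close>

lemma St_None:
  assumes I: "(None, Y) \<in> I" and q: "q \<in> Q" "(None, Y) \<in> St q"
  obtains x a where "x \<in> V0" "x \<in> \<Union>Y" "q = (if (Some x, Y) \<in> I then (Some x, Some Y) else (Some x, None))"
    "a \<in> St q" "a \<noteq> (None, Y)" "\<And>S. S \<in> reps (None, Y) \<Longrightarrow> side (None, Y) S a \<longleftrightarrow> x \<in> S"
  using q(1)
proof (cases rule: Q_cases)
  case (vertex x)
  then obtain Y1 where "(None, Y) = near x Y1" "Y1 \<in> CY" "x \<in> \<Union>Y1" using q(2) by (auto simp: St_simps)
  then have x: "(Some x, Y) \<notin> I" "Y \<in> CY" "x \<in> \<Union>Y" unfolding near_def by (auto split: if_splits)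
  obtain Y' where Y': "Y' \<in> CY" "Y' \<noteq> Y" "x \<in> \<Union>Y'" using V0_other[OF vertex(2)] .
  have ne: "near x Y' \<noteq> (None, Y)" using Y'(2) unfolding near_def by auto
  show ?thesis
  proof (rule that[of x "near x Y'"])
    show "near x Y' \<in> St q" using vertex Y' by (auto simp: St_simps)
    show "side (None, Y) S (near x Y') \<longleftrightarrow> x \<in> S" if "S \<in> reps (None, Y)" for S
      by (rule side_near[OF I that Y'(1) vertex(2) Y'(3) ne])
  qed (use vertex x ne in auto)
next
  case (edge x Y')
  then have Y': "Y' = Y" using q(2) by (auto simp: St_simps)
  have x: "x \<in> V0" "x \<in> \<Union>Y" using edge I_Some Y' by auto
  show ?thesis
  proof (rule that[of x "(Some x, Y)"])
    show "side (None, Y) S (Some x, Y) \<longleftrightarrow> x \<in> S" if "S \<in> reps (None, Y)" for S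
      unfolding side_def by simp
  qed (use edge Y' x in \<open>auto simp: St_simps\<close>)
next
  case (cyl Y')
  then show ?thesis using q(2) I by (auto simp: St_simps)
qed

text \<open>At \<open>(Some x, Y)\<close> there are at most two stars: one towards \<open>x\<close>
  and one towards the rest of \<open>Y\<close>.\<close>

lemma St_Some:
  assumes I: "(Some x, Y) \<in> I" and q: "q \<in> Q" "(Some x, Y) \<in> St q"
  obtains a where "a \<in> St q" "a \<noteq> (Some x, Y)" "q = (Some x, None)" 
      "\<And>S. S \<in> reps (Some x, Y) \<Longrightarrow> side (Some x, Y) S a \<longleftrightarrow> x \<in> S"
  | a where "a \<in> St q" "a \<noteq> (Some x, Y)" 
      "q = (if (None, Y) \<in> I then (Some x, Some Y) else (None, Some Y))" 
      "\<And>S. S \<in> reps (Some x, Y) \<Longrightarrow> side (Some x, Y) S a \<longleftrightarrow> x \<notin> S"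
  using q(1)
proof (cases rule: Q_cases)
  case (vertex z)
  then obtain Y1 where "(Some x, Y) = near z Y1" "Y1 \<in> CY" "z \<in> \<Union>Y1" using q(2) by (auto simp: St_simps)
  then have z: "z = x" unfolding near_def by (auto split: if_splits)
  obtain Y' where Y': "Y' \<in> CY" "Y' \<noteq> Y" "x \<in> \<Union>Y'" using V0_other[of x] vertex(2) z by metis
  have ne: "near x Y' \<noteq> (Some x, Y)" using Y'(2) unfolding near_def by auto
  show ?thesis
  proof (rule that(1)[of "near x Y'"])
    show "near x Y' \<in> St q" using vertex Y' z by (auto simp: St_simps)
    show "side (Some x, Y) S (near x Y') \<longleftrightarrow> x \<in> S" if "S \<in> reps (Some x, Y)" for S
      using side_near[OF I that Y'(1) _ Y'(3) ne] vertex(2) z by simp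
  qed (use vertex z ne in auto)
next
  case (edge z Y')
  then have "z = x" "Y' = Y" using q(2) by (auto simp: St_simps)
  note zY = this
  show ?thesis
  proof (rule that(2)[of "(None, Y)"])
    show "(None, Y) \<in> St q" using edge zY by (simp add: St_simps)
    show "q = (if (None, Y) \<in> I then (Some x, Some Y) else (None, Some Y))" using edge zY by simp
    show "side (Some x, Y) S (None, Y) \<longleftrightarrow> x \<notin> S" for S by (simp add: side_def)
  qed simp
next
  case (cyl Y')
  then have Y': "Y' = Y" using q(2) by (auto simp: St_simps)
  obtain z1 z2 where "z1 \<noteq> z2" "(Some z1, Y) \<in> I" "(Some z2, Y) \<in> I" 
    using two_Some[of Y] cyl Y' by auto
  then obtain z where z: "z \<noteq> x" "(Some z, Y) \<in> I" by metis
  have "side (Some x, Y) S (Some z, Y) \<longleftrightarrow> x \<notin> S" if "S \<in> reps (Some x, Y)" for S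
    using reps_Some_mem(3)[OF I that, of z] z I_Some unfolding side_def by simp
  note sd = this
  show ?thesis
  proof (rule that(2)[of "(Some z, Y)"])
    show "(Some z, Y) \<in> St q" using cyl Y' z by (simp add: St_simps)
    show "(Some z, Y) \<noteq> (Some x, Y)" using z by simp
    show "q = (if (None, Y) \<in> I then (Some x, Some Y) else (None, Some Y))" using cyl Y' by simp
  qed (rule sd)
qed

lemma St_side_sep:
  assumes q: "q \<in> Q" "q' \<in> Q" "q \<noteq> q'" and c: "c \<in> St q" "c \<in> St q'"
  shows "\<exists>S\<in>reps c. \<exists>a\<in>St q - {c}. \<exists>b\<in>St q' - {c}. side c S a \<and> \<not> side c S b"
proof -
  have cI: "c \<in> I" by (rule subsetD[OF St_I[OF q(1)] c(1)])
  obtain ox Y where oxY: "c = (ox, Y)" by (cases c)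
  have Y: "Y \<in> CY" using I_cyl[OF cI] oxY by simp
  show ?thesis
  proof (cases ox)
    case None
    then have cN: "c = (None, Y)" "(None, Y) \<in> I" using oxY cI by auto
    obtain x a where x: "x \<in> V0" "x \<in> \<Union>Y" "q = (if (Some x, Y) \<in> I then (Some x, Some Y) else (Some x, None))"
      "a \<in> St q" "a \<noteq> (None, Y)" "\<And>S. S \<in> reps (None, Y) \<Longrightarrow> side (None, Y) S a \<longleftrightarrow> x \<in> S"
      using St_None[OF cN(2) q(1)] c cN by metis
    obtain z b where z: "z \<in> V0" "z \<in> \<Union>Y" "q' = (if (Some z, Y) \<in> I then (Some z, Some Y) else (Some z, None))"
      "b \<in> St q'" "b \<noteq> (None, Y)" "\<And>S. S \<in> reps (None, Y) \<Longrightarrow> side (None, Y) S b \<longleftrightarrow> z \<in> S"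
      using St_None[OF cN(2) q(2)] c cN by metis
    have "x \<noteq> z" using q(3) x(3) z(3) by auto
    then obtain S where "S \<in> reps (None, Y)" "x \<in> S" "z \<notin> S" 
      using separating_rep[OF Y cN(2) x(1,2) z(1,2)] by auto
    then show ?thesis using x z cN by (intro bexI[of _ S] bexI[of _ a] bexI[of _ b]) auto
  next
    case (Some x)
    then have cS: "c = (Some x, Y)" "(Some x, Y) \<in> I" using oxY cI by auto
    obtain S0 where S0: "S0 \<in> reps c" using cI unfolding I_def by auto
    have xV: "x \<in> V" using cS(2) I_Some V0_sub by auto
    obtain S where S: "S \<in> reps c" "x \<in> S" using S0 reps_compl[OF S0] xV by (cases "x \<in> S0") auto
    have S': "V - S \<in> reps c" "x \<notin> V - S" using reps_compl[OF S(1)] S by auto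
    let ?q2 = "if (None, Y) \<in> I then (Some x, Some Y) else (None, Some Y)"
    have *: "(q = (Some x, None) \<and> (\<exists>a\<in>St q - {c}. \<forall>S\<in>reps c. side c S a \<longleftrightarrow> x \<in> S)) \<or>
       (q = ?q2 \<and> (\<exists>a\<in>St q - {c}. \<forall>S\<in>reps c. side c S a \<longleftrightarrow> x \<notin> S))" if qc: "q \<in> Q" "c \<in> St q" for q
    proof -
      have "(Some x, Y) \<in> St q" using qc(2) cS(1) by simp
      then show ?thesis
      proof (cases rule: St_Some[OF cS(2) qc(1), consumes 1, case_names vertex other])
        case (vertex a)
        have "\<exists>a\<in>St q - {c}. \<forall>S\<in>reps c. side c S a \<longleftrightarrow> x \<in> S"
          by (rule bexI[of _ a]) (use vertex(1,2,4) cS(1) in simp_all)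
        then show ?thesis using vertex(3) by simp
      next
        case (other a)
        have "\<exists>a\<in>St q - {c}. \<forall>S\<in>reps c. side c S a \<longleftrightarrow> x \<notin> S"
          by (rule bexI[of _ a]) (use other(1,2,4) cS(1) in simp_all)
        then show ?thesis using other(3) by simp
      qed
    qed
    consider a b where "a \<in> St q - {c}" "b \<in> St q' - {c}" 
        "\<forall>S\<in>reps c. side c S a \<longleftrightarrow> x \<in> S" "\<forall>S\<in>reps c. side c S b \<longleftrightarrow> x \<notin> S" 
      | a b where "a \<in> St q - {c}" "b \<in> St q' - {c}" 
        "\<forall>S\<in>reps c. side c S a \<longleftrightarrow> x \<notin> S" "\<forall>S\<in>reps c. side c S b \<longleftrightarrow> x \<in> S"
      using *[OF q(1) c(1)] *[OF q(2) c(2)] q(3) by metis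
    then show ?thesis
    proof cases
      case (1 a b)
      have "side c S a \<and> \<not> side c S b" using bspec[OF 1(3) S(1)] bspec[OF 1(4) S(1)] S(2) by simp
      then show ?thesis using S(1) 1(1,2) by (intro bexI[of _ S] bexI[of _ a] bexI[of _ b])
    next
      case (2 a b)
      have "side c (V - S) a \<and> \<not> side c (V - S) b" 
        using bspec[OF 2(3) S'(1)] bspec[OF 2(4) S'(1)] S'(2) by blast
      then show ?thesis using S'(1) 2(1,2) by (intro bexI[of _ "V - S"] bexI[of _ a] bexI[of _ b])
    qed
  qed
qed

lemma St_two: 
  assumes "q \<in> Q" 
  shows "\<exists>a\<in>St q. \<exists>b\<in>St q. a \<noteq> b"
  using assms
proof (cases rule: Q_cases)
  case (vertex x)
  obtain Y1 where Y1: "Y1 \<in> CY" "x \<in> \<Union>Y1" using vertex(2) unfolding V0_iff by auto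
  obtain Y2 where Y2: "Y2 \<in> CY" "Y2 \<noteq> Y1" "x \<in> \<Union>Y2" using V0_other[OF vertex(2)] .
  have "near x Y1 \<noteq> near x Y2" using Y2(2) snd_near by metis
  then show ?thesis using vertex Y1 Y2 unfolding vertex(1) St_simps by blast
next
  case (edge x Y)
  show ?thesis unfolding edge(1) St_simps 
    by (intro bexI[of _ "(Some x, Y)"] bexI[of _ "(None, Y)"]) simp_all
next
  case (cyl Y)
  obtain x z where "x \<noteq> z" "(Some x, Y) \<in> I" "(Some z, Y) \<in> I" using two_Some[OF cyl(2,3)] by auto
  then show ?thesis unfolding cyl(1) St_simps by (intro bexI[of _ "(Some x, Y)"] bexI[of _ "(Some z, Y)"]) auto
qed

section \<open>Connectedness of the stars\<close>

abbreviation "costarred \<equiv> {(a, b). \<exists>q\<in>Q. a \<in> St q \<and> b \<in> St q}"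

lemma costarred_sym: "(a, b) \<in> costarred\<^sup>* \<Longrightarrow> (b, a) \<in> costarred\<^sup>*"
proof -
  have "sym costarred" by (auto simp: sym_def)
  then show "(a, b) \<in> costarred\<^sup>* \<Longrightarrow> (b, a) \<in> costarred\<^sup>*" by (meson sym_rtrancl symD)
qed

lemma costarred_cyl:
  assumes "\<alpha> \<in> I" "\<beta> \<in> I" "snd \<alpha> = Y" "snd \<beta> = Y"
  shows "(\<alpha>, \<beta>) \<in> costarred\<^sup>*"
proof (cases "(None, Y) \<in> I")
  case True
  have *: "(\<alpha>, (None, Y)) \<in> costarred\<^sup>*" if a: "\<alpha> \<in> I" "snd \<alpha> = Y" for \<alpha>
  proof (cases "fst \<alpha>")
    case None
    then have "\<alpha> = (None, Y)" using a by (cases \<alpha>) auto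
    then show ?thesis by simp
  next
    case (Some x)
    then have ax: "\<alpha> = (Some x, Y)" using a by (cases \<alpha>) auto
    then have "(Some x, Some Y) \<in> Q" using True a unfolding Q_def by auto
    then have "(\<alpha>, (None, Y)) \<in> costarred" 
      using ax by (auto simp: St_simps intro!: bexI[of _ "(Some x, Some Y)"])
    then show ?thesis by (rule r_into_rtrancl)
  qed
  show ?thesis using *[OF assms(1,3)] costarred_sym[OF *[OF assms(2,4)]] by (rule rtrancl_trans)
next
  case False
  then have "(None, Some Y) \<in> Q" using assms(3) I_cyl[OF assms(1)] unfolding Q_def by auto
  then have "(\<alpha>, \<beta>) \<in> costarred" 
    using assms by (auto simp: St_simps intro!: bexI[of _ "(None, Some Y)"])
  then show ?thesis by (rule r_into_rtrancl)
qed

lemma costarred_share: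
  assumes I: "\<alpha> \<in> I" "\<beta> \<in> I" and x: "x \<in> \<Union>(snd \<alpha>)" "x \<in> \<Union>(snd \<beta>)"
  shows "(\<alpha>, \<beta>) \<in> costarred\<^sup>*"
proof (cases "snd \<alpha> = snd \<beta>")
  case True
  then show ?thesis using costarred_cyl[OF I] by simp
next
  case False
  note Y = I_cyl[OF I(1)] I_cyl[OF I(2)]
  have x0: "x \<in> V0" by (rule V0I[OF Y False x])
  then have "(Some x, None) \<in> Q" unfolding Q_def by simp
  moreover have "near x (snd \<alpha>) \<in> St (Some x, None)" "near x (snd \<beta>) \<in> St (Some x, None)"
    using Y x by (auto simp: St_simps)
  ultimately have "(near x (snd \<alpha>), near x (snd \<beta>)) \<in> costarred" by auto
  moreover have "(\<alpha>, near x (snd \<alpha>)) \<in> costarred\<^sup>*" 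
    by (rule costarred_cyl[OF I(1) near_I[OF Y(1) x0 x(1)] refl snd_near])
  moreover have "(near x (snd \<beta>), \<beta>) \<in> costarred\<^sup>*" 
    by (rule costarred_cyl[OF near_I[OF Y(2) x0 x(2)] I(2) snd_near refl])
  ultimately show ?thesis by (meson rtrancl_into_rtrancl rtrancl_trans)
qed

text \<open>Along a path in \<open>T\<close>, consecutive edges share a vertex, and components whose
  cylinders share a vertex are linked by the stars within these cylinders and, if the cylinders
  differ, the star of that vertex.\<close>

lemma costarred_connected:
  assumes I: "\<alpha> \<in> I" "\<beta> \<in> I"
  shows "(\<alpha>, \<beta>) \<in> costarred\<^sup>*"
proof -
  obtain a where a: "a \<in> \<Union>(snd \<alpha>)" using cyl_point[OF I_cyl[OF I(1)]] .
  obtain b where b: "b \<in> \<Union>(snd \<beta>)" using cyl_point[OF I_cyl[OF I(2)]] .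
  have V: "a \<in> V" "b \<in> V" using a b cyl_V[OF I_cyl[OF I(1)]] cyl_V[OF I_cyl[OF I(2)]] by auto
  have "\<forall>\<gamma>\<in>I. b \<in> \<Union>(snd \<gamma>) \<longrightarrow> (\<alpha>, \<gamma>) \<in> costarred\<^sup>*"
  proof (rule V_induct[OF V])
    show "\<forall>\<gamma>\<in>I. a \<in> \<Union>(snd \<gamma>) \<longrightarrow> (\<alpha>, \<gamma>) \<in> costarred\<^sup>*" using costarred_share[OF I(1) _ a] by simp
  next
    fix x y assume IH: "\<forall>\<gamma>\<in>I. x \<in> \<Union>(snd \<gamma>) \<longrightarrow> (\<alpha>, \<gamma>) \<in> costarred\<^sup>*" and xy: "{x, y} \<in> E"
    obtain Y where Y: "Y \<in> CY" "{x, y} \<in> Y" using cyl_ex[OF xy] .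
    obtain \<delta> where d: "\<delta> \<in> I" "snd \<delta> = Y" using cyl_index[OF Y(1)] .
    have xyY: "x \<in> \<Union>(snd \<delta>)" "y \<in> \<Union>(snd \<delta>)" using Y d by auto
    then have 1: "(\<alpha>, \<delta>) \<in> costarred\<^sup>*" using IH d(1) by simp
    show "\<forall>\<gamma>\<in>I. y \<in> \<Union>(snd \<gamma>) \<longrightarrow> (\<alpha>, \<gamma>) \<in> costarred\<^sup>*"
    proof (intro ballI impI)
      fix \<gamma> assume "\<gamma> \<in> I" "y \<in> \<Union>(snd \<gamma>)"
      then have "(\<delta>, \<gamma>) \<in> costarred\<^sup>*" using costarred_share[OF d(1) _ xyY(2)] by simp
      then show "(\<alpha>, \<gamma>) \<in> costarred\<^sup>*" by (rule rtrancl_trans[OF 1])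
    qed
  qed
  then show ?thesis using I(2) b by simp
qed

lemma walls_I:
  assumes "E \<noteq> {}"
  shows "walls I Q St (\<lambda>\<alpha> \<beta> \<gamma>. between_ccc G (ccc \<alpha>) (ccc \<beta>) (ccc \<gamma>)) (\<lambda>\<beta>. (side \<beta>) ` reps \<beta>)"
proof
  show "between_ccc G (ccc a) (ccc b) (ccc c) = 
      (a \<noteq> b \<and> b \<noteq> c \<and> a \<noteq> c \<and> (\<exists>s\<in>side b ` reps b. s a \<and> \<not> s c))" if "a \<in> I" "b \<in> I" "c \<in> I" for a b c
    using between_iff[OF that] by auto
  show "St q \<subseteq> I" if "q \<in> Q" for q using St_I[OF that] .
  show "s a = s b" if "c \<in> I" "q \<in> Q" "s \<in> side c ` reps c" "a \<in> St q" "b \<in> St q" "a \<noteq> c" "b \<noteq> c" 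
    for c q s a b
    using that St_side_const[OF that(1,2) _ that(4-7)] by auto
  show "\<exists>s\<in>side c ` reps c. \<exists>a\<in>St q - {c}. \<exists>b\<in>St q' - {c}. s a \<and> \<not> s b"
    if "q \<in> Q" "q' \<in> Q" "q \<noteq> q'" "c \<in> St q" "c \<in> St q'" for q q' c
    using St_side_sep[OF that] by auto
  show "\<exists>a\<in>St q. \<exists>b\<in>St q. a \<noteq> b" if "q \<in> Q" for q using St_two[OF that] .
  show "(a, b) \<in> costarred\<^sup>*" if "a \<in> I" "b \<in> I" for a b using costarred_connected[OF that] .
  obtain e where "e \<in> E" using assms by auto
  then obtain Y where "Y \<in> CY" using cyl_ex by metis
  then obtain \<alpha> where "\<alpha> \<in> I" using cyl_index by metis
  then show "I \<noteq> {}" by auto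
qed

end

section \<open>Equivariance\<close>

context group
begin

lemma l_coset_sym_diff: "sym_diff (g <# A) (g <# B) \<subseteq> g <# sym_diff A B"
  unfolding l_coset_def by auto

lemma ai_translate_almost_invariant:
  assumes g: "g \<in> carrier G" and Z: "almost_invariant G K Z"
  shows "almost_invariant G (g <# K #> inv g) (g <# Z)"
proof -
  have K: "subgroup K G" "Z \<subseteq> carrier G" "\<And>h x. h \<in> K \<Longrightarrow> x \<in> Z \<Longrightarrow> h \<otimes> x \<in> Z"
    "\<And>s. s \<in> carrier G \<Longrightarrow> H_finite G K (sym_diff Z (Z #> s))"
    using Z by (auto simp: almost_invariant_iff)
  note Kc = subgroup.subset[OF K(1)]
  show ?thesis unfolding almost_invariant_iff
  proof (intro conjI ballI)
    show "subgroup (g <# K #> inv g) G" by (rule subgroup_conjugation_is_surj2[OF g K(1)])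
    show "g <# Z \<subseteq> carrier G" using l_coset_subset_G[OF K(2) g] .
  next
    fix h x assume "h \<in> g <# K #> inv g" "x \<in> g <# Z"
    then obtain k z where kz: "k \<in> K" "h = g \<otimes> k \<otimes> inv g" "z \<in> Z" "x = g \<otimes> z"
      unfolding l_coset_def r_coset_def by auto
    moreover have "k \<in> carrier G" "z \<in> carrier G" using kz Kc K(2) by auto
    ultimately have "h \<otimes> x = g \<otimes> (k \<otimes> z)" using g by (simp add: m_assoc inv_solve_left) (simp add: m_assoc[symmetric])
    then show "h \<otimes> x \<in> g <# Z" using K(3)[OF kz(1,3)] unfolding l_coset_def by auto
  next
    fix s assume s: "s \<in> carrier G"
    have "H_finite G (g <# K #> inv g) (g <# sym_diff Z (Z #> s))"
      by (rule H_finite_translate[OF Kc g K(4)[OF s]])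
    moreover have "g <# Z #> s = g <# (Z #> s)" using coset_assoc[OF g s K(2)] by simp
    ultimately show "H_finite G (g <# K #> inv g) (sym_diff (g <# Z) (g <# Z #> s))"
      using H_finite_mono[OF _ l_coset_sym_diff] by simp
  qed
qed

lemma ai_translate_inv:
  assumes g: "g \<in> carrier G" and c: "K \<subseteq> carrier G" "Z \<subseteq> carrier G"
  shows "ai_translate G g (ai_translate G (inv g) (K, Z)) = (K, Z)"
proof -
  have i: "inv g \<in> carrier G" using g by simp
  have s: "inv g <# K \<subseteq> carrier G" by (rule l_coset_subset_G[OF c(1) i])
  have "g <# (inv g <# K #> g) = K #> g" 
    using coset_assoc[OF g g s] lcos_m_assoc[OF c(1) g i] lcos_mult_one[OF c(1)] g by simp
  then have "g <# (inv g <# K #> g) #> inv g = K"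
    using coset_mult_assoc[OF c(1) g i] g coset_mult_one[OF c(1)] by simp
  moreover have "g <# (inv g <# Z) = Z" 
    using lcos_m_assoc[OF c(2) g i] lcos_mult_one[OF c(2)] g by simp
  ultimately show ?thesis unfolding ai_translate_def using g by simp
qed

end

context tree_action
begin

lemma eqv_act:
  assumes g: "g \<in> carrier G" and Y: "Y \<in> CY" and S: "A \<subseteq> V" "B \<subseteq> V" 
  shows "eqv (actY g Y) (act g ` A) (act g ` B) \<longleftrightarrow> eqv Y A B"
proof -
  have d: "A - B \<subseteq> V" "B - A \<subseteq> V" using S by auto
  have "sym_diff (act g ` A) (act g ` B) = act g ` sym_diff A B"
    unfolding image_Un inj_on_image_set_diff[OF act_inj[OF g] d(1) S(2)] 
      inj_on_image_set_diff[OF act_inj[OF g] d(2) S(1)] ..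
  moreover have "sym_diff A B \<subseteq> V" using S by auto
  ultimately show ?thesis using small_act[OF g Y] by simp
qed

lemma nontriv_act:
  assumes g: "g \<in> carrier G" and Y: "Y \<in> CY" and S: "S \<subseteq> V"
  shows "nontriv (actY g Y) (act g ` S) \<longleftrightarrow> nontriv Y S"
  unfolding nontriv_def using small_act[OF g Y S] small_act[OF g Y, of "V - S"] act_image_Diff[OF g S] by simp

lemma alg_actE:
  assumes g: "g \<in> carrier G" and Y: "Y \<in> CY" and P: "P \<in> alg (actY g Y)"
  obtains P' where "P' \<in> alg Y" "P = act g ` P'"
proof
  show "act (inv g) ` P \<in> alg Y" using alg_act[OF inv_closed[OF g] actY_CY[OF g Y] P] actY_inv(1)[OF g Y] by simp
  show "P = act g ` act (inv g) ` P" using act_image_inv(2)[OF g algD(1)[OF P]] by simp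
qed

lemma atom_act:
  assumes g: "g \<in> carrier G" and Y: "Y \<in> CY" and S: "atom Y S"
  shows "atom (actY g Y) (act g ` S)"
  unfolding atom_def
proof (intro conjI ballI)
  have S': "S \<in> alg Y" "\<not> small Y S" "S \<subseteq> V" using S algD(1) unfolding atom_def by auto
  show "act g ` S \<in> alg (actY g Y)" by (rule alg_act[OF g Y S'(1)])
  show "\<not> small (actY g Y) (act g ` S)" using small_act[OF g Y S'(3)] S'(2) by simp
  fix P assume "P \<in> alg (actY g Y)"
  then obtain P' where P': "P' \<in> alg Y" "P = act g ` P'" by (rule alg_actE[OF g Y])
  note PV = algD(1)[OF P'(1)]
  have "act g ` S \<inter> P = act g ` (S \<inter> P')" "act g ` S - P = act g ` (S - P')"
    using inj_on_image_Int[OF act_inj[OF g] S'(3) PV] inj_on_image_set_diff[OF act_inj[OF g], of S P'] S'(3) PV P'(2)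
    by auto
  moreover have "S \<inter> P' \<subseteq> V" "S - P' \<subseteq> V" using S'(3) by auto
  ultimately show "small (actY g Y) (act g ` S \<inter> P) \<or> small (actY g Y) (act g ` S - P)"
    using S P'(1) small_act[OF g Y] unfolding atom_def by auto
qed

lemma atom_act_iff:
  assumes g: "g \<in> carrier G" and Y: "Y \<in> CY" and S: "S \<subseteq> V"
  shows "atom (actY g Y) (act g ` S) \<longleftrightarrow> atom Y S"
  using atom_act[OF g Y, of S] atom_act[OF inv_closed[OF g] actY_CY[OF g Y], of "act g ` S"]
    actY_inv(1)[OF g Y] act_image_inv(1)[OF g S] by auto

lemma ge3_act:
  assumes g: "g \<in> carrier G" and Y: "Y \<in> CY" and "ge3 Y"
  shows "ge3 (actY g Y)"
proof -
  obtain A B C where *: "A \<in> alg Y" "B \<in> alg Y" "C \<in> alg Y" "\<not> small Y A" "\<not> small Y B" "\<not> small Y C"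
    "A \<inter> B = {}" "A \<inter> C = {}" "B \<inter> C = {}" using assms(3) unfolding ge3_def by blast
  note V = algD(1)[OF *(1)] algD(1)[OF *(2)] algD(1)[OF *(3)]
  note i = inj_on_image_Int[OF act_inj[OF g], symmetric]
  show ?thesis unfolding ge3_def
    by (rule bexI[OF _ alg_act[OF g Y *(1)]], rule bexI[OF _ alg_act[OF g Y *(2)]], 
        rule bexI[OF _ alg_act[OF g Y *(3)]])
      (simp add: small_act[OF g Y] V i * )
qed

lemma ge3_act_iff:
  assumes g: "g \<in> carrier G" and Y: "Y \<in> CY"
  shows "ge3 (actY g Y) \<longleftrightarrow> ge3 Y"
  using ge3_act[OF g Y] ge3_act[OF inv_closed[OF g] actY_CY[OF g Y]] actY_inv(1)[OF g Y] by auto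

lemma mem_actY_iff:
  assumes g: "g \<in> carrier G" and Y: "Y \<in> CY" and e: "e \<subseteq> V"
  shows "act g ` e \<in> actY g Y \<longleftrightarrow> e \<in> Y"
proof
  assume "act g ` e \<in> actY g Y"
  then obtain f where f: "f \<in> Y" "act g ` e = act g ` f" unfolding actY_def by auto
  have "act (inv g) ` act g ` e = act (inv g) ` act g ` f" by (simp only: f(2))
  then have "e = f" 
    unfolding act_image_inv(1)[OF g e] act_image_inv(1)[OF g edge_sub_V[OF cyl_edge[OF Y f(1)]]] .
  then show "e \<in> Y" using f by simp
qed (auto simp: actY_def)

lemma fval_act:
  assumes g: "g \<in> carrier G" and Y: "Y \<in> CY" and "fval Y x" and x: "x \<in> V"
  shows "fval (actY g Y) (act g x)"
proof -
  have "{y. {act g x, y} \<in> actY g Y} \<subseteq> act g ` {y. {x, y} \<in> Y}"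
  proof
    fix y assume y: "y \<in> {y. {act g x, y} \<in> actY g Y}"
    then have "{act g x, y} \<in> E" using cyl_edge[OF actY_CY[OF g Y]] by simp
    then have yV: "y \<in> V" using edgeD by simp
    have eq: "act g ` {x, act (inv g) y} = {act g x, y}" using g yV by simp
    have "{x, act (inv g) y} \<in> Y" 
      using mem_actY_iff[OF g Y, of "{x, act (inv g) y}"] y eq x yV g by simp
    then show "y \<in> act g ` {y. {x, y} \<in> Y}" using g yV by (intro image_eqI[of _ _ "act (inv g) y"]) auto
  qed
  then show ?thesis using assms(3) unfolding fval_def by (rule finite_subset[OF _ finite_imageI])
qed

lemma branch_act:
  assumes g: "g \<in> carrier G" and Y: "Y \<in> CY" and x: "x \<in> V"
  shows "branch (actY g Y) (act g x) = act g ` branch Y x"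
proof -
  have *: "act g ` branch Y x \<subseteq> branch (actY g Y) (act g x)" 
    if g: "g \<in> carrier G" and Y: "Y \<in> CY" and x: "x \<in> V" for g Y x
  proof
    fix w assume "w \<in> act g ` branch Y x"
    then obtain v where v: "v \<in> V" "sep x v \<inter> Y = {}" "w = act g v" unfolding branch_def by auto
    have "sep (act g x) (act g v) \<inter> actY g Y = {}"
    proof (rule ccontr)
      assume "sep (act g x) (act g v) \<inter> actY g Y \<noteq> {}"
      then obtain e where e: "e \<in> sep x v" "act g ` e \<in> actY g Y" 
        unfolding sep_act[OF g x v(1)] by auto
      then have "e \<in> Y" using mem_actY_iff[OF g Y] edge_sub_V[OF subsetD[OF sep_sub e(1)]] by simp
      then show False using v e by auto
    qed
    then show "w \<in> branch (actY g Y) (act g x)" unfolding branch_def using v g by simp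
  qed
  have "act (inv g) ` branch (actY g Y) (act g x) \<subseteq> branch Y x"
    using *[OF inv_closed[OF g] actY_CY[OF g Y], of "act g x"] actY_inv(1)[OF g Y] g x by simp
  then have "act g ` act (inv g) ` branch (actY g Y) (act g x) \<subseteq> act g ` branch Y x" by (rule image_mono)
  then show ?thesis using *[OF g Y x] act_image_inv(2)[OF g branch_sub_V] by auto
qed

section \<open>The action on indices of components and stars\<close>

definition actI :: "'a \<Rightarrow> 'v option \<times> 'v set set \<Rightarrow> 'v option \<times> 'v set set" where
  "actI g \<alpha> = (map_option (act g) (fst \<alpha>), actY g (snd \<alpha>))"

definition actQ :: "'a \<Rightarrow> 'v option \<times> 'v set set option \<Rightarrow> 'v option \<times> 'v set set option" where
  "actQ g q = (map_option (act g) (fst q), map_option (actY g) (snd q))"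

lemma reps_act:
  assumes g: "g \<in> carrier G" and Y: "snd \<alpha> \<in> CY" and S: "S \<in> reps \<alpha>"
  shows "act g ` S \<in> reps (actI g \<alpha>)"
proof -
  obtain ox Y where a: "\<alpha> = (ox, Y)" by (cases \<alpha>)
  have Y: "Y \<in> CY" using Y a by simp
  have SV: "S \<subseteq> V" using reps_V[OF S] .
  have al: "act g ` S \<in> alg (actY g Y)" using alg_act[OF g Y] reps_alg[OF S] a by simp
  have D: "V - act g ` S = act g ` (V - S)" using act_image_Diff[OF g SV] by simp
  show ?thesis
  proof (cases ox)
    case None
    show ?thesis unfolding a None actI_def 
      using S a None al nontriv_act[OF g Y SV] ge3_act_iff[OF g Y] atom_act_iff[OF g Y SV] 
        atom_act_iff[OF g Y, of "V - S"] by (simp add: reps_None D)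
  next
    case (Some x)
    then have x: "x \<in> V0" "x \<in> \<Union>Y" "fval Y x" "ge3 Y" "eqv Y S (branch Y x) \<or> eqv Y (V - S) (branch Y x)"
      using S a by (auto simp: reps_Some)
    have xV: "x \<in> V" by (rule V0_sub[OF x(1)])
    have "act g x \<in> \<Union>(actY g Y)" unfolding Union_actY using x(2) by (rule imageI)
    moreover have "eqv (actY g Y) (act g ` S) (branch (actY g Y) (act g x)) \<or> 
        eqv (actY g Y) (V - act g ` S) (branch (actY g Y) (act g x))"
      using x(5) eqv_act[OF g Y SV branch_sub_V] eqv_act[OF g Y _ branch_sub_V, of "V - S"] 
      unfolding D branch_act[OF g Y xV] by auto
    ultimately have "act g ` S \<in> reps (Some (act g x), actY g Y)" unfolding reps_Some
      using al ge3_act[OF g Y x(4)] V0_act[OF g x(1)] fval_act[OF g Y x(3) xV] by simp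
    then show ?thesis unfolding a Some actI_def by simp
  qed
qed

lemma I_act: 
  assumes g: "g \<in> carrier G" and a: "\<alpha> \<in> I" 
  shows "actI g \<alpha> \<in> I"
  using reps_act[OF g I_cyl[OF a]] actY_CY[OF g I_cyl[OF a]] a unfolding I_def by (auto simp: actI_def)

lemma I_vertex: "\<alpha> \<in> I \<Longrightarrow> fst \<alpha> = Some x \<Longrightarrow> x \<in> V0"
  using I_Some[of x "snd \<alpha>"] by (cases \<alpha>) auto

lemma actI_one: "\<alpha> \<in> I \<Longrightarrow> actI \<one> \<alpha> = \<alpha>"
  using I_vertex[of \<alpha>] V0_sub actY_one[OF I_cyl] unfolding actI_def 
  by (cases \<alpha>; cases "fst \<alpha>") auto

lemma actI_mult: 
  "g \<in> carrier G \<Longrightarrow> h \<in> carrier G \<Longrightarrow> \<alpha> \<in> I \<Longrightarrow> actI (g \<otimes> h) \<alpha> = actI g (actI h \<alpha>)"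
  using I_vertex[of \<alpha>] V0_sub actY_mult[of g h, OF _ _ I_cyl] act_mult[of g h] unfolding actI_def 
  by (cases \<alpha>; cases "fst \<alpha>") auto

lemma actI_inv: 
  "g \<in> carrier G \<Longrightarrow> \<alpha> \<in> I \<Longrightarrow> actI g (actI (inv g) \<alpha>) = \<alpha>"
  "g \<in> carrier G \<Longrightarrow> \<alpha> \<in> I \<Longrightarrow> actI (inv g) (actI g \<alpha>) = \<alpha>"
  using actI_mult[of g "inv g" \<alpha>] actI_mult[of "inv g" g \<alpha>] actI_one by simp_all

lemma I_act_iff: 
  assumes g: "g \<in> carrier G" and x: "x \<in> V" and Y: "Y \<in> CY"
  shows "(Some (act g x), actY g Y) \<in> I \<longleftrightarrow> (Some x, Y) \<in> I" "(None, actY g Y) \<in> I \<longleftrightarrow> (None, Y) \<in> I"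
  using I_act[OF g, of "(Some x, Y)"] I_act[OF inv_closed[OF g], of "(Some (act g x), actY g Y)"]
    I_act[OF g, of "(None, Y)"] I_act[OF inv_closed[OF g], of "(None, actY g Y)"]
    g x actY_inv(1)[OF g Y] by (auto simp: actI_def)

lemma reps_actI:
  assumes g: "g \<in> carrier G" and a: "\<alpha> \<in> I"
  shows "reps (actI g \<alpha>) = (\<lambda>S. act g ` S) ` reps \<alpha>"
proof (intro equalityI subsetI)
  fix S assume S: "S \<in> reps (actI g \<alpha>)"
  have "act (inv g) ` S \<in> reps \<alpha>"
    using reps_act[OF inv_closed[OF g] I_cyl[OF I_act[OF g a]] S] actI_inv(2)[OF g a] by simp
  moreover have "S = act g ` act (inv g) ` S" using act_image_inv(2)[OF g reps_V[OF S]] by simp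
  ultimately show "S \<in> (\<lambda>S. act g ` S) ` reps \<alpha>" by (rule rev_image_eqI)
next
  fix S assume "S \<in> (\<lambda>S. act g ` S) ` reps \<alpha>"
  then show "S \<in> reps (actI g \<alpha>)" using reps_act[OF g I_cyl[OF a]] by auto
qed

lemma cyl_class_act:
  assumes g: "g \<in> carrier G" and Y: "Y \<in> CY" and S: "S \<subseteq> V"
  shows "ai_translate G g ` cyl_class Y S = cyl_class (actY g Y) (act g ` S)"
proof -
  have *: "ai_translate G g p \<in> cyl_class (actY g Y) (act g ` S)" 
    if g: "g \<in> carrier G" and Y: "Y \<in> CY" and S: "S \<subseteq> V" and p: "p \<in> cyl_class Y S" for g Y S p
  proof -
    obtain K Z where p': "p = (K, Z)" "almost_invariant G K Z" "finY Y (sym_diff (X S) Z)"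
      using p unfolding cyl_class_def by auto
    have "finY (actY g Y) (g <# sym_diff (X S) Z)" by (rule finY_act[OF g Y p'(3)])
    then have "finY (actY g Y) (sym_diff (g <# X S) (g <# Z))" 
      by (rule finY_mono[OF _ l_coset_sym_diff])
    then show ?thesis unfolding p'(1) cyl_class_def ai_translate_def 
      using ai_translate_almost_invariant[OF g p'(2)] X_act[OF g S] by simp
  qed
  show ?thesis
  proof (intro equalityI subsetI)
    fix p assume p: "p \<in> cyl_class (actY g Y) (act g ` S)"
    obtain K Z where KZ: "p = (K, Z)" "almost_invariant G K Z" using p unfolding cyl_class_def by auto
    have c: "K \<subseteq> carrier G" "Z \<subseteq> carrier G" using KZ(2) subgroup.subset by (auto simp: almost_invariant_iff)
    have "ai_translate G (inv g) p \<in> cyl_class Y S"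
      using *[OF inv_closed[OF g] actY_CY[OF g Y] act_image_sub[OF g S] p] 
        actY_inv(1)[OF g Y] act_image_inv(1)[OF g S] by simp
    moreover have "p = ai_translate G g (ai_translate G (inv g) p)" 
      unfolding KZ(1) using ai_translate_inv[OF g c] by simp
    ultimately show "p \<in> ai_translate G g ` cyl_class Y S" by (rule rev_image_eqI)
  qed (use *[OF g Y S] in auto)
qed

lemma cyl_pair_act:
  assumes g: "g \<in> carrier G" and Y: "Y \<in> CY" and S: "S \<subseteq> V"
  shows "(\<lambda>c. ai_translate G g ` c) ` cyl_pair Y S = cyl_pair (actY g Y) (act g ` S)"
  unfolding cyl_pair_def using cyl_class_act[OF g Y S] cyl_class_act[OF g Y, of "V - S"] act_image_Diff[OF g S] by simp

lemma ccc_act: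
  assumes g: "g \<in> carrier G" and a: "\<alpha> \<in> I"
  shows "ccc_translate G g (ccc \<alpha>) = ccc (actI g \<alpha>)"
proof -
  have "ccc_translate G g (ccc \<alpha>) = (\<lambda>S. (\<lambda>c. ai_translate G g ` c) ` cyl_pair (snd \<alpha>) S) ` reps \<alpha>"
    unfolding ccc_translate_def ccc_def by (simp add: image_image)
  also have "\<dots> = (\<lambda>S. cyl_pair (actY g (snd \<alpha>)) (act g ` S)) ` reps \<alpha>"
    by (rule image_cong[OF refl]) (rule cyl_pair_act[OF g I_cyl[OF a] reps_V])
  also have "\<dots> = ccc (actI g \<alpha>)"
    unfolding ccc_def reps_actI[OF g a] by (simp add: image_image actI_def)
  finally show ?thesis .
qed

lemma near_act:
  assumes g: "g \<in> carrier G" and x: "x \<in> V" and Y: "Y \<in> CY"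
  shows "near (act g x) (actY g Y) = actI g (near x Y)"
  unfolding near_def using I_act_iff[OF assms] by (simp add: actI_def)

lemma Q_act: 
  assumes g: "g \<in> carrier G" and q: "q \<in> Q"
  shows "actQ g q \<in> Q"
  using q
proof (cases rule: Q_cases)
  case (vertex x)
  then show ?thesis using V0_act[OF g] by (simp add: actQ_def Q_def)
next
  case (edge x Y)
  then have "x \<in> V" "Y \<in> CY" using I_Some V0_sub by auto
  then show ?thesis using edge I_act_iff[OF g] by (simp add: actQ_def Q_def)
next
  case (cyl Y)
  \<comment> \<open>\<open>v0\<close> only fills the vertex argument, which the statement about
    \<open>None\<close> does not mention.\<close>
  have "(None, actY g Y) \<notin> I" using I_act_iff(2)[OF g v0 cyl(2)] cyl(3) by simp
  then show ?thesis using cyl actY_CY[OF g cyl(2)] by (simp add: actQ_def Q_def)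
qed

lemma St_act_sub:
  assumes g: "g \<in> carrier G" and q: "q \<in> Q" and a: "\<alpha> \<in> St q"
  shows "actI g \<alpha> \<in> St (actQ g q)"
  using q
proof (cases rule: Q_cases)
  case (vertex x)
  then obtain Y where Y: "Y \<in> CY" "x \<in> \<Union>Y" "\<alpha> = near x Y" using a by (auto simp: St_simps)
  have "actI g \<alpha> = near (act g x) (actY g Y)" using near_act[OF g V0_sub[OF vertex(2)] Y(1)] Y(3) by simp
  moreover have "act g x \<in> \<Union>(actY g Y)" unfolding Union_actY using Y(2) by (rule imageI)
  moreover have "actQ g q = (Some (act g x), None)" using vertex by (simp add: actQ_def)
  ultimately show ?thesis using actY_CY[OF g Y(1)] by (auto simp: St_simps)
next
  case (edge x Y)
  then show ?thesis using a by (auto simp: St_simps actQ_def actI_def)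
next
  case (cyl Y)
  have "\<alpha> \<in> I" using St_I[OF q] a by auto
  moreover have "snd (actI g \<alpha>) = actY g (snd \<alpha>)" by (simp add: actI_def)
  ultimately show ?thesis using cyl a I_act[OF g, of \<alpha>] by (simp add: St_simps actQ_def)
qed

lemma actQ_one: 
  assumes "q \<in> Q" 
  shows "actQ \<one> q = q"
  using assms
  by (cases rule: Q_cases) (use V0_sub actY_one I_Some in \<open>auto simp: actQ_def\<close>)

lemma actQ_mult: 
  assumes g: "g \<in> carrier G" and h: "h \<in> carrier G" and q: "q \<in> Q" 
  shows "actQ (g \<otimes> h) q = actQ g (actQ h q)"
  using q
  by (cases rule: Q_cases) (use V0_sub act_mult[OF g h] actY_mult[OF g h] I_Some in \<open>auto simp: actQ_def\<close>)

lemma St_act: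
  assumes g: "g \<in> carrier G" and q: "q \<in> Q" 
  shows "St (actQ g q) = actI g ` St q"
proof (intro equalityI subsetI)
  fix \<alpha> assume a: "\<alpha> \<in> St (actQ g q)"
  have aI: "\<alpha> \<in> I" using St_I[OF Q_act[OF g q]] a by auto
  have "actQ (inv g) (actQ g q) = q" using actQ_mult[OF inv_closed[OF g] g q] actQ_one[OF q] g by simp
  then have "actI (inv g) \<alpha> \<in> St q" using St_act_sub[OF inv_closed[OF g] Q_act[OF g q] a] by simp
  moreover have "\<alpha> = actI g (actI (inv g) \<alpha>)" using actI_inv(1)[OF g aI] by simp
  ultimately show "\<alpha> \<in> actI g ` St q" by (rule rev_image_eqI)
qed (use St_act_sub[OF g q] in auto)

text \<open>The same graph as \<open>star_graph\<close>, stated outside the locale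
  \<open>walls\<close> because its instance \<open>walls_I\<close> is available only when
  \<open>T\<close> has edges.\<close>

definition stargraph :: "(('v option \<times> 'v set set) + ('v option \<times> 'v set set option)) sgraph" where
  "stargraph = \<lparr>verts = Inl ` I \<union> Inr ` Q, edges = {{Inl a, Inr q} | a q. a \<in> I \<and> q \<in> Q \<and> a \<in> St q}\<rparr>"

lemma stargraph_verts: 
  "Inl a \<in> verts stargraph \<longleftrightarrow> a \<in> I" "Inr q \<in> verts stargraph \<longleftrightarrow> q \<in> Q"
  unfolding stargraph_def by (simp_all add: image_iff)

lemma stargraph_edge: "a \<in> I \<Longrightarrow> q \<in> Q \<Longrightarrow> a \<in> St q \<Longrightarrow> {Inl a, Inr q} \<in> edges stargraph"
  unfolding stargraph_def sgraph.select_convs by blast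

lemma stargraph_edgeE:
  assumes "e \<in> edges stargraph"
  obtains a q where "e = {Inl a, Inr q}" "a \<in> I" "q \<in> Q" "a \<in> St q"
  using assms unfolding stargraph_def sgraph.select_convs by blast

lemma stargraph_action: "graph_action G stargraph (\<lambda>g. map_sum (actI g) (actQ g))"
  unfolding graph_action_def
proof (intro conjI ballI)
  show "group_action G (verts stargraph) (\<lambda>g. restrict (map_sum (actI g) (actQ g)) (verts stargraph))"
  proof (rule group_actionI[OF group_axioms])
    show "map_sum (actI g) (actQ g) w \<in> verts stargraph" if "g \<in> carrier G" "w \<in> verts stargraph" for g w
      using that I_act[OF that(1)] Q_act[OF that(1)] by (auto simp: stargraph_def)
    show "map_sum (actI \<one>) (actQ \<one>) w = w" if "w \<in> verts stargraph" for w
      using that by (auto simp: stargraph_def actI_one actQ_one)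
    show "map_sum (actI (g \<otimes> h)) (actQ (g \<otimes> h)) w = 
        map_sum (actI g) (actQ g) (map_sum (actI h) (actQ h) w)" 
      if "g \<in> carrier G" "h \<in> carrier G" "w \<in> verts stargraph" for g h w
      using that(3) actI_mult[OF that(1,2)] actQ_mult[OF that(1,2)] by (auto simp: stargraph_def)
  qed
  fix g e assume g: "g \<in> carrier G" and eE: "e \<in> edges stargraph"
  obtain a q where e: "e = {Inl a, Inr q}" "a \<in> I" "q \<in> Q" "a \<in> St q" using stargraph_edgeE[OF eE] .
  have "map_sum (actI g) (actQ g) ` e = {Inl (actI g a), Inr (actQ g q)}" using e(1) by simp
  then show "map_sum (actI g) (actQ g) ` e \<in> edges stargraph"
    using stargraph_edge[OF I_act[OF g e(2)] Q_act[OF g e(3)] St_act_sub[OF g e(3,4)]] by simp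
qed

section \<open>The regular neighbourhood\<close>

definition toRN :: "('v option \<times> 'v set set) + ('v option \<times> 'v set set option) \<Rightarrow> ('a ccc + 'a ccc set)" where
  "toRN = map_sum ccc (\<lambda>q. ccc ` St q)"

lemma toRN_act:
  assumes g: "g \<in> carrier G" and w: "w \<in> verts stargraph"
  shows "toRN (map_sum (actI g) (actQ g) w) = regular_neighbourhood_act G g (toRN w)"
proof -
  have 1: "ccc (actI g a) = ccc_translate G g (ccc a)" if "a \<in> I" for a using ccc_act[OF g that] by simp
  have 2: "ccc ` St (actQ g q) = ccc_translate G g ` ccc ` St q" if q: "q \<in> Q" for q
    unfolding St_act[OF g q] image_image using ccc_act[OF g] St_I[OF q] by (intro image_cong) auto
  show ?thesis using w 1 2 unfolding stargraph_def toRN_def regular_neighbourhood_act_def by auto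
qed

lemma nothing_between_image:
  "A \<subseteq> I \<Longrightarrow> nothing_between G based (ccc ` A) \<longleftrightarrow> 
    (\<forall>a\<in>A. \<forall>b\<in>A. \<forall>c\<in>I. \<not> between_ccc G (ccc a) (ccc c) (ccc b))"
  unfolding nothing_between_def cccs_eq by simp

text \<open>Every set of components is the image of a set of indices under the injective map
  \<open>ccc\<close>, so maximality can be tested on indices, where \<open>walls\<close> describes
  the stars.\<close>

lemma stars_based:
  assumes E: "E \<noteq> {}"
  shows "stars G based = (\<lambda>q. ccc ` St q) ` Q"
proof -
  interpret W: walls I Q St "\<lambda>\<alpha> \<beta> \<gamma>. between_ccc G (ccc \<alpha>) (ccc \<beta>) (ccc \<gamma>)" "\<lambda>\<beta>. (side \<beta>) ` reps \<beta>"
    by (rule walls_I[OF E])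
  have u: "nothing_between G based (ccc ` A) \<longleftrightarrow> W.undivided A" if "A \<subseteq> I" for A
    unfolding W.undivided_def using nothing_between_image[OF that] .
  have inj: "ccc ` A = ccc ` B \<longleftrightarrow> A = B" if "A \<subseteq> I" "B \<subseteq> I" for A B
    using inj_on_image_eq_iff[OF ccc_inj that] .
  let ?P = "\<lambda>A. A \<subseteq> I \<and> (\<exists>a\<in>A. \<exists>b\<in>A. a \<noteq> b) \<and> W.undivided A \<and> 
      (\<forall>B. A \<subseteq> B \<and> B \<subseteq> I \<and> W.undivided B \<longrightarrow> B = A)"
  have st: "ccc ` A \<in> stars G based \<longleftrightarrow> ?P A" if A: "A \<subseteq> I" for A
  proof -
    have "(\<exists>C\<in>ccc ` A. \<exists>C'\<in>ccc ` A. C \<noteq> C') \<longleftrightarrow> (\<exists>a\<in>A. \<exists>b\<in>A. a \<noteq> b)"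
    proof -
      have "ccc a \<noteq> ccc b \<longleftrightarrow> a \<noteq> b" if "a \<in> A" "b \<in> A" for a b
        using inj_on_eq_iff[OF ccc_inj, of a b] that A by (simp add: subsetD)
      then have "(\<exists>a\<in>A. \<exists>b\<in>A. ccc a \<noteq> ccc b) \<longleftrightarrow> (\<exists>a\<in>A. \<exists>b\<in>A. a \<noteq> b)" by (intro bex_cong refl)
      then show ?thesis by (simp only: bex_simps)
    qed
    moreover have "(\<forall>\<Sigma>'. ccc ` A \<subseteq> \<Sigma>' \<and> \<Sigma>' \<subseteq> ccc ` I \<and> nothing_between G based \<Sigma>' \<longrightarrow> \<Sigma>' = ccc ` A) \<longleftrightarrow>
      (\<forall>B. A \<subseteq> B \<and> B \<subseteq> I \<and> W.undivided B \<longrightarrow> B = A)" (is "?l \<longleftrightarrow> ?r")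
    proof
      assume l: ?l
      show ?r
      proof (intro allI impI)
        fix B assume B: "A \<subseteq> B \<and> B \<subseteq> I \<and> W.undivided B"
        then have "ccc ` B = ccc ` A" using l u[of B] by (simp add: image_mono)
        then show "B = A" using inj[of B A] A B by simp
      qed
    next
      assume r: ?r
      show ?l
      proof (intro allI impI)
        fix \<Sigma>' assume S: "ccc ` A \<subseteq> \<Sigma>' \<and> \<Sigma>' \<subseteq> ccc ` I \<and> nothing_between G based \<Sigma>'"
        then obtain B where B: "B \<subseteq> I" "\<Sigma>' = ccc ` B" by (meson subset_imageE)
        have "A \<subseteq> B"
        proof
          fix a assume a: "a \<in> A"
          then have "ccc a \<in> ccc ` B" using S B(2) by blast
          then show "a \<in> B" using inj_on_image_mem_iff[OF ccc_inj subsetD[OF A a] B(1)] by simp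
        qed
        moreover have "W.undivided B" using S B(2) u[OF B(1)] by simp
        ultimately have "B = A" using r B(1) by blast
        then show "\<Sigma>' = ccc ` A" using B(2) by simp
      qed
    qed
    ultimately show ?thesis unfolding stars_def cccs_eq using A u[OF A] by (simp add: image_mono)
  qed
  have "stars G based = (\<lambda>A. ccc ` A) ` {A. ?P A}"
  proof (intro equalityI subsetI)
    fix \<Sigma> assume S: "\<Sigma> \<in> stars G based"
    then have "\<Sigma> \<subseteq> ccc ` I" unfolding stars_def cccs_eq by simp
    then obtain A where A: "A \<subseteq> I" "\<Sigma> = ccc ` A" by (meson subset_imageE)
    then have "A \<in> {A. ?P A}" using S st[OF A(1)] by simp
    then show "\<Sigma> \<in> (\<lambda>A. ccc ` A) ` {A. ?P A}" using A(2) by (rule rev_image_eqI)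
  next
    fix \<Sigma> assume "\<Sigma> \<in> (\<lambda>A. ccc ` A) ` {A. ?P A}"
    then obtain A where "\<Sigma> = ccc ` A" "?P A" by (elim imageE CollectE)
    then show "\<Sigma> \<in> stars G based" using st[of A] by simp
  qed
  then show ?thesis unfolding W.stars_eq image_image .
qed

lemma RN_based:
  assumes E: "E \<noteq> {}"
  shows "inj_on toRN (verts stargraph)" 
    "verts (regular_neighbourhood G based) = toRN ` verts stargraph"
    "edges (regular_neighbourhood G based) = (\<lambda>e. toRN ` e) ` edges stargraph"
    "is_tree stargraph"
proof -
  interpret W: walls I Q St "\<lambda>\<alpha> \<beta> \<gamma>. between_ccc G (ccc \<alpha>) (ccc \<beta>) (ccc \<gamma>)" "\<lambda>\<beta>. (side \<beta>) ` reps \<beta>"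
    by (rule walls_I[OF E])
  have ne: "cccs G based \<noteq> {}" unfolding cccs_eq using W.nonempty by simp
  have inj: "inj_on (\<lambda>q. ccc ` St q) Q"
  proof (rule inj_onI)
    fix q q' assume q: "q \<in> Q" "q' \<in> Q" "ccc ` St q = ccc ` St q'"
    then have "St q = St q'" using inj_on_image_eq_iff[OF ccc_inj St_I[OF q(1)] St_I[OF q(2)]] by simp
    then show "q = q'" using inj_onD[OF W.St_inj _ q(1,2)] by simp
  qed
  show "inj_on toRN (verts stargraph)"
  proof (rule inj_onI)
    fix v w assume vw: "v \<in> verts stargraph" "w \<in> verts stargraph" "toRN v = toRN w"
    show "v = w"
    proof (cases v)
      case (Inl a)
      then obtain b where "w = Inl b" using vw(3) by (cases w) (simp_all add: toRN_def)
      then show ?thesis using vw Inl inj_onD[OF ccc_inj, of a b] by (simp add: toRN_def stargraph_verts)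
    next
      case (Inr q)
      then obtain r where "w = Inr r" using vw(3) by (cases w) (simp_all add: toRN_def)
      then show ?thesis using vw Inr inj_onD[OF inj, of q r] by (simp add: toRN_def stargraph_verts)
    qed
  qed
  show "verts (regular_neighbourhood G based) = toRN ` verts stargraph"
    using ne unfolding regular_neighbourhood_def toRN_def stargraph_def stars_based[OF E] cccs_eq 
    by (simp add: image_Un image_image)
  have mem: "ccc a \<in> ccc ` St q \<longleftrightarrow> a \<in> St q" if "a \<in> I" "q \<in> Q" for a q
    using inj_on_image_mem_iff[OF ccc_inj that(1) St_I[OF that(2)]] .
  have RN: "edges (regular_neighbourhood G based) = 
      {{Inl C, Inr \<Sigma>} | C \<Sigma>. C \<in> cccs G based \<and> \<Sigma> \<in> stars G based \<and> C \<in> \<Sigma>}"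
    using ne by (simp add: regular_neighbourhood_def)
  show "edges (regular_neighbourhood G based) = (\<lambda>e. toRN ` e) ` edges stargraph"
  proof (intro equalityI subsetI)
    fix e assume "e \<in> edges (regular_neighbourhood G based)"
    then obtain C \<Sigma> where "e = {Inl C, Inr \<Sigma>}" "C \<in> ccc ` I" "\<Sigma> \<in> (\<lambda>q. ccc ` St q) ` Q" "C \<in> \<Sigma>"
      unfolding RN stars_based[OF E] cccs_eq by blast
    then obtain a q where aq: "e = {Inl (ccc a), Inr (ccc ` St q)}" "a \<in> I" "q \<in> Q" "ccc a \<in> ccc ` St q"
      by blast
    then have "{Inl a, Inr q} \<in> edges stargraph" using mem stargraph_edge by simp
    then show "e \<in> (\<lambda>e. toRN ` e) ` edges stargraph" 
      by (rule rev_image_eqI) (simp add: toRN_def aq(1))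
  next
    fix e assume "e \<in> (\<lambda>e. toRN ` e) ` edges stargraph"
    then obtain f where f: "f \<in> edges stargraph" "e = toRN ` f" by (elim imageE)
    obtain a q where aq: "f = {Inl a, Inr q}" "a \<in> I" "q \<in> Q" "a \<in> St q" 
      using stargraph_edgeE[OF f(1)] .
    have e: "e = {Inl (ccc a), Inr (ccc ` St q)}" unfolding f(2) aq(1) toRN_def by simp
    have "ccc a \<in> cccs G based" unfolding cccs_eq by (rule imageI[OF aq(2)])
    moreover have "ccc ` St q \<in> stars G based" unfolding stars_based[OF E] by (rule image_eqI[OF refl aq(3)])
    moreover have "ccc a \<in> ccc ` St q" by (rule imageI[OF aq(4)])
    ultimately show "e \<in> edges (regular_neighbourhood G based)" unfolding RN e by blast
  qed
  show "is_tree stargraph" using W.star_graph_tree unfolding W.star_graph_def stargraph_def .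
qed

end

section \<open>The subdivision of the tree of cylinders\<close>

abbreviation vtx :: "'b \<Rightarrow> 'b \<Rightarrow> rat" where
  "vtx v \<equiv> bary v v 0"

lemma bary_0: "bary u v 0 = vtx u"
  unfolding bary_def by auto

lemma bary_1: "bary u v 1 = vtx v"
  unfolding bary_def by auto

lemma bary_swap: "bary u v t = bary v u (1 - t)"
  unfolding bary_def by auto

lemma vtx_inj [simp]: "vtx v = vtx w \<longleftrightarrow> v = w"
  unfolding bary_def fun_eq_iff by (metis add.right_neutral diff_zero zero_neq_one)

text \<open>Strictly between the ends exactly two coordinates are non-zero, and the tags
  \<open>Inl\<close> and \<open>Inr\<close> prevent the ends from being exchanged.\<close>

lemma bary_eqD:
  assumes eq: "bary (Inl x) (Inr y) s = bary (Inl x') (Inr y') t" and s: "0 < s" "s < 1"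
  shows "x = x' \<and> y = y' \<and> s = t"
proof -
  have "bary (Inl x) (Inr y) s (Inl x) = bary (Inl x') (Inr y') t (Inl x)" 
    "bary (Inl x) (Inr y) s (Inr y) = bary (Inl x') (Inr y') t (Inr y)" by (simp_all only: eq)
  then show ?thesis using s unfolding bary_def by (auto split: if_splits)
qed

lemma bary_ne_vtx:
  assumes s: "0 < s" "s < 1"
  shows "bary (Inl x) (Inr y) s \<noteq> vtx w"
proof
  assume "bary (Inl x) (Inr y) s = vtx w"
  then have "bary (Inl x) (Inr y) s (Inl x) = vtx w (Inl x)" by simp
  then show False using s unfolding bary_def by (auto split: if_splits)
qed

context tree_action
begin

abbreviation "Tc \<equiv> tree_of_cylinders G T act"
abbreviation "tc_act \<equiv> tree_of_cylinders_act act"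

lemma tc_act_simps [simp]: "tc_act g (Inl x) = Inl (act g x)" "tc_act g (Inr Y) = Inr (actY g Y)"
  unfolding tree_of_cylinders_act_def actY_def by simp_all

definition extra :: "'v \<Rightarrow> 'v set set \<Rightarrow> nat" where
  "extra x Y = (if (Some x, Y) \<in> I then if (None, Y) \<in> I then 2 else 1 else 0)"

text \<open>\<open>subdivision\<close> takes a function on unordered edges, so the two ends are
  recovered from the set by their tags; off such sets the value is unspecified.\<close>

definition edge_extra :: "('v + 'v set set) set \<Rightarrow> nat" where
  "edge_extra e = (THE k. \<exists>x Y. e = {Inl x, Inr Y} \<and> k = extra x Y)"

lemma edge_extra_edge: "edge_extra {Inl x, Inr Y} = extra x Y"
  unfolding edge_extra_def by (rule the_equality) (auto simp: doubleton_eq_iff)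

definition pt :: "'v \<Rightarrow> 'v set set \<Rightarrow> nat \<Rightarrow> ('v + 'v set set) \<Rightarrow> rat" where
  "pt x Y k = bary (Inl x) (Inr Y) (of_nat k / of_nat (extra x Y + 1))"

lemma pt_0: "pt x Y 0 = vtx (Inl x)"
  unfolding pt_def by (simp add: bary_0[of "Inl x" "Inr Y"])

lemma pt_last: "k = extra x Y + 1 \<Longrightarrow> pt x Y k = vtx (Inr Y)"
proof -
  assume "k = extra x Y + 1"
  then have "of_nat k / of_nat (extra x Y + 1) = (1 :: rat)" by (simp del: of_nat_add of_nat_Suc)
  then show ?thesis unfolding pt_def by (simp only: bary_1)
qed

lemma pt_frac:
  assumes "0 < k" "k \<le> extra x Y"
  shows "0 < (of_nat k / of_nat (extra x Y + 1) :: rat)" "(of_nat k / of_nat (extra x Y + 1) :: rat) < 1"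
proof -
  have "(0 :: rat) < of_nat (extra x Y + 1)" "(of_nat k :: rat) < of_nat (extra x Y + 1)" "(0 :: rat) < of_nat k"
    using assms by (simp_all only: of_nat_less_iff of_nat_0_less_iff)
  then show "0 < (of_nat k / of_nat (extra x Y + 1) :: rat)" "(of_nat k / of_nat (extra x Y + 1) :: rat) < 1"
    by (simp_all only: divide_pos_pos divide_less_eq_1_pos)
qed

lemma pt_ne_vtx: "0 < k \<Longrightarrow> k \<le> extra x Y \<Longrightarrow> pt x Y k \<noteq> vtx w"
  unfolding pt_def by (rule bary_ne_vtx[OF pt_frac])

lemma pt_eqD:
  assumes "pt x Y k = pt x' Y' k'" "0 < k" "k \<le> extra x Y"
  shows "x = x' \<and> Y = Y' \<and> k = k'"
proof -
  have *: "x = x' \<and> Y = Y' \<and> (of_nat k / of_nat (extra x Y + 1) :: rat) = of_nat k' / of_nat (extra x' Y' + 1)"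
    using bary_eqD[OF assms(1)[unfolded pt_def] pt_frac[OF assms(2,3)]] .
  then have "(of_nat k / of_nat (extra x Y + 1) :: rat) = of_nat k' / of_nat (extra x Y + 1)" by blast
  moreover have "(of_nat (extra x Y + 1) :: rat) \<noteq> 0" by (simp only: of_nat_eq_0_iff)
  ultimately have "(of_nat k :: rat) = of_nat k'" unfolding divide_cancel_right by blast
  then show ?thesis using * by (simp only: of_nat_eq_iff)
qed

text \<open>\<open>subdivision\<close> runs over both orientations of an edge; the reversed one
  numbers the same points backwards.\<close>

lemma pt_swap:
  assumes "k \<le> extra x Y + 1"
  shows "bary (Inr Y) (Inl x) (of_nat k / of_nat (extra x Y + 1)) = pt x Y (extra x Y + 1 - k)"
proof -
  have "1 - of_nat k / of_nat (extra x Y + 1) = (of_nat (extra x Y + 1 - k) / of_nat (extra x Y + 1) :: rat)"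
    using assms by (simp add: of_nat_diff field_simps)
  then show ?thesis unfolding pt_def bary_swap[of "Inr Y"] by simp
qed

section \<open>Vertices and edges of the subdivision\<close>

lemma Tc_edges:
  assumes "E \<noteq> {}"
  shows "{u, v} \<in> edges Tc \<longleftrightarrow> (\<exists>x Y. x \<in> V0 \<and> Y \<in> CY \<and> x \<in> \<Union>Y \<and> 
    (u = Inl x \<and> v = Inr Y \<or> u = Inr Y \<and> v = Inl x))"
  unfolding tree_of_cylinders_def using assms by (auto simp: doubleton_eq_iff)

lemma Tc_verts:
  assumes "E \<noteq> {}"
  shows "verts Tc = Inl ` V0 \<union> Inr ` CY"
  unfolding tree_of_cylinders_def using assms by simp

definition incident :: "'v \<Rightarrow> 'v set set \<Rightarrow> bool" where
  "incident x Y \<longleftrightarrow> x \<in> V0 \<and> Y \<in> CY \<and> x \<in> \<Union>Y"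

lemma subdivision_verts:
  assumes E: "E \<noteq> {}"
  shows "verts (subdivision Tc edge_extra) = vtx ` verts Tc \<union> {pt x Y k | x Y k. incident x Y \<and> k \<le> extra x Y + 1}"
    (is "?L = ?A \<union> ?B")
proof -
  have "{bary u v (of_nat k / of_nat (edge_extra {u, v} + 1)) | u v k. {u, v} \<in> edges Tc \<and> k \<le> edge_extra {u, v} + 1} = ?B"
    (is "?C = _")
  proof (intro equalityI subsetI)
    fix p assume "p \<in> ?C"
    then obtain u v k where p: "p = bary u v (of_nat k / of_nat (edge_extra {u, v} + 1))" 
      "{u, v} \<in> edges Tc" "k \<le> edge_extra {u, v} + 1" by blast
    then obtain x Y where xY: "incident x Y" "u = Inl x \<and> v = Inr Y \<or> u = Inr Y \<and> v = Inl x"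
      unfolding Tc_edges[OF E] incident_def by blast
    from xY(2) show "p \<in> ?B"
    proof
      assume "u = Inl x \<and> v = Inr Y"
      then have "p = pt x Y k" "k \<le> extra x Y + 1" using p by (simp_all add: pt_def edge_extra_edge)
      then show ?thesis using xY(1) by blast
    next
      assume uv: "u = Inr Y \<and> v = Inl x"
      then have "{u, v} = {Inl x, Inr Y}" by auto
      then have n: "edge_extra {u, v} = extra x Y" by (simp add: edge_extra_edge)
      have "p = pt x Y (extra x Y + 1 - k)" using p(1,3) uv pt_swap[of k x Y] unfolding n by simp
      moreover have "extra x Y + 1 - k \<le> extra x Y + 1" by simp
      ultimately show ?thesis using xY(1) by blast
    qed
  next
    fix p assume "p \<in> ?B"
    then obtain x Y k where p: "p = pt x Y k" "incident x Y" "k \<le> extra x Y + 1" by blast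
    then have "{Inl x, Inr Y} \<in> edges Tc" unfolding Tc_edges[OF E] incident_def by blast
    moreover have "p = bary (Inl x) (Inr Y) (of_nat k / of_nat (edge_extra {Inl x, Inr Y} + 1))"
      using p(1) by (simp add: pt_def edge_extra_edge)
    moreover have "k \<le> edge_extra {Inl x, Inr Y} + 1" using p(3) by (simp add: edge_extra_edge)
    ultimately show "p \<in> ?C" by blast
  qed
  moreover have "{vtx v | v. v \<in> verts Tc} = ?A" by blast
  ultimately show ?thesis unfolding subdivision_def by simp
qed

lemma subdivision_edges:
  assumes E: "E \<noteq> {}"
  shows "edges (subdivision Tc edge_extra) = {{pt x Y k, pt x Y (k + 1)} | x Y k. incident x Y \<and> k \<le> extra x Y}"
    (is "?L = ?B")
proof -
  have "{{bary u v (of_nat k / of_nat (edge_extra {u, v} + 1)), bary u v (of_nat (k + 1) / of_nat (edge_extra {u, v} + 1))} 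
      | u v k. {u, v} \<in> edges Tc \<and> k \<le> edge_extra {u, v}} = ?B"
    (is "?C = _")
  proof (intro equalityI subsetI)
    fix p assume "p \<in> ?C"
    then obtain u v k where p: "p = {bary u v (of_nat k / of_nat (edge_extra {u, v} + 1)), 
        bary u v (of_nat (k + 1) / of_nat (edge_extra {u, v} + 1))}" 
      "{u, v} \<in> edges Tc" "k \<le> edge_extra {u, v}" by blast
    then obtain x Y where xY: "incident x Y" "u = Inl x \<and> v = Inr Y \<or> u = Inr Y \<and> v = Inl x"
      unfolding Tc_edges[OF E] incident_def by blast
    from xY(2) show "p \<in> ?B"
    proof
      assume "u = Inl x \<and> v = Inr Y"
      then have "p = {pt x Y k, pt x Y (k + 1)}" "k \<le> extra x Y" using p unfolding pt_def by (simp_all add: edge_extra_edge)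
      then show ?thesis using xY(1) by blast
    next
      assume uv: "u = Inr Y \<and> v = Inl x"
      then have "{u, v} = {Inl x, Inr Y}" by auto
      then have n: "edge_extra {u, v} = extra x Y" by (simp add: edge_extra_edge)
      have k: "k \<le> extra x Y" using p(3) n by simp
      have "p = {pt x Y (extra x Y + 1 - k), pt x Y (extra x Y + 1 - (k + 1))}" 
        using p(1) uv pt_swap[of k x Y] pt_swap[of "k + 1" x Y] k unfolding n by simp
      moreover have "extra x Y + 1 - k = (extra x Y - k) + 1" "extra x Y + 1 - (k + 1) = extra x Y - k" using k by auto
      ultimately have "p = {pt x Y (extra x Y - k), pt x Y ((extra x Y - k) + 1)}" by (simp only: insert_commute)
      moreover have "extra x Y - k \<le> extra x Y" by simp
      ultimately show ?thesis using xY(1) by blast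
    qed
  next
    fix p assume "p \<in> ?B"
    then obtain x Y k where p: "p = {pt x Y k, pt x Y (k + 1)}" "incident x Y" "k \<le> extra x Y" by blast
    then have "{Inl x, Inr Y} \<in> edges Tc" unfolding Tc_edges[OF E] incident_def by blast
    moreover have "p = {bary (Inl x) (Inr Y) (of_nat k / of_nat (edge_extra {Inl x, Inr Y} + 1)), 
        bary (Inl x) (Inr Y) (of_nat (k + 1) / of_nat (edge_extra {Inl x, Inr Y} + 1))}"
      using p(1) unfolding pt_def edge_extra_edge .
    moreover have "k \<le> edge_extra {Inl x, Inr Y}" using p(3) by (simp add: edge_extra_edge)
    ultimately show "p \<in> ?C" by blast
  qed
  then show ?thesis unfolding subdivision_def by simp
qed

text \<open>Components and stars alternate along the edge from \<open>x\<close> to \<open>Y\<close>.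
  With two new vertices the order is: star of \<open>x\<close>, \<open>(Some x, Y)\<close>, star
  \<open>(Some x, Some Y)\<close>, \<open>(None, Y)\<close>. With one: star of \<open>x\<close>,
  \<open>(Some x, Y)\<close>, star \<open>(None, Some Y)\<close>. With none: star of
  \<open>x\<close>, \<open>(None, Y)\<close>. So the point \<open>Y\<close> is sometimes a component
  and sometimes a star.\<close>

definition toSub :: "('v option \<times> 'v set set) + ('v option \<times> 'v set set option) \<Rightarrow> ('v + 'v set set) \<Rightarrow> rat" where
  "toSub w = (case w of 
      Inl \<alpha> \<Rightarrow> (case fst \<alpha> of None \<Rightarrow> vtx (Inr (snd \<alpha>)) | Some x \<Rightarrow> pt x (snd \<alpha>) 1)
    | Inr q \<Rightarrow> (case fst q of 
          None \<Rightarrow> vtx (Inr (the (snd q))) 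
        | Some x \<Rightarrow> (case snd q of None \<Rightarrow> vtx (Inl x) | Some Y \<Rightarrow> pt x Y 2)))"

lemma toSub_simps [simp]:
  "toSub (Inl (None, Y)) = vtx (Inr Y)" "toSub (Inl (Some x, Y)) = pt x Y 1"
  "toSub (Inr (None, Some Y)) = vtx (Inr Y)" "toSub (Inr (Some x, None)) = vtx (Inl x)"
  "toSub (Inr (Some x, Some Y)) = pt x Y 2"
  unfolding toSub_def by simp_all

lemma Q_iff:
  "(Some x, None) \<in> Q \<longleftrightarrow> x \<in> V0" 
  "(Some x, Some Y) \<in> Q \<longleftrightarrow> (Some x, Y) \<in> I \<and> (None, Y) \<in> I"
  "(None, Some Y) \<in> Q \<longleftrightarrow> Y \<in> CY \<and> (None, Y) \<notin> I"
  unfolding Q_def by auto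

lemma I_incident: "(Some x, Y) \<in> I \<Longrightarrow> incident x Y"
  unfolding incident_def I_Some by simp

lemma toSub_edge_ex:
  assumes x: "incident x Y" and k: "k \<le> extra x Y"
  shows "\<exists>a q. a \<in> I \<and> q \<in> Q \<and> a \<in> St q \<and> {toSub (Inl a), toSub (Inr q)} = {pt x Y k, pt x Y (k + 1)}"
proof -
  have x': "x \<in> V0" "Y \<in> CY" "x \<in> \<Union>Y" using x unfolding incident_def by auto
  have q: "(Some x, None) \<in> Q" using x' Q_iff by simp
  have nS: "near x Y \<in> St (Some x, None)" unfolding St_simps using x' by blast
  have nI: "near x Y \<in> I" by (rule near_I[OF x'(2,1,3)])
  have "k = 0 \<or> k = 1 \<and> (Some x, Y) \<in> I \<or> k = 2 \<and> (Some x, Y) \<in> I \<and> (None, Y) \<in> I"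
    using k unfolding extra_def by (cases "(Some x, Y) \<in> I"; cases "(None, Y) \<in> I"; simp; arith)
  then consider "k = 0" "(Some x, Y) \<notin> I" | "k = 0" "(Some x, Y) \<in> I" 
    | "k = 1" "(Some x, Y) \<in> I" "(None, Y) \<notin> I" | "k = 1" "(Some x, Y) \<in> I" "(None, Y) \<in> I" 
    | "k = 2" "(Some x, Y) \<in> I" "(None, Y) \<in> I"
    by blast
  then show ?thesis
  proof cases
    case 1
    then have "near x Y = (None, Y)" "extra x Y = 0" unfolding near_def extra_def by simp_all
    then have "{toSub (Inl (near x Y)), toSub (Inr (Some x, None))} = {pt x Y k, pt x Y (k + 1)}"
      using 1 pt_0[of x Y] pt_last[of 1 x Y] by (simp add: insert_commute)
    then show ?thesis using q nS nI by blast
  next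
    case 2
    then have "near x Y = (Some x, Y)" unfolding near_def by simp
    then have "{toSub (Inl (near x Y)), toSub (Inr (Some x, None))} = {pt x Y k, pt x Y (k + 1)}"
      using 2 pt_0[of x Y] by (simp add: insert_commute)
    then show ?thesis using q nS nI by blast
  next
    case 3
    have "(Some x, Y) \<in> St (None, Some Y)" "(None, Some Y) \<in> Q" using 3 x' by (simp_all add: St_simps Q_iff)
    moreover have "extra x Y = 1" using 3 by (simp add: extra_def)
    then have "{toSub (Inl (Some x, Y)), toSub (Inr (None, Some Y))} = {pt x Y k, pt x Y (k + 1)}"
      using 3(1) pt_last[of 2 x Y] by (simp add: numeral_2_eq_2)
    ultimately show ?thesis using 3(2) by blast
  next
    case 4
    have "(Some x, Y) \<in> St (Some x, Some Y)" "(Some x, Some Y) \<in> Q" using 4 by (simp_all add: St_simps Q_iff)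
    moreover have "{toSub (Inl (Some x, Y)), toSub (Inr (Some x, Some Y))} = {pt x Y k, pt x Y (k + 1)}"
      using 4(1) by (simp add: numeral_2_eq_2)
    ultimately show ?thesis using 4(2) by blast
  next
    case 5
    have "(None, Y) \<in> St (Some x, Some Y)" "(Some x, Some Y) \<in> Q" using 5 by (simp_all add: St_simps Q_iff)
    moreover have "extra x Y = 2" using 5 by (simp add: extra_def)
    then have "{toSub (Inl (None, Y)), toSub (Inr (Some x, Some Y))} = {pt x Y k, pt x Y (k + 1)}"
      using 5(1) pt_last[of 3 x Y] by (simp add: insert_commute)
    ultimately show ?thesis using 5(3) by blast
  qed
qed

lemma toSub_edge:
  assumes a: "a \<in> I" and q: "q \<in> Q" "a \<in> St q"
  shows "\<exists>x Y k. incident x Y \<and> k \<le> extra x Y \<and> {toSub (Inl a), toSub (Inr q)} = {pt x Y k, pt x Y (k + 1)}"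
  using q(1)
proof (cases rule: Q_cases)
  case (vertex x)
  then obtain Y where Y: "Y \<in> CY" "x \<in> \<Union>Y" "a = near x Y" using q(2) unfolding vertex(1) St_simps by blast
  have i: "incident x Y" using Y vertex(2) unfolding incident_def by simp
  have "{toSub (Inl a), toSub (Inr q)} = {pt x Y 0, pt x Y (0 + 1)}"
  proof (cases "(Some x, Y) \<in> I")
    case True
    then show ?thesis using Y(3) vertex(1) pt_0[of x Y] by (simp add: near_def insert_commute)
  next
    case False
    then have "extra x Y = 0" unfolding extra_def by simp
    then show ?thesis using False Y(3) vertex(1) pt_0[of x Y] pt_last[of 1 x Y] 
      by (simp add: near_def insert_commute)
  qed
  then show ?thesis using i by blast
next
  case (edge x Y)
  have i: "incident x Y" using I_incident edge(2) .
  have n: "extra x Y = 2" using edge by (simp add: extra_def)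
  consider "a = (Some x, Y)" | "a = (None, Y)" using q(2) edge(1) by (auto simp: St_simps)
  then show ?thesis
  proof cases
    case 1
    then have "{toSub (Inl a), toSub (Inr q)} = {pt x Y 1, pt x Y (1 + 1)}" 
      using edge(1) by (simp add: numeral_2_eq_2)
    moreover have "1 \<le> extra x Y" using n by simp
    ultimately show ?thesis using i by blast
  next
    case 2
    then have "{toSub (Inl a), toSub (Inr q)} = {pt x Y 2, pt x Y (2 + 1)}" 
      using edge(1) pt_last[of 3 x Y] n by (simp add: insert_commute)
    moreover have "2 \<le> extra x Y" using n by simp
    ultimately show ?thesis using i by blast
  qed
next
  case (cyl Y)
  then have "a \<in> I" "snd a = Y" using q(2) by (simp_all add: St_simps)
  then obtain x where x: "a = (Some x, Y)" "(Some x, Y) \<in> I" using cyl(3) by (cases a; cases "fst a") auto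
  then have n: "extra x Y = 1" using cyl(3) by (simp add: extra_def)
  then have "{toSub (Inl a), toSub (Inr q)} = {pt x Y 1, pt x Y (1 + 1)}" 
    using x(1) cyl(1) pt_last[of 2 x Y] by (simp add: numeral_2_eq_2)
  moreover have "1 \<le> extra x Y" using n by simp
  ultimately show ?thesis using I_incident[OF x(2)] by blast
qed

lemma toSub_edges:
  assumes E: "E \<noteq> {}"
  shows "edges (subdivision Tc edge_extra) = (\<lambda>e. toSub ` e) ` edges stargraph"
proof (intro equalityI subsetI)
  fix e assume "e \<in> edges (subdivision Tc edge_extra)"
  then obtain x Y k where e: "e = {pt x Y k, pt x Y (k + 1)}" "incident x Y" "k \<le> extra x Y"
    unfolding subdivision_edges[OF E] by blast
  obtain a q where aq: "a \<in> I" "q \<in> Q" "a \<in> St q" 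
    "{toSub (Inl a), toSub (Inr q)} = {pt x Y k, pt x Y (k + 1)}" using toSub_edge_ex[OF e(2,3)] by blast
  have "e = toSub ` {Inl a, Inr q}" using e(1) aq(4) by simp
  then show "e \<in> (\<lambda>e. toSub ` e) ` edges stargraph" by (rule image_eqI[OF _ stargraph_edge[OF aq(1-3)]])
next
  fix e assume "e \<in> (\<lambda>e. toSub ` e) ` edges stargraph"
  then obtain f where f: "f \<in> edges stargraph" "e = toSub ` f" by (elim imageE)
  obtain a q where aq: "f = {Inl a, Inr q}" "a \<in> I" "q \<in> Q" "a \<in> St q" using stargraph_edgeE[OF f(1)] .
  have "e = {toSub (Inl a), toSub (Inr q)}" using f(2) aq(1) by simp
  then show "e \<in> edges (subdivision Tc edge_extra)" 
    unfolding subdivision_edges[OF E] using toSub_edge[OF aq(2-4)] by auto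
qed

lemma toSub_verts:
  assumes E: "E \<noteq> {}"
  shows "verts (subdivision Tc edge_extra) = toSub ` verts stargraph"
proof (intro equalityI subsetI)
  fix p assume "p \<in> verts (subdivision Tc edge_extra)"
  then consider (l) x where "p = vtx (Inl x)" "x \<in> V0" | (r) Y where "p = vtx (Inr Y)" "Y \<in> CY"
    | (m) x Y k where "p = pt x Y k" "incident x Y" "k \<le> extra x Y + 1"
    unfolding subdivision_verts[OF E] Tc_verts[OF E] by blast
  then show "p \<in> toSub ` verts stargraph"
  proof cases
    case l
    then show ?thesis by (intro image_eqI[of _ _ "Inr (Some x, None)"]) (simp_all add: stargraph_verts Q_iff)
  next
    case r
    show ?thesis
    proof (cases "(None, Y) \<in> I")
      case True
      then show ?thesis using r by (intro image_eqI[of _ _ "Inl (None, Y)"]) (simp_all add: stargraph_verts)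
    next
      case False
      then show ?thesis using r 
        by (intro image_eqI[of _ _ "Inr (None, Some Y)"]) (simp_all add: stargraph_verts Q_iff)
    qed
  next
    case m
    obtain j where j: "j \<le> extra x Y" "p = pt x Y j \<or> p = pt x Y (j + 1)"
    proof (cases "k = extra x Y + 1")
      case True
      then show thesis using that[of "extra x Y"] m(1) by simp
    next
      case False
      then show thesis using that[of k] m(1,3) by simp
    qed
    obtain a q where aq: "a \<in> I" "q \<in> Q" "{toSub (Inl a), toSub (Inr q)} = {pt x Y j, pt x Y (j + 1)}" 
      using toSub_edge_ex[OF m(2) j(1)] by blast
    then have "p = toSub (Inl a) \<or> p = toSub (Inr q)" using j(2) by (auto simp: doubleton_eq_iff)
    then show ?thesis using aq(1,2) stargraph_verts by blast
  qed
next
  fix p assume "p \<in> toSub ` verts stargraph"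
  then obtain w where w: "w \<in> verts stargraph" "p = toSub w" by (elim imageE)
  have P: "pt x Y k \<in> verts (subdivision Tc edge_extra)" if "incident x Y" "k \<le> extra x Y + 1" for x Y k
    unfolding subdivision_verts[OF E] using that by blast
  have L: "vtx (Inl x) \<in> verts (subdivision Tc edge_extra)" if "x \<in> V0" for x
    unfolding subdivision_verts[OF E] Tc_verts[OF E] using that by blast
  have R: "vtx (Inr Y) \<in> verts (subdivision Tc edge_extra)" if "Y \<in> CY" for Y
    unfolding subdivision_verts[OF E] Tc_verts[OF E] using that by blast
  show "p \<in> verts (subdivision Tc edge_extra)"
  proof (cases w)
    case (Inl a)
    then have a: "a \<in> I" using w stargraph_verts by simp
    obtain ox Y where oY: "a = (ox, Y)" by (cases a)
    show ?thesis
    proof (cases ox)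
      case None
      then show ?thesis using R[OF I_cyl[OF a]] w(2) Inl oY by simp
    next
      case (Some x)
      then show ?thesis using P[OF I_incident, of x Y 1] w(2) Inl oY a by simp
    qed
  next
    case (Inr q)
    then have "q \<in> Q" using w stargraph_verts by simp
    then show ?thesis
    proof (cases rule: Q_cases)
      case (vertex x)
      then show ?thesis using L w(2) Inr by simp
    next
      case (edge x Y)
      then have "extra x Y = 2" by (simp add: extra_def)
      then show ?thesis using P[OF I_incident, of x Y 2] w(2) Inr edge by simp
    next
      case (cyl Y)
      then show ?thesis using R w(2) Inr by simp
    qed
  qed
qed

lemma toSub_inj: "inj_on toSub (verts stargraph)"
proof -
  \<comment> \<open>The inverse map: an old vertex and a numbered new point each determine the
    component or star they come from.\<close>
  have kinds: "(\<exists>v. toSub w = vtx v \<and> (case v of Inl x \<Rightarrow> w = Inr (Some x, None) 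
        | Inr Y \<Rightarrow> w = (if (None, Y) \<in> I then Inl (None, Y) else Inr (None, Some Y)))) \<or>
      (\<exists>x Y k. 0 < k \<and> k \<le> extra x Y \<and> toSub w = pt x Y k \<and> 
         w = (if k = 1 then Inl (Some x, Y) else Inr (Some x, Some Y)))" 
    if w: "w \<in> verts stargraph" for w
  proof (cases w)
    case (Inl a)
    then have a: "a \<in> I" using w stargraph_verts by simp
    obtain ox Y where oY: "a = (ox, Y)" by (cases a)
    show ?thesis
    proof (cases ox)
      case None
      then show ?thesis using Inl oY a by (intro disjI1 exI[of _ "Inr Y"]) simp
    next
      case (Some x)
      then have "1 \<le> extra x Y" using a oY by (simp add: extra_def)
      then show ?thesis using Inl oY Some by (intro disjI2 exI[of _ x] exI[of _ Y] exI[of _ 1]) simp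
    qed
  next
    case (Inr q)
    then have "q \<in> Q" using w stargraph_verts by simp
    then show ?thesis
    proof (cases rule: Q_cases)
      case (vertex x)
      then show ?thesis using Inr by (intro disjI1 exI[of _ "Inl x"]) simp
    next
      case (edge x Y)
      then have "extra x Y = 2" by (simp add: extra_def)
      then show ?thesis using Inr edge by (intro disjI2 exI[of _ x] exI[of _ Y] exI[of _ 2]) simp
    next
      case (cyl Y)
      then show ?thesis using Inr by (intro disjI1 exI[of _ "Inr Y"]) simp
    qed
  qed
  show ?thesis
  proof (rule inj_onI)
    fix w w' assume w: "w \<in> verts stargraph" "w' \<in> verts stargraph" "toSub w = toSub w'"
    from kinds[OF w(1)] show "w = w'"
    proof
      assume "\<exists>v. toSub w = vtx v \<and> (case v of Inl x \<Rightarrow> w = Inr (Some x, None) 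
        | Inr Y \<Rightarrow> w = (if (None, Y) \<in> I then Inl (None, Y) else Inr (None, Some Y)))"
      then obtain v where v: "toSub w = vtx v" "case v of Inl x \<Rightarrow> w = Inr (Some x, None) 
        | Inr Y \<Rightarrow> w = (if (None, Y) \<in> I then Inl (None, Y) else Inr (None, Some Y))" by blast
      have "\<forall>x Y k. 0 < k \<and> k \<le> extra x Y \<longrightarrow> toSub w' \<noteq> pt x Y k"
        using pt_ne_vtx[of _ _ _ v] v(1) w(3) by metis
      then obtain v' where v': "toSub w' = vtx v'" "case v' of Inl x \<Rightarrow> w' = Inr (Some x, None) 
        | Inr Y \<Rightarrow> w' = (if (None, Y) \<in> I then Inl (None, Y) else Inr (None, Some Y))" 
        using kinds[OF w(2)] by blast
      have "v = v'" using v(1) v'(1) w(3) by simp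
      then show ?thesis using v(2) v'(2) unfolding \<open>v = v'\<close> by (cases v') simp_all
    next
      assume "\<exists>x Y k. 0 < k \<and> k \<le> extra x Y \<and> toSub w = pt x Y k \<and> 
         w = (if k = 1 then Inl (Some x, Y) else Inr (Some x, Some Y))"
      then obtain x Y k where k: "0 < k" "k \<le> extra x Y" "toSub w = pt x Y k" 
         "w = (if k = 1 then Inl (Some x, Y) else Inr (Some x, Some Y))" by blast
      have "\<forall>v. toSub w' \<noteq> vtx v" using pt_ne_vtx[OF k(1,2)] k(3) w(3) by metis
      then obtain x' Y' k' where k': "toSub w' = pt x' Y' k'" 
         "w' = (if k' = 1 then Inl (Some x', Y') else Inr (Some x', Some Y'))" 
        using kinds[OF w(2)] by blast
      have "pt x Y k = pt x' Y' k'" using k(3) k'(1) w(3) by simp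
      then have "x = x' \<and> Y = Y' \<and> k = k'" by (rule pt_eqD[OF _ k(1,2)])
      then show ?thesis using k(4) k'(2) by simp
    qed
  qed
qed

section \<open>Equivariance of the map to the subdivision\<close>

lemma tc_act_verts:
  assumes E: "E \<noteq> {}" and g: "g \<in> carrier G" and v: "v \<in> verts Tc"
  shows "tc_act g v \<in> verts Tc" "tc_act (inv g) (tc_act g v) = v" "tc_act g (tc_act (inv g) v) = v"
proof -
  show "tc_act g v \<in> verts Tc"
    using v V0_act[OF g] actY_CY[OF g] unfolding Tc_verts[OF E] by auto
  show "tc_act (inv g) (tc_act g v) = v"
    using v V0_sub g actY_inv(1)[OF g] unfolding Tc_verts[OF E] by auto
  show "tc_act g (tc_act (inv g) v) = v"
    using v V0_sub g actY_inv(2)[OF g] unfolding Tc_verts[OF E] by auto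
qed

lemma subdivision_act_bary:
  assumes E: "E \<noteq> {}" and g: "g \<in> carrier G" and u: "u \<in> verts Tc" and v: "v \<in> verts Tc"
  shows "subdivision_act G Tc tc_act g (bary u v t) = bary (tc_act g u) (tc_act g v) t"
proof
  fix w
  show "subdivision_act G Tc tc_act g (bary u v t) w = bary (tc_act g u) (tc_act g v) t w"
  proof (cases "w \<in> verts Tc")
    case True
    have "tc_act (inv g) w = z \<longleftrightarrow> w = tc_act g z" if "z \<in> verts Tc" for z
      using tc_act_verts(2)[OF E g that] tc_act_verts(3)[OF E g True] by metis
    then show ?thesis unfolding subdivision_act_def bary_def using True u v by simp
  next
    case False
    then have "w \<noteq> tc_act g u" "w \<noteq> tc_act g v" using tc_act_verts(1)[OF E g] u v by auto
    then show ?thesis unfolding subdivision_act_def bary_def using False by simp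
  qed
qed

lemma extra_act:
  assumes "g \<in> carrier G" "incident x Y"
  shows "extra (act g x) (actY g Y) = extra x Y"
  using I_act_iff[OF assms(1) V0_sub, of x Y] assms(2) unfolding extra_def incident_def by simp

lemma pt_act:
  assumes E: "E \<noteq> {}" and g: "g \<in> carrier G" and i: "incident x Y"
  shows "subdivision_act G Tc tc_act g (pt x Y k) = pt (act g x) (actY g Y) k"
proof -
  have "Inl x \<in> verts Tc" "Inr Y \<in> verts Tc" using i unfolding Tc_verts[OF E] incident_def by auto
  then show ?thesis unfolding pt_def extra_act[OF g i] using subdivision_act_bary[OF E g, of "Inl x" "Inr Y"] by simp
qed

lemma toSub_act:
  assumes E: "E \<noteq> {}" and g: "g \<in> carrier G" and w: "w \<in> verts stargraph"
  shows "toSub (map_sum (actI g) (actQ g) w) = subdivision_act G Tc tc_act g (toSub w)"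
proof -
  have vx: "subdivision_act G Tc tc_act g (vtx v) = vtx (tc_act g v)" if "v \<in> verts Tc" for v
    by (rule subdivision_act_bary[OF E g that that])
  have L: "Inl x \<in> verts Tc" if "x \<in> V0" for x using that unfolding Tc_verts[OF E] by simp
  have R: "Inr Y \<in> verts Tc" if "Y \<in> CY" for Y using that unfolding Tc_verts[OF E] by simp
  show ?thesis
  proof (cases w)
    case (Inl a)
    then have a: "a \<in> I" using w stargraph_verts by simp
    obtain ox Y where oY: "a = (ox, Y)" by (cases a)
    show ?thesis
    proof (cases ox)
      case None
      then show ?thesis using Inl oY vx[OF R[OF I_cyl[OF a]]] by (simp add: actI_def)
    next
      case (Some x)
      then show ?thesis using Inl oY pt_act[OF E g I_incident] a by (simp add: actI_def)
    qed
  next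
    case (Inr q)
    then have "q \<in> Q" using w stargraph_verts by simp
    then show ?thesis
    proof (cases rule: Q_cases)
      case (vertex x)
      then show ?thesis using Inr vx[OF L] by (simp add: actQ_def)
    next
      case (edge x Y)
      then show ?thesis using Inr pt_act[OF E g I_incident] by (simp add: actQ_def)
    next
      case (cyl Y)
      then show ?thesis using Inr vx[OF R] by (simp add: actQ_def)
    qed
  qed
qed

lemma edge_extra_act:
  assumes E: "E \<noteq> {}" and g: "g \<in> carrier G" and e: "e \<in> edges Tc"
  shows "edge_extra (tc_act g ` e) = edge_extra e"
proof -
  obtain x Y where xY: "e = {Inl x, Inr Y}" "incident x Y" 
    using e E unfolding tree_of_cylinders_def incident_def by auto
  then have "tc_act g ` e = {Inl (act g x), Inr (actY g Y)}" by simp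
  then show ?thesis using extra_act[OF g xY(2)] xY(1) edge_extra_edge by simp
qed

lemma isomorphic_nonempty:
  assumes E: "E \<noteq> {}"
  shows "isomorphic_to_subdivision G (regular_neighbourhood G based) (regular_neighbourhood_act G) Tc tc_act
    \<and> is_tree (regular_neighbourhood G based)"
proof
  note RN = RN_based[OF E]
  have sg: "simple_graph stargraph" using RN(4) unfolding is_tree_def by simp
  have "equivariantly_isomorphic G (regular_neighbourhood G based) (regular_neighbourhood_act G) 
      (subdivision Tc edge_extra) (subdivision_act G Tc tc_act)"
    by (rule equivariantly_isomorphic_images[of G stargraph "\<lambda>g. map_sum (actI g) (actQ g)" toRN _ _ toSub];
      fact stargraph_action sg RN toRN_act toSub_inj toSub_verts[OF E] toSub_edges[OF E] toSub_act[OF E])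
  then show "isomorphic_to_subdivision G (regular_neighbourhood G based) (regular_neighbourhood_act G) Tc tc_act"
    unfolding isomorphic_to_subdivision_def using edge_extra_act[OF E] by blast
  show "is_tree (regular_neighbourhood G based)" by (rule is_tree_image[OF RN(4,1,2,3)])
qed

text \<open>Without edges \<open>T\<close> is the vertex \<open>v0\<close> and there are no
  cylinders, hence no components. Both graphs are then points, obtained as images of the one-point
  graph \<open>?P\<close>.\<close>

lemma isomorphic_empty:
  assumes E: "E = {}"
  shows "isomorphic_to_subdivision G (regular_neighbourhood G based) (regular_neighbourhood_act G) Tc tc_act
    \<and> is_tree (regular_neighbourhood G based)"
proof -
  let ?P = "\<lparr>verts = {()}, edges = {}\<rparr> :: unit sgraph"
  let ?f = "\<lambda>_ :: unit. Inr {} :: 'a ccc + 'a ccc set"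
  let ?h = "\<lambda>_ :: unit. vtx (Inl v0 :: 'v + 'v set set)"
  have "CY = {}" using E by (auto simp: cyl_iff)
  then have "cccs G based = {}"
    by (simp add: based_on_tree_def ai_pairs_def cccs_def quotient_def)
  then have RN: "regular_neighbourhood G based = \<lparr>verts = {Inr {}}, edges = {}\<rparr>"
    by (simp add: regular_neighbourhood_def)
  have "cobd {v0} = {}" using cobd_sub[of "{v0}"] E by simp
  then have V: "V = {v0}" using cobd_empty_iff[of "{v0}"] v0 by auto
  have Tc: "Tc = \<lparr>verts = {Inl v0}, edges = {}\<rparr>" using E V by (simp add: tree_of_cylinders_def)
  have tree: "is_tree ?P"
    by (auto simp: is_tree_def simple_graph_def connected_graph_def graph_cycle_def)
  have act: "graph_action G ?P (\<lambda>g x. x)"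
    unfolding graph_action_def by (intro conjI group_actionI[OF group_axioms]) simp_all
  have S: "verts (subdivision Tc (\<lambda>_. 0)) = {vtx (Inl v0)}" "edges (subdivision Tc (\<lambda>_. 0)) = {}"
    unfolding subdivision_def Tc by auto
  have inv: "subdivision_act G Tc tc_act g (vtx (Inl v0)) = vtx (Inl v0)" if g: "g \<in> carrier G" for g
  proof
    fix w
    have "act (inv g) v0 = v0" using act_V[OF inv_closed[OF g] v0] V by simp
    then show "subdivision_act G Tc tc_act g (vtx (Inl v0)) w = vtx (Inl v0) w"
      unfolding subdivision_act_def Tc bary_def by simp
  qed
  have iso: "equivariantly_isomorphic G (regular_neighbourhood G based) (regular_neighbourhood_act G) 
      (subdivision Tc (\<lambda>_. 0)) (subdivision_act G Tc tc_act)"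
  proof (rule equivariantly_isomorphic_images[of G ?P "\<lambda>g x. x" ?f _ _ ?h])
    show "graph_action G ?P (\<lambda>g x. x)" by (rule act)
    show "simple_graph ?P" using tree by (simp add: is_tree_def)
    show "inj_on ?f (verts ?P)" "inj_on ?h (verts ?P)" by simp_all
    show "verts (regular_neighbourhood G based) = ?f ` verts ?P" 
      "edges (regular_neighbourhood G based) = (\<lambda>e. ?f ` e) ` edges ?P" by (simp_all add: RN)
    show "verts (subdivision Tc (\<lambda>_. 0)) = ?h ` verts ?P" 
      "edges (subdivision Tc (\<lambda>_. 0)) = (\<lambda>e. ?h ` e) ` edges ?P" by (simp_all add: S)
    show "?f v = regular_neighbourhood_act G g (?f v)" for g v 
      by (simp add: regular_neighbourhood_act_def)
    show "?h v = subdivision_act G Tc tc_act g (?h v)" if "g \<in> carrier G" for g v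
      using inv[OF that] by simp
  qed
  have "isomorphic_to_subdivision G (regular_neighbourhood G based) (regular_neighbourhood_act G) Tc tc_act"
    unfolding isomorphic_to_subdivision_def by (intro exI[of _ "\<lambda>_. 0"] conjI ballI refl iso)
  moreover have "is_tree (regular_neighbourhood G based)"
    unfolding RN by (auto simp: is_tree_def simple_graph_def connected_graph_def graph_cycle_def)
  ultimately show ?thesis ..
qed

end

theorem theorem3p3:
  fixes G :: "('a, 'm) monoid_scheme"
    and T :: "'v sgraph"
    and act :: "'a \<Rightarrow> 'v \<Rightarrow> 'v"
    and v0 :: 'v
  assumes "finitely_generated_group G"
    and "is_tree T"
    and "graph_action G T act"
    and "without_inversions G T act"
    and "minimal_action G T act"
    and "\<And>A B. \<lbrakk> subgroup A G; subgroup B G; A \<subseteq> B;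
                 \<exists>e \<in> edges T. commensurable G A (edge_stab G act e);
                 \<exists>e \<in> edges T. commensurable G B (edge_stab G act e) \<rbrakk>
               \<Longrightarrow> finite_index G A B"
    and "v0 \<in> verts T"
  shows "isomorphic_to_subdivision G
           (regular_neighbourhood G (based_on_tree G T act v0)) (regular_neighbourhood_act G)
           (tree_of_cylinders G T act) (tree_of_cylinders_act act)
       \<and> is_tree (regular_neighbourhood G (based_on_tree G T act v0))"
proof -
  interpret tree_action G T act v0
  proof -
    interpret group G using assms(1) unfolding finitely_generated_group_def by simp
    show "tree_action G T act v0" by unfold_locales (fact assms)+
  qed
  show ?thesis using isomorphic_nonempty isomorphic_empty by (cases "edges T = {}") simp_all
qed

end
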